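(* Let $k$ be a field of characteristic zero and let $q\in k$, $q\ne0$, be not a root of unity. Let $\delta$ be the character of the Hopf algebra $A(SL_q(2,k))$ defined by $\delta(x)=q$, $\delta(u)=\delta(v)=0$, $\delta(y)=q^{-1}$. Then $$\widetilde{HC}^{(\delta,1)}_1(A(SL_q(2,k)))=k\oplus k,\qquad \widetilde{HC}^{(\delta,1)}_n(A(SL_q(2,k)))=0\ \text{ for all } n\ne1.$$ In particular, $\widetilde{HP}^{(\delta,1)}_0(A(SL_q(2,k)))=\widetilde{HP}^{(\delta,1)}_1(A(SL_q(2,k)))=0$.
   Context: $H=A(SL_q(2,k))$ is the $k$-algebra generated by $x,u,v,y$ with relations $ux=qxu$, $vx=qxv$, $yu=quy$, $yv=qvy$, $uv=vu$, $xy-q^{-1}uv=yx-quv=1$. It is a Hopf algebra with $\Delta(x)=x\otimes x+u\otimes v$, $\Delta(u)=x\otimes u+u\otimes y$, $\Delta(v)=v\otimes x+y\otimes v$, $\Delta(y)=v\otimes u+y\otimes y$, $\varepsilon(x)=\varepsilon(y)=1$, $\varepsilon(u)=\varepsilon(v)=0$, $S(x)=y$, $S(y)=x$, $S(u)=-qu$, $S(v)=-q^{-1}v$. With $\widetilde S(h)=\sum\delta(h^{(2)})S(h^{(1)})$ one has $\widetilde S^2=\mathrm{id}$, so $(\delta,1)$ is a modular pair in involution. $\widetilde{HC}_*^{(\delta,1)}(H)$ and $\widetilde{HP}_*^{(\delta,1)}(H)$ are the cyclic homology (homology of the total complex of the cyclic double complex) and periodic cyclic homology of the cyclic module $\widetilde{H}^{(\delta,1)}$: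 $\widetilde{H}^{(\delta,1)}_n=H^{\otimes n}$ ($=k$ for $n=0$), with $d_0(h_1\otimes\dots\otimes h_n)=\varepsilon(h_1)h_2\otimes\dots\otimes h_n$; $d_i$ multiplies $h_i$ and $h_{i+1}$ for $1\le i\le n-1$; $d_n(h_1\otimes\dots\otimes h_n)=\delta(h_n)h_1\otimes\dots\otimes h_{n-1}$; $s_i$ ($0\le i\le n$) inserts $1$ after the $i$-th factor (in front if $i=0$); and $\tau_n(h_1\otimes\dots\otimes h_n)=\sum\delta(h_n^{(2)})S(h_1^{(1)}\cdots h_n^{(1)})\otimes h_1^{(2)}\otimes\dots\otimes h_{n-1}^{(2)}$ ($\tau_0=\mathrm{id}$), where $\Delta(h)=\sum h^{(1)}\otimes h^{(2)}$. *)

theory Defs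
  imports Complex_Main "HOL-Algebra.QuotRing" "HOL-Algebra.Module"
    "HOL-Library.Poly_Mapping"
begin

section \<open>Linear algebra over a type-class field\<close>

text \<open>
  Vector spaces and algebras over the type-class field \<^typ>\<open>'k\<close> are carrier-based records of
  type \<^typ>\<open>('k, 'v) module\<close>.  When such a record is used only as a vector space, its fields
  \<open>mult\<close> and \<open>one\<close> carry no meaning.
\<close>

definition fscale :: "'k::field \<Rightarrow> ('b \<Rightarrow>\<^sub>0 'k) \<Rightarrow> ('b \<Rightarrow>\<^sub>0 'k)"
  where "fscale c p = Poly_Mapping.map ((*) c) p"

lemma lookup_fscale [simp]: "Poly_Mapping.lookup (fscale c p) b = c * Poly_Mapping.lookup p b"
  unfolding fscale_def by transfer (simp add: when_def)

global_interpretation fscale: vector_space "fscale :: 'k::field \<Rightarrow> ('b \<Rightarrow>\<^sub>0 'k) \<Rightarrow> ('b \<Rightarrow>\<^sub>0 'k)"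
  by unfold_locales (auto intro!: poly_mapping_eqI simp: lookup_add algebra_simps)

definition lin_ext :: "('k \<Rightarrow> 'v \<Rightarrow> 'v) \<Rightarrow> ('b \<Rightarrow> 'v) \<Rightarrow> ('b \<Rightarrow>\<^sub>0 'k::field) \<Rightarrow> 'v::comm_monoid_add"
  where "lin_ext sc \<phi> p = (\<Sum>b\<in>Poly_Mapping.keys p. sc (Poly_Mapping.lookup p b) (\<phi> b))"

definition free_space :: "'b set \<Rightarrow> ('k::field, 'b \<Rightarrow>\<^sub>0 'k) module"
  where "free_space B =
    \<lparr>carrier = {p. Poly_Mapping.keys p \<subseteq> B}, mult = (\<lambda>_ _. 0), one = 0, zero = 0, add = (+), smult = fscale\<rparr>"

text \<open>
  For a two-sided ideal \<open>K\<close> of an algebra \<open>M\<close> this is \<open>M Quot K\<close> with the induced scalar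
  multiplication; for a subspace \<open>K\<close> of a vector space it is the quotient vector space.
\<close>

definition quot_module :: "('k, 'v) module \<Rightarrow> 'v set \<Rightarrow> ('k, 'v set) module"
  where "quot_module M K =
    \<lparr>carrier = a_rcosets\<^bsub>M\<^esub> K,
     mult = rcoset_mult M K,
     one = K +>\<^bsub>M\<^esub> \<one>\<^bsub>M\<^esub>,
     zero = K,
     add = set_add M,
     smult = (\<lambda>c A. \<Union>a\<in>A. K +>\<^bsub>M\<^esub> (c \<odot>\<^bsub>M\<^esub> a))\<rparr>"

definition scalar_space :: "('k::field, 'k) module"
  where "scalar_space =
    \<lparr>carrier = UNIV, mult = (*), one = 1, zero = 0, add = (+), smult = (*)\<rparr>"

definition direct_sum :: "('k, 'v) module \<Rightarrow> ('k, 'w) module \<Rightarrow> ('k, 'v \<times> 'w) module"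
  where "direct_sum M N =
    \<lparr>carrier = carrier M \<times> carrier N,
     mult = (\<lambda>(a, a') (b, b'). (a \<otimes>\<^bsub>M\<^esub> b, a' \<otimes>\<^bsub>N\<^esub> b')),
     one = (\<one>\<^bsub>M\<^esub>, \<one>\<^bsub>N\<^esub>),
     zero = (\<zero>\<^bsub>M\<^esub>, \<zero>\<^bsub>N\<^esub>),
     add = (\<lambda>(a, a') (b, b'). (a \<oplus>\<^bsub>M\<^esub> b, a' \<oplus>\<^bsub>N\<^esub> b')),
     smult = (\<lambda>c (a, a'). (c \<odot>\<^bsub>M\<^esub> a, c \<odot>\<^bsub>N\<^esub> a'))\<rparr>"

definition direct_product :: "'i set \<Rightarrow> ('i \<Rightarrow> ('k, 'v) module) \<Rightarrow> ('k, 'i \<Rightarrow> 'v) module"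
  where "direct_product I M =
    \<lparr>carrier = (\<Pi>\<^sub>E i\<in>I. carrier (M i)),
     mult = (\<lambda>f g. \<lambda>i\<in>I. f i \<otimes>\<^bsub>M i\<^esub> g i),
     one = (\<lambda>i\<in>I. \<one>\<^bsub>M i\<^esub>),
     zero = (\<lambda>i\<in>I. \<zero>\<^bsub>M i\<^esub>),
     add = (\<lambda>f g. \<lambda>i\<in>I. f i \<oplus>\<^bsub>M i\<^esub> g i),
     smult = (\<lambda>c f. \<lambda>i\<in>I. c \<odot>\<^bsub>M i\<^esub> f i)\<rparr>"

definition linear_iso :: "('k, 'v) module \<Rightarrow> ('k, 'w) module \<Rightarrow> bool"
  where "linear_iso M N \<longleftrightarrow> (\<exists>f. bij_betw f (carrier M) (carrier N) \<and>
    (\<forall>a\<in>carrier M. \<forall>b\<in>carrier M. f (a \<oplus>\<^bsub>M\<^esub> b) = f a \<oplus>\<^bsub>N\<^esub> f b) \<and>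
    (\<forall>c. \<forall>a\<in>carrier M. f (c \<odot>\<^bsub>M\<^esub> a) = c \<odot>\<^bsub>N\<^esub> f a))"

text \<open>Homology at \<open>B\<close> of \<open>A \<rightarrow> B \<rightarrow> C\<close>, with arrows \<open>d\<close> and \<open>e\<close>.\<close>

definition homology ::
    "('k, 'a) module \<Rightarrow> ('a \<Rightarrow> 'b) \<Rightarrow> ('k, 'b) module \<Rightarrow> ('b \<Rightarrow> 'c) \<Rightarrow> ('k, 'c) module \<Rightarrow> ('k, 'b set) module"
  where "homology A d B e C =
    quot_module (B\<lparr>carrier := {z \<in> carrier B. e z = \<zero>\<^bsub>C\<^esub>}\<rparr>) (d ` carrier A)"


section \<open>Tensor powers\<close>

definition tuples :: "('k, 'h, 'm) module_scheme \<Rightarrow> nat \<Rightarrow> 'h list set"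
  where "tuples M n = {hs. length hs = n \<and> set hs \<subseteq> carrier M}"

definition multilinear_relations :: "('k::field, 'h, 'm) module_scheme \<Rightarrow> nat \<Rightarrow> ('h list \<Rightarrow>\<^sub>0 'k) set"
  where "multilinear_relations M n = fscale.span
    ({Poly_Mapping.single (as @ [a \<oplus>\<^bsub>M\<^esub> b] @ bs) 1
        - Poly_Mapping.single (as @ [a] @ bs) 1 - Poly_Mapping.single (as @ [b] @ bs) 1 | as a b bs.
        as @ [a] @ bs \<in> tuples M n \<and> b \<in> carrier M} \<union>
     {Poly_Mapping.single (as @ [c \<odot>\<^bsub>M\<^esub> a] @ bs) 1
        - fscale c (Poly_Mapping.single (as @ [a] @ bs) 1) | as c a bs.
        as @ [a] @ bs \<in> tuples M n})"

definition tensor_power :: "('k::field, 'h, 'm) module_scheme \<Rightarrow> nat \<Rightarrow> ('k, ('h list \<Rightarrow>\<^sub>0 'k) set) module"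
  where "tensor_power M n = quot_module (free_space (tuples M n)) (multilinear_relations M n)"

definition tensor_class ::
    "('k::field, 'h, 'm) module_scheme \<Rightarrow> nat \<Rightarrow> ('h list \<Rightarrow>\<^sub>0 'k) \<Rightarrow> ('h list \<Rightarrow>\<^sub>0 'k) set"
  where "tensor_class M n p =
    multilinear_relations M n +>\<^bsub>(free_space (tuples M n) :: ('k, 'h list \<Rightarrow>\<^sub>0 'k) module)\<^esub> p"

text \<open>
  The linear map from a tensor power of \<open>M\<close> to the tensor power with \<open>m\<close> factors which sends
  \<open>h\<^sub>1 \<otimes> \<dots> \<otimes> h\<^sub>n\<close> to the class of \<open>\<phi> [h\<^sub>1, \<dots>, h\<^sub>n]\<close>; it is only used for \<open>\<phi>\<close> that
  are multilinear modulo \<open>multilinear_relations M m\<close>.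
\<close>

definition tensor_map ::
    "('k::field, 'h, 'm) module_scheme \<Rightarrow> nat \<Rightarrow> ('h list \<Rightarrow> ('h list \<Rightarrow>\<^sub>0 'k)) \<Rightarrow>
     ('h list \<Rightarrow>\<^sub>0 'k) set \<Rightarrow> ('h list \<Rightarrow>\<^sub>0 'k) set"
  where "tensor_map M m \<phi> A = the_elem ((\<lambda>p. tensor_class M m (lin_ext fscale \<phi> p)) ` A)"


section \<open>Cyclic modules and their homology\<close>

record ('k, 'c) cyclic_module =
  obj :: "nat \<Rightarrow> ('k, 'c) module"
  face :: "nat \<Rightarrow> nat \<Rightarrow> 'c \<Rightarrow> 'c"    \<comment> \<open>\<open>face C n i : C\<^sub>n \<rightarrow> C\<^sub>n\<^sub>-\<^sub>1\<close> for \<open>0 \<le> i \<le> n\<close>, \<open>n \<ge> 1\<close>\<close>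
  degen :: "nat \<Rightarrow> nat \<Rightarrow> 'c \<Rightarrow> 'c"   \<comment> \<open>\<open>degen C n i : C\<^sub>n \<rightarrow> C\<^sub>n\<^sub>+\<^sub>1\<close> for \<open>0 \<le> i \<le> n\<close>\<close>
  cyc :: "nat \<Rightarrow> 'c \<Rightarrow> 'c"            \<comment> \<open>\<open>\<tau>\<^sub>n\<close>\<close>

definition hoch_b :: "('k::field, 'c) cyclic_module \<Rightarrow> nat \<Rightarrow> 'c \<Rightarrow> 'c"
  where "hoch_b C n z =
    (\<Oplus>\<^bsub>obj C (n - 1)\<^esub> i\<in>{0..n}. (- 1) ^ i \<odot>\<^bsub>obj C (n - 1)\<^esub> face C n i z)"

definition hoch_b' :: "('k::field, 'c) cyclic_module \<Rightarrow> nat \<Rightarrow> 'c \<Rightarrow> 'c"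
  where "hoch_b' C n z =
    (\<Oplus>\<^bsub>obj C (n - 1)\<^esub> i\<in>{0..<n}. (- 1) ^ i \<odot>\<^bsub>obj C (n - 1)\<^esub> face C n i z)"

definition signed_cyc :: "('k::field, 'c) cyclic_module \<Rightarrow> nat \<Rightarrow> 'c \<Rightarrow> 'c"
  where "signed_cyc C n z = (- 1) ^ n \<odot>\<^bsub>obj C n\<^esub> cyc C n z"

definition cyc_norm :: "('k::field, 'c) cyclic_module \<Rightarrow> nat \<Rightarrow> 'c \<Rightarrow> 'c"
  where "cyc_norm C n z = (\<Oplus>\<^bsub>obj C n\<^esub> i\<in>{0..n}. (signed_cyc C n ^^ i) z)"

text \<open>
  The cyclic double complex has \<open>C\<^sub>r\<close> in column \<open>p\<close> and row \<open>r \<ge> 0\<close>; the vertical differential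
  is \<open>b\<close> in even and \<open>- b'\<close> in odd columns, and the horizontal differential leaving column \<open>p\<close> is
  \<open>1 - t\<close> for odd and \<open>N\<close> for even \<open>p\<close>.  An element of total degree \<open>n\<close> is recorded by its
  entries indexed by the row \<open>r\<close> alone, the column being \<open>p = n - r\<close>.  Columns \<open>p \<ge> 0\<close>
  correspond to the finite set of rows \<open>r \<le> n\<close>, all columns \<open>p \<in> \<int>\<close> to all rows; in the latter
  case this is the total complex formed with products.
\<close>

definition total_space :: "('k::field, 'c) cyclic_module \<Rightarrow> nat set \<Rightarrow> ('k, nat \<Rightarrow> 'c) module"
  where "total_space C R = direct_product R (obj C)"

definition total_diff ::
    "('k::field, 'c) cyclic_module \<Rightarrow> nat set \<Rightarrow> int \<Rightarrow> (nat \<Rightarrow> 'c) \<Rightarrow> (nat \<Rightarrow> 'c)"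
  \<comment> \<open>\<open>R\<close> is the set of rows in the target degree \<open>n - 1\<close>.\<close>
  where "total_diff C R n z = (\<lambda>r\<in>R.
    (if even (n - 1 - int r) then hoch_b C (r + 1) (z (r + 1))
     else \<ominus>\<^bsub>obj C r\<^esub> hoch_b' C (r + 1) (z (r + 1)))
    \<oplus>\<^bsub>obj C r\<^esub>
    (if odd (n - int r) then z r \<ominus>\<^bsub>obj C r\<^esub> signed_cyc C r (z r)
     else cyc_norm C r (z r)))"

definition total_homology ::
    "('k::field, 'c) cyclic_module \<Rightarrow> (int \<Rightarrow> nat set) \<Rightarrow> int \<Rightarrow> ('k, (nat \<Rightarrow> 'c) set) module"
  where "total_homology C R n = homology
    (total_space C (R (n + 1))) (total_diff C (R n) (n + 1))
    (total_space C (R n)) (total_diff C (R (n - 1)) n)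
    (total_space C (R (n - 1)))"

definition cyclic_homology :: "('k::field, 'c) cyclic_module \<Rightarrow> int \<Rightarrow> ('k, (nat \<Rightarrow> 'c) set) module"
  where "cyclic_homology C = total_homology C (\<lambda>n. {r. int r \<le> n})"

definition periodic_cyclic_homology ::
    "('k::field, 'c) cyclic_module \<Rightarrow> int \<Rightarrow> ('k, (nat \<Rightarrow> 'c) set) module"
  where "periodic_cyclic_homology C = total_homology C (\<lambda>n. UNIV)"


section \<open>The cyclic module of a Hopf algebra with a character\<close>

record (overloaded) ('k::zero, 'h) hopf = "('k, 'h) module" +
  comult :: "'h \<Rightarrow> ('h list \<Rightarrow>\<^sub>0 'k) set"   \<comment> \<open>values in \<open>tensor_power H 2\<close>\<close>
  counit :: "'h \<Rightarrow> 'k"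
  antipode :: "'h \<Rightarrow> 'h"

definition character :: "('k::field, 'h, 'm) module_scheme \<Rightarrow> ('h \<Rightarrow> 'k) \<Rightarrow> bool"
  where "character H \<delta> \<longleftrightarrow> \<delta> \<in> ring_hom H (scalar_space :: ('k, 'k) module) \<and>
    (\<forall>c. \<forall>a\<in>carrier H. \<delta> (c \<odot>\<^bsub>H\<^esub> a) = c * \<delta> a)"

text \<open>
  A list of pairs \<open>(h\<^sup>(\<^sup>1\<^sup>), h\<^sup>(\<^sup>2\<^sup>))\<close> with \<open>\<Delta> h = \<Sum> h\<^sup>(\<^sup>1\<^sup>) \<otimes> h\<^sup>(\<^sup>2\<^sup>)\<close>.  As usual with Sweedler
  notation, it is only used in expressions whose value does not depend on the choice.
\<close>

definition sweedler :: "('k::field, 'h, 'm) hopf_scheme \<Rightarrow> 'h \<Rightarrow> ('h \<times> 'h) list"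
  where "sweedler H h = (SOME ps. set ps \<subseteq> carrier H \<times> carrier H \<and>
    comult H h = tensor_class H 2 (\<Sum>(a, b)\<leftarrow>ps. Poly_Mapping.single [a, b] 1))"

definition hopf_face ::
    "('k::field, 'h, 'm) hopf_scheme \<Rightarrow> ('h \<Rightarrow> 'k) \<Rightarrow> nat \<Rightarrow> nat \<Rightarrow> 'h list \<Rightarrow> ('h list \<Rightarrow>\<^sub>0 'k)"
  where "hopf_face H \<delta> n i hs =
    (if i = 0 then Poly_Mapping.single (tl hs) (counit H (hd hs))
     else if i = n then Poly_Mapping.single (butlast hs) (\<delta> (last hs))
     else Poly_Mapping.single (take (i - 1) hs @ [hs ! (i - 1) \<otimes>\<^bsub>H\<^esub> hs ! i] @ drop (i + 1) hs) 1)"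

definition hopf_degen :: "('k::field, 'h, 'm) hopf_scheme \<Rightarrow> nat \<Rightarrow> 'h list \<Rightarrow> ('h list \<Rightarrow>\<^sub>0 'k)"
  where "hopf_degen H i hs = Poly_Mapping.single (take i hs @ [\<one>\<^bsub>H\<^esub>] @ drop i hs) 1"

text \<open>
  In the sum, \<open>ps\<close> runs over the lists \<open>[(h\<^sub>1\<^sup>(\<^sup>1\<^sup>), h\<^sub>1\<^sup>(\<^sup>2\<^sup>)), \<dots>, (h\<^sub>n\<^sup>(\<^sup>1\<^sup>), h\<^sub>n\<^sup>(\<^sup>2\<^sup>))]\<close>.
\<close>

definition hopf_cyc ::
    "('k::field, 'h, 'm) hopf_scheme \<Rightarrow> ('h \<Rightarrow> 'k) \<Rightarrow> 'h list \<Rightarrow> ('h list \<Rightarrow>\<^sub>0 'k)"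
  where "hopf_cyc H \<delta> hs =
    (if hs = [] then Poly_Mapping.single [] 1
     else \<Sum>ps\<leftarrow>product_lists (map (sweedler H) hs).
       Poly_Mapping.single
         (antipode H (foldr (\<otimes>\<^bsub>H\<^esub>) (map fst ps) \<one>\<^bsub>H\<^esub>) # butlast (map snd ps))
         (\<delta> (snd (last ps))))"

definition hopf_cyclic_module ::
    "('k::field, 'h, 'm) hopf_scheme \<Rightarrow> ('h \<Rightarrow> 'k) \<Rightarrow> ('k, ('h list \<Rightarrow>\<^sub>0 'k) set) cyclic_module"
  where "hopf_cyclic_module H \<delta> =
    \<lparr>obj = tensor_power H,
     face = (\<lambda>n i. tensor_map H (n - 1) (hopf_face H \<delta> n i)),
     degen = (\<lambda>n i. tensor_map H (n + 1) (hopf_degen H i)),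
     cyc = (\<lambda>n. tensor_map H n (hopf_cyc H \<delta>))\<rparr>"

definition HC :: "('k::field, 'h, 'm) hopf_scheme \<Rightarrow> ('h \<Rightarrow> 'k) \<Rightarrow> int \<Rightarrow>
    ('k, (nat \<Rightarrow> ('h list \<Rightarrow>\<^sub>0 'k) set) set) module"
  where "HC H \<delta> = cyclic_homology (hopf_cyclic_module H \<delta>)"

definition HP :: "('k::field, 'h, 'm) hopf_scheme \<Rightarrow> ('h \<Rightarrow> 'k) \<Rightarrow> int \<Rightarrow>
    ('k, (nat \<Rightarrow> ('h list \<Rightarrow>\<^sub>0 'k) set) set) module"
  where "HP H \<delta> = periodic_cyclic_homology (hopf_cyclic_module H \<delta>)"


section \<open>The Hopf algebra \<open>A(SL\<^sub>q(2,k))\<close>\<close>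

datatype gen = GX | GU | GV | GY

text \<open>
  Words form a monoid under concatenation (written additively, as \<^typ>\<open>'a \<Rightarrow>\<^sub>0 'b\<close> requires), so
  \<^typ>\<open>gen list \<Rightarrow>\<^sub>0 'k\<close> with its convolution product is the free algebra on \<^typ>\<open>gen\<close>.
\<close>

instantiation list :: (type) monoid_add
begin
definition zero_list :: "'a list" where "zero_list = []"
definition plus_list :: "'a list \<Rightarrow> 'a list \<Rightarrow> 'a list" where "plus_list = (@)"
instance by standard (simp_all add: zero_list_def plus_list_def)
end

definition free_alg :: "('k::field, gen list \<Rightarrow>\<^sub>0 'k) module"
  where "free_alg =
    \<lparr>carrier = UNIV, mult = (*), one = 1, zero = 0, add = (+), smult = fscale\<rparr>"

definition letter :: "gen \<Rightarrow> (gen list \<Rightarrow>\<^sub>0 'k::field)"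
  where "letter g = Poly_Mapping.single [g] 1"

definition SLq_relations :: "'k::field \<Rightarrow> (gen list \<Rightarrow>\<^sub>0 'k) set"
  where "SLq_relations q =
    (let x = letter GX; u = letter GU; v = letter GV; y = letter GY in
     {u * x - fscale q (x * u),
      v * x - fscale q (x * v),
      y * u - fscale q (u * y),
      y * v - fscale q (v * y),
      u * v - v * u,
      x * y - fscale (inverse q) (u * v) - 1,
      y * x - fscale q (u * v) - 1})"

definition SLq_ideal :: "'k::field \<Rightarrow> (gen list \<Rightarrow>\<^sub>0 'k) set"
  where "SLq_ideal q = Idl\<^bsub>free_alg\<^esub> (SLq_relations q)"

definition SLq_alg :: "'k::field \<Rightarrow> ('k, (gen list \<Rightarrow>\<^sub>0 'k) set) module"
  where "SLq_alg q = quot_module free_alg (SLq_ideal q)"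

definition SLq_class :: "'k::field \<Rightarrow> (gen list \<Rightarrow>\<^sub>0 'k) \<Rightarrow> (gen list \<Rightarrow>\<^sub>0 'k) set"
  where "SLq_class q p = SLq_ideal q +>\<^bsub>(free_alg :: ('k, gen list \<Rightarrow>\<^sub>0 'k) module)\<^esub> p"

abbreviation SLq_gen :: "'k::field \<Rightarrow> gen \<Rightarrow> (gen list \<Rightarrow>\<^sub>0 'k) set"
  where "SLq_gen q g \<equiv> SLq_class q (letter g)"

text \<open>
  The structure maps are given on generators, extended (anti-)multiplicatively to words, linearly to
  the free algebra, and pass to the quotient.
\<close>

fun gen_comult :: "gen \<Rightarrow> (gen \<times> gen) list" where
  "gen_comult GX = [(GX, GX), (GU, GV)]"
| "gen_comult GU = [(GX, GU), (GU, GY)]"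
| "gen_comult GV = [(GV, GX), (GY, GV)]"
| "gen_comult GY = [(GV, GU), (GY, GY)]"

fun gen_counit :: "gen \<Rightarrow> 'k::field" where
  "gen_counit GX = 1"
| "gen_counit GU = 0"
| "gen_counit GV = 0"
| "gen_counit GY = 1"

fun gen_antipode :: "'k::field \<Rightarrow> gen \<Rightarrow> (gen list \<Rightarrow>\<^sub>0 'k)" where
  "gen_antipode q GX = letter GY"
| "gen_antipode q GU = fscale (- q) (letter GU)"
| "gen_antipode q GV = fscale (- inverse q) (letter GV)"
| "gen_antipode q GY = letter GX"

definition word_comult :: "'k::field \<Rightarrow> gen list \<Rightarrow> ((gen list \<Rightarrow>\<^sub>0 'k) set list \<Rightarrow>\<^sub>0 'k)"
  where "word_comult q w = (\<Sum>ps\<leftarrow>product_lists (map gen_comult w).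
    Poly_Mapping.single
      [SLq_class q (Poly_Mapping.single (map fst ps) 1),
       SLq_class q (Poly_Mapping.single (map snd ps) 1)] 1)"

definition SLq_comult ::
    "'k::field \<Rightarrow> (gen list \<Rightarrow>\<^sub>0 'k) set \<Rightarrow> ((gen list \<Rightarrow>\<^sub>0 'k) set list \<Rightarrow>\<^sub>0 'k) set"
  where "SLq_comult q A =
    the_elem ((\<lambda>p. tensor_class (SLq_alg q) 2 (lin_ext fscale (word_comult q) p)) ` A)"

definition SLq_counit :: "(gen list \<Rightarrow>\<^sub>0 'k) set \<Rightarrow> 'k::field"
  where "SLq_counit A =
    the_elem (lin_ext (*) (\<lambda>w. prod_list (map gen_counit w)) ` A)"

definition SLq_antipode :: "'k::field \<Rightarrow> (gen list \<Rightarrow>\<^sub>0 'k) set \<Rightarrow> (gen list \<Rightarrow>\<^sub>0 'k) set"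
  where "SLq_antipode q A = the_elem
    ((\<lambda>p. SLq_class q (lin_ext fscale (\<lambda>w. prod_list (rev (map (gen_antipode q) w))) p)) ` A)"

definition SLq :: "'k::field \<Rightarrow> ('k, (gen list \<Rightarrow>\<^sub>0 'k) set) hopf"
  where "SLq q = module.extend (SLq_alg q)
    (hopf.fields (SLq_comult q) SLq_counit (SLq_antipode q))"

end

theory Submission
  imports Defs "HOL-Library.Product_Plus"
begin

text \<open>
  The algebra has the PBW basis \<open>x\<^sup>i u\<^sup>j v\<^sup>k\<close>, \<open>y\<^sup>i u\<^sup>j v\<^sup>k\<close>, obtained by letting the generators act on the
  span of the normal words, so that the cyclic module becomes an explicit structure on a tensor algebra.
  The map \<open>h\<^sub>1 \<otimes> \<dots> \<otimes> h\<^sub>n \<mapsto> S(h\<^sub>1\<^sup>(\<^sup>1\<^sup>) \<cdots> h\<^sub>n\<^sup>(\<^sup>1\<^sup>)) \<otimes> h\<^sub>1\<^sup>(\<^sup>2\<^sup>) \<otimes> \<dots> \<otimes> h\<^sub>n\<^sup>(\<^sup>2\<^sup>)\<close> turns the cyclic operator into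
  a twisted rotation, whence \<open>\<tau>\<^sup>n\<^sup>+\<^sup>1 = id\<close> and \<open>b (1 - t) = (1 - t) b'\<close>.

  The Hochschild homology is \<open>Tor\<^sup>H(k\<^sub>\<epsilon>, k\<^sub>\<delta>)\<close>.  Dividing \<open>H\<close> successively by \<open>u\<close>, \<open>v\<close> and \<open>x - q\<close> yields
  \<open>k\<^sub>\<delta>\<close>, and as \<open>q \<noteq> 1\<close> the homology is two-dimensional in degrees \<open>1\<close> and \<open>2\<close> and zero elsewhere; the classes
  in degree \<open>1\<close> are those of \<open>u\<close> and \<open>v\<close>.  The odd columns of the double complex are contractible, and
  Connes' operator \<open>B\<close> maps the classes of degree \<open>1\<close> isomorphically onto those of degree \<open>2\<close>.  Hence
  a cycle of the total complex can be solved for a primitive row by row; the classes of \<open>u\<close> and \<open>v\<close> in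
  row \<open>1\<close> are the only obstruction, and it is cancelled from row \<open>2\<close> unless the total degree is \<open>1\<close>.
\<close>


section \<open>Linear maps on free vector spaces\<close>

abbreviation vec :: "'b \<Rightarrow> ('b \<Rightarrow>\<^sub>0 'k::field)" where "vec b \<equiv> Poly_Mapping.single b 1"

text \<open>Only the scalar multiplication of the target is a parameter: \<open>fscale\<close> for
  maps into free spaces, the product of the field for functionals.\<close>

definition linear_map :: "('k::field \<Rightarrow> 'v \<Rightarrow> 'v) \<Rightarrow> (('b \<Rightarrow>\<^sub>0 'k) \<Rightarrow> 'v::ab_group_add) \<Rightarrow> bool"
  where "linear_map sc f \<longleftrightarrow>
    (\<forall>x y. f (x + y) = f x + f y) \<and> (\<forall>c x. f (fscale c x) = sc c (f x))"

text \<open>Most rules assume linearity of an inner map, so that \<open>intro lin\<close> decomposes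
  a composite term until the identity is reached.\<close>

named_theorems lin "linearity of maps"

lemma linear_mapI [intro?]:
  "(\<And>x y. f (x + y) = f x + f y) \<Longrightarrow> (\<And>c x. f (fscale c x) = sc c (f x)) \<Longrightarrow> linear_map sc f"
  by (simp add: linear_map_def)

lemma vector_space_fscale [lin]: "vector_space (fscale :: 'k::field \<Rightarrow> ('b \<Rightarrow>\<^sub>0 'k) \<Rightarrow> _)"
  by unfold_locales

lemma vector_space_times [lin]: "vector_space ((*) :: 'k::field \<Rightarrow> 'k \<Rightarrow> 'k)"
  by unfold_locales (auto simp: algebra_simps)

lemma fscale_eq_mult: "fscale c p = Poly_Mapping.single [] c * p"
  by (simp add: fscale_def mult_map_scale_conv_mult zero_list_def)

lemma fscale_single [simp]: "fscale c (Poly_Mapping.single b d) = Poly_Mapping.single b (c * d)"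
  by (rule poly_mapping_eqI) (simp add: lookup_single when_def)

lemma keys_fscale: "Poly_Mapping.keys (fscale c p) \<subseteq> Poly_Mapping.keys p"
  by (auto simp: in_keys_iff)

lemma mult_fscale_left: "fscale c x * y = fscale c (x * (y :: 'b list \<Rightarrow>\<^sub>0 'k::field))"
  by (simp add: fscale_eq_mult mult.assoc)

lemma vec_mult: "vec xs * vec ys = (vec (xs @ ys) :: 'b list \<Rightarrow>\<^sub>0 'k::field)"
  by (simp add: mult_single plus_list_def)

lemma vec_Nil: "vec [] = (1 :: 'b list \<Rightarrow>\<^sub>0 'k::field)"
  by (metis single_one zero_list_def)

context
  fixes sc :: "'k::field \<Rightarrow> 'v \<Rightarrow> 'v::ab_group_add" and f :: "('b \<Rightarrow>\<^sub>0 'k) \<Rightarrow> 'v"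
  assumes f: "linear_map sc f"
begin

lemma linear_map_add: "f (x + y) = f x + f y"
  using f by (simp add: linear_map_def)

lemma linear_map_scale: "f (fscale c x) = sc c (f x)"
  using f by (simp add: linear_map_def)

lemma linear_map_zero: "f 0 = 0"
  using linear_map_add[of 0 0] by simp

lemma linear_map_minus: "f (- x) = - f x"
  using linear_map_add[of x "- x"] linear_map_zero by (simp add: eq_neg_iff_add_eq_0 add.commute)

lemma linear_map_diff: "f (x - y) = f x - f y"
  using linear_map_add[of x "- y"] linear_map_minus by simp

lemma linear_map_sum: "f (\<Sum>i\<in>I. g i) = (\<Sum>i\<in>I. f (g i))"
  by (induction I rule: infinite_finite_induct) (auto simp: linear_map_zero linear_map_add)

lemma linear_map_sum_list: "f (\<Sum>i\<leftarrow>is. g i) = (\<Sum>i\<leftarrow>is. f (g i))"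
  by (induction "is") (auto simp: linear_map_zero linear_map_add)

lemmas linear_map_simps = linear_map_add linear_map_scale linear_map_zero linear_map_minus
  linear_map_diff linear_map_sum

end

lemma poly_mapping_expand:
  assumes "finite S" "Poly_Mapping.keys p \<subseteq> S"
  shows "p = (\<Sum>b\<in>S. fscale (Poly_Mapping.lookup p b) (vec b))"
proof (rule poly_mapping_eqI)
  fix c
  have "(\<Sum>b\<in>S. Poly_Mapping.lookup p b * Poly_Mapping.lookup (vec b) c) =
      (\<Sum>b\<in>S. if b = c then Poly_Mapping.lookup p c else 0)"
    by (intro sum.cong) (auto simp: lookup_single when_def)
  also have "\<dots> = Poly_Mapping.lookup p c"
    using assms by (auto simp: in_keys_iff)
  finally show "Poly_Mapping.lookup p c =
      Poly_Mapping.lookup (\<Sum>b\<in>S. fscale (Poly_Mapping.lookup p b) (vec b)) c"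
    by (simp add: lookup_sum del: fscale_single)
qed

lemma linear_map_expand:
  assumes "linear_map sc f" "finite S" "Poly_Mapping.keys p \<subseteq> S"
  shows "f p = (\<Sum>b\<in>S. sc (Poly_Mapping.lookup p b) (f (vec b)))"
  by (subst poly_mapping_expand[OF assms(2,3)])
    (simp add: linear_map_sum[OF assms(1)] linear_map_scale[OF assms(1)] del: fscale_single)

lemma linear_map_eqI:
  assumes "linear_map sc f" "linear_map sc g" "\<And>b. b \<in> Poly_Mapping.keys p \<Longrightarrow> f (vec b) = g (vec b)"
  shows "f p = g p"
  using linear_map_expand[OF assms(1), of "Poly_Mapping.keys p" p]
    linear_map_expand[OF assms(2), of "Poly_Mapping.keys p" p] assms(3) by simp

lemma lin_ext_superset:
  assumes "vector_space sc" "finite S" "Poly_Mapping.keys p \<subseteq> S"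
  shows "lin_ext sc \<phi> p = (\<Sum>b\<in>S. sc (Poly_Mapping.lookup p b) (\<phi> b))"
proof -
  interpret vector_space sc by fact
  show ?thesis unfolding lin_ext_def
    using assms by (intro sum.mono_neutral_left) (auto simp: in_keys_iff)
qed

lemma linear_map_lin_ext [lin]:
  assumes "vector_space sc"
  shows "linear_map sc (lin_ext sc \<phi>)"
proof
  interpret vector_space sc by fact
  show "lin_ext sc \<phi> (x + y) = lin_ext sc \<phi> x + lin_ext sc \<phi> y" for x y
    using keys_add[of x y]
    by (simp add: lin_ext_superset[OF assms, of "Poly_Mapping.keys x \<union> Poly_Mapping.keys y"]
        lookup_add scale_left_distrib sum.distrib)
  show "lin_ext sc \<phi> (fscale c x) = sc c (lin_ext sc \<phi> x)" for c x
    using keys_fscale[of c x]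
    by (simp add: lin_ext_superset[OF assms, of "Poly_Mapping.keys x"] scale_sum_right)
qed

lemma lin_ext_single:
  assumes "vector_space sc"
  shows "lin_ext sc \<phi> (Poly_Mapping.single b c) = sc c (\<phi> b)"
proof -
  interpret vector_space sc by fact
  show ?thesis by (simp add: lin_ext_superset[OF assms, of "{b}"])
qed

lemma lin_ext_vec [simp]:
  "lin_ext fscale \<phi> (vec b) = \<phi> b" "lin_ext (*) \<psi> (vec b) = \<psi> b"
  by (simp_all add: lin_ext_single lin)

lemma lin_ext_eq:
  assumes "linear_map sc f" "vector_space sc" "\<And>b. b \<in> Poly_Mapping.keys p \<Longrightarrow> \<phi> b = f (vec b)"
  shows "lin_ext sc \<phi> p = f p"
  by (rule linear_map_eqI[OF linear_map_lin_ext[OF assms(2)] assms(1)])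
    (use assms vector_space.vector_space_assms(4)[OF assms(2)] in \<open>simp add: lin_ext_single\<close>)

lemma linear_map_const_zero [lin]: "vector_space sc \<Longrightarrow> linear_map sc (\<lambda>_. 0)"
  by (simp add: linear_map_def module.scale_zero_right module_iff_vector_space)

lemma linear_map_id [lin]: "linear_map fscale (\<lambda>x. x)"
  by (simp add: linear_map_def)

lemma linear_map_plus [lin]:
  "vector_space sc \<Longrightarrow> linear_map sc f \<Longrightarrow> linear_map sc g \<Longrightarrow> linear_map sc (\<lambda>x. f x + g x)"
  by (simp add: linear_map_def vector_space.vector_space_assms(1) algebra_simps)

lemma linear_map_uminus [lin]:
  "vector_space sc \<Longrightarrow> linear_map sc f \<Longrightarrow> linear_map sc (\<lambda>x. - f x)"
  by (simp add: linear_map_def module.scale_minus_right module_iff_vector_space)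

lemma linear_map_minus' [lin]:
  "vector_space sc \<Longrightarrow> linear_map sc f \<Longrightarrow> linear_map sc g \<Longrightarrow> linear_map sc (\<lambda>x. f x - g x)"
  by (simp add: linear_map_def module.scale_right_diff_distrib module_iff_vector_space)

lemma linear_map_sum' [lin]:
  "vector_space sc \<Longrightarrow> (\<And>i. i \<in> I \<Longrightarrow> linear_map sc (f i)) \<Longrightarrow> linear_map sc (\<lambda>x. \<Sum>i\<in>I. f i x)"
  by (simp add: linear_map_def sum.distrib module.scale_sum_right module_iff_vector_space)

lemma linear_map_fscale [lin]: "linear_map fscale f \<Longrightarrow> linear_map fscale (\<lambda>x. fscale c (f x))"
  by (simp add: linear_map_def fscale.scale_right_distrib mult.commute)

lemma linear_map_fscale_left [lin]: "linear_map (*) f \<Longrightarrow> linear_map fscale (\<lambda>x. fscale (f x) p)"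
  by (simp add: linear_map_def fscale.scale_left_distrib)

lemma linear_map_times_left [lin]: "linear_map (*) f \<Longrightarrow> linear_map (*) (\<lambda>x. f x * c)"
  by (simp add: linear_map_def algebra_simps)

lemma linear_map_times_right [lin]: "linear_map (*) f \<Longrightarrow> linear_map (*) (\<lambda>x. c * f x)"
  by (simp add: linear_map_def algebra_simps)

lemma linear_map_comp:
  "linear_map sc g \<Longrightarrow> linear_map fscale f \<Longrightarrow> linear_map sc (\<lambda>x. g (f x))"
  by (simp add: linear_map_def)

text \<open>Scalars are multiples of the empty word, which is central although words do not commute;
  the rule for the left factor needs associativity only.\<close>

lemma mult_fscale_right: "x * fscale c y = fscale c (x * (y :: 'b list \<Rightarrow>\<^sub>0 'k::field))"
proof -
  have eq: "Poly_Mapping.single [] c * x = x * Poly_Mapping.single [] c"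
  proof -
    have l: "linear_map fscale (\<lambda>x :: 'b list \<Rightarrow>\<^sub>0 'k. Poly_Mapping.single [] c * x)"
      by rule (simp_all add: algebra_simps flip: fscale_eq_mult)
    have r: "linear_map fscale (\<lambda>x :: 'b list \<Rightarrow>\<^sub>0 'k. x * Poly_Mapping.single [] c)"
      by rule (simp_all add: algebra_simps mult_fscale_left)
    show ?thesis by (rule linear_map_eqI[OF l r]) (simp add: mult_single plus_list_def)
  qed
  show ?thesis by (simp add: fscale_eq_mult flip: mult.assoc) (simp add: eq)
qed

lemma linear_map_mult_left [lin]:
  "linear_map fscale f \<Longrightarrow> linear_map fscale (\<lambda>x. f x * (c :: 'b list \<Rightarrow>\<^sub>0 'k::field))"
  by (simp add: linear_map_def algebra_simps mult_fscale_left)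

lemma linear_map_mult_right [lin]:
  "linear_map fscale f \<Longrightarrow> linear_map fscale (\<lambda>x. (c :: 'b list \<Rightarrow>\<^sub>0 'k::field) * f x)"
  by (simp add: linear_map_def algebra_simps mult_fscale_right)

definition bilinear_map :: "(('a \<Rightarrow>\<^sub>0 'k::field) \<Rightarrow> ('b \<Rightarrow>\<^sub>0 'k) \<Rightarrow> ('c \<Rightarrow>\<^sub>0 'k)) \<Rightarrow> bool"
  where "bilinear_map \<Phi> \<longleftrightarrow> (\<forall>x. linear_map fscale (\<Phi> x)) \<and> (\<forall>y. linear_map fscale (\<lambda>x. \<Phi> x y))"

lemma bilinear_mapI:
  "(\<And>x. linear_map fscale (\<Phi> x)) \<Longrightarrow> (\<And>y. linear_map fscale (\<lambda>x. \<Phi> x y)) \<Longrightarrow> bilinear_map \<Phi>"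
  by (simp add: bilinear_map_def)

lemma bilinear_map_right: "bilinear_map \<Phi> \<Longrightarrow> linear_map fscale (\<Phi> x)"
  and bilinear_map_left: "bilinear_map \<Phi> \<Longrightarrow> linear_map fscale (\<lambda>x. \<Phi> x y)"
  by (simp_all add: bilinear_map_def)

lemma bilinear_map_eqI:
  assumes "bilinear_map \<Phi>" "bilinear_map \<Psi>"
    "\<And>a b. a \<in> Poly_Mapping.keys x \<Longrightarrow> b \<in> Poly_Mapping.keys y \<Longrightarrow> \<Phi> (vec a) (vec b) = \<Psi> (vec a) (vec b)"
  shows "\<Phi> x y = \<Psi> x y"
proof -
  have "\<Phi> (vec a) y = \<Psi> (vec a) y" if "a \<in> Poly_Mapping.keys x" for a
    by (rule linear_map_eqI[OF bilinear_map_right bilinear_map_right]) (use assms that in auto)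
  then show ?thesis
    by (rule linear_map_eqI[OF bilinear_map_left bilinear_map_left, OF assms(1,2)])
qed

section \<open>The PBW basis\<close>

text \<open>
  The index \<open>(i, j, k)\<close> stands for \<open>x\<^sup>i u\<^sup>j v\<^sup>k\<close> if \<open>i \<ge> 0\<close> and for \<open>y\<^sup>-\<^sup>i u\<^sup>j v\<^sup>k\<close> if \<open>i < 0\<close>;
  \<open>gen_op\<close> is left multiplication by a generator in this basis.
\<close>

type_synonym idx = "int \<times> nat \<times> nat"

section \<open>The free algebra and the ideal of relations\<close>

lemma ring_free_alg: "ring (free_alg :: ('k::field, gen list \<Rightarrow>\<^sub>0 'k) module)"
proof (rule ringI)
  show "abelian_group (free_alg :: ('k, gen list \<Rightarrow>\<^sub>0 'k) module)"
    by (rule abelian_groupI)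
      (auto simp: free_alg_def add.assoc add.commute intro: exI[of _ "- _"] ab_left_minus)
  show "Group.monoid (free_alg :: ('k, gen list \<Rightarrow>\<^sub>0 'k) module)"
    by (rule monoidI) (auto simp: free_alg_def mult.assoc)
qed (auto simp: free_alg_def algebra_simps)

lemma a_inv_free_alg: "\<ominus>\<^bsub>free_alg\<^esub> p = - (p :: gen list \<Rightarrow>\<^sub>0 'k::field)"
proof -
  interpret ring "free_alg :: ('k, gen list \<Rightarrow>\<^sub>0 'k) module" by (rule ring_free_alg)
  have "- p \<oplus>\<^bsub>free_alg\<^esub> p = \<zero>\<^bsub>free_alg\<^esub>" by (simp add: free_alg_def)
  then show ?thesis by (intro minus_equality) (auto simp: free_alg_def)
qed

lemma ideal_free_algI:
  fixes J :: "(gen list \<Rightarrow>\<^sub>0 'k::field) set"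
  assumes "0 \<in> J" "\<And>a b. a \<in> J \<Longrightarrow> b \<in> J \<Longrightarrow> a + b \<in> J" "\<And>a. a \<in> J \<Longrightarrow> - a \<in> J"
    "\<And>a b. a \<in> J \<Longrightarrow> a * b \<in> J" "\<And>a b. a \<in> J \<Longrightarrow> b * a \<in> J"
  shows "ideal J (free_alg :: ('k, gen list \<Rightarrow>\<^sub>0 'k) module)"
proof (rule idealI[OF ring_free_alg])
  interpret ring "free_alg :: ('k, gen list \<Rightarrow>\<^sub>0 'k) module" by (rule ring_free_alg)
  show "subgroup J (add_monoid (free_alg :: ('k, gen list \<Rightarrow>\<^sub>0 'k) module))"
  proof (rule subgroup.intro)
    fix x assume "x \<in> J"
    then show "inv\<^bsub>add_monoid (free_alg :: ('k, gen list \<Rightarrow>\<^sub>0 'k) module)\<^esub> x \<in> J"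
      using assms(3) a_inv_free_alg[of x] by (simp add: a_inv_def)
  qed (use assms in \<open>auto simp: free_alg_def\<close>)
qed (use assms in \<open>auto simp: free_alg_def\<close>)

lemma SLq_ideal_ideal: "ideal (SLq_ideal q) (free_alg :: ('k::field, gen list \<Rightarrow>\<^sub>0 'k) module)"
  unfolding SLq_ideal_def
  by (rule ring.genideal_ideal[OF ring_free_alg]) (simp add: free_alg_def)

lemma SLq_ideal_relation: "r \<in> SLq_relations q \<Longrightarrow> r \<in> SLq_ideal q"
  unfolding SLq_ideal_def
  using ring.genideal_self[OF ring_free_alg, of "SLq_relations q"] by (auto simp: free_alg_def)

lemma SLq_ideal_minimal:
  fixes J :: "(gen list \<Rightarrow>\<^sub>0 'k::field) set"
  assumes "ideal J (free_alg :: ('k, gen list \<Rightarrow>\<^sub>0 'k) module)" "SLq_relations q \<subseteq> J"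
  shows "SLq_ideal q \<subseteq> J"
  unfolding SLq_ideal_def using assms by (rule ring.genideal_minimal[OF ring_free_alg])

lemma SLq_ideal_closed:
  fixes a b :: "gen list \<Rightarrow>\<^sub>0 'k::field"
  shows "0 \<in> SLq_ideal q"
    and "a \<in> SLq_ideal q \<Longrightarrow> b \<in> SLq_ideal q \<Longrightarrow> a + b \<in> SLq_ideal q"
    and "a \<in> SLq_ideal q \<Longrightarrow> b \<in> SLq_ideal q \<Longrightarrow> a - b \<in> SLq_ideal q"
    and "a \<in> SLq_ideal q \<Longrightarrow> - a \<in> SLq_ideal q"
    and "a \<in> SLq_ideal q \<Longrightarrow> a * b \<in> SLq_ideal q"
    and "a \<in> SLq_ideal q \<Longrightarrow> b * a \<in> SLq_ideal q"
    and "a \<in> SLq_ideal q \<Longrightarrow> fscale c a \<in> SLq_ideal q"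
proof -
  interpret ideal "SLq_ideal q" "free_alg :: ('k, gen list \<Rightarrow>\<^sub>0 'k) module"
    by (rule SLq_ideal_ideal)
  show 0: "0 \<in> SLq_ideal q" using additive_subgroup.zero_closed[OF additive_subgroup_axioms]
    by (simp add: free_alg_def)
  show 1: "a + b \<in> SLq_ideal q" if "a \<in> SLq_ideal q" "b \<in> SLq_ideal q" for a b
    using additive_subgroup.a_closed[OF additive_subgroup_axioms that] by (simp add: free_alg_def)
  show 2: "- a \<in> SLq_ideal q" if "a \<in> SLq_ideal q" for a
    using additive_subgroup.a_inv_closed[OF additive_subgroup_axioms that]
    by (simp add: a_inv_free_alg)
  show "a - b \<in> SLq_ideal q" if "a \<in> SLq_ideal q" "b \<in> SLq_ideal q"
    using 1[OF that(1) 2[OF that(2)]] by simp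
  show 3: "b * a \<in> SLq_ideal q" if "a \<in> SLq_ideal q" for a b
    using I_l_closed[OF that, of b] by (simp add: free_alg_def)
  show "a * b \<in> SLq_ideal q" if "a \<in> SLq_ideal q"
    using I_r_closed[OF that, of b] by (simp add: free_alg_def)
  show "fscale c a \<in> SLq_ideal q" if "a \<in> SLq_ideal q"
    using 3[OF that, of "Poly_Mapping.single [] c"] by (simp add: fscale_eq_mult)
qed

lemma letter_mult: "letter g * vec w = (vec (g # w) :: gen list \<Rightarrow>\<^sub>0 'k::field)"
  by (simp add: letter_def vec_mult)

lemma letter_power: "letter g ^ m = (vec (replicate m g) :: gen list \<Rightarrow>\<^sub>0 'k::field)"
  by (induction m) (auto simp: vec_Nil letter_mult)

locale SLq_model =
  fixes q :: "'k::field_char_0"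
  assumes q0 [simp]: "q \<noteq> 0"
begin

text \<open>For i < 0 the correction comes from x y = 1 + q^-1 u v: moving u v to the right of the
  remaining power, of index i + 1, costs q^(2 i + 2), which leaves q^(2 i + 1). For y and i > 0 the
  same computation gives q q^(2 i - 2).\<close>

fun gen_op_vec :: "gen \<Rightarrow> idx \<Rightarrow> (idx \<Rightarrow>\<^sub>0 'k)" where
  "gen_op_vec GX (i, j, k) = vec (i + 1, j, k) +
     (if i < 0 then Poly_Mapping.single (i + 1, j + 1, k + 1) (q powi (2 * i + 1)) else 0)"
| "gen_op_vec GU (i, j, k) = Poly_Mapping.single (i, j + 1, k) (q powi i)"
| "gen_op_vec GV (i, j, k) = Poly_Mapping.single (i, j, k + 1) (q powi i)"
| "gen_op_vec GY (i, j, k) = vec (i - 1, j, k) +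
     (if i > 0 then Poly_Mapping.single (i - 1, j + 1, k + 1) (q powi (2 * i - 1)) else 0)"

definition gen_op :: "gen \<Rightarrow> (idx \<Rightarrow>\<^sub>0 'k) \<Rightarrow> (idx \<Rightarrow>\<^sub>0 'k)"
  where "gen_op g = lin_ext fscale (gen_op_vec g)"

lemma linear_gen_op [lin]: "linear_map fscale f \<Longrightarrow> linear_map fscale (\<lambda>x. gen_op g (f x))"
  unfolding gen_op_def by (intro linear_map_comp[OF linear_map_lin_ext] lin)

lemmas gen_op_simps = linear_map_simps[OF linear_gen_op[OF linear_map_id]]

lemma gen_op_single [simp]: "gen_op g (Poly_Mapping.single b c) = fscale c (gen_op_vec g b)"
  unfolding gen_op_def by (simp add: lin_ext_single lin)

definition act :: "(gen list \<Rightarrow>\<^sub>0 'k) \<Rightarrow> (idx \<Rightarrow>\<^sub>0 'k) \<Rightarrow> (idx \<Rightarrow>\<^sub>0 'k)"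
  where "act p a = lin_ext fscale (\<lambda>w. foldr gen_op w a) p"

lemma linear_foldr_gen_op: "linear_map fscale (foldr gen_op w)"
  by (induction w) (auto simp: comp_def id_def intro!: lin)

lemma linear_act_left [lin]: "linear_map fscale f \<Longrightarrow> linear_map fscale (\<lambda>p. act (f p) a)"
  unfolding act_def by (intro linear_map_comp[OF linear_map_lin_ext] lin)

lemma linear_act [lin]: "linear_map fscale f \<Longrightarrow> linear_map fscale (\<lambda>x. act p (f x))"
proof -
  have "linear_map fscale (act p)"
    unfolding act_def lin_ext_def
    by (intro lin linear_map_fscale) (rule linear_foldr_gen_op)
  then show "linear_map fscale f \<Longrightarrow> linear_map fscale (\<lambda>x. act p (f x))"
    by (rule linear_map_comp)
qed

lemmas act_left_simps = linear_map_simps[OF linear_act_left[OF linear_map_id]]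
lemmas act_simps = linear_map_simps[OF linear_act[OF linear_map_id]]

lemma act_vec [simp]: "act (vec w) a = foldr gen_op w a"
  by (simp add: act_def)

lemma act_letter [simp]: "act (letter g) a = gen_op g a"
  by (simp add: letter_def)

lemma act_one [simp]: "act 1 a = a"
  by (simp flip: vec_Nil)

lemma act_mult [simp]: "act (p * r) a = act p (act r a)"
  by (rule bilinear_map_eqI[where \<Phi> = "\<lambda>p r. act (p * r) a" and \<Psi> = "\<lambda>p r. act p (act r a)"])
    (auto intro!: bilinear_mapI lin simp: vec_mult)

text \<open>The relations hold as operator identities on basis vectors; this is what makes the
  normal words independent in the quotient and not merely spanning.\<close>

lemma act_relation:
  assumes "r \<in> SLq_relations q"
  shows "act r a = 0"
proof (rule linear_map_eqI[where sc = fscale and f = "act r" and g = "\<lambda>_. 0"])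
  fix b :: idx
  obtain i j k where b: "b = (i, j, k)" by (metis prod_cases3)
  have e: "q powi (i + 1) = q * q powi i" "q powi (1 + i) = q * q powi i"
    "q powi (i - 1) = inverse q * q powi i" "q powi (i * 2) = q powi i * q powi i"
    "q powi (1 + i * 2) = q * (q powi i * q powi i)" for i :: int
    by (simp_all add: power_int_add power_int_diff power_int_mult power2_eq_square field_simps)
  have c: "q * (inverse q * z) = z" for z by simp
  have "\<forall>r\<in>SLq_relations q. act r (vec b) = 0"
    unfolding b SLq_relations_def Let_def
    by (auto simp: act_left_simps gen_op_simps algebra_simps simp flip: single_add)
      (simp_all add: e c algebra_simps)
  then show "act r (vec b) = 0" using assms by blast
qed (auto intro: lin)

lemma act_ideal: "p \<in> SLq_ideal q \<Longrightarrow> act p a = 0"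
proof -
  have "SLq_ideal q \<subseteq> {p. \<forall>a. act p a = 0}"
    by (rule SLq_ideal_minimal[OF ideal_free_algI])
      (auto simp: act_left_simps act_simps act_relation)
  then show "p \<in> SLq_ideal q \<Longrightarrow> act p a = 0" by blast
qed

text \<open>Acting on the vector of the unit reads off the PBW coordinates of the class of
  p.\<close>

definition ev :: "(gen list \<Rightarrow>\<^sub>0 'k) \<Rightarrow> (idx \<Rightarrow>\<^sub>0 'k)"
  where "ev p = act p (vec (0, 0, 0))"

lemma linear_ev [lin]: "linear_map fscale f \<Longrightarrow> linear_map fscale (\<lambda>x. ev (f x))"
  unfolding ev_def by (intro lin)

lemmas ev_simps = linear_map_simps[OF linear_ev[OF linear_map_id]]

fun normal_word :: "idx \<Rightarrow> gen list" where
  "normal_word (i, j, k) = (if i \<ge> 0 then replicate (nat i) GX else replicate (nat (- i)) GY) @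
     replicate j GU @ replicate k GV"

definition lift :: "(idx \<Rightarrow>\<^sub>0 'k) \<Rightarrow> (gen list \<Rightarrow>\<^sub>0 'k)"
  where "lift = lin_ext fscale (\<lambda>b. vec (normal_word b))"

lemma linear_lift [lin]: "linear_map fscale f \<Longrightarrow> linear_map fscale (\<lambda>x. lift (f x))"
  unfolding lift_def by (intro linear_map_comp[OF linear_map_lin_ext] lin)

lemmas lift_simps = linear_map_simps[OF linear_lift[OF linear_map_id]]

lemma lift_single [simp]: "lift (Poly_Mapping.single b c) = Poly_Mapping.single (normal_word b) c"
  by (simp add: lift_def lin_ext_single lin)

lemma foldr_gen_op_GV: "foldr gen_op (replicate n GV) (vec (0, j, k)) = vec (0, j, k + n)"
  by (induction n) auto

lemma foldr_gen_op_GU: "foldr gen_op (replicate n GU) (vec (0, j, k)) = vec (0, j + n, k)"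
  by (induction n) auto

lemma foldr_gen_op_GX: "i \<ge> 0 \<Longrightarrow> foldr gen_op (replicate n GX) (vec (i, j, k)) = vec (i + int n, j, k)"
  by (induction n) (auto simp: algebra_simps)

lemma foldr_gen_op_GY: "i \<le> 0 \<Longrightarrow> foldr gen_op (replicate n GY) (vec (i, j, k)) = vec (i - int n, j, k)"
  by (induction n) (auto simp: algebra_simps)

lemma act_normal_word: "act (vec (normal_word (i, j, k))) (vec (0, j', k')) = vec (i, j + j', k + k')"
  by (auto simp: foldr_gen_op_GV foldr_gen_op_GU foldr_gen_op_GX foldr_gen_op_GY add.commute
      simp del: foldr_replicate)

text \<open>A normal word builds its basis vector without corrections: v and u act at index 0, and
  the powers of x or y act last, moving the index away from 0.\<close>

lemma ev_lift [simp]: "ev (lift a) = a"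
proof (rule linear_map_eqI[where sc = fscale and f = "\<lambda>a. ev (lift a)"])
  show "ev (lift (vec b)) = vec b" for b
    using act_normal_word[of "fst b" "fst (snd b)" "snd (snd b)" 0 0] by (simp add: ev_def)
qed (intro lin)+

section \<open>Straightening words modulo the relations\<close>

definition cong :: "(gen list \<Rightarrow>\<^sub>0 'k) \<Rightarrow> (gen list \<Rightarrow>\<^sub>0 'k) \<Rightarrow> bool" (infix "\<approx>" 50)
  where "a \<approx> b \<longleftrightarrow> a - b \<in> SLq_ideal q"

lemma cong_refl [simp]: "a \<approx> a"
  by (simp add: cong_def SLq_ideal_closed)

lemma cong_sym: "a \<approx> b \<Longrightarrow> b \<approx> a"
  using SLq_ideal_closed(4)[of "a - b" q] by (simp add: cong_def)

lemma cong_trans [trans]: "a \<approx> b \<Longrightarrow> b \<approx> c \<Longrightarrow> a \<approx> c"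
  using SLq_ideal_closed(2)[of "a - b" q "b - c"] by (simp add: cong_def)

lemma cong_add: "a \<approx> b \<Longrightarrow> c \<approx> d \<Longrightarrow> a + c \<approx> b + d"
  using SLq_ideal_closed(2)[of "a - b" q "c - d"] by (simp add: cong_def algebra_simps)

lemma cong_fscale: "a \<approx> b \<Longrightarrow> fscale c a \<approx> fscale c b"
  using SLq_ideal_closed(7)[of "a - b" q c] by (simp add: cong_def fscale.scale_right_diff_distrib)

lemma cong_mult_left: "a \<approx> b \<Longrightarrow> c * a \<approx> c * b"
  using SLq_ideal_closed(6)[of "a - b" q c] by (simp add: cong_def algebra_simps)

lemma cong_mult_right: "a \<approx> b \<Longrightarrow> a * c \<approx> b * c"
  using SLq_ideal_closed(5)[of "a - b" q c] by (simp add: cong_def algebra_simps)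

lemma cong_power:
  assumes "a * b \<approx> fscale c (b * a)"
  shows "a * b ^ m \<approx> fscale (c ^ m) (b ^ m * a)"
proof (induction m)
  case (Suc m)
  have "a * b ^ Suc m = (a * b) * b ^ m" by (simp add: mult.assoc)
  also have "\<dots> \<approx> fscale c (b * a) * b ^ m" using assms by (rule cong_mult_right)
  also have "\<dots> = fscale c (b * (a * b ^ m))" by (simp add: mult_fscale_left mult.assoc)
  also have "\<dots> \<approx> fscale c (b * fscale (c ^ m) (b ^ m * a))"
    by (intro cong_fscale cong_mult_left Suc)
  also have "\<dots> = fscale (c ^ Suc m) (b ^ Suc m * a)"
    by (simp add: mult_fscale_right mult.assoc)
  finally show ?case .
qed simp

lemma cong_relations:
  "letter GU * letter GX \<approx> fscale q (letter GX * letter GU)"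
  "letter GV * letter GX \<approx> fscale q (letter GX * letter GV)"
  "letter GY * letter GU \<approx> fscale q (letter GU * letter GY)"
  "letter GY * letter GV \<approx> fscale q (letter GV * letter GY)"
  "letter GU * letter GV \<approx> letter GV * letter GU"
  "letter GX * letter GY \<approx> 1 + fscale (inverse q) (letter GU * letter GV)"
  "letter GY * letter GX \<approx> 1 + fscale q (letter GU * letter GV)"
  unfolding cong_def by (rule SLq_ideal_relation, simp add: SLq_relations_def Let_def algebra_simps)+

lemma cong_commute:
  "letter GU * letter GY \<approx> fscale (inverse q) (letter GY * letter GU)"
  "letter GV * letter GY \<approx> fscale (inverse q) (letter GY * letter GV)"
  "letter GV * letter GU \<approx> fscale 1 (letter GU * letter GV)"
  using cong_fscale[OF cong_sym[OF cong_relations(3)], of "inverse q"]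
    cong_fscale[OF cong_sym[OF cong_relations(4)], of "inverse q"]
    cong_sym[OF cong_relations(5)] by simp_all

lemma cong_commute_mult:
  assumes "a * c \<approx> fscale s (c * a)" "b * c \<approx> fscale t (c * b)"
  shows "a * b * c \<approx> fscale (s * t) (c * (a * b))"
proof -
  have "a * b * c = a * (b * c)" by (simp add: mult.assoc)
  also have "\<dots> \<approx> a * fscale t (c * b)" by (intro cong_mult_left assms)
  also have "\<dots> = fscale t ((a * c) * b)" by (simp add: mult_fscale_right mult.assoc)
  also have "\<dots> \<approx> fscale t (fscale s (c * a) * b)" by (intro cong_fscale cong_mult_right assms)
  also have "\<dots> = fscale (s * t) (c * (a * b))"
    by (simp add: mult_fscale_left mult.assoc mult.commute[of s])
  finally show ?thesis .
qed

definition xy_power :: "int \<Rightarrow> (gen list \<Rightarrow>\<^sub>0 'k)"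
  where "xy_power i = (if i \<ge> 0 then letter GX ^ nat i else letter GY ^ nat (- i))"

lemma xy_power_int: "xy_power (int m) = letter GX ^ m" "xy_power (- int m) = letter GY ^ m"
  by (auto simp: xy_power_def)

lemma xy_power_step:
  "i \<ge> 0 \<Longrightarrow> letter GX * xy_power i = xy_power (i + 1)"
  "i \<le> 0 \<Longrightarrow> letter GY * xy_power i = xy_power (i - 1)"
proof -
  show "letter GX * xy_power i = xy_power (i + 1)" if "i \<ge> 0"
    using that xy_power_int(1)[of "nat i"] xy_power_int(1)[of "Suc (nat i)"]
    by (simp add: add.commute)
  show "letter GY * xy_power i = xy_power (i - 1)" if "i \<le> 0"
    using that xy_power_int(2)[of "nat (- i)"] xy_power_int(2)[of "Suc (nat (- i))"]
    by simp
qed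

lemma vec_normal_word: "vec (normal_word (i, j, k)) = xy_power i * letter GU ^ j * letter GV ^ k"
  by (simp add: xy_power_def letter_power vec_mult)

lemma cong_xy_power:
  assumes "a * letter GX \<approx> fscale c (letter GX * a)"
    and "a * letter GY \<approx> fscale (inverse c) (letter GY * a)"
  shows "a * xy_power i \<approx> fscale (c powi i) (xy_power i * a)"
  using cong_power[OF assms(1), of "nat i"] cong_power[OF assms(2), of "nat (- i)"]
  by (auto simp: xy_power_def power_int_def)

text \<open>The spanning half of the PBW theorem: straightening a letter times a normal word gives
  exactly the value prescribed for the operator.\<close>

lemma cong_letter_normal_word: "letter g * vec (normal_word b) \<approx> lift (gen_op_vec g b)"
proof -
  obtain i j k where b: "b = (i, j, k)" by (metis prod_cases3)
  let ?u = "letter GU" and ?v = "letter GV" and ?x = "letter GX" and ?y = "letter GY"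
  have vu: "?v * ?u ^ n \<approx> ?u ^ n * ?v" for n
    using cong_power[OF cong_commute(3), of n] by simp
  have insert: "xy_power i * (?u * ?v) * (?u ^ j * ?v ^ k) \<approx> vec (normal_word (i, j + 1, k + 1))" for i
  proof -
    have "xy_power i * (?u * ?v) * (?u ^ j * ?v ^ k) = xy_power i * ?u * ((?v * ?u ^ j) * ?v ^ k)"
      by (simp add: mult.assoc)
    also have "\<dots> \<approx> xy_power i * ?u * ((?u ^ j * ?v) * ?v ^ k)"
      by (intro cong_mult_left cong_mult_right vu)
    also have "\<dots> = vec (normal_word (i, j + 1, k + 1))"
    proof -
      have "vec (normal_word (i, j + 1, k + 1)) = xy_power i * (?u * ?u ^ j) * (?v * ?v ^ k)"
        by (simp only: vec_normal_word power_Suc[symmetric] Suc_eq_plus1)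
      then show ?thesis by (simp only: mult.assoc)
    qed
    finally show ?thesis .
  qed
  \<comment> \<open>Shared by the cases x and y, where a product x y or y x collapses to 1 + c u v
    in front of a shorter power, with c equal to q^-1 or q.\<close>
  have xy: "(1 + fscale c (?u * ?v)) * xy_power i * (?u ^ j * ?v ^ k) \<approx>
      lift (vec (i, j, k) + Poly_Mapping.single (i, j + 1, k + 1) (c * q powi (2 * i)))" for c i
  proof -
    have "?u * ?v * xy_power i \<approx> fscale ((q * q) powi i) (xy_power i * (?u * ?v))"
      using cong_xy_power[of "?u * ?v" "q * q" i] cong_commute_mult[OF cong_relations(1,2)]
        cong_commute_mult[OF cong_commute(1,2)] by simp
    then have comm: "?u * ?v * xy_power i * w \<approx> fscale ((q * q) powi i) (xy_power i * (?u * ?v)) * w" for w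
      by (rule cong_mult_right)
    have "(1 + fscale c (?u * ?v)) * xy_power i * (?u ^ j * ?v ^ k) =
        xy_power i * (?u ^ j * ?v ^ k) + fscale c (?u * ?v * xy_power i * (?u ^ j * ?v ^ k))"
      by (simp only: distrib_right mult_fscale_left mult.assoc mult_1_left)
    also have "\<dots> \<approx> xy_power i * (?u ^ j * ?v ^ k) +
        fscale c (fscale ((q * q) powi i) (xy_power i * (?u * ?v)) * (?u ^ j * ?v ^ k))"
      by (intro cong_add cong_fscale comm cong_refl)
    also have "\<dots> = xy_power i * (?u ^ j * ?v ^ k) +
        fscale (c * (q * q) powi i) (xy_power i * (?u * ?v) * (?u ^ j * ?v ^ k))"
      by (simp only: mult_fscale_left fscale.scale_scale)
    also have "\<dots> \<approx> xy_power i * (?u ^ j * ?v ^ k) +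
        fscale (c * (q * q) powi i) (vec (normal_word (i, j + 1, k + 1)))"
      by (intro cong_add cong_fscale insert cong_refl)
    also have "\<dots> = lift (vec (i, j, k) + Poly_Mapping.single (i, j + 1, k + 1) (c * q powi (2 * i)))"
      using vec_normal_word[of i j k]
      by (simp add: lift_simps mult.assoc power_int_mult power2_eq_square del: normal_word.simps)
    finally show ?thesis .
  qed
  show ?thesis
  proof (cases g)
    case GU
    have "?u * xy_power i * (?u ^ j * ?v ^ k) \<approx> fscale (q powi i) (xy_power i * ?u) * (?u ^ j * ?v ^ k)"
      by (intro cong_mult_right cong_xy_power cong_relations cong_commute)
    then show ?thesis
      using arg_cong[OF vec_normal_word[of i "j + 1" k], of "fscale (q powi i)"]
        vec_normal_word[of i j k]
      by (simp add: GU b mult.assoc mult_fscale_left del: normal_word.simps)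
  next
    case GV
    have "?v * xy_power i * (?u ^ j * ?v ^ k) \<approx> fscale (q powi i) (xy_power i * ?v) * (?u ^ j * ?v ^ k)"
      by (intro cong_mult_right cong_xy_power cong_relations cong_commute)
    also have "\<dots> = fscale (q powi i) (xy_power i * ((?v * ?u ^ j) * ?v ^ k))"
      by (simp add: mult.assoc mult_fscale_left)
    also have "\<dots> \<approx> fscale (q powi i) (xy_power i * ((?u ^ j * ?v) * ?v ^ k))"
      by (intro cong_mult_left cong_mult_right cong_fscale vu)
    also have "\<dots> = lift (gen_op_vec GV b)"
      using arg_cong[OF vec_normal_word[of i j "k + 1"], of "fscale (q powi i)"]
      by (simp add: b mult.assoc del: normal_word.simps)
    finally show ?thesis
      by (simp add: GV b vec_normal_word mult.assoc del: normal_word.simps)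
  next
    case GX
    show ?thesis
    proof (cases "i < 0")
      case True
      then have "xy_power i = ?y * xy_power (i + 1)"
        using xy_power_step(2)[of "i + 1"] by simp
      then have "?x * xy_power i * (?u ^ j * ?v ^ k) = ?x * ?y * xy_power (i + 1) * (?u ^ j * ?v ^ k)"
        by (simp add: mult.assoc)
      also have "\<dots> \<approx> (1 + fscale (inverse q) (?u * ?v)) * xy_power (i + 1) * (?u ^ j * ?v ^ k)"
        by (intro cong_mult_right cong_relations)
      also note xy
      finally show ?thesis using True
        by (simp add: GX b vec_normal_word mult.assoc power_int_add power_int_diff power2_eq_square field_simps
            del: normal_word.simps)
    next
      case False
      then have "?x * xy_power i = xy_power (i + 1)"
        using xy_power_step(1)[of i] by simp
      then show ?thesis using False
        by (simp add: GX b vec_normal_word flip: mult.assoc del: normal_word.simps)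
    qed
  next
    case GY
    show ?thesis
    proof (cases "i > 0")
      case True
      then have "xy_power i = ?x * xy_power (i - 1)"
        using xy_power_step(1)[of "i - 1"] by simp
      then have "?y * xy_power i * (?u ^ j * ?v ^ k) = ?y * ?x * xy_power (i - 1) * (?u ^ j * ?v ^ k)"
        by (simp add: mult.assoc)
      also have "\<dots> \<approx> (1 + fscale q (?u * ?v)) * xy_power (i - 1) * (?u ^ j * ?v ^ k)"
        by (intro cong_mult_right cong_relations)
      also note xy
      finally show ?thesis using True
        by (simp add: GY b vec_normal_word mult.assoc power_int_add power_int_diff power2_eq_square field_simps
            del: normal_word.simps)
    next
      case False
      then have "?y * xy_power i = xy_power (i - 1)"
        using xy_power_step(2)[of i] by simp
      then show ?thesis using False
        by (simp add: GY b vec_normal_word flip: mult.assoc del: normal_word.simps)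
    qed
  qed
qed

lemma cong_letter_lift: "letter g * lift a \<approx> lift (gen_op g a)"
proof -
  have "letter g * lift a - lift (gen_op g a) = lin_ext fscale (\<lambda>b. letter g * lift (vec b) - lift (gen_op g (vec b))) a"
    by (rule lin_ext_eq[symmetric]) (intro lin | simp)+
  also have "\<dots> \<in> SLq_ideal q"
    unfolding lin_ext_def
  proof (induction rule: infinite_finite_induct[of _ "Poly_Mapping.keys a"])
    case (insert x F)
    then show ?case
      using cong_letter_normal_word[of g x]
      by (auto simp: cong_def lift_simps intro!: SLq_ideal_closed)
  qed (auto intro: SLq_ideal_closed)
  finally show ?thesis by (simp add: cong_def)
qed

lemma cong_lift_ev: "p \<approx> lift (ev p)"
proof -
  have w: "vec w \<approx> lift (ev (vec w))" for w
  proof (induction w)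
    case Nil
    then show ?case by (simp add: ev_def)
  next
    case (Cons g w)
    have "vec (g # w) = letter g * vec w" by (simp add: letter_mult)
    also have "\<dots> \<approx> letter g * lift (ev (vec w))" by (intro cong_mult_left Cons)
    also have "\<dots> \<approx> lift (gen_op g (ev (vec w)))" by (rule cong_letter_lift)
    also have "\<dots> = lift (ev (vec (g # w)))" by (simp add: ev_def)
    finally show ?case .
  qed
  have "p - lift (ev p) = lin_ext fscale (\<lambda>b. vec b - lift (ev (vec b))) p"
    by (rule lin_ext_eq[symmetric]) (intro lin | simp)+
  also have "\<dots> \<in> SLq_ideal q"
    unfolding lin_ext_def
    by (induction rule: infinite_finite_induct[of _ "Poly_Mapping.keys p"])
      (use w in \<open>auto simp: cong_def intro!: SLq_ideal_closed(1,2,7)\<close>)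
  finally show ?thesis by (simp add: cong_def)
qed

text \<open>The action kills the ideal, and conversely every element is congruent to the normal form
  with its coordinates; so the quotient algebra is the free space on \<open>idx\<close>.\<close>

lemma ev_eq_0_iff: "ev p = 0 \<longleftrightarrow> p \<in> SLq_ideal q"
  using cong_lift_ev[of p] act_ideal[of p] by (auto simp: ev_def[of p] cong_def lift_simps)

lemma ev_eq_iff: "ev p = ev r \<longleftrightarrow> p \<approx> r"
  using ev_eq_0_iff[of "p - r"] by (simp add: ev_simps cong_def)

end

section \<open>Matrix coefficients\<close>

definition bool_lists :: "nat \<Rightarrow> bool list set"
  where "bool_lists n = {K. length K = n}"

lemma finite_bool_lists [simp]: "finite (bool_lists n)"
  using finite_lists_length_eq[of "UNIV :: bool set" n] by (simp add: bool_lists_def)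

lemma bool_lists_0 [simp]: "bool_lists 0 = {[]}"
  by (auto simp: bool_lists_def)

lemma length_bool_lists: "K \<in> bool_lists n \<Longrightarrow> length K = n"
  by (simp add: bool_lists_def)

lemma sum_bool_lists_append:
  "(\<Sum>K\<in>bool_lists (m + n). f K) = (\<Sum>K\<in>bool_lists m. \<Sum>L\<in>bool_lists n. f (K @ L))"
proof -
  have "(\<Sum>K\<in>bool_lists m. \<Sum>L\<in>bool_lists n. f (K @ L)) =
      (\<Sum>(K, L)\<in>bool_lists m \<times> bool_lists n. f (K @ L))"
    by (rule sum.cartesian_product)
  also have "\<dots> = (\<Sum>K\<in>bool_lists (m + n). f K)"
    by (rule sum.reindex_bij_witness[where j = "\<lambda>(K, L). K @ L" and i = "\<lambda>K. (take m K, drop m K)"])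
      (auto simp: bool_lists_def)
  finally show ?thesis by simp
qed

lemma sum_bool_lists_1: "(\<Sum>K\<in>bool_lists (Suc 0). f K) = f [False] + f [True]"
proof -
  have "bool_lists (Suc 0) = {[False], [True]}" by (auto simp: bool_lists_def length_Suc_conv)
  then show ?thesis by simp
qed

lemma sum_bool_lists_Suc:
  "(\<Sum>K\<in>bool_lists (Suc n). f K) = (\<Sum>K\<in>bool_lists n. f (False # K) + f (True # K))"
  using sum_bool_lists_append[of f "Suc 0" n] by (simp add: sum_bool_lists_1 sum.distrib)

text \<open>The generators as entries of the matrix with rows x, u and v, y; \<open>False\<close> is
  the first index.\<close>

fun mat_gen :: "bool \<Rightarrow> bool \<Rightarrow> gen" where
  "mat_gen False False = GX"
| "mat_gen False True = GU"
| "mat_gen True False = GV"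
| "mat_gen True True = GY"

fun gen_row :: "gen \<Rightarrow> bool" where
  "gen_row GX = False" | "gen_row GU = False" | "gen_row GV = True" | "gen_row GY = True"

fun gen_col :: "gen \<Rightarrow> bool" where
  "gen_col GX = False" | "gen_col GU = True" | "gen_col GV = False" | "gen_col GY = True"

lemma mat_gen_row_col [simp]: "mat_gen (gen_row g) (gen_col g) = g"
  by (cases g) auto

lemma gen_row_mat_gen [simp]: "gen_row (mat_gen i j) = i"
  and gen_col_mat_gen [simp]: "gen_col (mat_gen i j) = j"
  by (cases i; cases j; simp)+

lemma map2_mat_gen: "map2 mat_gen (map gen_row w) (map gen_col w) = w"
  by (induction w) auto

lemma map_gen_row: "length I = length J \<Longrightarrow> map gen_row (map2 mat_gen I J) = I"
  and map_gen_col: "length I = length J \<Longrightarrow> map gen_col (map2 mat_gen I J) = J"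
  by (induction I J rule: list_induct2) auto

context SLq_model
begin

section \<open>The product in PBW coordinates\<close>

definition mulA :: "(idx \<Rightarrow>\<^sub>0 'k) \<Rightarrow> (idx \<Rightarrow>\<^sub>0 'k) \<Rightarrow> (idx \<Rightarrow>\<^sub>0 'k)" (infixl "\<star>" 70)
  where "a \<star> b = act (lift a) b"

abbreviation oneA :: "idx \<Rightarrow>\<^sub>0 'k" ("\<e>") where "\<e> \<equiv> vec (0, 0, 0)"

lemma linear_mulA_left [lin]: "linear_map fscale f \<Longrightarrow> linear_map fscale (\<lambda>x. f x \<star> b)"
  unfolding mulA_def by (intro lin)

lemma linear_mulA_right [lin]: "linear_map fscale f \<Longrightarrow> linear_map fscale (\<lambda>x. a \<star> f x)"
  unfolding mulA_def by (intro lin)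

lemmas mulA_left_simps = linear_map_simps[OF linear_mulA_left[OF linear_map_id]]
lemmas mulA_right_simps = linear_map_simps[OF linear_mulA_right[OF linear_map_id]]

lemma act_eq_mulA: "act p a = ev p \<star> a"
  using act_ideal[of "p - lift (ev p)" a] cong_lift_ev[of p]
  by (simp add: mulA_def cong_def act_left_simps)

lemma ev_mult: "ev (p * r) = ev p \<star> ev r"
proof -
  have "ev (p * r) = act p (ev r)" by (simp add: ev_def)
  then show ?thesis by (simp add: act_eq_mulA)
qed

lemma ev_one [simp]: "ev 1 = \<e>"
  by (simp add: ev_def)

lemma mulA_assoc: "a \<star> b \<star> c = a \<star> (b \<star> c)"
  using ev_mult[of "lift a * lift b" "lift c"] ev_mult[of "lift a" "lift b * lift c"]
  by (simp add: ev_mult mult.assoc)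

lemma mulA_one [simp]: "\<e> \<star> a = a" "a \<star> \<e> = a"
  using ev_mult[of 1 "lift a"] ev_mult[of "lift a" 1] by simp_all

lemma gen_op_eq_mulA: "gen_op g a = ev (letter g) \<star> a"
  using act_eq_mulA[of "letter g" a] by simp

definition coef :: "bool list \<Rightarrow> bool list \<Rightarrow> (idx \<Rightarrow>\<^sub>0 'k)"
  where "coef I J = ev (vec (map2 mat_gen I J))"

lemma coef_Nil [simp]: "coef [] [] = \<e>"
  by (simp add: coef_def vec_Nil)

lemma coef_append:
  "length I = length J \<Longrightarrow> coef (I @ I') (J @ J') = coef I J \<star> coef I' J'"
  by (simp only: coef_def zip_append map_append vec_mult[symmetric] ev_mult)

lemma coef_Cons: "coef (i # I) (j # J) = coef [i] [j] \<star> coef I J"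
  using coef_append[of "[i]" "[j]" I J] by simp

lemma coef_single: "coef [i] [j] = ev (letter (mat_gen i j))"
  by (simp add: coef_def letter_def)

lemma coef_Cons_gen_op: "coef (i # I) (j # J) = gen_op (mat_gen i j) (coef I J)"
  by (subst coef_Cons) (simp only: coef_single gen_op_eq_mulA)

lemma ev_vec: "ev (vec w) = coef (map gen_row w) (map gen_col w)"
  by (simp add: coef_def map2_mat_gen)

lemma vec_eq_coef: "\<exists>I J. length I = length J \<and> vec b = coef I J"
proof -
  have "vec b = ev (vec (normal_word b))"
    using ev_lift[of "vec b"] by (simp only: lift_single)
  then have "vec b = coef (map gen_row (normal_word b)) (map gen_col (normal_word b))"
    by (simp only: ev_vec)
  then show ?thesis by (intro exI conjI) auto
qed

text \<open>A PBW basis vector is the value of its normal word, hence a single matrix coefficient.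
  Linear identities therefore need checking only on elements whose comultiplication and antipode
  have closed forms.\<close>

lemma linear_map_eq_coefI:
  assumes "linear_map sc f" "linear_map sc g" "\<And>I J. length I = length J \<Longrightarrow> f (coef I J) = g (coef I J)"
  shows "f a = g a"
  using linear_map_eqI[OF assms(1,2)] assms(3) vec_eq_coef by metis

definition kronecker :: "bool list \<Rightarrow> bool list \<Rightarrow> 'k"
  where "kronecker I J = (if I = J then 1 else 0)"

subsection \<open>Characters and skew derivations\<close>

text \<open>For nonzero s, the character sending x to s and y to its inverse: s = 1 gives the
  counit, s = q gives \<delta>.\<close>

definition chi :: "'k \<Rightarrow> (idx \<Rightarrow>\<^sub>0 'k) \<Rightarrow> 'k"
  where "chi s = lin_ext (*) (\<lambda>(i, j, k). if j = 0 \<and> k = 0 then s powi i else 0)"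

lemma linear_chi [lin]: "linear_map fscale f \<Longrightarrow> linear_map (*) (\<lambda>x. chi s (f x))"
  unfolding chi_def by (intro linear_map_comp[OF linear_map_lin_ext] lin)

lemmas chi_simps = linear_map_simps[OF linear_chi[OF linear_map_id]]

lemma chi_single [simp]: "chi s (Poly_Mapping.single (i, j, k) c) = (if j = 0 \<and> k = 0 then c * s powi i else 0)"
  by (simp add: chi_def lin_ext_single lin)

fun gen_chi :: "'k \<Rightarrow> gen \<Rightarrow> 'k" where
  "gen_chi s GX = s" | "gen_chi s GU = 0" | "gen_chi s GV = 0" | "gen_chi s GY = inverse s"

lemma chi_gen_op:
  assumes "s \<noteq> 0"
  shows "chi s (gen_op g a) = gen_chi s g * chi s a"
proof (rule linear_map_eqI[where f = "\<lambda>a. chi s (gen_op g a)" and sc = "(*)"])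
  fix b :: idx
  obtain i j k where b: "b = (i, j, k)" by (metis prod_cases3)
  show "chi s (gen_op g (vec b)) = gen_chi s g * chi s (vec b)"
    using assms by (cases g) (auto simp: b chi_simps power_int_add power_int_diff field_simps)
qed (intro lin)+

text \<open>Functionals D with this product rule are 1-cocycles for the two characters. It suffices
  to test left multiplication by a generator on basis vectors; \<open>dg\<close> then holds the
  values of D on the generators.\<close>

lemma skew_derivation:
  assumes D: "linear_map (*) D" and s: "s \<noteq> 0" and t: "t \<noteq> 0" and one: "D \<e> = 0"
    and gen: "\<And>g b. D (gen_op_vec g b) = gen_chi s g * D (vec b) + dg g * chi t (vec b)"
  shows "D (a \<star> b) = chi s a * D b + D a * chi t b"
proof -
  note D' = linear_map_comp[OF D]
  have gen': "D (gen_op g a) = gen_chi s g * D a + dg g * chi t a" for g a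
  proof (rule linear_map_eqI[where f = "\<lambda>a. D (gen_op g a)" and sc = "(*)"])
    show "linear_map (*) (\<lambda>a. D (gen_op g a))" by (intro D' lin)
    show "linear_map (*) (\<lambda>a. gen_chi s g * D a + dg g * chi t a)" by (intro lin D)
  qed (simp add: gen)
  \<comment> \<open>The two formulas share one induction, because the step for D needs
    multiplicativity of the second character on the shorter word.\<close>
  have w: "D (foldr gen_op w b) = chi s (foldr gen_op w \<e>) * D b + D (foldr gen_op w \<e>) * chi t b
     \<and> chi t (foldr gen_op w b) = chi t (foldr gen_op w \<e>) * chi t b" for w
  proof (induction w)
    case (Cons g w)
    then show ?case by (simp add: gen' chi_gen_op s t algebra_simps)
  qed (simp add: one)
  have "D (act p b) = chi s (ev p) * D b + D (ev p) * chi t b" for p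
  proof (rule linear_map_eqI[where f = "\<lambda>p. D (act p b)" and sc = "(*)"])
    show "linear_map (*) (\<lambda>p. D (act p b))" by (intro D' lin)
    show "linear_map (*) (\<lambda>p. chi s (ev p) * D b + D (ev p) * chi t b)" by (intro lin D')
  qed (use w in \<open>simp add: ev_def\<close>)
  from this[of "lift a"] show ?thesis by (simp add: mulA_def)
qed

lemma chi_mulA:
  assumes "s \<noteq> 0"
  shows "chi s (a \<star> b) = chi s a * chi s b"
proof -
  have w: "chi s (foldr gen_op w b) = chi s (foldr gen_op w \<e>) * chi s b" for w
    by (induction w) (auto simp: chi_gen_op assms)
  have "chi s (act p b) = chi s (ev p) * chi s b" for p
    by (rule linear_map_eqI[where f = "\<lambda>p. chi s (act p b)" and sc = "(*)"])
      (intro lin | simp add: ev_def w)+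
  from this[of "lift a"] show ?thesis by (simp add: mulA_def)
qed

definition weight :: "'k \<Rightarrow> bool list \<Rightarrow> 'k"
  where "weight s I = prod_list (map (\<lambda>i. if i then inverse s else s) I)"

lemma weight_simps [simp]:
  "weight s [] = 1" "weight s (i # I) = (if i then inverse s else s) * weight s I"
  by (simp_all add: weight_def)

lemma weight_one [simp]: "weight 1 I = 1"
  by (induction I) auto

lemma weight_nonzero: "s \<noteq> 0 \<Longrightarrow> weight s I \<noteq> 0"
  by (induction I) auto

lemma weight_append: "weight s (I @ J) = weight s I * weight s J"
  by (induction I) auto

lemma weight_dual: "weight s (map Not (rev I)) = inverse (weight s I)"
  by (induction I) (auto simp: weight_append)

lemma chi_coef:
  assumes "s \<noteq> 0" "length I = length J"
  shows "chi s (coef I J) = kronecker I J * weight s I"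
  using assms(2)
proof (induction I J rule: list_induct2)
  case (Cons i I j J)
  then show ?case
    by (cases i; cases j) (auto simp: coef_Cons_gen_op chi_gen_op assms(1) kronecker_def)
qed (simp add: kronecker_def)

text \<open>The cocycles dual to u and v, derivations with the counit on the left and \<delta> on
  the right. The functional \<open>deg_x\<close> is the derivative of \<open>chi s\<close> in s at s
  = 1, hence a derivation for the counit on both sides.\<close>

definition phi_u :: "(idx \<Rightarrow>\<^sub>0 'k) \<Rightarrow> 'k"
  where "phi_u = lin_ext (*) (\<lambda>(i, j, k). if j = 1 \<and> k = 0 then 1 else 0)"

definition phi_v :: "(idx \<Rightarrow>\<^sub>0 'k) \<Rightarrow> 'k"
  where "phi_v = lin_ext (*) (\<lambda>(i, j, k). if j = 0 \<and> k = 1 then 1 else 0)"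

definition deg_x :: "(idx \<Rightarrow>\<^sub>0 'k) \<Rightarrow> 'k"
  where "deg_x = lin_ext (*) (\<lambda>(i, j, k). if j = 0 \<and> k = 0 then of_int i else 0)"

lemma linear_phi [lin]:
  "linear_map fscale f \<Longrightarrow> linear_map (*) (\<lambda>x. phi_u (f x))"
  "linear_map fscale f \<Longrightarrow> linear_map (*) (\<lambda>x. phi_v (f x))"
  "linear_map fscale f \<Longrightarrow> linear_map (*) (\<lambda>x. deg_x (f x))"
  unfolding phi_u_def phi_v_def deg_x_def
  by (intro linear_map_comp[OF linear_map_lin_ext] lin; assumption)+

lemmas phi_simps = linear_map_simps[OF linear_phi(1)[OF linear_map_id]]
  linear_map_simps[OF linear_phi(2)[OF linear_map_id]]
  linear_map_simps[OF linear_phi(3)[OF linear_map_id]]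

lemma phi_single [simp]:
  "phi_u (Poly_Mapping.single (i, j, k) c) = (if j = 1 \<and> k = 0 then c else 0)"
  "phi_v (Poly_Mapping.single (i, j, k) c) = (if j = 0 \<and> k = 1 then c else 0)"
  "deg_x (Poly_Mapping.single (i, j, k) c) = (if j = 0 \<and> k = 0 then c * of_int i else 0)"
  by (auto simp: phi_u_def phi_v_def deg_x_def lin_ext_single lin)

lemma phi_u_mulA: "phi_u (a \<star> b) = chi 1 a * phi_u b + phi_u a * chi q b"
proof (rule skew_derivation[where dg = "\<lambda>g. if g = GU then 1 else 0"])
  show "phi_u (gen_op_vec g b) = gen_chi 1 g * phi_u (vec b) + (if g = GU then 1 else 0) * chi q (vec b)"
    for g b by (cases g; cases b) (auto simp: phi_simps)
qed (simp_all add: linear_phi[OF linear_map_id])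

lemma phi_v_mulA: "phi_v (a \<star> b) = chi 1 a * phi_v b + phi_v a * chi q b"
proof (rule skew_derivation[where dg = "\<lambda>g. if g = GV then 1 else 0"])
  show "phi_v (gen_op_vec g b) = gen_chi 1 g * phi_v (vec b) + (if g = GV then 1 else 0) * chi q (vec b)"
    for g b by (cases g; cases b) (auto simp: phi_simps)
qed (simp_all add: linear_phi[OF linear_map_id])

lemma deg_x_mulA: "deg_x (a \<star> b) = chi 1 a * deg_x b + deg_x a * chi 1 b"
proof (rule skew_derivation[where dg = "\<lambda>g. if g = GX then 1 else if g = GY then - 1 else 0"])
  show "deg_x (gen_op_vec g b) = gen_chi 1 g * deg_x (vec b) +
      (if g = GX then 1 else if g = GY then - 1 else 0) * chi 1 (vec b)"
    for g b by (cases g; cases b) (auto simp: phi_simps)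
qed (simp_all add: linear_phi[OF linear_map_id])

subsection \<open>The rescaling automorphism\<close>

text \<open>\<open>alpha h = \<Sum> \<delta>(h\<^sup>(\<^sup>1\<^sup>)) h\<^sup>(\<^sup>2\<^sup>)\<close>\<close>

definition alpha :: "(idx \<Rightarrow>\<^sub>0 'k) \<Rightarrow> (idx \<Rightarrow>\<^sub>0 'k)"
  where "alpha = lin_ext fscale (\<lambda>(i, j, k). Poly_Mapping.single (i, j, k) (q powi (i + int j - int k)))"

lemma linear_alpha [lin]: "linear_map fscale f \<Longrightarrow> linear_map fscale (\<lambda>x. alpha (f x))"
  unfolding alpha_def by (intro linear_map_comp[OF linear_map_lin_ext] lin)

lemmas alpha_simps = linear_map_simps[OF linear_alpha[OF linear_map_id]]

lemma alpha_single [simp]: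
  "alpha (Poly_Mapping.single (i, j, k) c) = Poly_Mapping.single (i, j, k) (c * q powi (i + int j - int k))"
  by (simp add: alpha_def lin_ext_single lin)

lemma alpha_gen_op: "alpha (gen_op g a) = fscale (weight q [gen_row g]) (gen_op g (alpha a))"
proof (rule linear_map_eqI[where f = "\<lambda>a. alpha (gen_op g a)" and sc = fscale])
  fix b :: idx
  obtain i j k where b: "b = (i, j, k)" by (metis prod_cases3)
  show "alpha (gen_op g (vec b)) = fscale (weight q [gen_row g]) (gen_op g (alpha (vec b)))"
    by (cases g) (auto simp: b alpha_simps gen_op_simps power_int_add power_int_diff field_simps
        fscale.scale_right_distrib power2_eq_square)
qed (intro lin)+

text \<open>Convolving with a character on the left scales c_IJ by its value on c_II, so the rows
  alone determine the weight.\<close>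

lemma alpha_coef: "length I = length J \<Longrightarrow> alpha (coef I J) = fscale (weight q I) (coef I J)"
proof (induction I J rule: list_induct2)
  case (Cons i I j J)
  then show ?case by (simp add: coef_Cons_gen_op alpha_gen_op gen_op_simps)
qed simp

end

section \<open>Comultiplication and antipode\<close>

context SLq_model
begin

text \<open>The elements p with \<open>G (s * p * t) = 0\<close> for all s, t form the largest
  two-sided ideal inside the kernel of G; by linearity in s and t the condition is tested with words
  around a relation.\<close>

lemma linear_ideal_kill:
  assumes G: "linear_map fscale G"
    and "\<And>w r w'. r \<in> SLq_relations q \<Longrightarrow> G (vec w * r * vec w') = (0 :: 'b \<Rightarrow>\<^sub>0 'k)"
    and "p \<in> SLq_ideal q"
  shows "G p = 0"
proof -
  let ?J = "{p. \<forall>s t. G (s * p * t) = 0}"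
  have "G (s * r * t) = 0" if "r \<in> SLq_relations q" for s r t
    by (rule bilinear_map_eqI[where \<Phi> = "\<lambda>s t. G (s * r * t)" and \<Psi> = "\<lambda>_ _. 0"])
      (use assms that in \<open>auto intro!: bilinear_mapI linear_map_comp[OF G] lin\<close>)
  moreover have "ideal ?J (free_alg :: ('k, gen list \<Rightarrow>\<^sub>0 'k) module)"
  proof (rule ideal_free_algI)
    fix a b assume a: "a \<in> ?J"
    show "a * b \<in> ?J"
    proof (intro CollectI allI)
      fix s t show "G (s * (a * b) * t) = 0" using a by (simp add: mult.assoc)
    qed
    show "b * a \<in> ?J"
    proof (intro CollectI allI)
      fix s t show "G (s * (b * a) * t) = 0" using a by (simp flip: mult.assoc)
    qed
  qed (auto simp: linear_map_simps[OF G] algebra_simps)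
  ultimately have "p \<in> ?J" using SLq_ideal_minimal[of ?J q] assms(3) by blast
  then have "G (1 * p * 1) = 0" by blast
  then show ?thesis by simp
qed

lemma linear_descend:
  assumes "linear_map fscale G" "\<And>p. p \<in> SLq_ideal q \<Longrightarrow> G p = 0"
  shows "G (lift (ev p)) = G p"
  using assms(2)[of "p - lift (ev p)"] cong_lift_ev[of p]
  by (simp add: cong_def linear_map_simps[OF assms(1)])

lemma gen_relations:
  shows "ev (letter GU) \<star> ev (letter GX) = fscale q (ev (letter GX) \<star> ev (letter GU))"
    and "ev (letter GV) \<star> ev (letter GX) = fscale q (ev (letter GX) \<star> ev (letter GV))"
    and "ev (letter GY) \<star> ev (letter GU) = fscale q (ev (letter GU) \<star> ev (letter GY))"
    and "ev (letter GY) \<star> ev (letter GV) = fscale q (ev (letter GV) \<star> ev (letter GY))"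
    and "ev (letter GV) \<star> ev (letter GU) = ev (letter GU) \<star> ev (letter GV)"
    and "ev (letter GX) \<star> ev (letter GY) = \<e> + fscale (inverse q) (ev (letter GU) \<star> ev (letter GV))"
    and "ev (letter GY) \<star> ev (letter GX) = \<e> + fscale q (ev (letter GU) \<star> ev (letter GV))"
  using cong_relations[folded ev_eq_iff] by (simp_all add: ev_mult ev_simps)

text \<open>
  \<open>sweedler_sum \<Phi> h\<close> is \<open>\<Sum> \<Phi>(h\<^sup>(\<^sup>1\<^sup>), h\<^sup>(\<^sup>2\<^sup>))\<close>; a matrix coefficient has
  \<open>\<Delta> c\<^sub>I\<^sub>J = \<Sum>\<^sub>K c\<^sub>I\<^sub>K \<otimes> c\<^sub>K\<^sub>J\<close>.
\<close>

definition word_sum ::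
    "((idx \<Rightarrow>\<^sub>0 'k) \<Rightarrow> (idx \<Rightarrow>\<^sub>0 'k) \<Rightarrow> 'b \<Rightarrow>\<^sub>0 'k) \<Rightarrow> gen list \<Rightarrow> 'b \<Rightarrow>\<^sub>0 'k"
  where "word_sum \<Phi> w =
    (\<Sum>K\<in>bool_lists (length w). \<Phi> (coef (map gen_row w) K) (coef K (map gen_col w)))"

definition sweedler_sum ::
    "((idx \<Rightarrow>\<^sub>0 'k) \<Rightarrow> (idx \<Rightarrow>\<^sub>0 'k) \<Rightarrow> 'b \<Rightarrow>\<^sub>0 'k) \<Rightarrow> (idx \<Rightarrow>\<^sub>0 'k) \<Rightarrow> 'b \<Rightarrow>\<^sub>0 'k"
  where "sweedler_sum \<Phi> h = lin_ext fscale (word_sum \<Phi>) (lift h)"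

lemma linear_sweedler_sum [lin]:
  "linear_map fscale f \<Longrightarrow> linear_map fscale (\<lambda>x. sweedler_sum \<Phi> (f x))"
  unfolding sweedler_sum_def by (intro linear_map_comp[OF linear_map_lin_ext] lin)

lemma linear_sweedler_sum_fun [lin]:
  assumes "\<And>a b. linear_map fscale (\<lambda>x. \<Phi> x a b)"
  shows "linear_map fscale (\<lambda>x. sweedler_sum (\<Phi> x) h)"
  unfolding sweedler_sum_def lin_ext_def word_sum_def
  by (intro linear_map_sum' linear_map_fscale assms lin)

text \<open>Compatibility of the comultiplication with the relations, with an arbitrary bilinear map
  in place of the tensor product.\<close>

lemma word_sum_relation:
  assumes \<Phi>: "bilinear_map \<Phi>" and r: "r \<in> SLq_relations q"
  shows "lin_ext fscale (word_sum \<Phi>) r = 0"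
proof -
  note l = linear_map_simps[OF linear_map_lin_ext[OF vector_space_fscale, of "word_sum \<Phi>"]]
  note b = linear_map_simps[OF bilinear_map_right[OF \<Phi>]] linear_map_simps[OF bilinear_map_left[OF \<Phi>]]
  have word: "lin_ext fscale (word_sum \<Phi>) (letter g * letter h) =
      (\<Sum>K\<in>bool_lists (Suc (Suc 0)). \<Phi> (coef [gen_row g, gen_row h] K) (coef K [gen_col g, gen_col h]))" for g h
    by (simp add: letter_def vec_mult word_sum_def)
  have one: "lin_ext fscale (word_sum \<Phi>) 1 = \<Phi> \<e> \<e>"
    by (simp flip: vec_Nil) (simp add: word_sum_def vec_Nil)
  have two: "coef [i, i'] [j, j'] = ev (letter (mat_gen i j)) \<star> ev (letter (mat_gen i' j'))" for i i' j j'
    using coef_Cons[of i "[i']" j "[j']"] by (simp add: coef_single)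
  have "\<forall>r\<in>SLq_relations q. lin_ext fscale (word_sum \<Phi>) r = 0"
    unfolding SLq_relations_def Let_def
    by (simp add: l word one two sum_bool_lists_Suc gen_relations b fscale.scale_right_distrib)
  then show ?thesis using r by blast
qed

lemma word_sum_append:
  "word_sum \<Phi> (w @ w') = (\<Sum>K\<in>bool_lists (length w). \<Sum>L\<in>bool_lists (length w').
     \<Phi> (coef (map gen_row w) K \<star> coef (map gen_row w') L) (coef K (map gen_col w) \<star> coef L (map gen_col w')))"
  unfolding word_sum_def
  by (simp add: sum_bool_lists_append) (intro sum.cong refl, simp add: coef_append length_bool_lists)

lemma word_sum_ideal:
  assumes \<Phi>: "bilinear_map \<Phi>" and p: "p \<in> SLq_ideal q"
  shows "lin_ext fscale (word_sum \<Phi>) p = 0"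
proof (rule linear_ideal_kill[OF linear_map_lin_ext[OF vector_space_fscale] _ p])
  fix w r w' assume r: "r \<in> SLq_relations q"
  \<comment> \<open>The words around the relation are absorbed into the bilinear map, so the bare
    relation can be treated separately for each pair of middle indices K, L.\<close>
  define \<Psi> where "\<Psi> K L a b = \<Phi> (coef (map gen_row w) K \<star> a \<star> coef (map gen_row w') L)
    (coef K (map gen_col w) \<star> b \<star> coef L (map gen_col w'))" for K L a b
  have \<Psi>: "bilinear_map (\<Psi> K L)" for K L
    unfolding \<Psi>_def
    by (intro bilinear_mapI linear_map_comp[OF bilinear_map_right[OF \<Phi>]]
        linear_map_comp[OF bilinear_map_left[OF \<Phi>]] lin)
  have "lin_ext fscale (word_sum \<Phi>) (vec w * r * vec w') =
      (\<Sum>K\<in>bool_lists (length w). \<Sum>L\<in>bool_lists (length w'). lin_ext fscale (word_sum (\<Psi> K L)) r)"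
  proof (rule linear_map_eqI[where sc = fscale and f = "\<lambda>r. lin_ext fscale (word_sum \<Phi>) (vec w * r * vec w')"])
    show "linear_map fscale (\<lambda>r. lin_ext fscale (word_sum \<Phi>) (vec w * r * vec w'))"
      by (intro linear_map_comp[OF linear_map_lin_ext] lin)
    show "linear_map fscale (\<lambda>r. \<Sum>K\<in>bool_lists (length w). \<Sum>L\<in>bool_lists (length w').
        lin_ext fscale (word_sum (\<Psi> K L)) r)"
      by (intro lin)
    fix v
    have "word_sum \<Phi> (w @ v @ w') = (\<Sum>K\<in>bool_lists (length w). \<Sum>M\<in>bool_lists (length v).
        \<Sum>L\<in>bool_lists (length w'). \<Psi> K L (coef (map gen_row v) M) (coef M (map gen_col v)))"
      unfolding \<Psi>_def word_sum_append[of _ w "v @ w'"]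
      by (simp add: sum_bool_lists_append)
        (intro sum.cong refl, simp add: coef_append length_bool_lists mulA_assoc)
    also have "\<dots> = (\<Sum>K\<in>bool_lists (length w). \<Sum>L\<in>bool_lists (length w'). word_sum (\<Psi> K L) v)"
      unfolding word_sum_def by (intro sum.cong refl sum.swap)
    finally show "lin_ext fscale (word_sum \<Phi>) (vec w * vec v * vec w') =
        (\<Sum>K\<in>bool_lists (length w). \<Sum>L\<in>bool_lists (length w'). lin_ext fscale (word_sum (\<Psi> K L)) (vec v))"
      by (simp add: vec_mult)
  qed
  then show "lin_ext fscale (word_sum \<Phi>) (vec w * r * vec w') = 0"
    by (simp add: word_sum_relation[OF \<Psi> r])
qed

lemma sweedler_sum_ev:
  "bilinear_map \<Phi> \<Longrightarrow> sweedler_sum \<Phi> (ev p) = lin_ext fscale (word_sum \<Phi>) p"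
  unfolding sweedler_sum_def
  by (rule linear_descend[OF linear_map_lin_ext[OF vector_space_fscale] word_sum_ideal])

lemma sweedler_sum_coef:
  assumes "bilinear_map \<Phi>" "length I = length J"
  shows "sweedler_sum \<Phi> (coef I J) = (\<Sum>K\<in>bool_lists (length I). \<Phi> (coef I K) (coef K J))"
proof -
  have "sweedler_sum \<Phi> (coef I J) = word_sum \<Phi> (map2 mat_gen I J)"
    by (simp add: coef_def sweedler_sum_ev[OF assms(1)])
  also have "\<dots> = (\<Sum>K\<in>bool_lists (length I). \<Phi> (coef I K) (coef K J))"
    using assms(2) by (simp only: word_sum_def map_gen_row map_gen_col length_map length_zip min.idem)
  finally show ?thesis .
qed

lemma sweedler_sum_mulA:
  assumes \<Phi>: "bilinear_map \<Phi>"
  shows "sweedler_sum \<Phi> (g \<star> h) =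
    sweedler_sum (\<lambda>g1 g2. sweedler_sum (\<lambda>h1 h2. \<Phi> (g1 \<star> h1) (g2 \<star> h2)) h) g"
proof -
  have \<Psi>: "bilinear_map (\<lambda>h1 h2. \<Phi> (g1 \<star> h1) (g2 \<star> h2))" for g1 g2
    by (intro bilinear_mapI linear_map_comp[OF bilinear_map_right[OF \<Phi>]]
        linear_map_comp[OF bilinear_map_left[OF \<Phi>]] lin)
  have \<Psi>': "bilinear_map (\<lambda>g1 g2. sweedler_sum (\<lambda>h1 h2. \<Phi> (g1 \<star> h1) (g2 \<star> h2)) h)" for h
    by (intro bilinear_mapI linear_sweedler_sum_fun linear_map_comp[OF bilinear_map_right[OF \<Phi>]]
        linear_map_comp[OF bilinear_map_left[OF \<Phi>]] lin)
  have "sweedler_sum \<Phi> (g \<star> coef I' J') =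
    sweedler_sum (\<lambda>g1 g2. sweedler_sum (\<lambda>h1 h2. \<Phi> (g1 \<star> h1) (g2 \<star> h2)) (coef I' J')) g"
    if len': "length I' = length J'" for I' J'
  proof (rule linear_map_eq_coefI[where sc = fscale and f = "\<lambda>g. sweedler_sum \<Phi> (g \<star> coef I' J')"])
    fix I J :: "bool list" assume len: "length I = length J"
    have "sweedler_sum \<Phi> (coef I J \<star> coef I' J') = (\<Sum>K\<in>bool_lists (length I).
        \<Sum>L\<in>bool_lists (length I'). \<Phi> (coef (I @ I') (K @ L)) (coef (K @ L) (J @ J')))"
      unfolding coef_append[OF len, of I' J', symmetric]
      by (subst sweedler_sum_coef[OF \<Phi>]) (simp_all add: len len' sum_bool_lists_append)
    also have "\<dots> = (\<Sum>K\<in>bool_lists (length I).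
        \<Sum>L\<in>bool_lists (length I'). \<Phi> (coef I K \<star> coef I' L) (coef K J \<star> coef L J'))"
      using len by (intro sum.cong refl) (simp only: coef_append length_bool_lists)
    also have "\<dots> = (\<Sum>K\<in>bool_lists (length I).
        sweedler_sum (\<lambda>h1 h2. \<Phi> (coef I K \<star> h1) (coef K J \<star> h2)) (coef I' J'))"
      by (simp only: sweedler_sum_coef[OF \<Psi> len'])
    also have "\<dots> = sweedler_sum (\<lambda>g1 g2. sweedler_sum (\<lambda>h1 h2. \<Phi> (g1 \<star> h1) (g2 \<star> h2)) (coef I' J')) (coef I J)"
      by (rule sweedler_sum_coef[OF \<Psi>' len, symmetric])
    finally show "sweedler_sum \<Phi> (coef I J \<star> coef I' J') =
      sweedler_sum (\<lambda>g1 g2. sweedler_sum (\<lambda>h1 h2. \<Phi> (g1 \<star> h1) (g2 \<star> h2)) (coef I' J')) (coef I J)" .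
  qed (intro lin)+
  then show ?thesis
    by (rule linear_map_eq_coefI[where sc = fscale and f = "\<lambda>h. sweedler_sum \<Phi> (g \<star> h)", rotated 2])
      (assumption | intro lin)+
qed

subsection \<open>The antipode\<close>

definition free_antipode :: "(gen list \<Rightarrow>\<^sub>0 'k) \<Rightarrow> (gen list \<Rightarrow>\<^sub>0 'k)"
  where "free_antipode = lin_ext fscale (\<lambda>w. prod_list (rev (map (gen_antipode q) w)))"

lemma linear_free_antipode [lin]:
  "linear_map fscale f \<Longrightarrow> linear_map fscale (\<lambda>x. free_antipode (f x))"
  unfolding free_antipode_def by (intro linear_map_comp[OF linear_map_lin_ext] lin)

lemmas free_antipode_simps = linear_map_simps[OF linear_free_antipode[OF linear_map_id]]

lemma free_antipode_mult: "free_antipode (p * r) = free_antipode r * free_antipode p"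
  by (rule bilinear_map_eqI[where \<Phi> = "\<lambda>p r. free_antipode (p * r)" and
        \<Psi> = "\<lambda>p r. free_antipode r * free_antipode p"])
    (intro bilinear_mapI lin | simp add: free_antipode_def vec_mult)+

lemma free_antipode_one [simp]: "free_antipode 1 = 1"
  by (simp add: free_antipode_def flip: vec_Nil)

lemma free_antipode_letter [simp]: "free_antipode (letter g) = gen_antipode q g"
  by (simp add: free_antipode_def letter_def)

lemma ev_free_antipode_relation:
  assumes "r \<in> SLq_relations q"
  shows "ev (free_antipode r) = 0"
proof -
  have "\<forall>r\<in>SLq_relations q. ev (free_antipode r) = 0"
    unfolding SLq_relations_def Let_def
    by (simp add: free_antipode_simps free_antipode_mult ev_mult ev_simps mulA_left_simps
        mulA_right_simps gen_relations)
  then show ?thesis using assms by blast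
qed

definition antip :: "(idx \<Rightarrow>\<^sub>0 'k) \<Rightarrow> (idx \<Rightarrow>\<^sub>0 'k)"
  where "antip h = ev (free_antipode (lift h))"

lemma linear_antip [lin]: "linear_map fscale f \<Longrightarrow> linear_map fscale (\<lambda>x. antip (f x))"
  unfolding antip_def by (intro lin)

lemmas antip_simps = linear_map_simps[OF linear_antip[OF linear_map_id]]

lemma antip_ev: "antip (ev p) = ev (free_antipode p)"
  unfolding antip_def
proof (rule linear_descend[where G = "\<lambda>p. ev (free_antipode p)"])
  show "ev (free_antipode p) = 0" if "p \<in> SLq_ideal q" for p
    by (rule linear_ideal_kill[OF _ _ that])
      (intro lin | simp add: free_antipode_mult ev_mult ev_free_antipode_relation
        mulA_left_simps mulA_right_simps)+
qed (intro lin)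

lemma antip_mulA: "antip (g \<star> h) = antip h \<star> antip g"
proof -
  have "antip (ev (lift g * lift h)) = antip (ev (lift h)) \<star> antip (ev (lift g))"
    by (simp only: antip_ev free_antipode_mult) (simp only: ev_mult)
  then show ?thesis by (simp add: ev_mult)
qed

lemma antip_one [simp]: "antip \<e> = \<e>"
  using antip_ev[of 1] by simp

text \<open>The factors -q and -q^-1 in the antipodes of u and v are ratios of a row weight and a
  column weight, so on words they multiply to a single ratio.\<close>

definition sign_weight :: "bool list \<Rightarrow> 'k"
  where "sign_weight I = prod_list (map (\<lambda>i. if i then 1 else - q) I)"

lemma sign_weight_nonzero: "sign_weight I \<noteq> 0"
  by (induction I) (auto simp: sign_weight_def)

lemma antip_coef:
  "length I = length J \<Longrightarrow> antip (coef I J) =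
    fscale (sign_weight I / sign_weight J) (coef (map Not (rev J)) (map Not (rev I)))"
proof (induction I J rule: list_induct2)
  case (Cons i I j J)
  have one: "antip (coef [i] [j]) = fscale (sign_weight [i] / sign_weight [j]) (coef [\<not> j] [\<not> i])"
    by (cases i; cases j) (simp_all add: coef_single antip_ev ev_simps sign_weight_def field_simps)
  have "antip (coef (i # I) (j # J)) = antip (coef I J) \<star> antip (coef [i] [j])"
    by (subst coef_Cons) (rule antip_mulA)
  also have "\<dots> = fscale (sign_weight (i # I) / sign_weight (j # J))
      (coef (map Not (rev J)) (map Not (rev I)) \<star> coef [\<not> j] [\<not> i])"
    using Cons by (simp add: one mulA_left_simps mulA_right_simps sign_weight_def field_simps)
  also have "coef (map Not (rev J)) (map Not (rev I)) \<star> coef [\<not> j] [\<not> i] =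
      coef (map Not (rev (j # J))) (map Not (rev (i # I)))"
    using Cons by (simp add: coef_append)
  finally show ?case .
qed (simp add: sign_weight_def)

text \<open>Since the antipode reverses products, the sum over the first middle index stands
  innermost and collapses to a scalar before the remaining sum is formed.\<close>

lemma antipode_left:
  "length I = length J \<Longrightarrow>
    (\<Sum>K\<in>bool_lists (length I). antip (coef I K) \<star> coef K J) = fscale (kronecker I J) \<e>"
proof (induction I J rule: list_induct2)
  case (Cons i I j J)
  have one: "antip (coef [i] [False]) \<star> coef [False] [j] + antip (coef [i] [True]) \<star> coef [True] [j] =
      fscale (if i = j then 1 else 0) \<e>"
    by (cases i; cases j; rule poly_mapping_eqI)
      (simp_all add: coef_single antip_ev ev_simps mulA_left_simps gen_relations lookup_add lookup_minus algebra_simps)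
  have "(\<Sum>K\<in>bool_lists (length (i # I)). antip (coef (i # I) K) \<star> coef K (j # J)) =
    (\<Sum>K\<in>bool_lists (length I). antip (coef I K) \<star> (antip (coef [i] [False]) \<star> coef [False] [j] +
       antip (coef [i] [True]) \<star> coef [True] [j]) \<star> coef K J)"
    unfolding length_Cons sum_bool_lists_Suc coef_Cons[of i I] coef_Cons[of _ _ j J] antip_mulA
    by (simp add: mulA_left_simps mulA_right_simps mulA_assoc)
  also have "\<dots> = fscale (kronecker (i # I) (j # J)) \<e>"
    unfolding one using Cons(2) by (auto simp: kronecker_def mulA_right_simps mulA_left_simps)
  finally show ?case .
qed (simp add: kronecker_def)

end

section \<open>The tensor algebra\<close>

text \<open>
  Under concatenation of lists, \<^typ>\<open>idx list \<Rightarrow>\<^sub>0 'k\<close> is the tensor algebra on the algebra spanned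
  by \<^typ>\<open>idx\<close>; \<open>tens n\<close> is its component of degree \<open>n\<close>.
\<close>

lemma linear_map_If [lin]:
  "linear_map sc f \<Longrightarrow> linear_map sc g \<Longrightarrow> linear_map sc (\<lambda>x. if P then f x else g x)"
  by (cases P) auto

definition tens :: "nat \<Rightarrow> (idx list \<Rightarrow>\<^sub>0 'k::field) set"
  where "tens n = {t. \<forall>bs\<in>Poly_Mapping.keys t. length bs = n}"

lemma tens_vec: "length bs = n \<Longrightarrow> Poly_Mapping.single bs c \<in> tens n"
  by (auto simp: tens_def)

lemma tens_closed:
  fixes s t :: "idx list \<Rightarrow>\<^sub>0 'k::field" and f :: "'i \<Rightarrow> idx list \<Rightarrow>\<^sub>0 'k"
  shows "0 \<in> tens n" "s \<in> tens n \<Longrightarrow> t \<in> tens n \<Longrightarrow> s + t \<in> tens n"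
  "s \<in> tens n \<Longrightarrow> t \<in> tens n \<Longrightarrow> s - t \<in> tens n"
  "s \<in> tens n \<Longrightarrow> - s \<in> tens n"
  "s \<in> tens n \<Longrightarrow> fscale c s \<in> tens n"
  "(\<And>i. i \<in> I \<Longrightarrow> f i \<in> tens n) \<Longrightarrow> (\<Sum>i\<in>I. f i) \<in> tens n"
proof -
  show 0: "0 \<in> tens n" by (simp add: tens_def)
  show add: "s + t \<in> tens n" if "s \<in> tens n" "t \<in> tens n" for s t :: "idx list \<Rightarrow>\<^sub>0 'k"
    using that keys_add[of s t] by (fastforce simp: tens_def)
  show scale: "fscale c s \<in> tens n" if "s \<in> tens n" for c and s :: "idx list \<Rightarrow>\<^sub>0 'k"
    using that keys_fscale[of c s] by (fastforce simp: tens_def)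
  show neg: "- s \<in> tens n" if "s \<in> tens n" for s :: "idx list \<Rightarrow>\<^sub>0 'k"
    using scale[OF that, of "- 1"] by simp
  show "s - t \<in> tens n" if "s \<in> tens n" "t \<in> tens n"
    using add[OF that(1) neg[OF that(2)]] by simp
  show "(\<And>i. i \<in> I \<Longrightarrow> f i \<in> tens n) \<Longrightarrow> (\<Sum>i\<in>I. f i) \<in> tens n"
    by (induction I rule: infinite_finite_induct) (auto intro: 0 add)
qed

lemma tens_1: "1 \<in> tens 0"
  using tens_vec[of "[]" 0 1] by (simp add: vec_Nil)

lemma linear_map_tens_mem:
  assumes "linear_map fscale f" "t \<in> tens n" "\<And>bs. length bs = n \<Longrightarrow> f (vec bs) \<in> tens m"
  shows "f t \<in> tens m"
  using assms(2,3)
  by (subst linear_map_expand[OF assms(1) finite_keys order_refl])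
    (auto simp: tens_def[of n] intro!: tens_closed)

lemma tens_mult: "s \<in> tens m \<Longrightarrow> t \<in> tens n \<Longrightarrow> s * t \<in> tens (m + n)"
proof (rule linear_map_tens_mem[where f = "\<lambda>s. s * t" and n = m])
  fix bs :: "idx list"
  assume t: "t \<in> tens n" and bs: "length bs = m"
  show "vec bs * t \<in> tens (m + n)"
    by (rule linear_map_tens_mem[OF _ t]) (intro lin | simp add: vec_mult tens_vec bs)+
qed (intro lin | assumption)+

lemma tens_eqI:
  assumes "linear_map sc f" "linear_map sc g" "t \<in> tens n"
    "\<And>bs. length bs = n \<Longrightarrow> f (vec bs) = g (vec bs)"
  shows "f t = g t"
  by (rule linear_map_eqI[OF assms(1,2)]) (use assms in \<open>auto simp: tens_def\<close>)

definition emb :: "('b \<Rightarrow>\<^sub>0 'k::field) \<Rightarrow> ('b list \<Rightarrow>\<^sub>0 'k)"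
  where "emb = lin_ext fscale (\<lambda>b. vec [b])"

lemma linear_emb [lin]: "linear_map fscale f \<Longrightarrow> linear_map fscale (\<lambda>x. emb (f x))"
  unfolding emb_def by (intro linear_map_comp[OF linear_map_lin_ext] lin)

lemmas emb_simps = linear_map_simps[OF linear_emb[OF linear_map_id]]

lemma emb_single [simp]: "emb (Poly_Mapping.single b c) = Poly_Mapping.single [b] c"
  by (simp add: emb_def lin_ext_single lin)

lemma vec_snoc: "vec (bs @ [b]) = vec bs * emb (vec b)"
  and vec_Cons: "vec (b # bs) = emb (vec b) * vec bs"
  by (simp_all add: vec_mult)

lemma tens_emb: "emb a \<in> tens (Suc 0)"
  unfolding emb_def lin_ext_def by (intro tens_closed tens_vec) simp

lemma tens_emb_snoc: "s \<in> tens n \<Longrightarrow> s * emb h \<in> tens (Suc n)"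
  using tens_mult[OF _ tens_emb] by fastforce

lemma tens_emb_Cons: "s \<in> tens n \<Longrightarrow> emb h * s \<in> tens (Suc n)"
  using tens_mult[OF tens_emb] by fastforce

lemma tens_0_eqI:
  assumes "linear_map sc f" "linear_map sc g" "t \<in> tens 0" "f 1 = g 1"
  shows "f t = g t"
  by (rule tens_eqI[OF assms(1-3)]) (simp add: assms(4) vec_Nil)

lemma tens_Suc_eqI:
  assumes "linear_map sc f" "linear_map sc g" "t \<in> tens (Suc n)"
    "\<And>s h. s \<in> tens n \<Longrightarrow> f (s * emb h) = g (s * emb h)"
  shows "f t = g t"
proof (rule tens_eqI[OF assms(1-3)])
  fix bs :: "idx list" assume "length bs = Suc n"
  then show "f (vec bs) = g (vec bs)"
    using assms(4)[OF tens_vec, of "butlast bs"]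
    by (cases bs rule: rev_cases) (auto simp: vec_snoc simp del: emb_single)
qed

lemma snoc_eqI:
  assumes "linear_map sc f" "linear_map sc g" "f 1 = g 1" "\<And>s h. f (s * emb h) = g (s * emb h)"
  shows "f t = g t"
proof (rule linear_map_eqI[OF assms(1,2)])
  show "f (vec bs) = g (vec bs)" for bs
    using assms(3,4) by (cases bs rule: rev_cases) (auto simp: vec_snoc vec_Nil simp del: emb_single)
qed

lemma Cons_eqI:
  assumes "linear_map sc f" "linear_map sc g" "f 1 = g 1" "\<And>s h. f (emb h * s) = g (emb h * s)"
  shows "f t = g t"
proof (rule linear_map_eqI[OF assms(1,2)])
  show "f (vec bs) = g (vec bs)" for bs
    using assms(3,4) by (cases bs) (auto simp: vec_Cons vec_Nil simp del: emb_single)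
qed

text \<open>Recursion on the last or the first factor, with z the value on the empty tensor. G is
  evaluated on basis vectors only; its bilinearity then gives the recursion for arbitrary
  factors.\<close>

definition snoc_map :: "('c \<Rightarrow>\<^sub>0 'k) \<Rightarrow> (('b list \<Rightarrow>\<^sub>0 'k) \<Rightarrow> ('b \<Rightarrow>\<^sub>0 'k) \<Rightarrow> ('c \<Rightarrow>\<^sub>0 'k)) \<Rightarrow>
    ('b list \<Rightarrow>\<^sub>0 'k::field) \<Rightarrow> ('c \<Rightarrow>\<^sub>0 'k)" where
  "snoc_map z G = lin_ext fscale (\<lambda>bs. if bs = [] then z else G (vec (butlast bs)) (vec (last bs)))"

definition Cons_map :: "('c \<Rightarrow>\<^sub>0 'k) \<Rightarrow> (('b \<Rightarrow>\<^sub>0 'k) \<Rightarrow> ('b list \<Rightarrow>\<^sub>0 'k) \<Rightarrow> ('c \<Rightarrow>\<^sub>0 'k)) \<Rightarrow>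
    ('b list \<Rightarrow>\<^sub>0 'k::field) \<Rightarrow> ('c \<Rightarrow>\<^sub>0 'k)" where
  "Cons_map z G = lin_ext fscale (\<lambda>bs. if bs = [] then z else G (vec (hd bs)) (vec (tl bs)))"

lemma linear_snoc_map: "linear_map fscale f \<Longrightarrow> linear_map fscale (\<lambda>x. snoc_map z G (f x))"
  and linear_Cons_map: "linear_map fscale f \<Longrightarrow> linear_map fscale (\<lambda>x. Cons_map z H (f x))"
  unfolding snoc_map_def Cons_map_def by (intro linear_map_comp[OF linear_map_lin_ext] lin; assumption)+

lemma snoc_map_1: "snoc_map z G 1 = z" and Cons_map_1: "Cons_map z H 1 = z"
  by (simp_all add: snoc_map_def Cons_map_def flip: vec_Nil)

lemma snoc_map_snoc:
  assumes "bilinear_map G"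
  shows "snoc_map z G (t * emb h) = G t h"
  by (rule bilinear_map_eqI[where \<Phi> = "\<lambda>t h. snoc_map z G (t * emb h)", OF _ assms])
    (intro bilinear_mapI linear_snoc_map lin | simp add: snoc_map_def vec_mult)+

lemma Cons_map_Cons:
  assumes "bilinear_map G"
  shows "Cons_map z G (emb h * t) = G h t"
  by (rule bilinear_map_eqI[where \<Phi> = "\<lambda>h t. Cons_map z G (emb h * t)", OF _ assms])
    (intro bilinear_mapI linear_Cons_map lin | simp add: Cons_map_def vec_mult)+

context SLq_model
begin

section \<open>Multiplications, faces and rotation on the tensor algebra\<close>

definition Rm :: "(idx \<Rightarrow>\<^sub>0 'k) \<Rightarrow> (idx list \<Rightarrow>\<^sub>0 'k) \<Rightarrow> (idx list \<Rightarrow>\<^sub>0 'k)"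
  where "Rm a = snoc_map (fscale (chi 1 a) 1) (\<lambda>t h. t * emb (h \<star> a))"

definition Lm :: "(idx \<Rightarrow>\<^sub>0 'k) \<Rightarrow> (idx list \<Rightarrow>\<^sub>0 'k) \<Rightarrow> (idx list \<Rightarrow>\<^sub>0 'k)"
  where "Lm a = Cons_map 0 (\<lambda>h t. emb (a \<star> h) * t)"

definition last_delta :: "(idx list \<Rightarrow>\<^sub>0 'k) \<Rightarrow> (idx list \<Rightarrow>\<^sub>0 'k)"
  where "last_delta = snoc_map 0 (\<lambda>t h. fscale (chi q h) t)"

definition rot :: "(idx list \<Rightarrow>\<^sub>0 'k) \<Rightarrow> (idx list \<Rightarrow>\<^sub>0 'k)"
  where "rot = snoc_map 0 (\<lambda>t h. emb (alpha h) * t)"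

lemma linear_Rm [lin]: "linear_map fscale f \<Longrightarrow> linear_map fscale (\<lambda>x. Rm a (f x))"
  and linear_Lm [lin]: "linear_map fscale f \<Longrightarrow> linear_map fscale (\<lambda>x. Lm a (f x))"
  and linear_last_delta [lin]: "linear_map fscale f \<Longrightarrow> linear_map fscale (\<lambda>x. last_delta (f x))"
  and linear_rot [lin]: "linear_map fscale f \<Longrightarrow> linear_map fscale (\<lambda>x. rot (f x))"
  unfolding Rm_def Lm_def last_delta_def rot_def by (intro linear_snoc_map linear_Cons_map; assumption)+

lemmas Rm_simps = linear_map_simps[OF linear_Rm[OF linear_map_id]]
lemmas Lm_simps = linear_map_simps[OF linear_Lm[OF linear_map_id]]
lemmas last_delta_simps = linear_map_simps[OF linear_last_delta[OF linear_map_id]]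
lemmas rot_simps = linear_map_simps[OF linear_rot[OF linear_map_id]]

lemma Rm_1 [simp]: "Rm a 1 = fscale (chi 1 a) 1"
  and Lm_1 [simp]: "Lm a 1 = 0"
  and last_delta_1 [simp]: "last_delta 1 = 0"
  and rot_1 [simp]: "rot 1 = 0"
  by (simp_all add: Rm_def Lm_def last_delta_def rot_def snoc_map_1 Cons_map_1)

lemma Rm_snoc: "Rm a (t * emb h) = t * emb (h \<star> a)"
  and Lm_Cons: "Lm a (emb h * t) = emb (a \<star> h) * t"
  and last_delta_snoc: "last_delta (t * emb h) = fscale (chi q h) t"
  and rot_snoc: "rot (t * emb h) = emb (alpha h) * t"
  unfolding Rm_def Lm_def last_delta_def rot_def
  by (subst snoc_map_snoc Cons_map_Cons; (intro bilinear_mapI lin | simp))+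

lemma Rm_emb [simp]: "Rm a (emb h) = emb (h \<star> a)"
  and Lm_emb [simp]: "Lm a (emb h) = emb (a \<star> h)"
  using Rm_snoc[of a 1 h] Lm_Cons[of a h 1] by simp_all

lemma linear_Rm_left [lin]: "linear_map fscale f \<Longrightarrow> linear_map fscale (\<lambda>x. Rm (f x) t)"
proof -
  have "linear_map fscale (\<lambda>a. Rm a t)"
    unfolding Rm_def snoc_map_def lin_ext_def
    by (intro lin linear_map_fscale)
  then show "linear_map fscale f \<Longrightarrow> linear_map fscale (\<lambda>x. Rm (f x) t)" by (rule linear_map_comp)
qed

lemma linear_Lm_left [lin]: "linear_map fscale f \<Longrightarrow> linear_map fscale (\<lambda>x. Lm (f x) t)"
proof -
  have "linear_map fscale (\<lambda>a. Lm a t)"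
    unfolding Lm_def Cons_map_def lin_ext_def
    by (intro lin linear_map_fscale)
  then show "linear_map fscale f \<Longrightarrow> linear_map fscale (\<lambda>x. Lm (f x) t)" by (rule linear_map_comp)
qed

lemmas Rm_left_simps = linear_map_simps[OF linear_Rm_left[OF linear_map_id]]
lemmas Lm_left_simps = linear_map_simps[OF linear_Lm_left[OF linear_map_id]]

lemma tens_Rm: "t \<in> tens n \<Longrightarrow> Rm a t \<in> tens n"
proof (rule linear_map_tens_mem[where f = "Rm a" and n = n])
  show "Rm a (vec bs) \<in> tens n" if "length bs = n" for bs
    using that by (cases bs rule: rev_cases)
      (auto simp: vec_snoc vec_Nil Rm_snoc tens_emb_snoc tens_vec tens_1 simp del: emb_single intro!: tens_closed)
qed (intro lin)

lemma tens_Lm: "t \<in> tens n \<Longrightarrow> Lm a t \<in> tens n"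
proof (rule linear_map_tens_mem[where f = "Lm a" and n = n])
  show "Lm a (vec bs) \<in> tens n" if "length bs = n" for bs
    using that by (cases bs)
      (auto simp: vec_Cons vec_Nil Lm_Cons tens_emb_Cons tens_vec tens_1 simp del: emb_single intro!: tens_closed)
qed (intro lin)

lemma tens_last_delta: "t \<in> tens (Suc n) \<Longrightarrow> last_delta t \<in> tens n"
proof (rule linear_map_tens_mem[where f = "last_delta" and n = "Suc n"])
  show "last_delta (vec bs) \<in> tens n" if "length bs = Suc n" for bs
    using that by (cases bs rule: rev_cases)
      (auto simp: vec_snoc last_delta_snoc tens_vec simp del: emb_single intro!: tens_closed)
qed (intro lin)

lemma Rm_Rm: "Rm a (Rm b t) = Rm (b \<star> a) t"
proof (rule snoc_eqI[where sc = fscale and f = "\<lambda>t. Rm a (Rm b t)"])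
  show "Rm a (Rm b 1) = Rm (b \<star> a) 1" by (simp add: Rm_simps chi_mulA mult.commute)
qed (intro lin | simp add: Rm_snoc mulA_assoc)+

lemma Lm_Lm: "Lm a (Lm b t) = Lm (a \<star> b) t"
  by (rule Cons_eqI[where sc = fscale and f = "\<lambda>t. Lm a (Lm b t)"])
    (intro lin | simp add: Lm_simps Lm_Cons mulA_assoc)+

lemma Lm_mult: "t \<in> tens (Suc n) \<Longrightarrow> Lm a (t * s) = Lm a t * s"
proof (rule tens_eqI[where sc = fscale and f = "\<lambda>t. Lm a (t * s)" and n = "Suc n"])
  show "Lm a (vec bs * s) = Lm a (vec bs) * s" if "length bs = Suc n" for bs
    using that by (cases bs) (auto simp: vec_Cons Lm_Cons mult.assoc simp del: emb_single)
qed (intro lin | assumption)+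

lemma Lm_Rm: "Lm a (Rm b t) = Rm b (Lm a t)"
proof (rule linear_map_eqI[where sc = fscale and f = "\<lambda>t. Lm a (Rm b t)"])
  fix bs :: "idx list"
  show "Lm a (Rm b (vec bs)) = Rm b (Lm a (vec bs))"
  proof (cases bs rule: rev_cases)
    case (snoc ys y)
    show ?thesis
    proof (cases ys)
      case Nil
      then have "vec bs = (emb (vec y) :: idx list \<Rightarrow>\<^sub>0 'k)" using snoc by simp
      then show ?thesis by (simp only: Rm_emb Lm_emb mulA_assoc)
    next
      case (Cons z zs)
      define c :: "idx list \<Rightarrow>\<^sub>0 'k" where "c = vec zs"
      have bs: "vec bs = emb (vec z) * c * emb (vec y)"
        using snoc Cons by (simp add: c_def vec_mult)
      show ?thesis
        unfolding bs Rm_snoc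
        by (simp only: mult.assoc Lm_Cons) (simp only: Rm_snoc flip: mult.assoc)
    qed
  qed (simp add: vec_Nil Lm_simps Rm_simps)
qed (intro lin)+

text \<open>
  \<open>fc i\<close> is the \<open>i\<close>-th face except for the last one: it applies \<open>\<epsilon>\<close> to the first factor if \<open>i = 0\<close>
  (encoded in \<open>Rm\<close> on degree \<open>0\<close>), and multiplies two adjacent factors if \<open>i > 0\<close>.
\<close>

definition fc :: "nat \<Rightarrow> (idx list \<Rightarrow>\<^sub>0 'k) \<Rightarrow> (idx list \<Rightarrow>\<^sub>0 'k)"
  where "fc i = lin_ext fscale (\<lambda>bs. if length bs \<le> i then 0
    else Rm (vec (bs ! i)) (vec (take i bs)) * vec (drop (Suc i) bs))"

lemma linear_fc [lin]: "linear_map fscale f \<Longrightarrow> linear_map fscale (\<lambda>x. fc i (f x))"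
  unfolding fc_def by (intro linear_map_comp[OF linear_map_lin_ext] lin)

lemmas fc_simps = linear_map_simps[OF linear_fc[OF linear_map_id]]

lemma fc_1 [simp]: "fc i 1 = 0"
  by (simp add: fc_def flip: vec_Nil)

lemma fc_snoc:
  assumes "s \<in> tens n"
  shows "fc i (s * emb h) = (if i < n then fc i s * emb h else if i = n then Rm h s else 0)"
proof -
  have "fc i (s * emb (vec b)) = (if i < n then fc i s * emb (vec b) else if i = n then Rm (vec b) s else 0)" for b
  proof (rule tens_eqI[where sc = fscale and f = "\<lambda>s. fc i (s * emb (vec b))", OF _ _ assms])
    show "fc i (vec bs * emb (vec b)) = (if i < n then fc i (vec bs) * emb (vec b)
        else if i = n then Rm (vec b) (vec bs) else 0)" if "length bs = n" for bs
      using that by (auto simp: fc_def vec_mult nth_append mult.assoc vec_Nil)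
  qed (intro lin)+
  then show ?thesis
    by (rule linear_map_eqI[where sc = fscale and f = "\<lambda>h. fc i (s * emb h)", rotated 2])
      (assumption | intro lin)+
qed

lemma tens_fc: "t \<in> tens (Suc n) \<Longrightarrow> fc i t \<in> tens n"
proof (rule linear_map_tens_mem[where f = "fc i" and n = "Suc n"])
  show "fc i (vec bs) \<in> tens n" if "length bs = Suc n" for bs
  proof (cases "length bs \<le> i")
    case False
    then have "Rm (vec (bs ! i)) (vec (take i bs)) * vec (drop (Suc i) bs) \<in> tens (i + (n - i))"
      using that by (intro tens_mult tens_Rm tens_vec) auto
    then show ?thesis using False that by (simp add: fc_def)
  qed (simp add: fc_def tens_closed)
qed (intro lin)

text \<open>The index \<open>Suc i\<close> leaves out face 0, which applies the counit to the factor
  being multiplied; the other faces are left linear by associativity.\<close>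

lemma fc_Lm:
  assumes "t \<in> tens n"
  shows "fc (Suc i) (Lm a t) = Lm a (fc (Suc i) t)"
  using assms
proof (induction n arbitrary: t)
  case 0
  show ?case
    by (rule tens_0_eqI[where sc = fscale and f = "\<lambda>t. fc (Suc i) (Lm a t)", OF _ _ 0])
      (intro lin | simp add: fc_simps Lm_simps)+
next
  case (Suc n)
  show ?case
  proof (rule tens_Suc_eqI[where sc = fscale and f = "\<lambda>t. fc (Suc i) (Lm a t)", OF _ _ Suc.prems])
    fix s :: "idx list \<Rightarrow>\<^sub>0 'k" and h assume s: "s \<in> tens n"
    show "fc (Suc i) (Lm a (s * emb h)) = Lm a (fc (Suc i) (s * emb h))"
    proof (cases n)
      case 0
      have "fc (Suc i) (x * emb h) = 0" if "x \<in> tens 0" for x h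
        using fc_snoc[OF that, of "Suc i" h] by simp
      moreover have "fc (Suc i) (Lm a (s * emb h)) = 0"
        by (rule tens_0_eqI[where sc = fscale and f = "\<lambda>s. fc (Suc i) (Lm a (s * emb h))" and g = "\<lambda>_. 0"])
          (intro lin | use s 0 fc_snoc[OF tens_1, of "Suc i"] in \<open>simp add: fc_simps\<close>)+
      ultimately show ?thesis using s 0 by (simp add: Lm_simps)
    next
      case (Suc m)
      have "fc (Suc i) s \<in> tens m" using s Suc by (simp add: tens_fc)
      then have "Suc i < n \<Longrightarrow> Lm a (fc (Suc i) s * emb h) = Lm a (fc (Suc i) s) * emb h"
        using Suc by (intro Lm_mult[of _ "m - 1"]) auto
      then show ?thesis
        using s Suc Suc.IH[OF s] Lm_mult[of s m a "emb h"]
        by (auto simp: fc_snoc[OF s] fc_snoc[OF tens_Lm[OF s]] Lm_Rm Lm_simps)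
    qed
  qed (intro lin)+
qed

end

section \<open>The cyclic operator\<close>

context SLq_model
begin

text \<open>
  \<open>coact (h\<^sub>1 \<otimes> \<dots> \<otimes> h\<^sub>n) = S(h\<^sub>1\<^sup>(\<^sup>1\<^sup>) \<cdots> h\<^sub>n\<^sup>(\<^sup>1\<^sup>)) \<otimes> h\<^sub>1\<^sup>(\<^sup>2\<^sup>) \<otimes> \<dots> \<otimes> h\<^sub>n\<^sup>(\<^sup>2\<^sup>)\<close> embeds the module
  into the twisted Hochschild complex, where the cyclic operator becomes a rotation.
\<close>

fun coact_rev :: "idx list \<Rightarrow> (idx list \<Rightarrow>\<^sub>0 'k)" where
  "coact_rev [] = emb \<e>"
| "coact_rev (b # bs) = sweedler_sum (\<lambda>h1 h2. Lm (antip h1) (coact_rev bs) * emb h2) (vec b)"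

definition coact :: "(idx list \<Rightarrow>\<^sub>0 'k) \<Rightarrow> (idx list \<Rightarrow>\<^sub>0 'k)"
  where "coact = lin_ext fscale (\<lambda>bs. coact_rev (rev bs))"

definition tau :: "(idx list \<Rightarrow>\<^sub>0 'k) \<Rightarrow> (idx list \<Rightarrow>\<^sub>0 'k)"
  where "tau t = last_delta (coact t)"

lemma linear_coact [lin]: "linear_map fscale f \<Longrightarrow> linear_map fscale (\<lambda>x. coact (f x))"
  unfolding coact_def by (intro linear_map_comp[OF linear_map_lin_ext] lin)

lemma linear_tau [lin]: "linear_map fscale f \<Longrightarrow> linear_map fscale (\<lambda>x. tau (f x))"
  unfolding tau_def by (intro lin)

lemmas coact_simps = linear_map_simps[OF linear_coact[OF linear_map_id]]
lemmas tau_simps = linear_map_simps[OF linear_tau[OF linear_map_id]]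

lemma coact_1 [simp]: "coact 1 = emb \<e>"
  by (simp add: coact_def flip: vec_Nil)

lemma bilinear_coact_step: "bilinear_map (\<lambda>h1 h2. Lm (antip h1) s * emb h2)"
  by (intro bilinear_mapI lin)

text \<open>The antipode reverses the product of first legs, so the first leg of a new last factor
  multiplies from the left.\<close>

lemma coact_snoc: "coact (t * emb h) = sweedler_sum (\<lambda>h1 h2. Lm (antip h1) (coact t) * emb h2) h"
  by (rule bilinear_map_eqI[where \<Phi> = "\<lambda>t h. coact (t * emb h)"])
    (intro bilinear_mapI lin | simp add: coact_def vec_mult)+

lemma coact_snoc_coef:
  "length I = length J \<Longrightarrow> coact (t * emb (coef I J)) =
    (\<Sum>K\<in>bool_lists (length I). Lm (antip (coef I K)) (coact t) * emb (coef K J))"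
  unfolding coact_snoc by (rule sweedler_sum_coef[OF bilinear_coact_step])

lemma tens_Suc_coefI:
  assumes "linear_map sc f" "linear_map sc g" "t \<in> tens (Suc n)"
    "\<And>s I J. s \<in> tens n \<Longrightarrow> length I = length J \<Longrightarrow> f (s * emb (coef I J)) = g (s * emb (coef I J))"
  shows "f t = g t"
proof (rule tens_Suc_eqI[OF assms(1-3)])
  fix s :: "idx list \<Rightarrow>\<^sub>0 'k" and h assume s: "s \<in> tens n"
  show "f (s * emb h) = g (s * emb h)"
    by (rule linear_map_eq_coefI[where f = "\<lambda>h. f (s * emb h)" and g = "\<lambda>h. g (s * emb h)"])
      (rule linear_map_comp[OF assms(1)] linear_map_comp[OF assms(2)] assms(4)[OF s] | assumption | intro lin)+
qed

lemma tens_coact: "t \<in> tens n \<Longrightarrow> coact t \<in> tens (Suc n)"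
proof (rule linear_map_tens_mem[where f = coact and n = n])
  have mem: "sweedler_sum \<Phi> h \<in> tens m" if "\<And>a b. \<Phi> a b \<in> tens m" for \<Phi> h m
    unfolding sweedler_sum_def lin_ext_def word_sum_def by (intro tens_closed that)
  have "coact_rev bs \<in> tens (Suc (length bs))" for bs
    by (induction bs) (auto intro!: mem tens_emb tens_emb_snoc tens_Lm simp del: emb_single)
  from this[of "rev _"] show "coact (vec bs) \<in> tens (Suc n)" if "length bs = n" for bs
    unfolding that[symmetric] coact_def lin_ext_vec by (metis length_rev)
qed (intro lin)

lemma tens_tau: "t \<in> tens n \<Longrightarrow> tau t \<in> tens n"
  unfolding tau_def by (intro tens_last_delta tens_coact)

lemma antip_antipode_left:
  "length I = length J \<Longrightarrow>
    (\<Sum>K\<in>bool_lists (length I). antip (coef K J) \<star> antip (antip (coef I K))) = fscale (kronecker I J) \<e>"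
  using arg_cong[OF antipode_left, of I J antip]
  by (simp add: antip_simps antip_mulA del: fscale_single)

lemma sum_kronecker:
  assumes "length I = n"
  shows "(\<Sum>K\<in>bool_lists n. fscale (kronecker I K) (f K)) = f I"
    and "(\<Sum>K\<in>bool_lists n. fscale (kronecker K I) (f K)) = f I"
proof -
  have "fscale (kronecker I K) (f K) = (if K = I then f K else 0)"
    "fscale (kronecker K I) (f K) = (if K = I then f K else 0)" for K
    by (auto simp: kronecker_def)
  moreover have "I \<in> bool_lists n" using assms by (simp add: bool_lists_def)
  ultimately show "(\<Sum>K\<in>bool_lists n. fscale (kronecker I K) (f K)) = f I"
    "(\<Sum>K\<in>bool_lists n. fscale (kronecker K I) (f K)) = f I"
    by simp_all
qed

text \<open>Comultiplication is multiplicative and the antipode anti-multiplicative; in degree 0,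
  where right multiplication is the counit, the claim is the antipode axiom.\<close>

lemma coact_Rm:
  assumes "t \<in> tens n" "length I = length J"
  shows "coact (Rm (coef I J) t) =
    (\<Sum>K\<in>bool_lists (length I). Rm (coef K J) (Lm (antip (coef I K)) (coact t)))"
proof (cases n)
  case 0
  show ?thesis
  proof (rule tens_0_eqI[where sc = fscale and f = "\<lambda>t. coact (Rm (coef I J) t)"])
    have "(\<Sum>K\<in>bool_lists (length I). emb (antip (coef I K) \<star> coef K J)) = fscale (kronecker I J) (emb \<e>)"
      using arg_cong[OF antipode_left[OF assms(2)], of emb] by (simp add: emb_simps del: emb_single fscale_single)
    then show "coact (Rm (coef I J) 1) =
        (\<Sum>K\<in>bool_lists (length I). Rm (coef K J) (Lm (antip (coef I K)) (coact 1)))"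
      using assms(2) by (simp add: coact_simps chi_coef del: emb_single fscale_single)
  qed (use assms 0 in \<open>(intro lin | simp)+\<close>)
next
  case (Suc m)
  show ?thesis
  proof (rule tens_Suc_coefI[where sc = fscale and f = "\<lambda>t. coact (Rm (coef I J) t)"])
    fix s :: "idx list \<Rightarrow>\<^sub>0 'k" and I' J' :: "bool list"
    assume s: "s \<in> tens m" and len: "length I' = length J'"
    have "coact (Rm (coef I J) (s * emb (coef I' J'))) = coact (s * emb (coef (I' @ I) (J' @ J)))"
      using len by (simp add: Rm_snoc coef_append)
    also have "\<dots> = (\<Sum>L\<in>bool_lists (length I'). \<Sum>K\<in>bool_lists (length I).
        Lm (antip (coef (I' @ I) (L @ K))) (coact s) * emb (coef (L @ K) (J' @ J)))"
      using len assms(2) by (subst coact_snoc_coef) (simp_all add: sum_bool_lists_append)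
    also have "\<dots> = (\<Sum>L\<in>bool_lists (length I'). \<Sum>K\<in>bool_lists (length I).
        Rm (coef K J) (Lm (antip (coef I K)) (Lm (antip (coef I' L)) (coact s) * emb (coef L J'))))"
    proof (intro sum.cong refl)
      fix L K assume "L \<in> bool_lists (length I')" "K \<in> bool_lists (length I)"
      then have l: "length I' = length L" "length L = length J'" using len by (simp_all add: bool_lists_def)
      show "Lm (antip (coef (I' @ I) (L @ K))) (coact s) * emb (coef (L @ K) (J' @ J)) =
        Rm (coef K J) (Lm (antip (coef I K)) (Lm (antip (coef I' L)) (coact s) * emb (coef L J')))"
        using Lm_mult[OF tens_Lm[OF tens_coact[OF s]], of "antip (coef I K)" "antip (coef I' L)" "emb (coef L J')"]
        by (simp add: coef_append l antip_mulA Lm_Lm Rm_snoc)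
    qed
    also have "\<dots> = (\<Sum>K\<in>bool_lists (length I). Rm (coef K J) (Lm (antip (coef I K)) (coact (s * emb (coef I' J')))))"
      by (subst sum.swap) (simp add: coact_snoc_coef[OF len] Rm_simps Lm_simps)
    finally show "coact (Rm (coef I J) (s * emb (coef I' J'))) =
      (\<Sum>K\<in>bool_lists (length I). Rm (coef K J) (Lm (antip (coef I K)) (coact (s * emb (coef I' J')))))" .
  qed (use assms Suc in \<open>(intro lin | simp)+\<close>)
qed

text \<open>The additional first factor shifts the face numbers by one. Face 0 of the source, the
  counit, becomes the product of the antipode factor with its neighbour; there the antipode axiom
  enters.\<close>

lemma fc_coact:
  assumes "t \<in> tens n" "i < n"
  shows "fc (Suc i) (coact t) = coact (fc i t)"
  using assms
proof (induction n arbitrary: t)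
  case (Suc n)
  show ?case
  proof (rule tens_Suc_coefI[where sc = fscale and f = "\<lambda>t. fc (Suc i) (coact t)", OF _ _ Suc.prems(1)])
    fix s :: "idx list \<Rightarrow>\<^sub>0 'k" and I J :: "bool list"
    assume s: "s \<in> tens n" and len: "length I = length J"
    have L: "Lm a (coact s) \<in> tens (Suc n)" for a by (intro tens_Lm tens_coact s)
    show "fc (Suc i) (coact (s * emb (coef I J))) = coact (fc i (s * emb (coef I J)))"
    proof (cases "i < n")
      case True
      then show ?thesis
        by (simp add: coact_snoc_coef[OF len] fc_simps fc_snoc[OF L] fc_snoc[OF s]
            fc_Lm[OF tens_coact[OF s]] Suc.IH[OF s])
    next
      case False
      then have "i = n" using Suc.prems(2) by simp
      then show ?thesis
        by (simp add: coact_snoc_coef[OF len] fc_simps fc_snoc[OF L] fc_snoc[OF s] coact_Rm[OF s len])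
    qed
  qed (intro lin)+
qed simp

lemma fc_0_emb: "fc 0 (emb h * t) = fscale (chi 1 h) t"
  by (rule bilinear_map_eqI[where \<Phi> = "\<lambda>h t. fc 0 (emb h * t)"])
    (intro bilinear_mapI lin | simp add: fc_def vec_mult vec_Nil mult_fscale_left)+

lemma fc_0_Lm: "fc 0 (Lm a t) = fscale (chi 1 a) (fc 0 t)"
  by (rule Cons_eqI[where sc = fscale and f = "\<lambda>t. fc 0 (Lm a t)"])
    (intro lin | simp add: fc_simps Lm_Cons fc_0_emb chi_mulA)+

lemma dual_dual [simp]: "map Not (rev (map Not (rev I))) = I"
  by (simp add: rev_map comp_def)

lemma chi_antip: "chi 1 (antip h) = chi 1 h"
proof (rule linear_map_eq_coefI[where sc = "(*)" and f = "\<lambda>h. chi 1 (antip h)"])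
  fix I J :: "bool list" assume len: "length I = length J"
  have "map Not (rev J) = map Not (rev I) \<longleftrightarrow> I = J"
    using dual_dual[of I] dual_dual[of J] by metis
  then have "kronecker (map Not (rev J)) (map Not (rev I)) = kronecker I J"
    by (simp only: kronecker_def)
  then have "chi 1 (antip (coef I J)) = sign_weight I / sign_weight J * kronecker I J"
    using len by (simp add: antip_coef chi_coef chi_simps)
  also have "\<dots> = chi 1 (coef I J)"
    using len sign_weight_nonzero by (simp add: chi_coef kronecker_def)
  finally show "chi 1 (antip (coef I J)) = chi 1 (coef I J)" .
qed (intro lin)+

text \<open>The counit of the antipode factor undoes the coaction. In particular
  \<open>coact\<close> is injective, so identities can be pulled back along it.\<close>

lemma fc_0_coact:
  assumes "t \<in> tens n"
  shows "fc 0 (coact t) = t"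
  using assms
proof (induction n arbitrary: t)
  case 0
  show ?case
    by (rule tens_0_eqI[where sc = fscale and f = "\<lambda>t. fc 0 (coact t)", OF _ _ 0])
      (intro lin | use fc_0_emb[of \<e> 1] in simp)+
next
  case (Suc n)
  show ?case
  proof (rule tens_Suc_coefI[where sc = fscale and f = "\<lambda>t. fc 0 (coact t)", OF _ _ Suc.prems])
    fix s :: "idx list \<Rightarrow>\<^sub>0 'k" and I J :: "bool list"
    assume s: "s \<in> tens n" and len: "length I = length J"
    have L: "Lm a (coact s) \<in> tens (Suc n)" for a by (intro tens_Lm tens_coact s)
    have "fc 0 (coact (s * emb (coef I J))) =
        (\<Sum>K\<in>bool_lists (length I). fscale (kronecker I K) (s * emb (coef K J)))"
      unfolding coact_snoc_coef[OF len]
      by (simp add: fc_simps fc_snoc[OF L] fc_0_Lm Suc.IH[OF s] chi_antip)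
        (intro sum.cong refl, simp add: chi_coef length_bool_lists mult_fscale_left)
    then show "fc 0 (coact (s * emb (coef I J))) = s * emb (coef I J)"
      by (simp add: sum_kronecker(1))
  qed (intro lin)+
qed

text \<open>The final \<delta> vanishes on c_KJ unless K = J, so a single summand survives.\<close>

lemma tau_snoc_coef:
  assumes "length I = length J"
  shows "tau (s * emb (coef I J)) = fscale (weight q J) (Lm (antip (coef I J)) (coact s))"
proof -
  have "tau (s * emb (coef I J)) = (\<Sum>K\<in>bool_lists (length I).
      fscale (kronecker K J) (fscale (weight q K) (Lm (antip (coef I K)) (coact s))))"
    unfolding tau_def coact_snoc_coef[OF assms] last_delta_simps last_delta_snoc
    using assms by (intro sum.cong refl) (simp add: chi_coef length_bool_lists)
  then show ?thesis
    using sum_kronecker(2)[OF assms[symmetric], of "\<lambda>K. fscale (weight q K) (Lm (antip (coef I K)) (coact s))"]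
    by (simp only:)
qed

lemma last_delta_Rm:
  assumes "t \<in> tens (Suc n)"
  shows "last_delta (Rm h t) = fscale (chi q h) (last_delta t)"
  by (rule tens_Suc_eqI[where sc = fscale and f = "\<lambda>t. last_delta (Rm h t)", OF _ _ assms])
    (intro lin | simp add: Rm_snoc last_delta_snoc chi_mulA mult.commute)+

lemma fc_last_delta:
  assumes "t \<in> tens (Suc n)" "i < n"
  shows "fc i (last_delta t) = last_delta (fc i t)"
  by (rule tens_Suc_eqI[where sc = fscale and f = "\<lambda>t. fc i (last_delta t)", OF _ _ assms(1)])
    (intro lin | simp add: assms(2) fc_snoc last_delta_snoc fc_simps)+

lemma last_delta_fc:
  assumes "t \<in> tens (Suc (Suc n))"
  shows "last_delta (fc (Suc n) t) = last_delta (last_delta t)"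
  by (rule tens_Suc_eqI[where sc = fscale and f = "\<lambda>t. last_delta (fc (Suc n) t)", OF _ _ assms])
    (intro lin | simp add: fc_snoc last_delta_snoc last_delta_Rm last_delta_simps)+

text \<open>This and the next two lemmas are the commutation rules of the cyclic operator with the
  faces. They reflect those of \<open>coact\<close>, as \<delta> is multiplicative and the counit is
  invariant under the antipode.\<close>

lemma fc_0_tau:
  assumes "t \<in> tens (Suc n)"
  shows "fc 0 (tau t) = last_delta t"
proof (rule tens_Suc_coefI[where sc = fscale and f = "\<lambda>t. fc 0 (tau t)", OF _ _ assms])
  fix s :: "idx list \<Rightarrow>\<^sub>0 'k" and I J :: "bool list"
  assume s: "s \<in> tens n" and len: "length I = length J"
  show "fc 0 (tau (s * emb (coef I J))) = last_delta (s * emb (coef I J))"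
    by (simp add: tau_snoc_coef[OF len] fc_simps fc_0_Lm fc_0_coact[OF s] chi_antip last_delta_snoc
        chi_coef[OF _ len] kronecker_def)
qed (intro lin)+

lemma fc_tau:
  assumes "t \<in> tens n" "Suc i < n"
  shows "fc (Suc i) (tau t) = tau (fc i t)"
  using assms by (simp add: tau_def fc_coact[symmetric] fc_last_delta[OF tens_coact])

lemma last_delta_tau:
  assumes "t \<in> tens (Suc n)"
  shows "last_delta (tau t) = tau (fc n t)"
  using last_delta_fc[OF tens_coact[OF assms]] fc_coact[OF assms, of n] by (simp add: tau_def)

subsection \<open>Cyclicity\<close>

lemma sum_bool_lists_dual: "(\<Sum>K\<in>bool_lists n. f (map Not (rev K))) = (\<Sum>K\<in>bool_lists n. f K)"
  by (rule sum.reindex_bij_witness[where i = "\<lambda>K. map Not (rev K)" and j = "\<lambda>K. map Not (rev K)"])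
    (auto simp: bool_lists_def rev_map comp_def)

text \<open>The antipode flips the comultiplication: on coefficients this is reindexing the middle
  index by reversal and complement, while the scalar ratios telescope.\<close>

lemma sweedler_sum_antip:
  assumes \<Phi>: "bilinear_map \<Phi>" and len: "length I = length J"
  shows "sweedler_sum \<Phi> (antip (coef I J)) =
    (\<Sum>K\<in>bool_lists (length I). \<Phi> (antip (coef K J)) (antip (coef I K)))"
proof -
  note b = linear_map_simps[OF bilinear_map_right[OF \<Phi>]] linear_map_simps[OF bilinear_map_left[OF \<Phi>]]
  have "sweedler_sum \<Phi> (antip (coef I J)) = (\<Sum>K\<in>bool_lists (length I).
      fscale (sign_weight I / sign_weight J) (\<Phi> (coef (map Not (rev J)) K) (coef K (map Not (rev I)))))"
    using len by (simp add: antip_coef linear_map_scale[OF linear_sweedler_sum[OF linear_map_id]]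
      sweedler_sum_coef[OF \<Phi>] fscale.scale_sum_right)
  also have "\<dots> = (\<Sum>K\<in>bool_lists (length I). fscale (sign_weight I / sign_weight J)
      (\<Phi> (coef (map Not (rev J)) (map Not (rev K))) (coef (map Not (rev K)) (map Not (rev I)))))"
    by (rule sum_bool_lists_dual[symmetric])
  also have "\<dots> = (\<Sum>K\<in>bool_lists (length I). \<Phi> (antip (coef K J)) (antip (coef I K)))"
    using len sign_weight_nonzero
    by (intro sum.cong refl) (simp add: antip_coef length_bool_lists b field_simps)
  finally show ?thesis .
qed

lemma sum_rotate3:
  "(\<Sum>a\<in>A. \<Sum>b\<in>B. \<Sum>c\<in>C. f a b c) = (\<Sum>b\<in>B. \<Sum>c\<in>C. \<Sum>a\<in>A. f a b c)"
  by (rule trans[OF sum.swap], rule sum.cong[OF refl], rule sum.swap)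

lemma sum_rotate4:
  "(\<Sum>a\<in>A. \<Sum>b\<in>B. \<Sum>c\<in>C. \<Sum>d\<in>D. f a b c d) = (\<Sum>b\<in>B. \<Sum>c\<in>C. \<Sum>d\<in>D. \<Sum>a\<in>A. f a b c d)"
  by (rule trans[OF sum.swap], rule sum.cong[OF refl], rule sum_rotate3)

lemma bilinear_coact_Lm: "bilinear_map (\<lambda>a1 a2. emb (antip a1) * Lm a2 t)"
  by (intro bilinear_mapI lin)

text \<open>Coacting a second time produces antipodes of the legs of the antipode factor; they
  cancel against the first legs of the other factors, and only the legs of the multiplier a
  remain.\<close>

lemma coact_Lm_coact:
  assumes "t \<in> tens n"
  shows "coact (Lm a (coact t)) = sweedler_sum (\<lambda>a1 a2. emb (antip a1) * Lm a2 (coact t)) a"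
  using assms
proof (induction n arbitrary: t a)
  case 0
  show ?case
  proof (rule tens_0_eqI[where sc = fscale and f = "\<lambda>t. coact (Lm a (coact t))", OF _ _ 0])
    have "coact (emb a) = sweedler_sum (\<lambda>a1 a2. emb (antip a1) * emb a2) a"
      using coact_snoc[of 1 a] by (simp del: emb_single)
    then show "coact (Lm a (coact 1)) = sweedler_sum (\<lambda>a1 a2. emb (antip a1) * Lm a2 (coact 1)) a"
      by (simp del: emb_single)
  qed (intro lin)+
next
  case (Suc n)
  have coef: "coact (Lm (coef A B) (coact (s * emb (coef I J)))) =
      sweedler_sum (\<lambda>a1 a2. emb (antip a1) * Lm a2 (coact (s * emb (coef I J)))) (coef A B)"
    if s: "s \<in> tens n" and len: "length I = length J" and AB: "length A = length B"
    for A B I J and s :: "idx list \<Rightarrow>\<^sub>0 'k"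
  proof -
    let ?S = "\<lambda>I. bool_lists (length I)"
    define G where "G C N = Lm (coef C B) (Lm (antip (coef I N)) (coact s))" for C N
    have L: "Lm a (coact s) \<in> tens (Suc n)" for a by (intro tens_Lm tens_coact s)
    have step: "coact (Lm (coef A B \<star> antip (coef I K)) (coact s)) =
        (\<Sum>C\<in>?S A. \<Sum>N\<in>?S I. emb (antip (antip (coef N K)) \<star> antip (coef A C)) * G C N)"
      if K: "K \<in> ?S I" for K
    proof -
      have lenK: "length I = length K" using K by (simp add: bool_lists_def)
      have bl: "bilinear_map (\<lambda>h1 h2. emb (antip (a1 \<star> h1)) * Lm (a2 \<star> h2) (coact s))" for a1 a2
        by (intro bilinear_mapI lin)
      have "coact (Lm (coef A B \<star> antip (coef I K)) (coact s)) =
          sweedler_sum (\<lambda>a1 a2. emb (antip a1) * Lm a2 (coact s)) (coef A B \<star> antip (coef I K))"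
        by (rule Suc.IH[OF s])
      also have "\<dots> = sweedler_sum (\<lambda>a1 a2. sweedler_sum
          (\<lambda>h1 h2. emb (antip (a1 \<star> h1)) * Lm (a2 \<star> h2) (coact s)) (antip (coef I K))) (coef A B)"
        by (rule sweedler_sum_mulA[OF bilinear_coact_Lm])
      also have "\<dots> = sweedler_sum (\<lambda>a1 a2. \<Sum>N\<in>?S I.
          emb (antip (a1 \<star> antip (coef N K))) * Lm (a2 \<star> antip (coef I N)) (coact s)) (coef A B)"
        by (simp only: sweedler_sum_antip[OF bl lenK])
      also have "\<dots> = (\<Sum>C\<in>?S A. \<Sum>N\<in>?S I.
          emb (antip (coef A C \<star> antip (coef N K))) * Lm (coef C B \<star> antip (coef I N)) (coact s))"
        by (rule sweedler_sum_coef[OF bilinear_mapI AB]) (intro lin)+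
      finally show ?thesis by (simp add: G_def antip_mulA Lm_Lm)
    qed
    have "coact (Lm (coef A B) (coact (s * emb (coef I J)))) =
        (\<Sum>K\<in>?S I. coact (Lm (coef A B \<star> antip (coef I K)) (coact s) * emb (coef K J)))"
      by (simp add: coact_snoc_coef[OF len] Lm_simps coact_simps Lm_mult[OF L] Lm_Lm)
    also have "\<dots> = (\<Sum>K\<in>?S I. \<Sum>M\<in>?S I.
        Lm (antip (coef K M)) (coact (Lm (coef A B \<star> antip (coef I K)) (coact s))) * emb (coef M J))"
      using len by (intro sum.cong refl) (simp add: coact_snoc_coef length_bool_lists)
    also have "\<dots> = (\<Sum>K\<in>?S I. \<Sum>M\<in>?S I. \<Sum>C\<in>?S A. \<Sum>N\<in>?S I.
        emb (antip (coef K M) \<star> antip (antip (coef N K)) \<star> antip (coef A C)) * G C N * emb (coef M J))"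
      by (intro sum.cong refl) (simp add: step Lm_simps Lm_Cons sum_distrib_right mulA_assoc)
    also have "\<dots> = (\<Sum>M\<in>?S I. \<Sum>C\<in>?S A. \<Sum>N\<in>?S I. \<Sum>K\<in>?S I.
        emb (antip (coef K M) \<star> antip (antip (coef N K)) \<star> antip (coef A C)) * G C N * emb (coef M J))"
      by (rule sum_rotate4)
    also have "\<dots> = (\<Sum>M\<in>?S I. \<Sum>C\<in>?S A. \<Sum>N\<in>?S I.
        fscale (kronecker N M) (emb (antip (coef A C)) * G C N * emb (coef M J)))"
    proof (intro sum.cong refl)
      fix M C N assume M: "M \<in> ?S I" and N: "N \<in> ?S I"
      have "(\<Sum>K\<in>?S I. emb (antip (coef K M) \<star> antip (antip (coef N K)) \<star> antip (coef A C)) * G C N * emb (coef M J)) =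
        emb ((\<Sum>K\<in>?S I. antip (coef K M) \<star> antip (antip (coef N K))) \<star> antip (coef A C)) * G C N * emb (coef M J)"
        by (simp add: mulA_left_simps emb_simps sum_distrib_right)
      \<comment> \<open>The cancellation: the antipode applied to its own axiom forces the outer
        indices M and N to agree.\<close>
      also have "(\<Sum>K\<in>?S I. antip (coef K M) \<star> antip (antip (coef N K))) = fscale (kronecker N M) \<e>"
        using antip_antipode_left[of N M] M N by (simp only: length_bool_lists)
      finally show "(\<Sum>K\<in>?S I. emb (antip (coef K M) \<star> antip (antip (coef N K)) \<star> antip (coef A C)) * G C N * emb (coef M J)) =
        fscale (kronecker N M) (emb (antip (coef A C)) * G C N * emb (coef M J))"
        by (simp add: mulA_left_simps emb_simps mult_fscale_left del: fscale_single)
    qed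
    also have "\<dots> = (\<Sum>C\<in>?S A. \<Sum>N\<in>?S I. \<Sum>M\<in>?S I.
        fscale (kronecker N M) (emb (antip (coef A C)) * G C N * emb (coef M J)))"
      by (rule sum_rotate3)
    also have "\<dots> = (\<Sum>C\<in>?S A. \<Sum>N\<in>?S I. emb (antip (coef A C)) * G C N * emb (coef N J))"
      by (intro sum.cong refl sum_kronecker(1)) (simp add: length_bool_lists)
    also have "\<dots> = (\<Sum>C\<in>?S A. emb (antip (coef A C)) * Lm (coef C B) (coact (s * emb (coef I J))))"
      by (simp add: coact_snoc_coef[OF len] Lm_simps Lm_mult[OF L] G_def sum_distrib_left mult.assoc)
    also have "\<dots> = sweedler_sum (\<lambda>a1 a2. emb (antip a1) * Lm a2 (coact (s * emb (coef I J)))) (coef A B)"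
      by (rule sweedler_sum_coef[OF bilinear_coact_Lm AB, symmetric])
    finally show ?thesis .
  qed
  show ?case
  proof (rule tens_Suc_coefI[where sc = fscale and f = "\<lambda>t. coact (Lm a (coact t))", OF _ _ Suc.prems])
    fix s :: "idx list \<Rightarrow>\<^sub>0 'k" and I J :: "bool list"
    assume s: "s \<in> tens n" and len: "length I = length J"
    show "coact (Lm a (coact (s * emb (coef I J)))) =
      sweedler_sum (\<lambda>a1 a2. emb (antip a1) * Lm a2 (coact (s * emb (coef I J)))) a"
      by (rule linear_map_eq_coefI[where sc = fscale and f = "\<lambda>a. coact (Lm a (coact (s * emb (coef I J))))"])
        (intro lin | rule coef[OF s len])+
  qed (intro lin)+
qed

lemma sign_weight_dual: "sign_weight K = (- 1) ^ length K * weight q K * sign_weight (map Not (rev K))"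
proof (induction K)
  case (Cons k K)
  have "sign_weight (map Not (rev K) @ [x]) = sign_weight (map Not (rev K)) * sign_weight [x]" for x
    by (simp add: sign_weight_def)
  then show ?case using Cons by (cases k) (auto simp: sign_weight_def field_simps)
qed (simp add: sign_weight_def)

text \<open>The squared antipode scales c_KJ by the ratio of the \<delta>-weights of K and J, that
  is, it is conjugation by \<delta>. This is the involution condition on the modular pair and lets
  the rotation close up.\<close>

lemma weight_antip_antip:
  assumes "length K = length J"
  shows "fscale (weight q J) (antip (antip (coef K J))) = alpha (coef K J)"
proof -
  have "sign_weight K * sign_weight (map Not (rev J)) * weight q J =
      weight q K * (sign_weight J * sign_weight (map Not (rev K)))"
    using sign_weight_dual[of K] sign_weight_dual[of J] assms by simp
  then have "weight q J * (sign_weight K / sign_weight J *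
      (sign_weight (map Not (rev J)) / sign_weight (map Not (rev K)))) = weight q K"
    using sign_weight_nonzero by (simp add: field_simps)
  then show ?thesis using assms
    by (simp add: antip_coef antip_simps alpha_coef)
qed

lemma coact_tau:
  assumes "t \<in> tens (Suc n)"
  shows "coact (tau t) = rot (coact t)"
proof (rule tens_Suc_coefI[where sc = fscale and f = "\<lambda>t. coact (tau t)", OF _ _ assms])
  fix s :: "idx list \<Rightarrow>\<^sub>0 'k" and I J :: "bool list"
  assume s: "s \<in> tens n" and len: "length I = length J"
  have "coact (tau (s * emb (coef I J))) = (\<Sum>K\<in>bool_lists (length I).
      emb (fscale (weight q J) (antip (antip (coef K J)))) * Lm (antip (coef I K)) (coact s))"
    by (simp add: tau_snoc_coef[OF len] coact_simps coact_Lm_coact[OF s]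
        sweedler_sum_antip[OF bilinear_coact_Lm len] fscale.scale_sum_right emb_simps mult_fscale_left)
  also have "\<dots> = (\<Sum>K\<in>bool_lists (length I). emb (alpha (coef K J)) * Lm (antip (coef I K)) (coact s))"
    using len by (intro sum.cong refl) (simp only: weight_antip_antip length_bool_lists)
  also have "\<dots> = rot (coact (s * emb (coef I J)))"
    by (simp add: coact_snoc_coef[OF len] rot_simps rot_snoc)
  finally show "coact (tau (s * emb (coef I J))) = rot (coact (s * emb (coef I J)))" .
qed (intro lin)+

lemma alpha_mulA: "alpha (a \<star> b) = alpha a \<star> alpha b"
proof -
  have "alpha (coef I J \<star> b) = alpha (coef I J) \<star> alpha b" if len: "length I = length J" for I J
  proof (rule linear_map_eq_coefI[where sc = fscale and f = "\<lambda>b. alpha (coef I J \<star> b)"])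
    fix I' J' :: "bool list" assume "length I' = length J'"
    then show "alpha (coef I J \<star> coef I' J') = alpha (coef I J) \<star> alpha (coef I' J')"
      using len by (simp add: alpha_coef mulA_left_simps mulA_right_simps weight_append flip: coef_append)
  qed (intro lin)+
  then show ?thesis
    by (rule linear_map_eq_coefI[where sc = fscale and f = "\<lambda>a. alpha (a \<star> b)", rotated 2])
      (assumption | intro lin)+
qed

definition idx_weight :: "idx \<Rightarrow> 'k"
  where "idx_weight b = q powi (fst b + int (fst (snd b)) - int (snd (snd b)))"

lemma alpha_vec: "alpha (vec b) = fscale (idx_weight b) (vec b)"
  by (cases b) (simp add: idx_weight_def)

definition alpha_tens :: "(idx list \<Rightarrow>\<^sub>0 'k) \<Rightarrow> (idx list \<Rightarrow>\<^sub>0 'k)"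
  where "alpha_tens = lin_ext fscale (\<lambda>bs. Poly_Mapping.single bs (prod_list (map idx_weight bs)))"

lemma linear_alpha_tens [lin]: "linear_map fscale f \<Longrightarrow> linear_map fscale (\<lambda>x. alpha_tens (f x))"
  unfolding alpha_tens_def by (intro linear_map_comp[OF linear_map_lin_ext] lin)

lemmas alpha_tens_simps = linear_map_simps[OF linear_alpha_tens[OF linear_map_id]]

lemma alpha_tens_mult: "alpha_tens (s * t) = alpha_tens s * alpha_tens t"
  by (rule bilinear_map_eqI[where \<Phi> = "\<lambda>s t. alpha_tens (s * t)" and \<Psi> = "\<lambda>s t. alpha_tens s * alpha_tens t"])
    (intro bilinear_mapI lin | simp add: alpha_tens_def vec_mult mult_single plus_list_def)+

lemma alpha_tens_emb: "alpha_tens (emb h) = emb (alpha h)"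
  by (rule linear_map_eqI[where sc = fscale and f = "\<lambda>h. alpha_tens (emb h)"])
    (intro lin | simp add: alpha_tens_def alpha_vec)+

lemma alpha_tens_1 [simp]: "alpha_tens 1 = 1"
  by (simp add: alpha_tens_def flip: vec_Nil)

lemma alpha_tens_Lm: "alpha_tens (Lm a t) = Lm (alpha a) (alpha_tens t)"
  by (rule Cons_eqI[where sc = fscale and f = "\<lambda>t. alpha_tens (Lm a t)"])
    (intro lin | simp add: alpha_tens_simps Lm_Cons alpha_tens_mult alpha_tens_emb alpha_mulA)+

text \<open>In each summand c_KJ has the weight of K, and the antipode of c_IK has its inverse; so
  the image of the coaction is fixed by the diagonal twist.\<close>

lemma alpha_tens_coact:
  assumes "t \<in> tens n"
  shows "alpha_tens (coact t) = coact t"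
  using assms
proof (induction n arbitrary: t)
  case 0
  have e: "alpha_tens (emb \<e>) = emb \<e>" unfolding alpha_tens_emb by simp
  show ?case
    by (rule tens_0_eqI[where sc = fscale and f = "\<lambda>t. alpha_tens (coact t)" and g = coact, OF _ _ 0, rotated 2])
      (intro lin | simp add: e del: emb_single)+
next
  case (Suc n)
  show ?case
  proof (rule tens_Suc_coefI[where sc = fscale and f = "\<lambda>t. alpha_tens (coact t)", OF _ _ Suc.prems])
    fix s :: "idx list \<Rightarrow>\<^sub>0 'k" and I J :: "bool list"
    assume s: "s \<in> tens n" and len: "length I = length J"
    have "alpha_tens (Lm (antip (coef I K)) (coact s) * emb (coef K J)) =
        Lm (antip (coef I K)) (coact s) * emb (coef K J)" if "K \<in> bool_lists (length I)" for K
    proof -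
      have l: "length I = length K" "length K = length J" using that len by (simp_all add: bool_lists_def)
      have "alpha (antip (coef I K)) = fscale (inverse (weight q K)) (antip (coef I K))"
        using l by (simp add: antip_coef alpha_simps alpha_coef weight_dual mult.commute)
      then show ?thesis
        using l weight_nonzero[OF q0]
        by (simp add: alpha_tens_mult alpha_tens_Lm alpha_tens_emb Suc.IH[OF s] alpha_coef
            Lm_left_simps emb_simps mult_fscale_left mult_fscale_right)
    qed
    then show "alpha_tens (coact (s * emb (coef I J))) = coact (s * emb (coef I J))"
      by (simp add: coact_snoc_coef[OF len] alpha_tens_simps)
  qed (intro lin)+
qed

lemma rot_funpow:
  "(rot ^^ length ys) (vec (xs @ ys)) = Poly_Mapping.single (ys @ xs) (prod_list (map idx_weight ys))"
proof (induction ys arbitrary: xs rule: rev_induct)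
  case (snoc y ys)
  have lin: "(rot ^^ n) (fscale c t) = fscale c ((rot ^^ n) t)" for n c t
    by (induction n) (auto simp: rot_simps)
  have "rot (vec (xs @ ys @ [y])) = rot (vec (xs @ ys) * emb (vec y))"
    by (simp add: vec_mult)
  also have "\<dots> = fscale (idx_weight y) (vec ((y # xs) @ ys))"
    unfolding rot_snoc alpha_vec by (simp add: mult_single plus_list_def)
  finally have "rot (vec (xs @ ys @ [y])) = fscale (idx_weight y) (vec ((y # xs) @ ys))" .
  moreover have "(rot ^^ length (ys @ [y])) (vec (xs @ ys @ [y])) = (rot ^^ length ys) (rot (vec (xs @ ys @ [y])))"
    by (simp add: funpow_swap1)
  ultimately show ?case by (simp only: lin snoc.IH) (simp add: mult.commute)
qed simp

lemma linear_funpow_rot: "linear_map fscale f \<Longrightarrow> linear_map fscale (\<lambda>x. (rot ^^ n) (f x))"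
  by (induction n) (auto intro: lin)

text \<open>A full turn twists every factor exactly once; on the image of the coaction this is the
  identity, whence cyclicity.\<close>

lemma rot_cyclic: "t \<in> tens n \<Longrightarrow> (rot ^^ n) t = alpha_tens t"
  by (rule tens_eqI[where sc = fscale and f = "rot ^^ n"])
    (use rot_funpow[of _ "[]"] in \<open>auto simp: alpha_tens_def intro: lin linear_funpow_rot[OF linear_map_id]\<close>)

lemma tau_1 [simp]: "tau 1 = 1"
  using last_delta_snoc[of 1 \<e>] by (simp add: tau_def)

lemma tau_cyclic:
  assumes "t \<in> tens n"
  shows "(tau ^^ Suc n) t = t"
proof (cases n)
  case 0
  have "tau t = t"
    by (rule tens_0_eqI[where sc = fscale and f = tau]) (intro lin | use assms 0 in simp)+
  then show ?thesis using 0 by simp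
next
  case (Suc m)
  have tens: "(tau ^^ j) t \<in> tens n" for j
    using assms by (induction j) (auto intro: tens_tau)
  have "coact ((tau ^^ j) t) = (rot ^^ j) (coact t)" for j
    by (induction j) (use coact_tau[OF tens[unfolded Suc]] in auto)
  then have "coact ((tau ^^ Suc n) t) = coact t"
    using rot_cyclic[OF tens_coact[OF assms]] alpha_tens_coact[OF assms] by metis
  then show ?thesis using fc_0_coact[OF tens] fc_0_coact[OF assms] by metis
qed

end

section \<open>Hochschild homology\<close>

lemma linear_lookup [lin]: "linear_map fscale f \<Longrightarrow> linear_map (*) (\<lambda>x. Poly_Mapping.lookup (f x) b)"
  by (simp add: linear_map_def lookup_add)

lemma poly_mapping_in_span:
  assumes "0 \<in> W" "\<And>s t. s \<in> W \<Longrightarrow> t \<in> W \<Longrightarrow> s + t \<in> W" "\<And>c s. s \<in> W \<Longrightarrow> fscale c s \<in> W"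
    and "\<And>b. b \<in> Poly_Mapping.keys t \<Longrightarrow> vec b \<in> W"
  shows "t \<in> W"
proof -
  have "(\<Sum>b\<in>A. fscale (Poly_Mapping.lookup t b) (vec b)) \<in> W" if "A \<subseteq> Poly_Mapping.keys t" for A
    using finite_subset[OF that finite_keys] that
    by (induction A rule: finite_induct) (auto intro!: assms simp del: fscale_single)
  from this[OF order_refl] show ?thesis
    using poly_mapping_expand[OF finite_keys order_refl, of t] by simp
qed

context SLq_model
begin

definition bp :: "nat \<Rightarrow> (idx list \<Rightarrow>\<^sub>0 'k) \<Rightarrow> (idx list \<Rightarrow>\<^sub>0 'k)"
  where "bp n t = (\<Sum>i<n. fscale ((- 1) ^ i) (fc i t))"

definition bd :: "nat \<Rightarrow> (idx list \<Rightarrow>\<^sub>0 'k) \<Rightarrow> (idx list \<Rightarrow>\<^sub>0 'k)"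
  where "bd n t = bp n t + fscale ((- 1) ^ n) (last_delta t)"

lemma linear_bp [lin]: "linear_map fscale f \<Longrightarrow> linear_map fscale (\<lambda>x. bp n (f x))"
  unfolding bp_def by (intro lin)

lemma linear_bd [lin]: "linear_map fscale f \<Longrightarrow> linear_map fscale (\<lambda>x. bd n (f x))"
  unfolding bd_def by (intro lin)

lemmas bp_simps = linear_map_simps[OF linear_bp[OF linear_map_id]]
lemmas bd_simps = linear_map_simps[OF linear_bd[OF linear_map_id]]

lemma bp_0 [simp]: "bp 0 t = 0"
  by (simp add: bp_def)

lemma tens_bp: "t \<in> tens (Suc n) \<Longrightarrow> bp (Suc n) t \<in> tens n"
  unfolding bp_def by (intro tens_closed tens_fc)

lemma bp_snoc:
  assumes "s \<in> tens n"
  shows "bp (Suc n) (s * emb h) = bp n s * emb h + fscale ((- 1) ^ n) (Rm h s)"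
  unfolding bp_def by (simp add: fc_snoc[OF assms] sum_distrib_right mult_fscale_left)

lemma Rm_one [simp]: "Rm \<e> t = t"
  by (rule snoc_eqI[where sc = fscale and f = "Rm \<e>"]) (intro lin | simp add: Rm_snoc)+

text \<open>The last face of b' multiplies into the last factor, so b' is linear for right
  multiplication there. With values in degree 0 this relies on \<open>Rm\<close> being the
  counit.\<close>

lemma bp_Rm:
  assumes "t \<in> tens n"
  shows "bp n (Rm h t) = Rm h (bp n t)"
proof (cases n)
  case (Suc m)
  show ?thesis
  proof (rule tens_Suc_eqI[where sc = fscale and f = "\<lambda>t. bp n (Rm h t)"])
    fix s :: "idx list \<Rightarrow>\<^sub>0 'k" and g assume "s \<in> tens m"
    then show "bp n (Rm h (s * emb g)) = Rm h (bp n (s * emb g))"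
      by (simp add: Suc Rm_snoc bp_snoc Rm_simps Rm_Rm)
  qed (use assms Suc in \<open>(intro lin | simp)+\<close>)
qed (simp add: Rm_simps)

lemma bp_bp:
  assumes "t \<in> tens (Suc n)"
  shows "bp n (bp (Suc n) t) = 0"
  using assms
proof (induction n arbitrary: t)
  case (Suc n)
  show ?case
  proof (rule tens_Suc_eqI[where sc = fscale and f = "\<lambda>t. bp (Suc n) (bp (Suc (Suc n)) t)" and g = "\<lambda>_. 0",
        OF _ _ Suc.prems])
    fix s :: "idx list \<Rightarrow>\<^sub>0 'k" and h assume s: "s \<in> tens (Suc n)"
    show "bp (Suc n) (bp (Suc (Suc n)) (s * emb h)) = 0"
      by (simp add: bp_snoc[OF s] bp_snoc[OF tens_bp[OF s]] bp_simps bp_Rm[OF s] Suc.IH[OF s])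
  qed (intro lin)+
qed simp

text \<open>Appending the unit contracts b', up to the sign of the last face.\<close>

lemma bp_exact:
  assumes "t \<in> tens n" "bp n t = 0"
  shows "\<exists>s\<in>tens (Suc n). bp (Suc n) s = t"
proof (intro bexI)
  show "bp (Suc n) (fscale ((- 1) ^ n) (t * emb \<e>)) = t"
    using assms by (simp add: bp_simps bp_snoc del: emb_single)
  show "fscale ((- 1) ^ n) (t * emb \<e>) \<in> tens (Suc n)"
    by (intro tens_closed tens_emb_snoc assms)
qed

lemma tens_0: "t \<in> tens 0 \<Longrightarrow> t = fscale (Poly_Mapping.lookup t []) 1"
  by (rule tens_0_eqI[where sc = fscale and f = "\<lambda>t. t"])
    (intro lin | assumption | simp add: lookup_one zero_list_def)+

lemma bp_1_emb: "bp (Suc 0) (emb h) = fscale (chi 1 h) 1"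
  using bp_snoc[OF tens_1, of h] by simp

subsection \<open>Right multiplication by the generators\<close>

abbreviation "gu \<equiv> (vec (0, Suc 0, 0) :: idx \<Rightarrow>\<^sub>0 'k)"
abbreviation "gv \<equiv> (vec (0, 0, Suc 0) :: idx \<Rightarrow>\<^sub>0 'k)"
abbreviation "gx \<equiv> (vec (1, 0, 0) :: idx \<Rightarrow>\<^sub>0 'k)"
abbreviation "gy \<equiv> (vec (- 1, 0, 0) :: idx \<Rightarrow>\<^sub>0 'k)"

lemma vec_mulA_gu: "vec (i, j, k) \<star> gu = vec (i, j + 1, k)"
  and vec_mulA_gv: "vec (i, j, k) \<star> gv = vec (i, j, k + 1)"
  using act_normal_word[of i j k "Suc 0" 0] act_normal_word[of i j k 0 "Suc 0"]
  by (simp_all add: mulA_def del: normal_word.simps act_vec)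

lemma foldr_GU: "foldr gen_op (replicate n GU) (vec (i, j, k)) = Poly_Mapping.single (i, j + n, k) (q powi (i * int n))"
  by (induction n) (auto simp: power_int_add algebra_simps)

lemma foldr_GV: "foldr gen_op (replicate n GV) (vec (i, j, k)) = Poly_Mapping.single (i, j, k + n) (q powi (i * int n))"
  by (induction n) (auto simp: power_int_add algebra_simps)

text \<open>Passing all of u^j v^k costs q^(j + k); then x meets a power of x, or a power of y in
  which one product y x becomes 1 + q u v.\<close>

lemma vec_mulA_gx: "vec (i, j, k) \<star> gx = fscale (q ^ (j + k)) (vec (i + 1, j, k) +
    (if i < 0 then Poly_Mapping.single (i + 1, j + 1, k + 1) q else 0))"
proof -
  have uv: "foldr gen_op (replicate j GU) (foldr gen_op (replicate k GV) gx) =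
      Poly_Mapping.single (1, j, k) (q ^ (j + k))"
    unfolding foldr_GV
    using foldr_GU[of j 1 0 k] linear_map_scale[OF linear_foldr_gen_op, of "replicate j GU" "q ^ k" "vec (1, 0, k)"]
    by (simp add: power_add mult.commute del: foldr_replicate)
  show ?thesis
  proof (cases "i \<ge> 0")
    case True
    have "vec (i, j, k) \<star> gx = foldr gen_op (replicate (nat i) GX) (fscale (q ^ (j + k)) (vec (1, j, k)))"
      using True uv by (simp add: mulA_def del: foldr_replicate)
    also have "\<dots> = fscale (q ^ (j + k)) (vec (1 + i, j, k))"
      using True foldr_gen_op_GX[of 1 "nat i" j k]
      by (simp only: linear_map_scale[OF linear_foldr_gen_op]) simp
    finally show ?thesis using True by (simp add: add.commute)
  next
    case False
    define m where "m = nat (- i - 1)"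
    have m: "nat (- i) = Suc m" "i = - int m - 1" using False by (auto simp: m_def)
    have l: "foldr gen_op (replicate m GY) (s + t) = foldr gen_op (replicate m GY) s + foldr gen_op (replicate m GY) t"
      "foldr gen_op (replicate m GY) (fscale c s) = fscale c (foldr gen_op (replicate m GY) s)" for s t c
      by (rule linear_map_add[OF linear_foldr_gen_op] linear_map_scale[OF linear_foldr_gen_op])+
    have "vec (i, j, k) \<star> gx = foldr gen_op (replicate m GY) (gen_op GY (fscale (q ^ (j + k)) (vec (1, j, k))))"
      using False uv by (simp add: mulA_def m(1) replicate_append_same[symmetric] del: foldr_replicate replicate_Suc)
        (simp add: replicate_append_same[symmetric] del: foldr_replicate)
    also have "\<dots> = foldr gen_op (replicate m GY)
        (fscale (q ^ (j + k)) (vec (0, j, k) + fscale q (vec (0, j + 1, k + 1))))"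
      by (simp add: gen_op_simps)
    also have "\<dots> = fscale (q ^ (j + k)) (vec (- int m, j, k) + fscale q (vec (- int m, j + 1, k + 1)))"
      using foldr_gen_op_GY[of 0 m] by (simp only: l) simp
    finally show ?thesis using False m by simp
  qed
qed

section \<open>Divisibility of the last factor, read off from coefficients\<close>

lemma lookup_Rm_gu: "Poly_Mapping.lookup (Rm gu t) (bs @ [(i, j, k)]) =
    (if j = 0 then 0 else Poly_Mapping.lookup t (bs @ [(i, j - 1, k)]))"
proof (rule linear_map_eqI[where sc = "(*)" and f = "\<lambda>t. Poly_Mapping.lookup (Rm gu t) (bs @ [(i, j, k)])"])
  fix cs :: "idx list"
  show "Poly_Mapping.lookup (Rm gu (vec cs)) (bs @ [(i, j, k)]) =
    (if j = 0 then 0 else Poly_Mapping.lookup (vec cs) (bs @ [(i, j - 1, k)]))"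
  proof (cases cs rule: rev_cases)
    case (snoc ds d)
    then have "Rm gu (vec cs) = vec (ds @ [(fst d, fst (snd d) + 1, snd (snd d))])"
      using Rm_snoc[of gu "vec ds" "vec d"] vec_mulA_gu[of "fst d" "fst (snd d)" "snd (snd d)"]
      by (simp add: vec_mult)
    then show ?thesis using snoc by (auto simp: lookup_single when_def)
  qed (simp add: vec_Nil, simp add: lookup_single flip: vec_Nil)
qed (intro lin)+

lemma lookup_Rm_gv: "Poly_Mapping.lookup (Rm gv t) (bs @ [(i, j, k)]) =
    (if k = 0 then 0 else Poly_Mapping.lookup t (bs @ [(i, j, k - 1)]))"
proof (rule linear_map_eqI[where sc = "(*)" and f = "\<lambda>t. Poly_Mapping.lookup (Rm gv t) (bs @ [(i, j, k)])"])
  fix cs :: "idx list"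
  show "Poly_Mapping.lookup (Rm gv (vec cs)) (bs @ [(i, j, k)]) =
    (if k = 0 then 0 else Poly_Mapping.lookup (vec cs) (bs @ [(i, j, k - 1)]))"
  proof (cases cs rule: rev_cases)
    case (snoc ds d)
    then have "Rm gv (vec cs) = vec (ds @ [(fst d, fst (snd d), snd (snd d) + 1)])"
      using Rm_snoc[of gv "vec ds" "vec d"] vec_mulA_gv[of "fst d" "fst (snd d)" "snd (snd d)"]
      by (simp add: vec_mult)
    then show ?thesis using snoc by (auto simp: lookup_single when_def)
  qed (simp add: vec_Nil, simp add: lookup_single flip: vec_Nil)
qed (intro lin)+

lemma lookup_Rm_gx:
  assumes t: "t \<in> tens (Suc n)"
  shows "Poly_Mapping.lookup (Rm gx t) (bs @ [(i, 0, 0)]) = Poly_Mapping.lookup t (bs @ [(i - 1, 0, 0)])"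
proof (rule tens_eqI[where sc = "(*)" and f = "\<lambda>t. Poly_Mapping.lookup (Rm gx t) (bs @ [(i, 0, 0)])", OF _ _ t])
  fix cs :: "idx list" assume "length cs = Suc n"
  then obtain ds i' j k where cs: "cs = ds @ [(i', j, k)]" by (cases cs rule: rev_cases) auto
  have "Rm gx (vec cs) = vec ds * emb (vec (i', j, k) \<star> gx)"
    using Rm_snoc[of gx "vec ds" "vec (i', j, k)"] by (simp add: cs vec_mult)
  also have "\<dots> = fscale (q ^ (j + k)) (vec (ds @ [(i' + 1, j, k)]) +
      (if i' < 0 then fscale q (vec (ds @ [(i' + 1, j + 1, k + 1)])) else 0))"
    unfolding vec_mulA_gx
    by (simp add: emb_simps distrib_left vec_mult mult_fscale_right fscale.scale_right_distrib
        mult_single plus_list_def)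
  finally show "Poly_Mapping.lookup (Rm gx (vec cs)) (bs @ [(i, 0, 0)]) =
      Poly_Mapping.lookup (vec cs) (bs @ [(i - 1, 0, 0)])"
    by (auto simp: cs lookup_single when_def lookup_add)
qed (intro lin)+

text \<open>In positive degree this says that u divides the last factor of every basis tensor that
  occurs, which by PBW is membership in the image of right multiplication by u. Likewise
  \<open>no_uv\<close> describes the sum of the images of u and v.\<close>

definition no_u :: "(idx list \<Rightarrow>\<^sub>0 'k) \<Rightarrow> bool"
  where "no_u t \<longleftrightarrow> (\<forall>bs i k. Poly_Mapping.lookup t (bs @ [(i, 0, k)]) = 0)"

definition no_uv :: "(idx list \<Rightarrow>\<^sub>0 'k) \<Rightarrow> bool"
  where "no_uv t \<longleftrightarrow> (\<forall>bs i. Poly_Mapping.lookup t (bs @ [(i, 0, 0)]) = 0)"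

lemma no_uv_closed:
  "no_uv 0" "no_uv s \<Longrightarrow> no_uv t \<Longrightarrow> no_uv (s + t)" "no_uv s \<Longrightarrow> no_uv t \<Longrightarrow> no_uv (s - t)"
  "no_uv s \<Longrightarrow> no_uv (- s)" "no_uv s \<Longrightarrow> no_uv (fscale c s)"
  by (auto simp: no_uv_def lookup_add lookup_minus)

lemma no_u_Rm_gu: "no_u (Rm gu t)"
  by (simp add: no_u_def lookup_Rm_gu)

lemma no_uv_Rm: "no_uv (Rm gu t)" "no_uv (Rm gv t)"
  by (simp_all add: no_uv_def lookup_Rm_gu lookup_Rm_gv)

text \<open>Right multiplication by v is injective modulo multiples of u: the regularity needed at
  the second stage, as \<open>Rm_gu_inj\<close> is at the first.\<close>

lemma no_u_Rm_gv: "no_u (Rm gv t) \<Longrightarrow> no_u t"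
  unfolding no_u_def using lookup_Rm_gv[of t _ _ 0 "Suc _"] by simp

lemma lookup_tens: "t \<in> tens n \<Longrightarrow> length bs \<noteq> n \<Longrightarrow> Poly_Mapping.lookup t bs = 0"
  by (auto simp: tens_def in_keys_iff)

lemma Rm_gu_inj:
  assumes "t \<in> tens (Suc n)" "Rm gu t = 0"
  shows "t = 0"
proof (rule poly_mapping_eqI)
  fix cs :: "idx list"
  show "Poly_Mapping.lookup t cs = Poly_Mapping.lookup 0 cs"
  proof (cases cs rule: rev_cases)
    case Nil
    then show ?thesis using lookup_tens[OF assms(1), of "[]"] by simp
  next
    case (snoc bs b)
    then show ?thesis
      using lookup_Rm_gu[of t bs "fst b" "Suc (fst (snd b))" "snd (snd b)"] assms(2) by simp
  qed
qed

lemma no_u_tens: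
  assumes "t \<in> tens (Suc n)" "no_u t"
  obtains s where "s \<in> tens (Suc n)" "t = Rm gu s"
proof -
  have "t \<in> {t. \<exists>s\<in>tens (Suc n). t = Rm gu s}"
  proof (rule poly_mapping_in_span)
    show "0 \<in> {t. \<exists>s\<in>tens (Suc n). t = Rm gu s}"
      using Rm_simps(3)[of gu] tens_closed(1)[of "Suc n"] by (auto intro!: bexI[of _ 0])
    show "s + t \<in> {t. \<exists>s\<in>tens (Suc n). t = Rm gu s}"
      if "s \<in> {t. \<exists>s\<in>tens (Suc n). t = Rm gu s}" "t \<in> {t. \<exists>s\<in>tens (Suc n). t = Rm gu s}" for s t
      using that tens_closed(2) by (fastforce simp flip: Rm_simps(1))
    show "fscale c s \<in> {t. \<exists>s\<in>tens (Suc n). t = Rm gu s}"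
      if "s \<in> {t. \<exists>s\<in>tens (Suc n). t = Rm gu s}" for c s
      using that tens_closed(5) by (fastforce simp flip: Rm_simps(2))
    fix cs assume cs: "cs \<in> Poly_Mapping.keys t"
    then have "length cs = Suc n" using assms(1) by (auto simp: tens_def)
    then obtain ds i j k where d: "cs = ds @ [(i, j, k)]" by (cases cs rule: rev_cases) auto
    then have "j \<noteq> 0" using cs assms(2) by (cases "j = 0") (auto simp: no_u_def in_keys_iff)
    then have "vec cs = Rm gu (vec ds * emb (vec (i, j - 1, k)))"
      using d vec_mulA_gu[of i "j - 1" k] by (simp add: Rm_snoc vec_mult del: emb_single) (simp add: vec_mult)
    moreover have "vec ds * emb (vec (i, j - 1, k)) \<in> tens (Suc n)"
      using d \<open>length cs = Suc n\<close> by (intro tens_emb_snoc tens_vec) simp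
    ultimately show "vec cs \<in> {t. \<exists>s\<in>tens (Suc n). t = Rm gu s}" by blast
  qed
  then show thesis using that by blast
qed

lemma no_uv_tens:
  assumes "t \<in> tens (Suc n)" "no_uv t"
  obtains s s' where "s \<in> tens (Suc n)" "s' \<in> tens (Suc n)" "t = Rm gu s + Rm gv s'"
proof -
  let ?W = "{t. \<exists>s\<in>tens (Suc n). \<exists>s'\<in>tens (Suc n). t = Rm gu s + Rm gv s'}"
  have I: "Rm gu s + Rm gv s' \<in> ?W" if "s \<in> tens (Suc n)" "s' \<in> tens (Suc n)" for s s'
    using that by blast
  have "t \<in> ?W"
  proof (rule poly_mapping_in_span)
    show "0 \<in> ?W" using I[OF tens_closed(1) tens_closed(1)] by (simp add: Rm_simps)
    show "s + t \<in> ?W" if "s \<in> ?W" "t \<in> ?W" for s t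
    proof -
      from that obtain a b c d where "a \<in> tens (Suc n)" "b \<in> tens (Suc n)" "c \<in> tens (Suc n)" "d \<in> tens (Suc n)"
        "s = Rm gu a + Rm gv b" "t = Rm gu c + Rm gv d" by blast
      then show ?thesis using I[of "a + c" "b + d"] by (simp add: tens_closed Rm_simps algebra_simps)
    qed
    show "fscale c s \<in> ?W" if "s \<in> ?W" for c s
    proof -
      from that obtain a b where "a \<in> tens (Suc n)" "b \<in> tens (Suc n)" "s = Rm gu a + Rm gv b" by blast
      then show ?thesis using I[of "fscale c a" "fscale c b"]
        by (simp add: tens_closed Rm_simps fscale.scale_right_distrib)
    qed
    fix cs assume cs: "cs \<in> Poly_Mapping.keys t"
    then have len: "length cs = Suc n" using assms(1) by (auto simp: tens_def)
    then obtain ds i j k where d: "cs = ds @ [(i, j, k)]" by (cases cs rule: rev_cases) auto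
    then have jk: "j \<noteq> 0 \<or> k \<noteq> 0" using cs assms(2)
      by (cases "j = 0"; cases "k = 0") (auto simp: no_uv_def in_keys_iff)
    have mem: "vec ds * emb h \<in> tens (Suc n)" for h
      using d len by (intro tens_emb_snoc tens_vec) simp
    show "vec cs \<in> ?W"
    proof (cases "j = 0")
      case False
      then have "vec cs = Rm gu (vec ds * emb (vec (i, j - 1, k)))"
        using d vec_mulA_gu[of i "j - 1" k] by (simp add: Rm_snoc vec_mult del: emb_single) (simp add: vec_mult)
      then show ?thesis using I[OF mem tens_closed(1)] by (simp add: Rm_simps del: emb_single)
    next
      case True
      then have "vec cs = Rm gv (vec ds * emb (vec (i, j, k - 1)))"
        using d jk vec_mulA_gv[of i j "k - 1"] by (simp add: Rm_snoc vec_mult del: emb_single) (simp add: vec_mult)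
      then show ?thesis using I[OF tens_closed(1) mem] by (simp add: Rm_simps del: emb_single)
    qed
  qed
  then show thesis using that by blast
qed

definition dx :: "(idx list \<Rightarrow>\<^sub>0 'k) \<Rightarrow> (idx list \<Rightarrow>\<^sub>0 'k)"
  where "dx t = Rm gx t - fscale q t"

lemma linear_dx [lin]: "linear_map fscale f \<Longrightarrow> linear_map fscale (\<lambda>x. dx (f x))"
  unfolding dx_def by (intro lin)

lemmas dx_simps = linear_map_simps[OF linear_dx[OF linear_map_id]]

lemma tens_dx: "t \<in> tens n \<Longrightarrow> dx t \<in> tens n"
  unfolding dx_def by (intro tens_closed tens_Rm)

lemma bp_dx: "t \<in> tens n \<Longrightarrow> bp n (dx t) = dx (bp n t)"
  by (simp add: dx_def bp_simps bp_Rm)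

text \<open>Modulo u and v only Laurent polynomials in x remain, where x - q is regular: the
  coefficients of an element it kills form an endless geometric progression, which finite support
  excludes.\<close>

lemma no_uv_dx:
  assumes "t \<in> tens (Suc n)"
  shows "no_uv (dx t) \<longleftrightarrow> no_uv t"
proof
  assume "no_uv t"
  then show "no_uv (dx t)"
    by (simp add: no_uv_def dx_def lookup_minus lookup_Rm_gx[OF assms])
next
  assume *: "no_uv (dx t)"
  show "no_uv t" unfolding no_uv_def
  proof (intro allI)
    fix bs :: "idx list" and i :: int
    let ?g = "\<lambda>i. Poly_Mapping.lookup t (bs @ [(i, 0, 0)])"
    have step: "?g i = q * ?g (i + 1)" for i
      using * lookup_Rm_gx[OF assms, of bs "i + 1"] by (simp add: no_uv_def dx_def lookup_minus)
    show "?g i = 0"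
    proof (rule ccontr)
      assume nz: "?g i \<noteq> 0"
      have "?g (i + int m) \<noteq> 0" for m
        by (induction m) (use nz step[of "i + int _"] in \<open>auto simp: algebra_simps\<close>)
      then have "range (\<lambda>m. bs @ [(i + int m, 0, 0)]) \<subseteq> Poly_Mapping.keys t"
        by (auto simp: in_keys_iff)
      then have "finite (range (\<lambda>m. bs @ [(i + int m, 0 :: nat, 0 :: nat)]))"
        using finite_keys finite_subset by blast
      moreover have "inj (\<lambda>m. bs @ [(i + int m, 0 :: nat, 0 :: nat)])"
        by (rule injI) simp
      ultimately show False using finite_imageD infinite_UNIV_nat by blast
    qed
  qed
qed

end

subsection \<open>Cycles modulo left ideals\<close>

text \<open>
  Relative to the left ideals generated by \<open>u\<close>, by \<open>u, v\<close> and by \<open>u, v, x - q\<close> (the kernel of \<open>\<delta>\<close>),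
  the cycles of \<^term>\<open>SLq_model.bp\<close> are computed one generator at a time: multiplication by the new generator is
  injective modulo the previous ideal, which gives the connecting map of a long exact sequence.
\<close>

context SLq_model
begin

lemma mulA_gens:
  "gu \<star> gy = fscale (inverse q) (gy \<star> gu)"
  "gv \<star> gy = fscale (inverse q) (gy \<star> gv)"
  "gv \<star> gx = fscale q (gx \<star> gv)"
  "gu \<star> gx = fscale q (gx \<star> gu)"
  "gv \<star> gu = gu \<star> gv"
  "gy \<star> gx = \<e> + fscale q (gu \<star> gv)"
  by (simp_all add: mulA_def)

lemma Rm_commute:
  "Rm gv (Rm gu t) = Rm gu (Rm gv t)"
  "Rm gx (Rm gu t) = fscale q (Rm gu (Rm gx t))"
  "Rm gx (Rm gv t) = fscale q (Rm gv (Rm gx t))"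
  by (simp_all only: Rm_Rm mulA_gens Rm_left_simps)

text \<open>The lowest homology of the resolution is k, detected by the counit, and any h of counit
  1 represents a generator.\<close>

lemma eps_cycle:
  assumes "y \<in> tens (Suc 0)" "chi 1 h = 1"
  obtains c y' where "y' \<in> tens (Suc (Suc 0))" "y = bp (Suc (Suc 0)) y' + fscale c (emb h)"
    "bp (Suc 0) y = fscale c 1"
proof -
  define c where "c = Poly_Mapping.lookup (bp (Suc 0) y) []"
  have c: "bp (Suc 0) y = fscale c 1" unfolding c_def by (rule tens_0[OF tens_bp[OF assms(1)]])
  have "y - fscale c (emb h) \<in> tens (Suc 0)" by (intro tens_closed assms tens_emb)
  moreover have "bp (Suc 0) (y - fscale c (emb h)) = 0"
    by (simp add: bp_simps c bp_1_emb assms(2))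
  ultimately obtain y' where "y' \<in> tens (Suc (Suc 0))" "bp (Suc (Suc 0)) y' = y - fscale c (emb h)"
    using bp_exact by blast
  then show thesis using c that[of y' c] by simp
qed

text \<open>From b' z = y u follows (b' y) u = 0, so y is a cycle because u is regular. Writing y =
  b' s makes z - s u a cycle, hence a boundary.\<close>

lemma cycle_u:
  assumes z: "z \<in> tens (Suc (Suc (Suc n)))" and y: "y \<in> tens (Suc (Suc n))"
    and "bp (Suc (Suc (Suc n))) z = Rm gu y"
  obtains p s where "p \<in> tens (Suc (Suc (Suc (Suc n))))" "s \<in> tens (Suc (Suc (Suc n)))"
    "z = bp (Suc (Suc (Suc (Suc n)))) p + Rm gu s"
proof -
  have "Rm gu (bp (Suc (Suc n)) y) = 0"
    using bp_bp[OF z] bp_Rm[OF y] assms(3) by metis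
  then have "bp (Suc (Suc n)) y = 0"
    by (rule Rm_gu_inj[OF tens_bp[OF y]])
  then obtain s where s: "s \<in> tens (Suc (Suc (Suc n)))" "bp (Suc (Suc (Suc n))) s = y"
    using bp_exact[OF y] by blast
  have "bp (Suc (Suc (Suc n))) (z - Rm gu s) = 0"
    using s assms(3) by (simp add: bp_simps bp_Rm)
  moreover have "z - Rm gu s \<in> tens (Suc (Suc (Suc n)))" by (intro tens_closed tens_Rm z s)
  ultimately obtain p where "p \<in> tens (Suc (Suc (Suc (Suc n))))"
    "bp (Suc (Suc (Suc (Suc n)))) p = z - Rm gu s" using bp_exact by blast
  then show thesis using s that[of p s] by simp
qed

text \<open>Cycles modulo the left ideals of u and of v: their boundaries are y u and v. The second
  factor y in \<open>cu\<close> is chosen so that multiplication by x - q leads directly to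
  \<open>Bu\<close> modulo u and v.\<close>

definition cu :: "idx list \<Rightarrow>\<^sub>0 'k" where "cu = fscale (- q) (emb gu * emb gy)"
definition cv :: "idx list \<Rightarrow>\<^sub>0 'k" where "cv = - (emb gv * emb \<e>)"

lemma tens_cu: "cu \<in> tens (Suc (Suc 0))" and tens_cv: "cv \<in> tens (Suc (Suc 0))"
  unfolding cu_def cv_def by (intro tens_closed tens_emb_snoc tens_emb)+

lemma bp_2_emb: "bp (Suc (Suc 0)) (emb g * emb h) = fscale (chi 1 g) (emb h) - emb (g \<star> h)"
  using bp_snoc[OF tens_emb, of g h] by (simp add: bp_1_emb mult_fscale_left)

lemma bp_cu: "bp (Suc (Suc 0)) cu = Rm gu (emb gy)"
  unfolding cu_def by (simp add: bp_simps bp_2_emb mulA_gens emb_simps del: emb_single)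

lemma bp_cv: "bp (Suc (Suc 0)) cv = Rm gv (emb \<e>)"
  unfolding cv_def by (simp add: bp_simps bp_2_emb emb_simps del: emb_single)

lemma chi_gens [simp]: "chi 1 gu = 0" "chi 1 gv = 0" "chi s \<e> = 1" "chi 1 gx = 1" "chi 1 gy = 1"
  by simp_all

lemma cycle_u_1:
  assumes z: "z \<in> tens (Suc (Suc 0))" and y: "y \<in> tens (Suc 0)" and bz: "bp (Suc (Suc 0)) z = Rm gu y"
  obtains p s c where "p \<in> tens (Suc (Suc (Suc 0)))" "s \<in> tens (Suc (Suc 0))"
    "z = bp (Suc (Suc (Suc 0))) p + Rm gu s + fscale c cu" "bp (Suc 0) y = fscale c 1"
proof -
  obtain c s where s: "s \<in> tens (Suc (Suc 0))" "y = bp (Suc (Suc 0)) s + fscale c (emb gy)"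
    and c: "bp (Suc 0) y = fscale c 1"
    using eps_cycle[OF y, of gy] chi_gens by metis
  have "bp (Suc (Suc 0)) (z - Rm gu s - fscale c cu) = 0"
    using s bz by (simp add: bp_simps bp_Rm bp_cu Rm_simps del: Rm_emb emb_single fscale_single)
  moreover have "z - Rm gu s - fscale c cu \<in> tens (Suc (Suc 0))"
    by (intro tens_closed tens_Rm z s tens_cu)
  ultimately obtain p where "p \<in> tens (Suc (Suc (Suc 0)))"
    "bp (Suc (Suc (Suc 0))) p = z - Rm gu s - fscale c cu" using bp_exact by blast
  then show thesis using that[of p s c] s c by (simp add: algebra_simps)
qed

text \<open>Applying b' to the hypothesis puts (b' y2) v among the multiples of u, and v is regular
  modulo u.\<close>

lemma Rm_gv_boundary:
  assumes "y \<in> tens (Suc (Suc n))" "y2 \<in> tens (Suc (Suc n))" "z \<in> tens (Suc (Suc (Suc n)))"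
    "bp (Suc (Suc (Suc n))) z = Rm gu y + Rm gv y2"
  obtains y3 where "y3 \<in> tens (Suc n)" "bp (Suc (Suc n)) y2 = Rm gu y3"
proof -
  have "Rm gu (bp (Suc (Suc n)) y) + Rm gv (bp (Suc (Suc n)) y2) = 0"
    using bp_bp[OF assms(3)] assms(4) by (simp add: bp_simps bp_Rm[OF assms(1)] bp_Rm[OF assms(2)])
  then have "Rm gv (bp (Suc (Suc n)) y2) = Rm gu (- bp (Suc (Suc n)) y)"
    by (simp add: Rm_simps eq_neg_iff_add_eq_0 add.commute)
  then have "no_u (bp (Suc (Suc n)) y2)" using no_u_Rm_gv no_u_Rm_gu by metis
  then show thesis using no_u_tens[OF tens_bp[OF assms(2)]] that by blast
qed

text \<open>The coefficient y2 of v is itself a cycle modulo u, so y2 = b' y4 + y5 u; subtracting y4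
  v from z leaves a boundary divisible by u alone.\<close>

lemma cycle_uv:
  assumes z: "z \<in> tens (Suc (Suc (Suc (Suc n))))"
    and bz: "no_uv (bp (Suc (Suc (Suc (Suc n)))) z)"
  obtains p l where "p \<in> tens (Suc (Suc (Suc (Suc (Suc n)))))" "l \<in> tens (Suc (Suc (Suc (Suc n))))"
    "no_uv l" "z = bp (Suc (Suc (Suc (Suc (Suc n))))) p + l"
proof -
  obtain y y2 where y: "y \<in> tens (Suc (Suc (Suc n)))" "y2 \<in> tens (Suc (Suc (Suc n)))"
    "bp (Suc (Suc (Suc (Suc n)))) z = Rm gu y + Rm gv y2"
    using no_uv_tens[OF tens_bp[OF z] bz] by metis
  obtain y3 where y3: "y3 \<in> tens (Suc (Suc n))" "bp (Suc (Suc (Suc n))) y2 = Rm gu y3"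
    using Rm_gv_boundary[OF y(1,2) z y(3)] by blast
  obtain y4 y5 where y4: "y4 \<in> tens (Suc (Suc (Suc (Suc n))))" "y5 \<in> tens (Suc (Suc (Suc n)))"
    "y2 = bp (Suc (Suc (Suc (Suc n)))) y4 + Rm gu y5"
    using cycle_u[OF y(2) y3] by blast
  have mem: "z - Rm gv y4 \<in> tens (Suc (Suc (Suc (Suc n))))" "y + Rm gv y5 \<in> tens (Suc (Suc (Suc n)))"
    by (intro tens_closed tens_Rm z y y4)+
  have "bp (Suc (Suc (Suc (Suc n)))) (z - Rm gv y4) = Rm gu (y + Rm gv y5)"
    using y4 y by (simp add: bp_simps bp_Rm Rm_simps Rm_commute)
  then obtain p s where p: "p \<in> tens (Suc (Suc (Suc (Suc (Suc n)))))" "s \<in> tens (Suc (Suc (Suc (Suc n))))"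
    "z - Rm gv y4 = bp (Suc (Suc (Suc (Suc (Suc n))))) p + Rm gu s"
    using cycle_u[OF mem] by blast
  show thesis
  proof (rule that[OF p(1)])
    show "z = bp (Suc (Suc (Suc (Suc (Suc n))))) p + (Rm gu s + Rm gv y4)"
      using p(3) by (simp add: algebra_simps)
    show "Rm gu s + Rm gv y4 \<in> tens (Suc (Suc (Suc (Suc n))))" by (intro tens_closed tens_Rm p y4)
  qed (intro no_uv_closed no_uv_Rm)
qed

text \<open>The class of degree 2 goes to \<open>cu\<close> under the connecting map for v. The
  boundary of cu v is y u v = (y v) u, and since y v has counit 0, it is - b' w for some w.\<close>

lemma ex_cuv:
  "\<exists>cuv\<in>tens (Suc (Suc (Suc 0))). \<exists>w\<in>tens (Suc (Suc 0)). bp (Suc (Suc (Suc 0))) cuv = Rm gv cu + Rm gu w"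
proof -
  have "- Rm gv (emb gy) \<in> tens (Suc 0)" by (intro tens_closed tens_Rm tens_emb)
  moreover have "bp (Suc 0) (- Rm gv (emb gy)) = 0"
    by (simp add: bp_simps bp_1_emb chi_mulA del: emb_single)
  ultimately obtain w where w: "w \<in> tens (Suc (Suc 0))" "bp (Suc (Suc 0)) w = - Rm gv (emb gy)"
    using bp_exact by blast
  have "Rm gv cu + Rm gu w \<in> tens (Suc (Suc 0))" by (intro tens_closed tens_Rm w tens_cu)
  moreover have "bp (Suc (Suc 0)) (Rm gv cu + Rm gu w) = 0"
    using w by (simp add: bp_simps bp_Rm tens_cu bp_cu Rm_simps Rm_commute del: Rm_emb)
  ultimately show ?thesis using bp_exact w by blast
qed

definition cuv :: "idx list \<Rightarrow>\<^sub>0 'k" where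
  "cuv = (SOME c. c \<in> tens (Suc (Suc (Suc 0))) \<and> (\<exists>w\<in>tens (Suc (Suc 0)). bp (Suc (Suc (Suc 0))) c = Rm gv cu + Rm gu w))"

lemma cuv:
  "cuv \<in> tens (Suc (Suc (Suc 0)))" "\<exists>w\<in>tens (Suc (Suc 0)). bp (Suc (Suc (Suc 0))) cuv = Rm gv cu + Rm gu w"
proof -
  have "\<exists>c. c \<in> tens (Suc (Suc (Suc 0))) \<and> (\<exists>w\<in>tens (Suc (Suc 0)). bp (Suc (Suc (Suc 0))) c = Rm gv cu + Rm gu w)"
    using ex_cuv by blast
  from someI_ex[OF this] show "cuv \<in> tens (Suc (Suc (Suc 0)))"
    "\<exists>w\<in>tens (Suc (Suc 0)). bp (Suc (Suc (Suc 0))) cuv = Rm gv cu + Rm gu w"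
    by (simp_all add: cuv_def)
qed

lemma cycle_uv_2:
  assumes z: "z \<in> tens (Suc (Suc (Suc 0)))" and bz: "no_uv (bp (Suc (Suc (Suc 0))) z)"
  obtains p l c where "p \<in> tens (Suc (Suc (Suc (Suc 0))))" "l \<in> tens (Suc (Suc (Suc 0)))"
    "no_uv l" "z = bp (Suc (Suc (Suc (Suc 0)))) p + l + fscale c cuv"
proof -
  obtain y y2 where y: "y \<in> tens (Suc (Suc 0))" "y2 \<in> tens (Suc (Suc 0))"
    "bp (Suc (Suc (Suc 0))) z = Rm gu y + Rm gv y2"
    using no_uv_tens[OF tens_bp[OF z] bz] by metis
  obtain y3 where y3: "y3 \<in> tens (Suc 0)" "bp (Suc (Suc 0)) y2 = Rm gu y3"
    using Rm_gv_boundary[OF y(1,2) z y(3)] by blast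
  obtain y4 y5 c where y4: "y4 \<in> tens (Suc (Suc (Suc 0)))" "y5 \<in> tens (Suc (Suc 0))"
    "y2 = bp (Suc (Suc (Suc 0))) y4 + Rm gu y5 + fscale c cu"
    using cycle_u_1[OF y(2) y3] by metis
  obtain w where w: "w \<in> tens (Suc (Suc 0))" "bp (Suc (Suc (Suc 0))) cuv = Rm gv cu + Rm gu w"
    using cuv(2) by blast
  have mem: "z - Rm gv y4 - fscale c cuv \<in> tens (Suc (Suc (Suc 0)))"
    "y + Rm gv y5 - fscale c w \<in> tens (Suc (Suc 0))"
    by (intro tens_closed tens_Rm z y y4 w cuv)+
  have "bp (Suc (Suc (Suc 0))) (z - Rm gv y4 - fscale c cuv) = Rm gu (y + Rm gv y5 - fscale c w)"
    using y4 y w by (simp add: bp_simps bp_Rm Rm_simps Rm_commute fscale.scale_right_distrib)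
  then obtain p s where p: "p \<in> tens (Suc (Suc (Suc (Suc 0))))" "s \<in> tens (Suc (Suc (Suc 0)))"
    "z - Rm gv y4 - fscale c cuv = bp (Suc (Suc (Suc (Suc 0)))) p + Rm gu s"
    using cycle_u[OF mem] by blast
  show thesis
  proof (rule that[OF p(1)])
    show "z = bp (Suc (Suc (Suc (Suc 0)))) p + (Rm gu s + Rm gv y4) + fscale c cuv"
      using p(3) by (simp add: algebra_simps)
    show "Rm gu s + Rm gv y4 \<in> tens (Suc (Suc (Suc 0)))" by (intro tens_closed tens_Rm p y4)
  qed (intro no_uv_closed no_uv_Rm)
qed

lemma cycle_uv_1:
  assumes z: "z \<in> tens (Suc (Suc 0))" and bz: "no_uv (bp (Suc (Suc 0)) z)"
  obtains p l a b where "p \<in> tens (Suc (Suc (Suc 0)))" "l \<in> tens (Suc (Suc 0))"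
    "no_uv l" "z = bp (Suc (Suc (Suc 0))) p + l + fscale a cu + fscale b cv"
proof -
  obtain y y2 where y: "y \<in> tens (Suc 0)" "y2 \<in> tens (Suc 0)"
    "bp (Suc (Suc 0)) z = Rm gu y + Rm gv y2"
    using no_uv_tens[OF tens_bp[OF z] bz] by metis
  obtain a s where s: "s \<in> tens (Suc (Suc 0))" "y = bp (Suc (Suc 0)) s + fscale a (emb gy)"
    using eps_cycle[OF y(1), of gy] chi_gens by metis
  obtain b s' where s': "s' \<in> tens (Suc (Suc 0))" "y2 = bp (Suc (Suc 0)) s' + fscale b (emb \<e>)"
    using eps_cycle[OF y(2), of \<e>] chi_gens by metis
  have "bp (Suc (Suc 0)) (z - Rm gu s - Rm gv s' - fscale a cu - fscale b cv) = 0"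
    using s s' y by (simp add: bp_simps bp_Rm Rm_simps bp_cu bp_cv del: Rm_emb emb_single)
  moreover have "z - Rm gu s - Rm gv s' - fscale a cu - fscale b cv \<in> tens (Suc (Suc 0))"
    by (intro tens_closed tens_Rm z s s' tens_cu tens_cv)
  ultimately obtain p where p: "p \<in> tens (Suc (Suc (Suc 0)))"
    "bp (Suc (Suc (Suc 0))) p = z - Rm gu s - Rm gv s' - fscale a cu - fscale b cv"
    using bp_exact by blast
  show thesis
  proof (rule that[OF p(1)])
    show "z = bp (Suc (Suc (Suc 0))) p + (Rm gu s + Rm gv s') + fscale a cu + fscale b cv"
      using p(2) by (simp add: algebra_simps)
    show "Rm gu s + Rm gv s' \<in> tens (Suc (Suc 0))" by (intro tens_closed tens_Rm s s')
  qed (intro no_uv_closed no_uv_Rm)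
qed

lemma dx_Rm_u: "dx (Rm gu s) = Rm gu (fscale q (Rm gx s) - fscale q s)"
  by (simp add: dx_def Rm_commute Rm_simps)

text \<open>The boundary of (x - q) cu is y' u with y' = q y x - q y of counit 0, so x - q kills the
  class of \<open>cu\<close> modulo u: the eigenvalue of x is q.\<close>

lemma dx_cu:
  obtains p s where "p \<in> tens (Suc (Suc (Suc 0)))" "s \<in> tens (Suc (Suc 0))"
    "dx cu = bp (Suc (Suc (Suc 0))) p + Rm gu s"
proof -
  let ?y = "fscale q (Rm gx (emb gy)) - fscale q (emb gy)"
  have y: "?y \<in> tens (Suc 0)" by (intro tens_closed tens_Rm tens_emb)
  have "bp (Suc (Suc 0)) (dx cu) = Rm gu ?y"
    unfolding bp_dx[OF tens_cu] bp_cu dx_Rm_u ..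
  then obtain p s c where p: "p \<in> tens (Suc (Suc (Suc 0)))" "s \<in> tens (Suc (Suc 0))"
    "dx cu = bp (Suc (Suc (Suc 0))) p + Rm gu s + fscale c cu" "bp (Suc 0) ?y = fscale c 1"
    using cycle_u_1[OF tens_dx[OF tens_cu] y] by metis
  have "bp (Suc 0) ?y = 0"
    by (simp add: bp_simps bp_1_emb chi_mulA del: emb_single)
  then have "Poly_Mapping.lookup (fscale c 1) ([] :: idx list) = 0" using p(4) by simp
  then have "c = 0" by (simp add: lookup_one zero_list_def)
  then show thesis using p that[of p s] by simp
qed

text \<open>Moving x past v contributes a factor q on top of the eigenvalue q on \<open>cu\<close>,
  so x acts on the class of degree 2 as q^2.\<close>

lemma dx_cuv:
  obtains g l where "g \<in> tens (Suc (Suc (Suc (Suc 0))))" "l \<in> tens (Suc (Suc (Suc 0)))" "no_uv l"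
    "dx cuv = fscale (q * (q - 1)) cuv + bp (Suc (Suc (Suc (Suc 0)))) g + l"
proof -
  obtain w where w: "w \<in> tens (Suc (Suc 0))" "bp (Suc (Suc (Suc 0))) cuv = Rm gv cu + Rm gu w"
    using cuv(2) by blast
  obtain p s where p: "p \<in> tens (Suc (Suc (Suc 0)))" "s \<in> tens (Suc (Suc 0))"
    "dx cu = bp (Suc (Suc (Suc 0))) p + Rm gu s" by (rule dx_cu)
  let ?z = "Rm gx cuv - fscale (q * q) cuv - fscale q (Rm gv p)"
  let ?y = "fscale q (Rm gv s) + fscale q (Rm gx w) - fscale (q * q) w"
  have mem: "?z \<in> tens (Suc (Suc (Suc 0)))" "?y \<in> tens (Suc (Suc 0))"
    by (intro tens_closed tens_Rm cuv p w)+
  have "Rm gx cu = bp (Suc (Suc (Suc 0))) p + Rm gu s + fscale q cu"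
    using p(3) by (simp add: dx_def algebra_simps)
  then have "bp (Suc (Suc (Suc 0))) ?z = Rm gu ?y"
    using w p(1,2) by (simp add: bp_simps bp_Rm cuv(1) Rm_simps Rm_commute fscale.scale_right_distrib)
  then obtain g s' where g: "g \<in> tens (Suc (Suc (Suc (Suc 0))))" "s' \<in> tens (Suc (Suc (Suc 0)))"
    "?z = bp (Suc (Suc (Suc (Suc 0)))) g + Rm gu s'"
    using cycle_u[OF mem] by blast
  show thesis
  proof (rule that[OF g(1)])
    have "Rm gx cuv = fscale (q * q) cuv + fscale q (Rm gv p) + (bp (Suc (Suc (Suc (Suc 0)))) g + Rm gu s')"
      using g(3) by (simp add: algebra_simps)
    then show "dx cuv = fscale (q * (q - 1)) cuv + bp (Suc (Suc (Suc (Suc 0)))) g + (Rm gu s' + fscale q (Rm gv p))"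
      by (simp add: dx_def right_diff_distrib fscale.scale_left_diff_distrib algebra_simps)
    show "Rm gu s' + fscale q (Rm gv p) \<in> tens (Suc (Suc (Suc 0)))" by (intro tens_closed tens_Rm g p)
  qed (intro no_uv_closed no_uv_Rm)
qed

text \<open>Taking boundaries strips off v and u in turn: if c times the class vanishes, then c y is
  a boundary, and its counit is c.\<close>

lemma cuv_nontrivial:
  assumes "y \<in> tens (Suc (Suc (Suc (Suc 0))))" "l \<in> tens (Suc (Suc (Suc 0)))" "no_uv l"
    "fscale c cuv = bp (Suc (Suc (Suc (Suc 0)))) y + l"
  shows "c = 0"
proof -
  obtain w where w: "w \<in> tens (Suc (Suc 0))" "bp (Suc (Suc (Suc 0))) cuv = Rm gv cu + Rm gu w"
    using cuv(2) by blast
  obtain s s' where s: "s \<in> tens (Suc (Suc (Suc 0)))" "s' \<in> tens (Suc (Suc (Suc 0)))" "l = Rm gu s + Rm gv s'"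
    using no_uv_tens[OF assms(2,3)] by blast
  let ?b = "bp (Suc (Suc (Suc 0)))"
  have "fscale c (Rm gv cu + Rm gu w) = Rm gu (?b s) + Rm gv (?b s')"
    using arg_cong[OF assms(4), of ?b] s w bp_bp[OF assms(1)] by (simp add: bp_simps bp_Rm)
  then have "Rm gv (fscale c cu - ?b s') = Rm gu (?b s - fscale c w)"
    by (simp add: Rm_simps fscale.scale_right_distrib algebra_simps)
  then have "no_u (fscale c cu - ?b s')" using no_u_Rm_gv no_u_Rm_gu by metis
  moreover have "fscale c cu - ?b s' \<in> tens (Suc (Suc 0))"
    by (intro tens_closed tens_bp tens_cu s)
  ultimately obtain e where e: "e \<in> tens (Suc (Suc 0))" "fscale c cu - ?b s' = Rm gu e"
    using no_u_tens by blast
  have "fscale c (Rm gu (emb gy)) = Rm gu (bp (Suc (Suc 0)) e)"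
    using arg_cong[OF e(2), of "bp (Suc (Suc 0))"] e(1) bp_bp[OF s(2)]
    by (simp add: bp_simps bp_Rm bp_cu del: Rm_emb)
  then have "Rm gu (fscale c (emb gy) - bp (Suc (Suc 0)) e) = 0"
    by (simp add: Rm_simps del: Rm_emb emb_single fscale_single)
  then have "fscale c (emb gy) - bp (Suc (Suc 0)) e = 0"
    by (rule Rm_gu_inj[of _ 0, rotated]) (intro tens_closed tens_emb tens_bp e)
  then have "bp (Suc 0) (fscale c (emb gy)) = 0" using bp_bp[OF e(1)] by simp
  then have "Poly_Mapping.lookup (fscale c 1) ([] :: idx list) = 0"
    by (simp add: bp_simps bp_1_emb del: emb_single)
  then show "c = 0" by (simp add: lookup_one zero_list_def)
qed

end

subsection \<open>Homology with trivial coefficients twisted by the character\<close>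

locale SLq_generic = SLq_model q for q :: "'k::field_char_0" +
  assumes q1: "q \<noteq> 1"
begin

text \<open>As a projection from the resolution onto its tensor product with the \<delta>-module,
  \<open>last_delta\<close> lowers the tensor degree by one; multiplicativity of \<delta> turns the
  product of the last two factors into the \<delta>-face.\<close>

lemma last_delta_bp:
  assumes "t \<in> tens (Suc (Suc n))"
  shows "last_delta (bp (Suc (Suc n)) t) = bd (Suc n) (last_delta t)"
proof (rule tens_Suc_eqI[where sc = fscale and f = "\<lambda>t. last_delta (bp (Suc (Suc n)) t)", OF _ _ assms])
  fix s :: "idx list \<Rightarrow>\<^sub>0 'k" and h assume s: "s \<in> tens (Suc n)"
  show "last_delta (bp (Suc (Suc n)) (s * emb h)) = bd (Suc n) (last_delta (s * emb h))"
    by (simp add: bp_snoc[OF s] last_delta_simps last_delta_snoc last_delta_Rm[OF s] bd_def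
        bp_simps fscale.scale_right_distrib mult.commute)
qed (intro lin)+

lemma last_delta_ideal:
  assumes "t \<in> tens (Suc n)"
  shows "last_delta (Rm gu t) = 0" "last_delta (Rm gv t) = 0" "last_delta (dx t) = 0"
  using assms by (simp_all add: last_delta_Rm dx_def last_delta_simps)

lemma last_delta_no_uv:
  assumes "t \<in> tens (Suc n)" "no_uv t"
  shows "last_delta t = 0"
proof -
  obtain s s' where "s \<in> tens (Suc n)" "s' \<in> tens (Suc n)" "t = Rm gu s + Rm gv s'"
    using no_uv_tens[OF assms] by blast
  then show ?thesis by (simp add: last_delta_simps last_delta_ideal)
qed

text \<open>The kernel of \<delta> is the left ideal of u, v and x - q: modulo u and v it is spanned
  by the differences x^i - q^i, which are multiples of x - q for i of either sign.\<close>

lemma ker_last_delta: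
  assumes t: "t \<in> tens (Suc n)" "last_delta t = 0"
  obtains y l where "y \<in> tens (Suc n)" "l \<in> tens (Suc n)" "no_uv l" "t = dx y + l"
proof -
  define W where "W = {t. \<exists>y\<in>tens (Suc n). \<exists>l\<in>tens (Suc n). no_uv l \<and> t = dx y + l}"
  have I: "dx y + l \<in> W" if "y \<in> tens (Suc n)" "l \<in> tens (Suc n)" "no_uv l" for y l
    using that unfolding W_def by blast
  have add: "s + t \<in> W" if "s \<in> W" "t \<in> W" for s t
  proof -
    from that obtain a b c d where "a \<in> tens (Suc n)" "b \<in> tens (Suc n)" "no_uv b" "c \<in> tens (Suc n)"
      "d \<in> tens (Suc n)" "no_uv d" "s = dx a + b" "t = dx c + d" unfolding W_def by blast
    then show ?thesis using I[of "a + c" "b + d"] by (simp add: tens_closed no_uv_closed dx_simps algebra_simps)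
  qed
  have scale: "fscale c s \<in> W" if "s \<in> W" for c s
  proof -
    from that obtain a b where "a \<in> tens (Suc n)" "b \<in> tens (Suc n)" "no_uv b" "s = dx a + b" unfolding W_def by blast
    then show ?thesis using I[of "fscale c a" "fscale c b"]
      by (simp add: tens_closed no_uv_closed dx_simps fscale.scale_right_distrib)
  qed
  have zero: "0 \<in> W" using I[OF tens_closed(1) tens_closed(1)] by (simp add: dx_simps no_uv_closed)
  \<comment> \<open>A projection onto the kernel of \<open>last_delta\<close>. Basis tensors need
    not lie in the kernel, but their images under r do and can be treated one at a time.\<close>
  define r where "r t = t - last_delta t * emb \<e>" for t
  have r: "linear_map fscale r" unfolding r_def by (intro lin)
  have power: "vec ds * emb (vec (i, 0, 0)) - fscale (q powi i) (vec ds * emb \<e>) \<in> W"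
    if ds: "length ds = n" for ds i
  proof -
    let ?e = "\<lambda>i. vec ds * emb (vec (i, 0, 0))"
    have mem: "vec ds * emb h \<in> tens (Suc n)" for h by (intro tens_emb_snoc tens_vec ds)
    have step: "?e (i + 1) - fscale q (?e i) \<in> W" for i
    proof -
      let ?l = "?e (i + 1) - fscale q (?e i) - dx (?e i)"
      have "no_uv ?l"
        unfolding no_uv_def
      proof (intro allI)
        fix bs :: "idx list" and i'
        show "Poly_Mapping.lookup ?l (bs @ [(i', 0, 0)]) = 0"
          using lookup_Rm_gx[OF mem, of "vec (i, 0, 0)" bs i']
          by (auto simp: dx_def lookup_minus vec_mult lookup_single when_def)
      qed
      moreover have "?l \<in> tens (Suc n)" by (intro tens_closed tens_dx mem)
      ultimately show ?thesis using I[OF mem[of "vec (i, 0, 0)"], of ?l] by (simp del: emb_single)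
    qed
    show ?thesis
    proof (induction i rule: int_induct[where k = 0])
      case base
      show ?case using zero by (simp del: emb_single)
    next
      case (step1 i)
      have eq: "?e (i + 1) - fscale (q powi (i + 1)) (?e 0) =
          (?e (i + 1) - fscale q (?e i)) + fscale q (?e i - fscale (q powi i) (?e 0))"
        by (simp add: power_int_add fscale.scale_right_diff_distrib mult.commute del: emb_single)
      show ?case unfolding eq by (rule add[OF step scale[OF step1(2)]])
    next
      case (step2 i)
      have eq: "?e (i - 1) - fscale (q powi (i - 1)) (?e 0) =
          fscale (- inverse q) (?e (i - 1 + 1) - fscale q (?e (i - 1))) + fscale (inverse q) (?e i - fscale (q powi i) (?e 0))"
        by (simp add: power_int_diff fscale.scale_right_diff_distrib field_simps del: emb_single)
      show ?case unfolding eq by (rule add[OF scale[OF step] scale[OF step2(2)]])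
    qed
  qed
  have mem0: "r (vec cs) \<in> W" if "length cs = Suc n" for cs
  proof -
    from that obtain ds i j k where cs: "cs = ds @ [(i, j, k)]" "length ds = n"
      by (cases cs rule: rev_cases) auto
    have v: "vec cs = vec ds * emb (vec (i, j, k))" by (simp add: cs vec_mult)
    have d: "last_delta (vec cs) = (if j = 0 \<and> k = 0 then fscale (q powi i) (vec ds) else 0)"
      unfolding v last_delta_snoc by simp
    show ?thesis
    proof (cases "j = 0 \<and> k = 0")
      case True
      then have "r (vec cs) = vec ds * emb (vec (i, 0, 0)) - fscale (q powi i) (vec ds * emb \<e>)"
        unfolding r_def d by (simp add: v mult_fscale_left del: emb_single fscale_single)
      then show ?thesis using power[OF cs(2), of i] by simp
    next
      case False
      then have nu: "no_uv (vec cs)" by (auto simp: no_uv_def cs lookup_single when_def)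
      have eq: "r (vec cs) = dx 0 + vec cs"
        unfolding r_def d using False by (simp only: if_False mult_zero_left dx_simps) simp
      show ?thesis unfolding eq by (rule I[OF tens_closed(1) tens_vec[OF that] nu])
    qed
  qed
  have mem: "r (vec b) \<in> W" if "b \<in> Poly_Mapping.keys t" for b
  proof -
    have "length b = Suc n" using t(1) that by (auto simp: tens_def)
    then show ?thesis by (rule mem0)
  qed
  have "(\<Sum>b\<in>A. fscale (Poly_Mapping.lookup t b) (r (vec b))) \<in> W" if "A \<subseteq> Poly_Mapping.keys t" for A
    using finite_subset[OF that finite_keys] that
  proof (induction A rule: finite_induct)
    case (insert x F)
    have "fscale (Poly_Mapping.lookup t x) (r (vec x)) \<in> W"
      by (rule scale[OF mem]) (use insert(4) in simp)
    moreover have "(\<Sum>b\<in>F. fscale (Poly_Mapping.lookup t b) (r (vec b))) \<in> W"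
      by (rule insert(3)) (use insert(4) in simp)
    ultimately show ?case unfolding sum.insert[OF insert(1,2)] by (rule add)
  qed (simp only: sum.empty zero)
  from this[OF order_refl]
  have "r t \<in> W" using linear_map_expand[OF r finite_keys order_refl, of t] by simp
  then have "t \<in> W" using t(2) by (simp add: r_def)
  then show thesis using that unfolding W_def by blast
qed

text \<open>
  Up to scalars, these are the images of the classes of \<open>u\<close> and \<open>v\<close> under Connes' operator \<open>(1 - t) s N\<close>,
  where \<open>s a = a \<otimes> 1\<close> contracts \<open>b'\<close>.
\<close>

definition Bu :: "idx list \<Rightarrow>\<^sub>0 'k"
  where "Bu = emb gu * emb \<e> - emb gy * emb gu + fscale q (emb gu * emb gy)"

definition Bv :: "idx list \<Rightarrow>\<^sub>0 'k"
  where "Bv = emb gv * emb \<e> - emb gx * emb gv + fscale (inverse q) (emb gv * emb gx)"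

lemma tens_B: "Bu \<in> tens (Suc (Suc 0))" "Bv \<in> tens (Suc (Suc 0))"
  unfolding Bu_def Bv_def by (intro tens_closed tens_emb_snoc tens_emb)+

lemma fscale_2: "fscale 2 t = t + t"
  using fscale.scale_left_distrib[of 1 1 t] by simp

lemma bp_B: "bp (Suc (Suc 0)) Bu = fscale (- 2) (emb gu)" "bp (Suc (Suc 0)) Bv = fscale (- 2) (emb gv)"
  unfolding Bu_def Bv_def
  by (simp_all add: bp_simps bp_2_emb mulA_gens emb_simps fscale_2 fscale.scale_right_diff_distrib
      del: emb_single fscale_single)

lemma mulA_gy_gx: "gy \<star> gx = \<e> + fscale q (gu \<star> gv)"
  by (rule mulA_gens)

lemma bp_B_one:
  "bp (Suc (Suc (Suc 0))) (Bu * emb \<e>) = Bu - fscale 2 (emb gu * emb \<e>)"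
  "bp (Suc (Suc (Suc 0))) (Bv * emb \<e>) = Bv - fscale 2 (emb gv * emb \<e>)"
  using bp_snoc[OF tens_B(1), of \<e>] bp_snoc[OF tens_B(2), of \<e>]
  by (simp_all add: bp_B mult_fscale_left del: emb_single)

text \<open>Both classes of degree 1 are killed by x - q, and the explicit primitives carry them to
  degree 2. These are multiples of \<open>Bu\<close> and \<open>Bv\<close> with a unit appended, so
  \<open>last_delta\<close> recovers the images under Connes' operator.\<close>

lemma dx_cu_cv:
  "\<exists>l\<in>tens (Suc (Suc 0)). no_uv l \<and> dx cu = bp (Suc (Suc (Suc 0))) (fscale q (Bu * emb \<e>)) + l"
  "\<exists>l\<in>tens (Suc (Suc 0)). no_uv l \<and> dx cv = bp (Suc (Suc (Suc 0))) (fscale (- q) (Bv * emb \<e>)) + l"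
proof -
  have t: "emb g * emb h \<in> tens (Suc (Suc 0))" for g h :: "idx \<Rightarrow>\<^sub>0 'k"
    by (intro tens_emb_snoc tens_emb)
  have n: "no_uv (emb g * emb gu)" "no_uv (emb g * emb gv)" "no_uv (emb g * emb (gu \<star> gv))" for g
    using no_uv_Rm(1)[of "emb g * emb \<e>"] no_uv_Rm(2)[of "emb g * emb \<e>"] no_uv_Rm(2)[of "emb g * emb gu"]
    by (simp_all add: Rm_snoc del: emb_single)
  have "dx cu = bp (Suc (Suc (Suc 0))) (fscale q (Bu * emb \<e>)) +
      (fscale q (emb gy * emb gu) - fscale (q * q) (emb gu * emb (gu \<star> gv)))"
    unfolding bp_simps bp_B_one dx_def cu_def Rm_simps Rm_snoc mulA_gy_gx
    by (simp add: Bu_def emb_simps fscale_2 fscale.scale_right_distrib fscale.scale_right_diff_distrib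
        distrib_left mult_fscale_right del: emb_single fscale_single)
  then show "\<exists>l\<in>tens (Suc (Suc 0)). no_uv l \<and> dx cu = bp (Suc (Suc (Suc 0))) (fscale q (Bu * emb \<e>)) + l"
    by (intro bexI[of _ "fscale q (emb gy * emb gu) - fscale (q * q) (emb gu * emb (gu \<star> gv))"] conjI
        no_uv_closed n tens_closed t)
  have "dx cv = bp (Suc (Suc (Suc 0))) (fscale (- q) (Bv * emb \<e>)) + fscale (- q) (emb gx * emb gv)"
    unfolding bp_simps bp_B_one dx_def cv_def Rm_simps Rm_snoc mulA_one
    by (simp add: Bv_def emb_simps fscale_2 fscale.scale_right_distrib fscale.scale_right_diff_distrib
        del: emb_single fscale_single)
  then show "\<exists>l\<in>tens (Suc (Suc 0)). no_uv l \<and> dx cv = bp (Suc (Suc (Suc 0))) (fscale (- q) (Bv * emb \<e>)) + l"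
    by (intro bexI[of _ "fscale (- q) (emb gx * emb gv)"] conjI no_uv_closed n tens_closed t)
qed

text \<open>Appending the unit lifts a cycle to the resolution; its boundary there lies in the
  kernel of \<open>last_delta\<close>.\<close>

lemma lift_cycle:
  assumes z: "z \<in> tens (Suc n)" and bz: "bd (Suc n) z = 0"
  obtains w y l where "w \<in> tens (Suc (Suc n))" "last_delta w = z" "y \<in> tens (Suc n)" "l \<in> tens (Suc n)"
    "no_uv l" "bp (Suc (Suc n)) w = dx y + l"
proof -
  let ?w = "z * emb \<e>"
  have w: "?w \<in> tens (Suc (Suc n))" by (intro tens_emb_snoc z)
  have "last_delta ?w = z" by (simp add: last_delta_snoc del: emb_single)
  then show thesis
    using ker_last_delta[OF tens_bp[OF w]] last_delta_bp[OF w] bz that[OF w] by metis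
qed

text \<open>The boundary of x is its counit minus its \<delta>-value, 1 - q, which is
  invertible.\<close>

lemma homology_0:
  assumes "t \<in> tens 0"
  shows "\<exists>s\<in>tens (Suc 0). bd (Suc 0) s = t"
proof
  define c where "c = Poly_Mapping.lookup t [] / (1 - q)"
  have "bd (Suc 0) (emb gx) = fscale (1 - q) 1"
    using last_delta_snoc[of 1 gx]
    by (simp add: bd_def bp_1_emb fscale.scale_left_diff_distrib del: emb_single)
  then show "bd (Suc 0) (fscale c (emb gx)) = t"
    using tens_0[OF assms] q1 by (simp add: bd_simps c_def del: emb_single fscale_single)
  show "fscale c (emb gx) \<in> tens (Suc 0)" by (intro tens_closed tens_emb)
qed

lemma homology_1:
  assumes z: "z \<in> tens (Suc 0)" and bz: "bd (Suc 0) z = 0"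
  obtains p a b where "p \<in> tens (Suc (Suc 0))"
    "z = bd (Suc (Suc 0)) p + fscale a (emb gu) + fscale b (emb gv)"
proof -
  obtain w y l where w: "w \<in> tens (Suc (Suc 0))" "last_delta w = z" "y \<in> tens (Suc 0)" "l \<in> tens (Suc 0)"
    "no_uv l" "bp (Suc (Suc 0)) w = dx y + l"
    using lift_cycle[OF z bz] by metis
  obtain s s' where s: "s \<in> tens (Suc 0)" "s' \<in> tens (Suc 0)" "l = Rm gu s + Rm gv s'"
    using no_uv_tens[OF w(4,5)] by blast
  have Rm0: "Rm gu t = 0" "Rm gv t = 0" if "t \<in> tens 0" for t
    by (subst tens_0[OF that], simp add: Rm_simps del: fscale_single)+
  obtain c y3 where y3: "y3 \<in> tens (Suc (Suc 0))" "y = bp (Suc (Suc 0)) y3 + fscale c (emb \<e>)"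
    "bp (Suc 0) y = fscale c 1"
    using eps_cycle[OF w(3), of \<e>] chi_gens by metis
  have "bp (Suc 0) (dx y + l) = 0" using bp_bp[OF w(1)] w(6) by simp
  \<comment> \<open>In degree 0 multiplication by x is its counit, so this reads (1 - q) c = 0: x -
    q is injective on the lowest homology.\<close>
  then have "dx (fscale c 1) = 0"
    using w(3) s y3 Rm0[OF tens_bp[OF s(1)]] Rm0[OF tens_bp[OF s(2)]] by (simp add: bp_simps bp_dx bp_Rm)
  then have "Poly_Mapping.lookup (dx (fscale c 1)) [] = 0" by simp
  then have "c = 0" using q1
    by (simp add: dx_def Rm_simps lookup_minus lookup_one zero_list_def del: fscale_single)
  then have y: "y = bp (Suc (Suc 0)) y3" using y3 by simp
  have mem: "w - dx y3 \<in> tens (Suc (Suc 0))" by (intro tens_closed tens_dx w y3)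
  have "bp (Suc (Suc 0)) (w - dx y3) = l"
    using w y y3 by (simp add: bp_simps bp_dx)
  then obtain p l' a b where p: "p \<in> tens (Suc (Suc (Suc 0)))" "l' \<in> tens (Suc (Suc 0))"
    "no_uv l'" "w - dx y3 = bp (Suc (Suc (Suc 0))) p + l' + fscale a cu + fscale b cv"
    using cycle_uv_1[OF mem] w(5) by metis
  have "last_delta cu = - emb gu" "last_delta cv = - emb gv"
    by (simp_all add: cu_def cv_def last_delta_simps last_delta_snoc del: emb_single)
  moreover have "z = last_delta (w - dx y3)"
    using w y3 by (simp add: last_delta_simps last_delta_ideal)
  ultimately have "z = bd (Suc (Suc 0)) (last_delta p) + fscale (- a) (emb gu) + fscale (- b) (emb gv)"
    using last_delta_bp[OF p(1)] last_delta_no_uv[OF p(2,3)]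
    by (simp add: p(4) last_delta_simps del: emb_single fscale_single)
  then show thesis using that tens_last_delta[OF p(1)] by blast
qed

text \<open>The element y with b' w = (x - q) y + l is a cycle modulo u and v, hence a combination
  of \<open>cu\<close> and \<open>cv\<close>, and these contribute \<open>Bu\<close> and
  \<open>Bv\<close>. The image of \<open>cuv\<close> is a boundary because q (q - 1) is
  invertible.\<close>

lemma homology_2:
  assumes z: "z \<in> tens (Suc (Suc 0))" and bz: "bd (Suc (Suc 0)) z = 0"
  obtains p a b where "p \<in> tens (Suc (Suc (Suc 0)))"
    "z = bd (Suc (Suc (Suc 0))) p + fscale a Bu + fscale b Bv"
proof -
  obtain w y l where w: "w \<in> tens (Suc (Suc (Suc 0)))" "last_delta w = z" "y \<in> tens (Suc (Suc 0))"
    "l \<in> tens (Suc (Suc 0))" "no_uv l" "bp (Suc (Suc (Suc 0))) w = dx y + l"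
    using lift_cycle[OF z bz] by metis
  have "bp (Suc (Suc 0)) (dx y + l) = 0" using bp_bp[OF w(1)] w(6) by simp
  moreover obtain s s' where s: "s \<in> tens (Suc (Suc 0))" "s' \<in> tens (Suc (Suc 0))" "l = Rm gu s + Rm gv s'"
    using no_uv_tens[OF w(4,5)] by blast
  ultimately have "dx (bp (Suc (Suc 0)) y) + (Rm gu (bp (Suc (Suc 0)) s) + Rm gv (bp (Suc (Suc 0)) s')) = 0"
    using w(3) by (simp add: bp_simps bp_dx bp_Rm)
  then have "dx (bp (Suc (Suc 0)) y) = - (Rm gu (bp (Suc (Suc 0)) s) + Rm gv (bp (Suc (Suc 0)) s'))"
    by (rule iffD2[OF eq_neg_iff_add_eq_0])
  then have "no_uv (dx (bp (Suc (Suc 0)) y))" by (simp only:) (intro no_uv_closed no_uv_Rm)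
  then have "no_uv (bp (Suc (Suc 0)) y)" using no_uv_dx[OF tens_bp[OF w(3)]] by simp
  then obtain y3 l' a b where y3: "y3 \<in> tens (Suc (Suc (Suc 0)))" "l' \<in> tens (Suc (Suc 0))" "no_uv l'"
    "y = bp (Suc (Suc (Suc 0))) y3 + l' + fscale a cu + fscale b cv"
    using cycle_uv_1[OF w(3)] by metis
  obtain lu lv where lu: "lu \<in> tens (Suc (Suc 0))" "no_uv lu"
    "dx cu = bp (Suc (Suc (Suc 0))) (fscale q (Bu * emb \<e>)) + lu"
    and lv: "lv \<in> tens (Suc (Suc 0))" "no_uv lv"
    "dx cv = bp (Suc (Suc (Suc 0))) (fscale (- q) (Bv * emb \<e>)) + lv"
    using dx_cu_cv by blast
  define eu ev where "eu = fscale q (Bu * emb \<e>)" and "ev = fscale (- q) (Bv * emb \<e>)"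
  have e: "eu \<in> tens (Suc (Suc (Suc 0)))" "ev \<in> tens (Suc (Suc (Suc 0)))"
    unfolding eu_def ev_def by (intro tens_closed tens_emb_snoc tens_B)+
  have mem: "w - dx y3 - fscale a eu - fscale b ev \<in> tens (Suc (Suc (Suc 0)))"
    by (intro tens_closed tens_dx w y3 e)
  have "bp (Suc (Suc (Suc 0))) (w - dx y3 - fscale a eu - fscale b ev) = l + dx l' + fscale a lu + fscale b lv"
    using w y3 lu lv by (simp add: bp_simps bp_dx dx_simps eu_def ev_def fscale.scale_right_distrib
        fscale.scale_right_diff_distrib algebra_simps del: fscale_single emb_single)
  moreover have "no_uv (l + dx l' + fscale a lu + fscale b lv)"
    using no_uv_dx[OF y3(2)] y3(3) by (intro no_uv_closed w lu lv) simp
  ultimately obtain p l'' c where p: "p \<in> tens (Suc (Suc (Suc (Suc 0))))" "l'' \<in> tens (Suc (Suc (Suc 0)))"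
    "no_uv l''" "w - dx y3 - fscale a eu - fscale b ev = bp (Suc (Suc (Suc (Suc 0)))) p + l'' + fscale c cuv"
    using cycle_uv_2[OF mem] by metis
  obtain g m where g: "g \<in> tens (Suc (Suc (Suc (Suc 0))))" "m \<in> tens (Suc (Suc (Suc 0)))" "no_uv m"
    "dx cuv = fscale (q * (q - 1)) cuv + bp (Suc (Suc (Suc (Suc 0)))) g + m"
    using dx_cuv by metis
  define k where "k = q * (q - 1)"
  have k: "k \<noteq> 0" using q1 by (simp add: k_def)
  have "fscale k (last_delta cuv) + bd (Suc (Suc (Suc 0))) (last_delta g) = 0"
    using last_delta_ideal(3)[OF cuv(1)] last_delta_bp[OF g(1)] last_delta_no_uv[OF g(2,3)]
    by (simp add: g(4) last_delta_simps k_def)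
  then have e: "fscale k (last_delta cuv) = - bd (Suc (Suc (Suc 0))) (last_delta g)"
    by (rule iffD2[OF eq_neg_iff_add_eq_0])
  have "last_delta cuv = fscale (1 / k) (fscale k (last_delta cuv))" using k by simp
  also have "\<dots> = bd (Suc (Suc (Suc 0))) (fscale (- 1 / k) (last_delta g))"
    unfolding e by (simp add: bd_simps)
  finally have "last_delta cuv = bd (Suc (Suc (Suc 0))) (fscale (- 1 / k) (last_delta g))" .
  moreover have "last_delta eu = fscale q Bu" "last_delta ev = fscale (- q) Bv"
    by (simp_all add: eu_def ev_def last_delta_simps last_delta_snoc del: emb_single fscale_single)
  moreover have "last_delta (w - dx y3 - fscale a eu - fscale b ev) =
      z - fscale a (last_delta eu) - fscale b (last_delta ev)"
    using w y3 by (simp add: last_delta_simps last_delta_ideal)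
  ultimately have "z = bd (Suc (Suc (Suc 0))) (last_delta p + fscale c (fscale (- 1 / k) (last_delta g)))
      + fscale (a * q) Bu + fscale (- b * q) Bv"
    using last_delta_bp[OF p(1)] last_delta_no_uv[OF p(2,3)]
    unfolding p(4) by (simp add: last_delta_simps bd_simps algebra_simps)
  then show thesis
    by (rule that[rotated]) (intro tens_closed tens_last_delta p g)
qed

text \<open>In degree 3 a multiple c of \<open>cuv\<close> may occur in y. As x - q acts on that
  class by q (q - 1), it would be a boundary unless c = 0. In higher degrees the quotient by u and v
  has no homology.\<close>

lemma homology_ge_3:
  assumes z: "z \<in> tens (Suc (Suc (Suc n)))" and bz: "bd (Suc (Suc (Suc n))) z = 0"
  shows "\<exists>p\<in>tens (Suc (Suc (Suc (Suc n)))). bd (Suc (Suc (Suc (Suc n)))) p = z"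
proof -
  let ?N = "Suc (Suc (Suc n))"
  obtain w y l where w: "w \<in> tens (Suc ?N)" "last_delta w = z" "y \<in> tens ?N"
    "l \<in> tens ?N" "no_uv l" "bp (Suc ?N) w = dx y + l"
    using lift_cycle[OF z bz] by metis
  have "bp ?N (dx y + l) = 0" using bp_bp[OF w(1)] w(6) by simp
  moreover obtain s s' where s: "s \<in> tens ?N" "s' \<in> tens ?N" "l = Rm gu s + Rm gv s'"
    using no_uv_tens[OF w(4,5)] by blast
  ultimately have "dx (bp ?N y) + (Rm gu (bp ?N s) + Rm gv (bp ?N s')) = 0"
    using w(3) by (simp add: bp_simps bp_dx bp_Rm)
  then have "dx (bp ?N y) = - (Rm gu (bp ?N s) + Rm gv (bp ?N s'))"
    by (rule iffD2[OF eq_neg_iff_add_eq_0])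
  then have "no_uv (dx (bp ?N y))" by (simp only:) (intro no_uv_closed no_uv_Rm)
  then have ny: "no_uv (bp ?N y)" using no_uv_dx[OF tens_bp[OF w(3)]] by simp
  have "\<exists>y3 l'. y3 \<in> tens (Suc ?N) \<and> l' \<in> tens ?N \<and> no_uv l' \<and> y = bp (Suc ?N) y3 + l'"
  proof (cases n)
    case 0
    obtain y3 l' c where y3: "y3 \<in> tens (Suc ?N)" "l' \<in> tens ?N" "no_uv l'"
      "y = bp (Suc ?N) y3 + l' + fscale c cuv"
      using cycle_uv_2 w(3) ny unfolding 0 by metis
    obtain g m where g: "g \<in> tens (Suc ?N)" "m \<in> tens ?N" "no_uv m"
      "dx cuv = fscale (q * (q - 1)) cuv + bp (Suc ?N) g + m"
      using dx_cuv unfolding 0 by metis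
    have "bp (Suc ?N) (w - dx y3 - fscale c g) = fscale (c * (q * (q - 1))) cuv + (l + dx l' + fscale c m)"
      using w y3 g by (simp add: bp_simps bp_dx dx_simps fscale.scale_right_distrib algebra_simps)
    then have eq: "fscale (c * (q * (q - 1))) cuv = bp (Suc ?N) (w - dx y3 - fscale c g) + - (l + dx l' + fscale c m)"
      by simp
    have "c * (q * (q - 1)) = 0"
    proof (rule cuv_nontrivial)
      show "w - dx y3 - fscale c g \<in> tens (Suc (Suc (Suc (Suc 0))))"
        using w y3 g unfolding 0 by (intro tens_closed tens_dx)
      show "- (l + dx l' + fscale c m) \<in> tens (Suc (Suc (Suc 0)))"
        using w y3 g unfolding 0 by (intro tens_closed tens_dx)
      show "no_uv (- (l + dx l' + fscale c m))"
        using no_uv_dx[OF y3(2)] y3(3) by (intro no_uv_closed w g) simp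
    qed (use eq 0 in simp)
    then have "c = 0" using q1 by simp
    then show ?thesis using y3 by auto
  next
    case (Suc m)
    then show ?thesis using cycle_uv[of y m] w(3) ny by metis
  qed
  then obtain y3 l' where y3: "y3 \<in> tens (Suc ?N)" "l' \<in> tens ?N" "no_uv l'" "y = bp (Suc ?N) y3 + l'"
    by blast
  have mem: "w - dx y3 \<in> tens (Suc ?N)" by (intro tens_closed tens_dx w y3)
  have "bp (Suc ?N) (w - dx y3) = l + dx l'"
    using w y3 by (simp add: bp_simps bp_dx dx_simps)
  moreover have "no_uv (l + dx l')" using no_uv_dx[OF y3(2)] y3(3) by (intro no_uv_closed w) simp
  ultimately obtain p l'' where p: "p \<in> tens (Suc (Suc ?N))" "l'' \<in> tens (Suc ?N)" "no_uv l''"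
    "w - dx y3 = bp (Suc (Suc ?N)) p + l''"
    using cycle_uv[OF mem] by metis
  have "z = last_delta (w - dx y3)" using w y3 by (simp add: last_delta_simps last_delta_ideal)
  then have "bd (Suc ?N) (last_delta p) = z"
    using last_delta_bp[OF p(1)] last_delta_no_uv[OF p(2,3)] by (simp add: p(4) last_delta_simps)
  then show ?thesis using tens_last_delta[OF p(1)] by blast
qed

end

section \<open>The total complex\<close>

context SLq_generic
begin

definition st :: "nat \<Rightarrow> (idx list \<Rightarrow>\<^sub>0 'k) \<Rightarrow> (idx list \<Rightarrow>\<^sub>0 'k)"
  where "st n t = fscale ((- 1) ^ n) (tau t)"

definition cn :: "nat \<Rightarrow> (idx list \<Rightarrow>\<^sub>0 'k) \<Rightarrow> (idx list \<Rightarrow>\<^sub>0 'k)"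
  where "cn n t = (\<Sum>i\<le>n. (st n ^^ i) t)"

lemma linear_st [lin]: "linear_map fscale f \<Longrightarrow> linear_map fscale (\<lambda>x. st n (f x))"
  unfolding st_def by (intro lin)

lemma linear_st_funpow [lin]: "linear_map fscale f \<Longrightarrow> linear_map fscale (\<lambda>x. (st n ^^ i) (f x))"
  by (induction i) (simp_all add: linear_st)

lemma linear_cn [lin]: "linear_map fscale f \<Longrightarrow> linear_map fscale (\<lambda>x. cn n (f x))"
  unfolding cn_def by (intro lin)

lemmas st_simps = linear_map_simps[OF linear_st[OF linear_map_id]]
lemmas cn_simps = linear_map_simps[OF linear_cn[OF linear_map_id]]

lemma tens_st: "t \<in> tens n \<Longrightarrow> st m t \<in> tens n"
  unfolding st_def by (intro tens_closed tens_tau)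

lemma tens_st_funpow: "t \<in> tens n \<Longrightarrow> (st m ^^ i) t \<in> tens n"
  by (induction i) (auto intro: tens_st)

lemma tens_cn: "t \<in> tens n \<Longrightarrow> cn m t \<in> tens n"
  unfolding cn_def by (intro tens_closed tens_st_funpow)

lemma st_funpow_eq: "(st n ^^ i) t = fscale ((- 1) ^ (n * i)) ((tau ^^ i) t)"
  by (induction i) (simp_all add: st_def tau_simps power_add)

lemma st_cyclic: "t \<in> tens n \<Longrightarrow> (st n ^^ Suc n) t = t"
  unfolding st_funpow_eq using tau_cyclic[of t n] by simp

lemma cn_st: "t \<in> tens n \<Longrightarrow> cn n (st n t) = cn n t"
proof -
  assume t: "t \<in> tens n"
  have "cn n (st n t) = (\<Sum>i\<le>n. (st n ^^ Suc i) t)" by (simp add: cn_def funpow_swap1)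
  also have "\<dots> = (\<Sum>i\<le>Suc n. (st n ^^ i) t) - t"
    unfolding sum.atMost_Suc_shift[of "\<lambda>i. (st n ^^ i) t"] by simp
  also have "\<dots> = cn n t" using st_cyclic[OF t] by (simp add: cn_def)
  finally show ?thesis .
qed

lemma st_cn: "t \<in> tens n \<Longrightarrow> st n (cn n t) = cn n t"
  using cn_st[of t n] by (simp add: cn_def st_simps funpow_swap1)

text \<open>Face 0 after \<tau> is the last face and the other faces move one place; this turns the
  sum for b into that for b' and leaves the last face over.\<close>

lemma bd_st:
  assumes t: "t \<in> tens (Suc n)"
  shows "bd (Suc n) (st (Suc n) t) = st n (bp (Suc n) t) + fscale ((- 1) ^ Suc n) (last_delta t)"
proof -
  have "bd (Suc n) (tau t) = (\<Sum>i<Suc n. fscale ((- 1) ^ i) (fc i (tau t))) + fscale ((- 1) ^ Suc n) (tau (fc n t))"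
    by (simp add: bd_def bp_def last_delta_tau[OF t])
  also have "(\<Sum>i<Suc n. fscale ((- 1) ^ i) (fc i (tau t))) =
      last_delta t - (\<Sum>i<n. fscale ((- 1) ^ i) (tau (fc i t)))"
    unfolding sum.lessThan_Suc_shift
    by (simp add: fc_0_tau[OF t] fc_tau[OF t] sum_negf)
  finally have "bd (Suc n) (tau t) = last_delta t - tau (bp (Suc n) t)"
    by (simp add: bp_def tau_simps)
  then show ?thesis by (simp add: st_def bd_simps fscale.scale_right_diff_distrib)
qed

lemma bd_one_minus_st:
  assumes "t \<in> tens (Suc n)"
  shows "bd (Suc n) (t - st (Suc n) t) = bp (Suc n) t - st n (bp (Suc n) t)"
  by (simp add: bd_simps bd_st[OF assms]) (simp add: bd_def)

text \<open>Each turn lowers the face index by one, so the last face after i + 1 turns is face n - i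
  before them: the last face alone recovers all others.\<close>

lemma last_delta_tau_funpow:
  assumes t: "t \<in> tens (Suc n)" and "i \<le> n"
  shows "last_delta ((tau ^^ Suc i) t) = (tau ^^ Suc i) (fc (n - i) t)"
proof -
  have tens: "(tau ^^ j) t \<in> tens (Suc n)" for j
    using t by (induction j) (auto intro: tens_tau)
  have fc: "fc n ((tau ^^ j) t) = (tau ^^ j) (fc (n - j) t)" if "j \<le> n" for j
  proof -
    have "i + j \<le> n \<Longrightarrow> fc (i + j) ((tau ^^ j) t) = (tau ^^ j) (fc i t)" for i
    proof (induction j)
      case (Suc j)
      have "fc (Suc (i + j)) (tau ((tau ^^ j) t)) = tau (fc (i + j) ((tau ^^ j) t))"
        using Suc.prems by (intro fc_tau[OF tens]) simp
      then show ?case using Suc by simp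
    qed simp
    from this[of "n - j"] that show ?thesis by simp
  qed
  show ?thesis using last_delta_tau[OF tens[of i]] fc[OF assms(2)] by simp
qed

lemma fscale_of_nat: "(\<Sum>i\<le>m. x) = fscale (of_nat (Suc m)) x"
proof (induction m)
  case (Suc m)
  have "fscale (of_nat (Suc (Suc m))) x = fscale (of_nat (Suc m)) x + x"
    by (simp only: of_nat_Suc[of "Suc m"] fscale.scale_left_distrib fscale.scale_one add.commute)
  then show ?case by (simp only: sum.atMost_Suc Suc)
qed simp

text \<open>
  Both sides of \<open>b' N = N b\<close> are determined by composing with the norm: in characteristic zero
  this replaces the usual rearrangement of the double sum.
\<close>

lemma bp_cn:
  assumes t: "t \<in> tens (Suc n)"
  shows "bp (Suc n) (cn (Suc n) t) = cn n (bd (Suc n) t)"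
proof -
  let ?N = "cn (Suc n) t"
  have N: "?N \<in> tens (Suc n)" by (intro tens_cn t)
  have cn_funpow: "cn n ((st n ^^ i) s) = cn n s" if "s \<in> tens n" for i s
    by (induction i) (simp_all add: cn_st[OF tens_st_funpow[OF that]])
  have cn_bd: "cn n (bd (Suc n) (st (Suc n) s)) = cn n (bd (Suc n) s)" if s: "s \<in> tens (Suc n)" for s
    using arg_cong[OF bd_one_minus_st[OF s], of "cn n"] by (simp add: bd_simps cn_simps cn_st[OF tens_bp[OF s]])
  have cn_bd_funpow: "cn n (bd (Suc n) ((st (Suc n) ^^ i) t)) = cn n (bd (Suc n) t)" for i
    by (induction i) (simp_all add: cn_bd[OF tens_st_funpow[OF t]])
  have 1: "cn n (bd (Suc n) ?N) = fscale (of_nat (Suc (Suc n))) (cn n (bd (Suc n) t))"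
    unfolding cn_def[of "Suc n"] bd_simps cn_simps cn_bd_funpow fscale_of_nat ..
  have "st n (bp (Suc n) ?N) = bp (Suc n) ?N"
    using bd_one_minus_st[OF N] by (simp add: st_cn[OF t] bd_simps)
  then have inv: "(st n ^^ i) (bp (Suc n) ?N) = bp (Suc n) ?N" for i
    by (induction i) simp_all
  have 2: "cn n (bp (Suc n) ?N) = fscale (of_nat (Suc n)) (bp (Suc n) ?N)"
    unfolding cn_def[of n] inv fscale_of_nat ..
  have shift: "?N = (\<Sum>i\<le>Suc n. (st (Suc n) ^^ Suc i) t)"
    using st_cn[OF t] by (simp add: cn_def st_simps del: sum.atMost_Suc)
  have "cn n (fscale ((- 1) ^ Suc n) (last_delta ((st (Suc n) ^^ Suc i) t))) =
      fscale ((- 1) ^ (n - i)) (cn n (fc (n - i) t))" if "i \<le> n" for i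
  proof -
    have f: "fc (n - i) t \<in> tens n" by (rule tens_fc[OF t])
    have "(tau ^^ Suc i) (fc (n - i) t) = fscale ((- 1) ^ (n * Suc i)) ((st n ^^ Suc i) (fc (n - i) t))"
      unfolding st_funpow_eq by (simp flip: power_mult_distrib)
    note e = this
    have "cn n (fscale ((- 1) ^ Suc n) (last_delta ((st (Suc n) ^^ Suc i) t))) =
        fscale ((- 1) ^ Suc n) (fscale ((- 1) ^ (Suc n * Suc i)) (cn n ((tau ^^ Suc i) (fc (n - i) t))))"
      unfolding st_funpow_eq[where n = "Suc n"] last_delta_simps last_delta_tau_funpow[OF t that] cn_simps ..
    also have "\<dots> = fscale ((- 1) ^ Suc n) (fscale ((- 1) ^ (Suc n * Suc i))
        (fscale ((- 1) ^ (n * Suc i)) (cn n (fc (n - i) t))))"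
      unfolding e cn_simps cn_funpow[OF f] ..
    also have "\<dots> = fscale ((- 1) ^ Suc n * ((- 1) ^ (Suc n * Suc i) * (- 1) ^ (n * Suc i))) (cn n (fc (n - i) t))"
      by (simp only: fscale.scale_scale mult.assoc)
    also have "(- 1 :: 'k) ^ Suc n * ((- 1) ^ (Suc n * Suc i) * (- 1) ^ (n * Suc i)) = (- 1) ^ (n - i)"
    proof -
      have "even (Suc n + (Suc n * Suc i + n * Suc i)) \<longleftrightarrow> even (n - i)"
        using that by auto
      then show ?thesis unfolding power_add[symmetric] by (simp add: uminus_power_if)
    qed
    finally show ?thesis .
  qed
  moreover have "cn n (fscale ((- 1) ^ Suc n) (last_delta ((st (Suc n) ^^ Suc (Suc n)) t))) =
      fscale ((- 1) ^ Suc n) (cn n (last_delta t))"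
    using st_cyclic[OF t] by (simp add: cn_simps)
  ultimately have "cn n (fscale ((- 1) ^ Suc n) (last_delta ?N)) =
      (\<Sum>i\<le>n. fscale ((- 1) ^ (n - i)) (cn n (fc (n - i) t))) + fscale ((- 1) ^ Suc n) (cn n (last_delta t))"
    unfolding shift by (simp add: last_delta_simps cn_simps fscale.scale_sum_right fscale.scale_right_distrib
        del: funpow.simps)
  also have "(\<Sum>i\<le>n. fscale ((- 1) ^ (n - i)) (cn n (fc (n - i) t))) = (\<Sum>i\<le>n. fscale ((- 1) ^ i) (cn n (fc i t)))"
    by (rule sum.reindex_bij_witness[where i = "\<lambda>i. n - i" and j = "\<lambda>i. n - i"]) auto
  finally have 3: "cn n (fscale ((- 1) ^ Suc n) (last_delta ?N)) = cn n (bd (Suc n) t)"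
    by (simp add: bd_def bp_def cn_simps lessThan_Suc_atMost del: sum.lessThan_Suc)
  \<comment> \<open>With X the norm of b t, the three computations give (n + 2) X = (n + 1) b' N t +
    X, and n + 1 is invertible.\<close>
  have "cn n (bd (Suc n) ?N) = cn n (bp (Suc n) ?N) + cn n (fscale ((- 1) ^ Suc n) (last_delta ?N))"
    by (simp add: bd_def[of _ ?N] cn_simps)
  also have "cn n (bd (Suc n) ?N) = fscale (of_nat (Suc n)) (cn n (bd (Suc n) t)) + cn n (bd (Suc n) t)"
    unfolding 1 of_nat_Suc[of "Suc n"] fscale.scale_left_distrib by (simp only: fscale.scale_one add.commute)
  finally have "fscale (of_nat (Suc n)) (cn n (bd (Suc n) t)) = fscale (of_nat (Suc n)) (bp (Suc n) ?N)"
    unfolding 2 3 by (simp only: add_right_cancel)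
  then show ?thesis using of_nat_neq_0[of n, where 'a = 'k] by (simp only: fscale.scale_cancel_left) simp
qed

text \<open>Appending the unit lifts t to the resolution, where b' squares to zero, and
  \<open>last_delta\<close> carries this back.\<close>

lemma bd_bd:
  assumes t: "t \<in> tens (Suc (Suc n))"
  shows "bd (Suc n) (bd (Suc (Suc n)) t) = 0"
proof -
  define w where "w = t * emb \<e>"
  have w: "w \<in> tens (Suc (Suc (Suc n)))" "last_delta w = t"
    unfolding w_def by (intro tens_emb_snoc t) (simp add: last_delta_snoc del: emb_single)
  show ?thesis
    using last_delta_bp[OF w(1)] last_delta_bp[OF tens_bp[OF w(1)]] bp_bp[OF w(1)] w(2)
    by (simp add: last_delta_simps)
qed

section \<open>The double complex and exactness of its columns\<close>

definition vd :: "int \<Rightarrow> nat \<Rightarrow> (idx list \<Rightarrow>\<^sub>0 'k) \<Rightarrow> (idx list \<Rightarrow>\<^sub>0 'k)"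
  where "vd p r x = (if even p then bd r x else - bp r x)"

definition hd' :: "int \<Rightarrow> nat \<Rightarrow> (idx list \<Rightarrow>\<^sub>0 'k) \<Rightarrow> (idx list \<Rightarrow>\<^sub>0 'k)"
  where "hd' p r x = (if odd p then x - st r x else cn r x)"

definition td :: "int \<Rightarrow> (nat \<Rightarrow> idx list \<Rightarrow>\<^sub>0 'k) \<Rightarrow> nat \<Rightarrow> (idx list \<Rightarrow>\<^sub>0 'k)"
  where "td n z r = vd (n - 1 - int r) (Suc r) (z (Suc r)) + hd' (n - int r) r (z r)"

lemma linear_vd [lin]: "linear_map fscale f \<Longrightarrow> linear_map fscale (\<lambda>x. vd p r (f x))"
  unfolding vd_def by (intro lin)

lemma linear_hd' [lin]: "linear_map fscale f \<Longrightarrow> linear_map fscale (\<lambda>x. hd' p r (f x))"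
  unfolding hd'_def by (intro lin)

lemmas vd_simps = linear_map_simps[OF linear_vd[OF linear_map_id]]
lemmas hd'_simps = linear_map_simps[OF linear_hd'[OF linear_map_id]]

lemma tens_hd': "t \<in> tens r \<Longrightarrow> hd' p r t \<in> tens r"
  unfolding hd'_def by (auto intro: tens_closed tens_st tens_cn)

lemma vd_vd: "t \<in> tens (Suc (Suc r)) \<Longrightarrow> vd p (Suc r) (vd p (Suc (Suc r)) t) = 0"
  by (simp add: vd_def bd_bd bp_bp bp_simps)

lemma hd'_hd':
  assumes "t \<in> tens r"
  shows "hd' (p - 1) r (hd' p r t) = 0"
  using cn_st[OF assms] st_cn[OF assms] by (auto simp: hd'_def cn_simps)

lemma vd_hd':
  assumes "t \<in> tens (Suc r)"
  shows "vd (p - 1) (Suc r) (hd' p (Suc r) t) = - hd' p r (vd p (Suc r) t)"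
  using bd_one_minus_st[OF assms] bp_cn[OF assms] by (auto simp: vd_def hd'_def st_simps)

lemma vd_0 [simp]: "t \<in> tens 0 \<Longrightarrow> vd p 0 t = 0"
  by (rule tens_0_eqI[where sc = fscale and f = "vd p 0" and g = "\<lambda>_. 0"])
    (intro lin | assumption | simp add: vd_def bd_def)+

lemma td_td:
  assumes "z r \<in> tens r" "z (Suc r) \<in> tens (Suc r)" "z (Suc (Suc r)) \<in> tens (Suc (Suc r))"
  shows "td (n - 1) (td n z) r = 0"
proof -
  define p where "p = n - 1 - 1 - int r"
  have p: "n - 1 - 1 - int r = p" "n - 1 - int r = p + 1" "n - 1 - int (Suc r) = p"
    "n - int (Suc r) = p + 1" "n - int r = p + 2"
    by (simp_all add: p_def)
  have "td (n - 1) (td n z) r = vd p (Suc r) (td n z (Suc r)) + hd' (p + 1) r (td n z r)"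
    "td n z (Suc r) = vd p (Suc (Suc r)) (z (Suc (Suc r))) + hd' (p + 1) (Suc r) (z (Suc r))"
    "td n z r = vd (p + 1) (Suc r) (z (Suc r)) + hd' (p + 2) r (z r)"
    by (simp_all only: td_def p)
  moreover have "p + 2 - 1 = p + 1" by simp
  note hh = hd'_hd'[OF assms(1), of "p + 2", unfolded this]
  ultimately show ?thesis
    using vd_vd[OF assms(3), of p] hh vd_hd'[OF assms(2), of "p + 1"]
    by (simp add: vd_simps hd'_simps)
qed

text \<open>Exactness of column p at row r. It holds in odd columns, and in even columns away from
  rows 1 and 2.\<close>

definition exact_at :: "int \<Rightarrow> nat \<Rightarrow> bool"
  where "exact_at p r \<longleftrightarrow> (\<forall>c\<in>tens r. vd p r c = 0 \<longrightarrow> (\<exists>y\<in>tens (Suc r). vd p (Suc r) y = c))"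

lemma exact_at_odd: "odd p \<Longrightarrow> exact_at p r"
  unfolding exact_at_def vd_def
proof (intro ballI impI)
  fix c :: "idx list \<Rightarrow>\<^sub>0 'k" assume p: "odd p" and c: "c \<in> tens r" "(if even p then bd r c else - bp r c) = 0"
  then obtain y where "y \<in> tens (Suc r)" "bp (Suc r) y = c" using bp_exact[of c r] by auto
  then show "\<exists>y\<in>tens (Suc r). (if even p then bd (Suc r) y else - bp (Suc r) y) = c"
    using p by (intro bexI[of _ "- y"]) (auto simp: bp_simps intro: tens_closed)
qed

lemma exact_at_0: "exact_at p 0"
proof (cases "even p")
  case True
  then show ?thesis using homology_0 by (auto simp: exact_at_def vd_def)
qed (rule exact_at_odd)

lemma exact_at_ge_3: "r \<ge> 3 \<Longrightarrow> exact_at p r"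
proof (cases "even p")
  assume "r \<ge> 3" and p: "even p"
  obtain n where n: "r = Suc (Suc (Suc n))"
    using le_Suc_ex[OF \<open>r \<ge> 3\<close>] by (auto simp: numeral_3_eq_3)
  show ?thesis
    unfolding exact_at_def vd_def n using homology_ge_3 p by simp
qed (rule exact_at_odd)

end

subsection \<open>Detecting the classes in degrees 1 and 2\<close>

context SLq_generic
begin

definition eval1 :: "((idx \<Rightarrow>\<^sub>0 'k) \<Rightarrow> 'k) \<Rightarrow> (idx list \<Rightarrow>\<^sub>0 'k) \<Rightarrow> 'k"
  where "eval1 f = lin_ext (*) (\<lambda>bs. if length bs = 1 then f (vec (hd bs)) else 0)"

definition eval2 :: "((idx \<Rightarrow>\<^sub>0 'k) \<Rightarrow> 'k) \<Rightarrow> ((idx \<Rightarrow>\<^sub>0 'k) \<Rightarrow> 'k) \<Rightarrow> (idx list \<Rightarrow>\<^sub>0 'k) \<Rightarrow> 'k"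
  where "eval2 f g = lin_ext (*) (\<lambda>bs. if length bs = 2 then f (vec (bs ! 0)) * g (vec (bs ! 1)) else 0)"

lemma linear_eval1 [lin]: "linear_map fscale h \<Longrightarrow> linear_map (*) (\<lambda>x. eval1 f (h x))"
  and linear_eval2 [lin]: "linear_map fscale h \<Longrightarrow> linear_map (*) (\<lambda>x. eval2 f g (h x))"
  unfolding eval1_def eval2_def by (intro linear_map_comp[OF linear_map_lin_ext] lin; assumption)+

lemmas eval1_simps = linear_map_simps[OF linear_eval1[OF linear_map_id]]
lemmas eval2_simps = linear_map_simps[OF linear_eval2[OF linear_map_id]]

lemma eval1_emb:
  assumes "linear_map (*) f"
  shows "eval1 f (emb h) = f h"
  by (rule linear_map_eqI[where sc = "(*)" and f = "\<lambda>h. eval1 f (emb h)", OF _ assms])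
    (intro lin | simp add: eval1_def)+

lemma eval2_emb:
  assumes f: "linear_map (*) f" and g: "linear_map (*) g"
  shows "eval2 f g (emb a * emb b) = f a * g b"
proof (rule linear_map_eqI[where sc = "(*)" and f = "\<lambda>b. eval2 f g (emb a * emb b)"])
  fix c
  show "eval2 f g (emb a * emb (vec c)) = f a * g (vec c)"
    by (rule linear_map_eqI[where sc = "(*)" and f = "\<lambda>a. eval2 f g (emb a * emb (vec c))"])
      (intro lin f linear_map_times_left | simp add: eval2_def vec_mult)+
qed (intro lin g linear_map_times_right)+

text \<open>A derivation with the counit on the left and \<delta> on the right is a Hochschild
  1-cocycle.\<close>

lemma eval1_bd:
  assumes f: "linear_map (*) f" "\<And>a b. f (a \<star> b) = chi 1 a * f b + f a * chi q b"
    and t: "t \<in> tens (Suc (Suc 0))"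
  shows "eval1 f (bd (Suc (Suc 0)) t) = 0"
proof (rule tens_Suc_eqI[where sc = "(*)" and f = "\<lambda>t. eval1 f (bd (Suc (Suc 0)) t)" and g = "\<lambda>_. 0", OF _ _ t])
  fix s :: "idx list \<Rightarrow>\<^sub>0 'k" and h assume s: "s \<in> tens (Suc 0)"
  show "eval1 f (bd (Suc (Suc 0)) (s * emb h)) = 0"
  proof (rule tens_Suc_eqI[where sc = "(*)" and f = "\<lambda>s. eval1 f (bd (Suc (Suc 0)) (s * emb h))" and g = "\<lambda>_. 0", OF _ _ s])
    fix r :: "idx list \<Rightarrow>\<^sub>0 'k" and g assume r: "r \<in> tens 0"
    have e: "eval1 f (bd (Suc (Suc 0)) (emb g * emb h)) = 0"
      by (simp add: eval1_simps eval1_emb[OF f(1)] bd_def bp_2_emb last_delta_snoc f(2)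
          del: fscale_single emb_single)
    show "eval1 f (bd (Suc (Suc 0)) (r * emb g * emb h)) = 0"
      by (subst tens_0[OF r]) (simp only: mult_fscale_left mult_1_left bd_simps eval1_simps e mult_zero_right)
  qed (intro lin)+
qed (intro lin)+

text \<open>A cup product of 1-cocycles is a 2-cocycle when the characters match in the middle; here
  the middle character is the counit.\<close>

lemma eval2_bd:
  assumes f: "linear_map (*) f" "\<And>a b. f (a \<star> b) = chi 1 a * f b + f a * chi 1 b"
    and g: "linear_map (*) g" "\<And>a b. g (a \<star> b) = chi 1 a * g b + g a * chi q b"
    and t: "t \<in> tens (Suc (Suc (Suc 0)))"
  shows "eval2 f g (bd (Suc (Suc (Suc 0))) t) = 0"
proof -
  let ?B = "\<lambda>t. eval2 f g (bd (Suc (Suc (Suc 0))) t)"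
  have bp3: "bp (Suc (Suc (Suc 0))) (emb a * emb b * emb c) =
      fscale (chi 1 a) (emb b * emb c) - emb (a \<star> b) * emb c + emb a * emb (b \<star> c)" for a b c
    using bp_snoc[OF tens_emb_snoc[OF tens_emb], of a b c]
    by (simp add: bp_2_emb Rm_snoc left_diff_distrib mult_fscale_left del: fscale_single emb_single)
  have "?B (emb a * emb b * emb c) = 0" for a b c
    unfolding bd_def bp3 last_delta_snoc eval2_simps eval2_emb[OF f(1) g(1)] f(2) g(2)
    by (simp add: algebra_simps)
  then have 1: "?B (fscale k 1 * emb a * emb b * emb c) = 0" for k a b c
    by (simp add: mult_fscale_left bd_simps eval2_simps del: fscale_single emb_single)
  have 2: "?B (r * emb a * emb b * emb c) = 0" if "r \<in> tens 0" for r a b c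
    by (subst tens_0[OF that]) (rule 1)
  have 3: "?B (s * emb b * emb c) = 0" if "s \<in> tens (Suc 0)" for s b c
    by (rule tens_Suc_eqI[where sc = "(*)" and f = "\<lambda>s. ?B (s * emb b * emb c)" and g = "\<lambda>_. 0", OF _ _ that 2])
      (intro lin)+
  have 4: "?B (s * emb c) = 0" if "s \<in> tens (Suc (Suc 0))" for s c
    by (rule tens_Suc_eqI[where sc = "(*)" and f = "\<lambda>s. ?B (s * emb c)" and g = "\<lambda>_. 0", OF _ _ that 3])
      (intro lin)+
  show ?thesis
    by (rule tens_Suc_eqI[where sc = "(*)" and f = ?B and g = "\<lambda>_. 0", OF _ _ t 4]) (intro lin)+
qed

lemma linear_phis: "linear_map (*) phi_u" "linear_map (*) phi_v" "linear_map (*) deg_x"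
  by (rule linear_phi[OF linear_map_id])+

text \<open>Pairing with \<open>deg_x\<close> in the first factor leaves only y \<otimes> u in
  \<open>Bu\<close> and x \<otimes> v in \<open>Bv\<close>. As y and x have degrees -1 and 1, the
  values are 1 and -1.\<close>

lemma B_independent:
  assumes "y \<in> tens (Suc (Suc (Suc 0)))" "fscale a Bu + fscale b Bv = bd (Suc (Suc (Suc 0))) y"
  shows "a = 0 \<and> b = 0"
proof -
  have "eval2 deg_x phi_u (fscale a Bu + fscale b Bv) = 0"
    "eval2 deg_x phi_v (fscale a Bu + fscale b Bv) = 0"
    unfolding assms(2)
    by (intro eval2_bd linear_phis deg_x_mulA phi_u_mulA phi_v_mulA assms(1))+
  moreover have "phi_u \<e> = 0" "phi_v \<e> = 0" by simp_all
  ultimately show ?thesis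
    by (simp add: Bu_def Bv_def eval2_simps eval2_emb linear_phis del: emb_single)
qed

lemma coef_gens:
  "coef [False] [False] = gx" "coef [False] [True] = gu" "coef [True] [False] = gv" "coef [True] [True] = gy"
  by (simp_all add: coef_single ev_def)

lemma antip_gens:
  "antip gx = gy" "antip gy = gx" "antip gu = fscale (- q) gu" "antip gv = fscale (- inverse q) gv"
  using antip_coef[of "[False]" "[False]"] antip_coef[of "[True]" "[True]"]
    antip_coef[of "[False]" "[True]"] antip_coef[of "[True]" "[False]"]
  by (simp_all add: coef_gens sign_weight_def field_simps)

text \<open>Here \<delta>(y) S(u) = q^-1 (-q u) and \<delta>(x) S(v) = q (-q^-1 v): q cancels, the
  signed operator fixes u and v, and the norm doubles them.\<close>

lemma tau_gens: "tau (emb gu) = - emb gu" "tau (emb gv) = - emb gv"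
  using tau_snoc_coef[of "[False]" "[True]" 1] tau_snoc_coef[of "[True]" "[False]" 1]
  by (simp_all add: coef_gens antip_gens emb_simps del: emb_single fscale_single)

lemma cn_gens: "cn (Suc 0) (emb gu) = fscale 2 (emb gu)" "cn (Suc 0) (emb gv) = fscale 2 (emb gv)"
  by (simp_all add: cn_def st_def tau_gens fscale_2 del: emb_single fscale_single)

lemma one_minus_st:
  "emb gu * emb \<e> - st (Suc (Suc 0)) (emb gu * emb \<e>) = Bu"
  "emb gv * emb \<e> - st (Suc (Suc 0)) (emb gv * emb \<e>) = Bv"
proof -
  have L: "Lm \<e> t = t" if "t \<in> tens (Suc n)" for t n
    by (rule tens_eqI[where sc = fscale and f = "Lm \<e>", OF _ _ that])
      (intro lin | auto simp: length_Suc_conv vec_Cons Lm_Cons simp del: emb_single)+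
  have t: "tau (s * emb \<e>) = coact s" if "s \<in> tens n" for s n
    using tau_snoc_coef[of "[]" "[]" s] L[OF tens_coact[OF that]] by (simp del: emb_single)
  have "coact (emb gu) = emb gy * emb gu + emb (fscale (- q) gu) * emb gy"
    "coact (emb gv) = emb (fscale (- inverse q) gv) * emb gx + emb gx * emb gv"
    using coact_snoc_coef[of "[False]" "[True]" 1] coact_snoc_coef[of "[True]" "[False]" 1]
    by (simp_all add: coef_gens antip_gens sum_bool_lists_1 del: emb_single fscale_single)
  then show "emb gu * emb \<e> - st (Suc (Suc 0)) (emb gu * emb \<e>) = Bu"
    "emb gv * emb \<e> - st (Suc (Suc 0)) (emb gv * emb \<e>) = Bv"
    by (simp_all add: st_def t[OF tens_emb] Bu_def Bv_def emb_simps mult_fscale_left del: emb_single fscale_single)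
qed

lemma bd_gens: "bd (Suc 0) (emb gu) = 0" "bd (Suc 0) (emb gv) = 0"
  using last_delta_snoc[of 1 gu] last_delta_snoc[of 1 gv]
  by (simp_all add: bd_def bp_1_emb del: emb_single)

subsection \<open>Solving for a primitive\<close>

context
  fixes R :: "nat set" and n :: int and z :: "nat \<Rightarrow> idx list \<Rightarrow>\<^sub>0 'k"
  assumes down: "\<And>r. Suc r \<in> R \<Longrightarrow> r \<in> R"
    and z: "\<And>r. r \<in> R \<Longrightarrow> z r \<in> tens r"
    and cycle: "\<And>r. Suc r \<in> R \<Longrightarrow> td n z r = 0"
begin

text \<open>Admissible as the entry of a primitive in row r: what remains of \<open>z r\<close>
  after the horizontal part is a vertical cycle, so only column homology obstructs the next
  entry.\<close>

definition adm :: "nat \<Rightarrow> (idx list \<Rightarrow>\<^sub>0 'k) \<Rightarrow> bool"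
  where "adm r x \<longleftrightarrow> x \<in> tens r \<and> (r \<in> R \<longrightarrow> vd (n - int r) r (z r - hd' (n + 1 - int r) r x) = 0)"

definition solves :: "nat \<Rightarrow> (idx list \<Rightarrow>\<^sub>0 'k) \<Rightarrow> (idx list \<Rightarrow>\<^sub>0 'k) \<Rightarrow> bool"
  where "solves r x y \<longleftrightarrow> (r \<in> R \<longrightarrow> vd (n - int r) (Suc r) y + hd' (n + 1 - int r) r x = z r)"

lemma adm_0: "adm 0 0"
  using z[of 0] by (auto simp: adm_def tens_closed hd'_simps)

text \<open>The zigzag argument: with the equation in row r and the cycle condition on z, the
  residue in row r + 1 is a vertical cycle, because the differentials anticommute and the horizontal
  one squares to zero.\<close>

lemma adm_Suc:
  assumes x: "x \<in> tens r" and y: "y \<in> tens (Suc r)" and eq: "solves r x y"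
  shows "adm (Suc r) y"
proof (cases "Suc r \<in> R")
  case True
  define p where "p = n - 1 - int r"
  have p: "n - 1 - int r = p" "n - int (Suc r) = p" "n + 1 - int (Suc r) = p + 1" "n - int r = p + 1"
    "n + 1 - int r = p + 2" by (simp_all add: p_def)
  have "vd p (Suc r) (z (Suc r)) + hd' (p + 1) r (z r) = 0"
    using cycle[OF True] by (simp only: td_def p)
  then have 1: "vd p (Suc r) (z (Suc r)) = - hd' (p + 1) r (z r)"
    by (rule iffD2[OF eq_neg_iff_add_eq_0])
  have "vd (p + 1) (Suc r) y = z r - hd' (p + 2) r x"
    using eq down[OF True] unfolding solves_def p by (simp add: eq_diff_eq)
  moreover have "p + 1 - 1 = p" "p + 2 - 1 = p + 1" by simp_all
  note v = vd_hd'[OF y, of "p + 1", unfolded this] and h = hd'_hd'[OF x, of "p + 2", unfolded this]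
  ultimately have "vd p (Suc r) (hd' (p + 1) (Suc r) y) = - hd' (p + 1) r (z r)"
    by (simp add: hd'_simps)
  then show ?thesis using 1 y unfolding adm_def p by (simp add: vd_simps)
qed (use y in \<open>simp add: adm_def\<close>)

lemma solve_step:
  assumes x: "adm r x" and ex: "exact_at (n - int r) r"
  shows "\<exists>y. adm (Suc r) y \<and> solves r x y"
proof (cases "r \<in> R")
  case True
  then have "z r - hd' (n + 1 - int r) r x \<in> tens r" "vd (n - int r) r (z r - hd' (n + 1 - int r) r x) = 0"
    using x z by (auto simp: adm_def intro: tens_closed tens_hd')
  then obtain y where y: "y \<in> tens (Suc r)" "vd (n - int r) (Suc r) y = z r - hd' (n + 1 - int r) r x"
    using ex unfolding exact_at_def by blast
  then have "solves r x y" by (simp add: solves_def)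
  then show ?thesis using adm_Suc[of x r y] x y(1) by (auto simp: adm_def)
next
  case False
  \<comment> \<open>R is closed downwards, so row r + 1 is outside R as well and imposes no
    equation.\<close>
  then have "adm (Suc r) 0" using down[of r] by (auto simp: adm_def tens_closed)
  then show ?thesis using False by (auto simp: solves_def)
qed

text \<open>Dependent choice covers the periodic complex, where infinitely many rows have to be
  solved.\<close>

lemma solve_from:
  assumes x: "adm k x" and ex: "\<And>r. r \<ge> k \<Longrightarrow> exact_at (n - int r) r"
  shows "\<exists>f. f k = x \<and> (\<forall>r\<ge>k. adm r (f r) \<and> solves r (f r) (f (Suc r)))"
proof -
  have "\<exists>g. \<forall>i. (adm (k + i) (g i) \<and> (i = 0 \<longrightarrow> g i = x)) \<and> solves (k + i) (g i) (g (Suc i))"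
  proof (rule dependent_nat_choice)
    show "\<exists>y. adm (k + 0) y \<and> (0 = (0 :: nat) \<longrightarrow> y = x)" using x by auto
    fix y and i :: nat assume "adm (k + i) y \<and> (i = 0 \<longrightarrow> y = x)"
    then show "\<exists>y'. (adm (k + Suc i) y' \<and> (Suc i = 0 \<longrightarrow> y' = x)) \<and> solves (k + i) y y'"
      using solve_step[of "k + i" y] ex[of "k + i"] by auto
  qed
  then obtain g where g: "\<And>i. adm (k + i) (g i)" "g 0 = x" "\<And>i. solves (k + i) (g i) (g (Suc i))"
    by blast
  show ?thesis
  proof (intro exI[of _ "\<lambda>r. g (r - k)"] conjI allI impI)
    fix r assume "k \<le> r"
    then obtain i where "r = k + i" using le_Suc_ex by blast
    then show "adm r (g (r - k))" "solves r (g (r - k)) (g (Suc r - k))"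
      using g(1,3)[of i] by (simp_all add: Suc_diff_le)
  qed (simp add: g)
qed

lemma solves_td: "r \<in> R \<Longrightarrow> solves r (w r) (w (Suc r)) \<Longrightarrow> td (n + 1) w r = z r"
proof -
  have "n + 1 - 1 - int r = n - int r" by simp
  then show "r \<in> R \<Longrightarrow> solves r (w r) (w (Suc r)) \<Longrightarrow> td (n + 1) w r = z r"
    by (simp add: solves_def td_def)
qed

text \<open>For even n the even column is met at row 2 with the obstruction spanned by
  \<open>Bu\<close> and \<open>Bv\<close>; row 1 lies in an odd column. The obstruction is removed
  by altering the entries already chosen in rows 1 and 2.\<close>

lemma total_acyclic_even:
  assumes "even n"
  shows "\<exists>w. (\<forall>r. w r \<in> tens r) \<and> (\<forall>r\<in>R. td (n + 1) w r = z r)"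
proof -
  obtain y1 where y1: "adm (Suc 0) y1" "solves 0 0 y1"
    using solve_step[OF adm_0] exact_at_0 by blast
  have "exact_at (n - int (Suc 0)) (Suc 0)" using assms by (intro exact_at_odd) simp
  then obtain y2 where y2: "adm (Suc (Suc 0)) y2" "solves (Suc 0) y1 y2"
    using solve_step[OF y1(1)] by blast
  have t: "y1 \<in> tens (Suc 0)" "y2 \<in> tens (Suc (Suc 0))" using y1 y2 by (simp_all add: adm_def)
  have "\<exists>w1 w2 w3. w1 \<in> tens (Suc 0) \<and> w2 \<in> tens (Suc (Suc 0)) \<and> w3 \<in> tens (Suc (Suc (Suc 0))) \<and>
      solves 0 0 w1 \<and> solves (Suc 0) w1 w2 \<and> solves (Suc (Suc 0)) w2 w3"
  proof (cases "Suc (Suc 0) \<in> R")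
    case False
    then have "solves (Suc (Suc 0)) y2 0" by (simp add: solves_def)
    then show ?thesis using t y1 y2 tens_closed(1) by blast
  next
    case True
    let ?c = "z (Suc (Suc 0)) - hd' (n + 1 - int (Suc (Suc 0))) (Suc (Suc 0)) y2"
    have "?c \<in> tens (Suc (Suc 0))" by (intro tens_closed tens_hd' z True t)
    moreover have "bd (Suc (Suc 0)) ?c = 0"
      using y2(1) True assms by (simp add: adm_def vd_def)
    ultimately obtain p a b where p: "p \<in> tens (Suc (Suc (Suc 0)))"
      "?c = bd (Suc (Suc (Suc 0))) p + fscale a Bu + fscale b Bv"
      using homology_2 by blast
    \<comment> \<open>The correction s satisfies (1 - t) s = a Bu + b Bv. It disturbs row 1 by - b'
      s = g, which the norm of -g/2 compensates, and b g = 0 keeps row 0 intact.\<close>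
    define g where "g = fscale a (emb gu) + fscale b (emb gv)"
    define s where "s = fscale a (emb gu * emb \<e>) + fscale b (emb gv * emb \<e>)"
    have mem: "g \<in> tens (Suc 0)" "s \<in> tens (Suc (Suc 0))"
      unfolding g_def s_def by (intro tens_closed tens_emb tens_emb_snoc)+
    have g: "bd (Suc 0) g = 0" "cn (Suc 0) g = fscale 2 g"
      by (simp_all add: g_def bd_simps bd_gens cn_simps cn_gens fscale.scale_right_distrib mult.commute
          del: emb_single fscale_single)
    have bs: "bp (Suc (Suc 0)) s = - g"
      by (simp add: s_def g_def bp_simps bp_2_emb del: emb_single fscale_single)
    have "s - st (Suc (Suc 0)) s = fscale a (emb gu * emb \<e> - st (Suc (Suc 0)) (emb gu * emb \<e>)) +
        fscale b (emb gv * emb \<e> - st (Suc (Suc 0)) (emb gv * emb \<e>))"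
      unfolding s_def by (simp add: st_simps fscale.scale_right_diff_distrib del: emb_single fscale_single)
    then have ss: "s - st (Suc (Suc 0)) s = fscale a Bu + fscale b Bv" unfolding one_minus_st .
    show ?thesis
    proof (intro exI conjI)
      show "y1 + fscale (- 1 / 2) g \<in> tens (Suc 0)" "y2 + s \<in> tens (Suc (Suc 0))"
        by (intro tens_closed t mem)+
      show "solves 0 0 (y1 + fscale (- 1 / 2) g)"
        using y1(2) assms g by (simp add: solves_def vd_def bd_simps)
      show "solves (Suc 0) (y1 + fscale (- 1 / 2) g) (y2 + s)"
        using y2(2) assms g bs by (simp add: solves_def vd_def hd'_def bp_simps cn_simps algebra_simps)
      have "s = st (Suc (Suc 0)) s + (fscale a Bu + fscale b Bv)"
        using ss by (simp add: algebra_simps)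
      then have "hd' (n + 1 - int (Suc (Suc 0))) (Suc (Suc 0)) s = fscale a Bu + fscale b Bv"
        using assms ss by (simp add: hd'_def)
      then show "solves (Suc (Suc 0)) (y2 + s) p"
        using p(2) assms unfolding solves_def hd'_simps by (simp add: vd_def algebra_simps)
    qed (rule p)
  qed
  then obtain w1 w2 w3 where w: "w1 \<in> tens (Suc 0)" "w2 \<in> tens (Suc (Suc 0))" "w3 \<in> tens (Suc (Suc (Suc 0)))"
    "solves 0 0 w1" "solves (Suc 0) w1 w2" "solves (Suc (Suc 0)) w2 w3" by blast
  have "adm (Suc (Suc (Suc 0))) w3" by (rule adm_Suc[OF w(2,3,6)])
  then obtain f where f: "f (Suc (Suc (Suc 0))) = w3"
    "\<And>r. r \<ge> Suc (Suc (Suc 0)) \<Longrightarrow> adm r (f r) \<and> solves r (f r) (f (Suc r))"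
    using solve_from[of "Suc (Suc (Suc 0))" w3] exact_at_ge_3 by (auto simp: numeral_3_eq_3)
  define w where "w r = (if r = 0 then 0 else if r = Suc 0 then w1 else if r = Suc (Suc 0) then w2 else f r)" for r
  have "solves r (w r) (w (Suc r)) \<and> w r \<in> tens r" for r
  proof -
    consider "r = 0" | "r = Suc 0" | "r = Suc (Suc 0)" | "r \<ge> Suc (Suc (Suc 0))" by linarith
    then show ?thesis
      by cases (use w f in \<open>auto simp: w_def adm_def tens_closed\<close>)
  qed
  then show ?thesis using solves_td by blast
qed

text \<open>For odd n the obstruction sits in row 1 and is a combination of u and v. The cycle
  conditions in rows 1 and 2 force its image under Connes' operator to be a boundary, so it
  vanishes; this involves the entries of z up to row 3.\<close>

lemma total_acyclic_odd:
  assumes n: "odd n" and R3: "Suc (Suc (Suc 0)) \<in> R"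
  shows "\<exists>w. (\<forall>r. w r \<in> tens r) \<and> (\<forall>r\<in>R. td (n + 1) w r = z r)"
proof -
  have R: "Suc (Suc 0) \<in> R" "Suc 0 \<in> R" "0 \<in> R" using R3 down by blast+
  obtain y1 where y1: "adm (Suc 0) y1" "solves 0 0 y1"
    using solve_step[OF adm_0] exact_at_0 by blast
  have t: "y1 \<in> tens (Suc 0)" using y1 by (simp add: adm_def)
  let ?c = "z (Suc 0) - hd' (n + 1 - int (Suc 0)) (Suc 0) y1"
  have "?c \<in> tens (Suc 0)" by (intro tens_closed tens_hd' z R t)
  moreover have "bd (Suc 0) ?c = 0" using y1(1) R n by (simp add: adm_def vd_def)
  ultimately obtain p a b where p: "p \<in> tens (Suc (Suc 0))"
    "?c = bd (Suc (Suc 0)) p + fscale a (emb gu) + fscale b (emb gv)"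
    using homology_1 by blast
  define g where "g = fscale a (emb gu) + fscale b (emb gv)"
  define s where "s = fscale a (emb gu * emb \<e>) + fscale b (emb gv * emb \<e>)"
  have mem: "g \<in> tens (Suc 0)" "s \<in> tens (Suc (Suc 0))"
    unfolding g_def s_def by (intro tens_closed tens_emb tens_emb_snoc)+
  have cg: "cn (Suc 0) g = fscale 2 g"
    by (simp add: g_def cn_simps cn_gens fscale.scale_right_distrib mult.commute del: emb_single fscale_single)
  have bs: "bp (Suc (Suc 0)) s = - g"
    by (simp add: s_def g_def bp_simps bp_2_emb del: emb_single fscale_single)
  have "s - st (Suc (Suc 0)) s = fscale a (emb gu * emb \<e> - st (Suc (Suc 0)) (emb gu * emb \<e>)) +
      fscale b (emb gv * emb \<e> - st (Suc (Suc 0)) (emb gv * emb \<e>))"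
    unfolding s_def by (simp add: st_simps fscale.scale_right_diff_distrib del: emb_single fscale_single)
  then have ss: "s - st (Suc (Suc 0)) s = fscale a Bu + fscale b Bv" unfolding one_minus_st .
  let ?S = "st (Suc (Suc 0))"
  have z1: "z (Suc 0) = (y1 - st (Suc 0) y1) + bd (Suc (Suc 0)) p + g"
    using p(2) n by (simp add: hd'_def g_def algebra_simps)
  \<comment> \<open>The cycle condition in row 1 determines the entry of z in row 2 up to an image
    of b', by exactness of b'.\<close>
  have "bp (Suc (Suc 0)) (z (Suc (Suc 0))) = cn (Suc 0) (z (Suc 0))"
    using cycle[OF R(1)] n by (simp add: td_def vd_def hd'_def)
  also have "\<dots> = bp (Suc (Suc 0)) (cn (Suc (Suc 0)) p - fscale 2 s)"
    by (simp add: z1 cn_simps cn_st[OF t] cg bp_simps bp_cn[OF p(1)] bs)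
  finally have "bp (Suc (Suc 0)) (z (Suc (Suc 0)) - (cn (Suc (Suc 0)) p - fscale 2 s)) = 0"
    by (simp add: bp_simps)
  moreover have "z (Suc (Suc 0)) - (cn (Suc (Suc 0)) p - fscale 2 s) \<in> tens (Suc (Suc 0))"
    by (intro tens_closed z R tens_cn p mem)
  ultimately obtain y where y: "y \<in> tens (Suc (Suc (Suc 0)))"
    "bp (Suc (Suc (Suc 0))) y = z (Suc (Suc 0)) - (cn (Suc (Suc 0)) p - fscale 2 s)"
    using bp_exact by blast
  have z2: "z (Suc (Suc 0)) = bp (Suc (Suc (Suc 0))) y + cn (Suc (Suc 0)) p - fscale 2 s"
    using y(2) by simp
  have "bd (Suc (Suc (Suc 0))) (z (Suc (Suc (Suc 0)))) + (z (Suc (Suc 0)) - ?S (z (Suc (Suc 0)))) = 0"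
    using cycle[OF R3] n by (simp add: td_def vd_def hd'_def)
  moreover have "z (Suc (Suc 0)) - ?S (z (Suc (Suc 0))) =
      (bp (Suc (Suc (Suc 0))) y - ?S (bp (Suc (Suc (Suc 0))) y)) - fscale 2 (s - ?S s)"
    unfolding z2 by (simp add: st_simps st_cn[OF p(1)] fscale.scale_right_diff_distrib algebra_simps)
  \<comment> \<open>Norms vanish under 1 - t, and (1 - t) b' y = b (1 - t) y is a boundary; only
    twice the image of the obstruction is left.\<close>
  ultimately have "fscale (2 * a) Bu + fscale (2 * b) Bv = bd (Suc (Suc (Suc 0)))
      (z (Suc (Suc (Suc 0))) + (y - st (Suc (Suc (Suc 0))) y))"
    unfolding ss bd_one_minus_st[OF y(1), symmetric]
    by (simp add: bd_simps fscale.scale_right_distrib algebra_simps)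
  then have "2 * a = 0 \<and> 2 * b = 0"
    by (rule B_independent[rotated]) (intro tens_closed z R3 tens_st y)
  then have "solves (Suc 0) y1 p" using p(2) n by (simp add: solves_def vd_def algebra_simps)
  then have "adm (Suc (Suc 0)) p" by (rule adm_Suc[OF t p(1)])
  moreover have "exact_at (n - int r) r" if "r \<ge> Suc (Suc 0)" for r
  proof (cases "r = Suc (Suc 0)")
    case False
    then show ?thesis using that by (intro exact_at_ge_3) simp
  qed (use n in \<open>intro exact_at_odd, simp\<close>)
  ultimately obtain f where f: "f (Suc (Suc 0)) = p"
    "\<And>r. r \<ge> Suc (Suc 0) \<Longrightarrow> adm r (f r) \<and> solves r (f r) (f (Suc r))"
    using solve_from[of "Suc (Suc 0)" p] by blast
  define w where "w r = (if r = 0 then 0 else if r = Suc 0 then y1 else f r)" for r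
  have "solves r (w r) (w (Suc r)) \<and> w r \<in> tens r" for r
  proof -
    consider "r = 0" | "r = Suc 0" | "r \<ge> Suc (Suc 0)" by linarith
    then show ?thesis
      by cases (use t y1 f \<open>solves (Suc 0) y1 p\<close> in \<open>auto simp: w_def adm_def tens_closed\<close>)
  qed
  then show ?thesis using solves_td by blast
qed

end

text \<open>Applying f to the antipode axiom gives f(h) plus the sum of f(S(h^(1))) \<delta>(h^(2))
  equal to 0. So \<tau> reverses f in degree 1, and the signed operator fixes it.\<close>

lemma eval1_st:
  assumes f: "linear_map (*) f" "\<And>a b. f (a \<star> b) = chi 1 a * f b + f a * chi q b" "f \<e> = 0"
    and t: "t \<in> tens (Suc 0)"
  shows "eval1 f (st (Suc 0) t) = eval1 f t"
proof (rule tens_Suc_coefI[where sc = "(*)" and f = "\<lambda>t. eval1 f (st (Suc 0) t)", OF _ _ t])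
  fix s :: "idx list \<Rightarrow>\<^sub>0 'k" and I J :: "bool list" assume s: "s \<in> tens 0" and len: "length I = length J"
  have "0 = f (fscale (kronecker I J) \<e>)"
    using f by (simp add: linear_map_scale[OF f(1)] del: fscale_single)
  also have "\<dots> = (\<Sum>K\<in>bool_lists (length I). f (antip (coef I K) \<star> coef K J))"
    unfolding antipode_left[OF len, symmetric] by (rule linear_map_sum[OF f(1)])
  also have "\<dots> = (\<Sum>K\<in>bool_lists (length I). (if I = K then f (coef K J) else 0) +
      (if K = J then f (antip (coef I K)) * weight q K else 0))"
    using len by (intro sum.cong refl) (simp add: f(2) chi_antip chi_coef length_bool_lists kronecker_def)
  also have "\<dots> = f (coef I J) + f (antip (coef I J)) * weight q J"
  proof -
    have "I \<in> bool_lists (length I)" "J \<in> bool_lists (length I)" using len by (simp_all add: bool_lists_def)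
    then show ?thesis by (simp add: sum.distrib)
  qed
  finally have "weight q J * f (antip (coef I J)) = - f (coef I J)"
    by (simp add: eq_neg_iff_add_eq_0 algebra_simps)
  then have "eval1 f (st (Suc 0) (1 * emb (coef I J))) = eval1 f (1 * emb (coef I J))"
    unfolding st_def tau_snoc_coef[OF len]
    by (simp add: eval1_simps eval1_emb[OF f(1)] del: emb_single fscale_single)
  then show "eval1 f (st (Suc 0) (s * emb (coef I J))) = eval1 f (s * emb (coef I J))"
    by (subst (1 2) tens_0[OF s]) (simp add: mult_fscale_left st_simps eval1_simps)
qed (intro lin)+

end

section \<open>Quotient modules and their models\<close>

text \<open>\<open>models M s \<Psi> W\<close>: \<open>\<Psi>\<close> identifies the vector space \<open>M\<close> with the subspace \<open>W\<close> of a type.\<close>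

definition models :: "('k::field, 'v, 'm) module_scheme \<Rightarrow> ('k \<Rightarrow> 'w \<Rightarrow> 'w) \<Rightarrow> ('v \<Rightarrow> 'w::ab_group_add) \<Rightarrow> 'w set \<Rightarrow> bool"
  where "models M s \<Psi> W \<longleftrightarrow> bij_betw \<Psi> (carrier M) W \<and> \<zero>\<^bsub>M\<^esub> \<in> carrier M \<and> \<Psi> \<zero>\<^bsub>M\<^esub> = 0 \<and>
    (\<forall>a\<in>carrier M. \<forall>b\<in>carrier M. a \<oplus>\<^bsub>M\<^esub> b \<in> carrier M \<and> \<Psi> (a \<oplus>\<^bsub>M\<^esub> b) = \<Psi> a + \<Psi> b) \<and>
    (\<forall>c. \<forall>a\<in>carrier M. c \<odot>\<^bsub>M\<^esub> a \<in> carrier M \<and> \<Psi> (c \<odot>\<^bsub>M\<^esub> a) = s c (\<Psi> a))"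

context
  fixes M :: "('k::field, 'v, 'm) module_scheme" and s :: "'k \<Rightarrow> 'w \<Rightarrow> 'w::ab_group_add" and \<Psi> W
  assumes M: "models M s \<Psi> W" and s: "vector_space s"
begin

interpretation vector_space s by (rule s)

lemma models_inj: "a \<in> carrier M \<Longrightarrow> b \<in> carrier M \<Longrightarrow> \<Psi> a = \<Psi> b \<Longrightarrow> a = b"
  using M by (auto simp: models_def bij_betw_def inj_on_def)

lemma models_closed:
  "\<zero>\<^bsub>M\<^esub> \<in> carrier M" "a \<in> carrier M \<Longrightarrow> b \<in> carrier M \<Longrightarrow> a \<oplus>\<^bsub>M\<^esub> b \<in> carrier M"
  "a \<in> carrier M \<Longrightarrow> c \<odot>\<^bsub>M\<^esub> a \<in> carrier M" "a \<in> carrier M \<Longrightarrow> \<Psi> a \<in> W"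
  using M by (auto simp: models_def bij_betw_def)

lemma models_simps:
  "\<Psi> \<zero>\<^bsub>M\<^esub> = 0" "a \<in> carrier M \<Longrightarrow> b \<in> carrier M \<Longrightarrow> \<Psi> (a \<oplus>\<^bsub>M\<^esub> b) = \<Psi> a + \<Psi> b"
  "a \<in> carrier M \<Longrightarrow> \<Psi> (c \<odot>\<^bsub>M\<^esub> a) = s c (\<Psi> a)"
  using M by (auto simp: models_def)

lemma models_surj: "w \<in> W \<Longrightarrow> \<exists>a\<in>carrier M. \<Psi> a = w"
  using M by (auto simp: models_def bij_betw_def)

lemma models_abelian_group: "abelian_group M"
proof (rule abelian_groupI)
  show "\<exists>y\<in>carrier M. y \<oplus>\<^bsub>M\<^esub> x = \<zero>\<^bsub>M\<^esub>" if "x \<in> carrier M" for x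
  proof
    show "(- 1) \<odot>\<^bsub>M\<^esub> x \<oplus>\<^bsub>M\<^esub> x = \<zero>\<^bsub>M\<^esub>"
      using that by (intro models_inj) (auto simp: models_simps models_closed)
  qed (use that in \<open>simp add: models_closed\<close>)
qed (auto intro!: models_inj simp: models_simps models_closed add_ac)

lemma models_finsum:
  assumes "f \<in> A \<rightarrow> carrier M" "finite A"
  shows "(\<Oplus>\<^bsub>M\<^esub>i\<in>A. f i) \<in> carrier M \<and> \<Psi> (\<Oplus>\<^bsub>M\<^esub>i\<in>A. f i) = (\<Sum>i\<in>A. \<Psi> (f i))"
proof -
  interpret abelian_group M by (rule models_abelian_group)
  show ?thesis using assms(2,1)
  proof (induction A rule: finite_induct)
    case (insert x F)
    then have "f x \<in> carrier M" "f \<in> F \<rightarrow> carrier M" by auto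
    then show ?case using insert by (simp add: models_simps)
  qed (simp add: models_simps)
qed

lemma models_a_inv: "a \<in> carrier M \<Longrightarrow> \<ominus>\<^bsub>M\<^esub> a \<in> carrier M \<and> \<Psi> (\<ominus>\<^bsub>M\<^esub> a) = - \<Psi> a"
proof -
  interpret abelian_group M by (rule models_abelian_group)
  assume a: "a \<in> carrier M"
  have "\<Psi> (\<ominus>\<^bsub>M\<^esub> a) + \<Psi> a = 0"
    using models_simps(2)[of "\<ominus>\<^bsub>M\<^esub> a" a] a by (simp add: l_neg models_simps)
  then show ?thesis using a by (simp add: eq_neg_iff_add_eq_0)
qed

lemma models_a_minus:
  "a \<in> carrier M \<Longrightarrow> b \<in> carrier M \<Longrightarrow> a \<ominus>\<^bsub>M\<^esub> b \<in> carrier M \<and> \<Psi> (a \<ominus>\<^bsub>M\<^esub> b) = \<Psi> a - \<Psi> b"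
  using models_a_inv[of b] by (simp add: a_minus_def models_simps models_closed)

end

context
  fixes M :: "('k::field, 'v) module" and s :: "'k \<Rightarrow> 'w \<Rightarrow> 'w::ab_group_add" and \<phi> :: "'v \<Rightarrow> 'w" and K
  assumes M: "abelian_group M"
    and K: "K = {m \<in> carrier M. \<phi> m = 0}"
    and add: "\<And>a b. a \<in> carrier M \<Longrightarrow> b \<in> carrier M \<Longrightarrow> \<phi> (a \<oplus>\<^bsub>M\<^esub> b) = \<phi> a + \<phi> b"
    and smult: "\<And>c a. a \<in> carrier M \<Longrightarrow> c \<odot>\<^bsub>M\<^esub> a \<in> carrier M \<and> \<phi> (c \<odot>\<^bsub>M\<^esub> a) = s c (\<phi> a)"
begin

interpretation abelian_group M by (rule M)

lemma quot_zero: "\<phi> \<zero>\<^bsub>M\<^esub> = 0"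
  using add[of "\<zero>\<^bsub>M\<^esub>" "\<zero>\<^bsub>M\<^esub>"] by simp

lemma quot_coset: "m \<in> carrier M \<Longrightarrow> K +>\<^bsub>M\<^esub> m = {m' \<in> carrier M. \<phi> m' = \<phi> m}"
proof
  assume m: "m \<in> carrier M"
  show "K +>\<^bsub>M\<^esub> m \<subseteq> {m' \<in> carrier M. \<phi> m' = \<phi> m}"
    using m by (auto simp: a_r_coset_def' K add)
  show "{m' \<in> carrier M. \<phi> m' = \<phi> m} \<subseteq> K +>\<^bsub>M\<^esub> m"
  proof
    fix m' assume m': "m' \<in> {m' \<in> carrier M. \<phi> m' = \<phi> m}"
    have "\<phi> (m' \<ominus>\<^bsub>M\<^esub> m) + \<phi> m = \<phi> m'"
      using m m' add[of "m' \<ominus>\<^bsub>M\<^esub> m" m] by (simp add: a_minus_def a_assoc l_neg)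
    then have "m' \<ominus>\<^bsub>M\<^esub> m \<in> K" using m m' by (simp add: K)
    moreover have "m' = (m' \<ominus>\<^bsub>M\<^esub> m) \<oplus>\<^bsub>M\<^esub> m" using m m' by (simp add: a_minus_def a_assoc l_neg)
    ultimately show "m' \<in> K +>\<^bsub>M\<^esub> m" unfolding a_r_coset_def' by blast
  qed
qed

lemma quot_carrier: "carrier (quot_module M K) = (\<lambda>m. K +>\<^bsub>M\<^esub> m) ` carrier M"
  by (auto simp: quot_module_def A_RCOSETS_def')

lemma quot_the_elem: "m \<in> carrier M \<Longrightarrow> the_elem (\<phi> ` (K +>\<^bsub>M\<^esub> m)) = \<phi> m"
proof -
  assume "m \<in> carrier M"
  then have "\<phi> ` (K +>\<^bsub>M\<^esub> m) = {\<phi> m}" by (auto simp: quot_coset)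
  then show ?thesis by simp
qed

lemma quot_add:
  assumes "a \<in> carrier M" "b \<in> carrier M"
  shows "(K +>\<^bsub>M\<^esub> a) \<oplus>\<^bsub>quot_module M K\<^esub> (K +>\<^bsub>M\<^esub> b) = K +>\<^bsub>M\<^esub> (a \<oplus>\<^bsub>M\<^esub> b)"
proof -
  have "set_add M (K +>\<^bsub>M\<^esub> a) (K +>\<^bsub>M\<^esub> b) = K +>\<^bsub>M\<^esub> (a \<oplus>\<^bsub>M\<^esub> b)" (is "?L = ?R")
  proof
    show "?L \<subseteq> ?R" using assms by (auto simp: set_add_def' quot_coset add)
    show "?R \<subseteq> ?L"
    proof
      fix m assume "m \<in> ?R"
      then have m: "m \<in> carrier M" "\<phi> m = \<phi> a + \<phi> b" using assms by (auto simp: quot_coset add)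
      have m': "m \<ominus>\<^bsub>M\<^esub> b \<in> carrier M" "m = (m \<ominus>\<^bsub>M\<^esub> b) \<oplus>\<^bsub>M\<^esub> b"
        using m assms by (simp_all add: a_minus_def a_assoc l_neg)
      then have "\<phi> (m \<ominus>\<^bsub>M\<^esub> b) = \<phi> a"
        using add[of "m \<ominus>\<^bsub>M\<^esub> b" b] m assms by simp
      then have "m \<ominus>\<^bsub>M\<^esub> b \<in> K +>\<^bsub>M\<^esub> a" "b \<in> K +>\<^bsub>M\<^esub> b" using m' assms by (simp_all add: quot_coset)
      then show "m \<in> ?L" unfolding set_add_def' using m'(2) by blast
    qed
  qed
  then show ?thesis by (simp add: quot_module_def)
qed

lemma quot_smult:
  assumes "a \<in> carrier M"
  shows "c \<odot>\<^bsub>quot_module M K\<^esub> (K +>\<^bsub>M\<^esub> a) = K +>\<^bsub>M\<^esub> (c \<odot>\<^bsub>M\<^esub> a)"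
proof -
  have "K +>\<^bsub>M\<^esub> (c \<odot>\<^bsub>M\<^esub> b) = K +>\<^bsub>M\<^esub> (c \<odot>\<^bsub>M\<^esub> a)" if "b \<in> K +>\<^bsub>M\<^esub> a" for b
    using that assms by (auto simp: quot_coset smult)
  moreover have "a \<in> K +>\<^bsub>M\<^esub> a" using assms by (simp add: quot_coset)
  ultimately have "(\<Union>b\<in>K +>\<^bsub>M\<^esub> a. K +>\<^bsub>M\<^esub> (c \<odot>\<^bsub>M\<^esub> b)) = K +>\<^bsub>M\<^esub> (c \<odot>\<^bsub>M\<^esub> a)" by blast
  then show ?thesis by (simp add: quot_module_def)
qed

lemma quot_zero_eq: "\<zero>\<^bsub>quot_module M K\<^esub> = K +>\<^bsub>M\<^esub> \<zero>\<^bsub>M\<^esub>"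
proof -
  have "K +>\<^bsub>M\<^esub> \<zero>\<^bsub>M\<^esub> = K" by (auto simp: quot_coset quot_zero K)
  then show ?thesis by (simp add: quot_module_def)
qed

text \<open>The first isomorphism theorem: cosets of the kernel are the fibres of \<phi>, so
  \<open>the_elem\<close> returns the common value on a coset.\<close>

lemma models_quot: "models (quot_module M K) s (\<lambda>S. the_elem (\<phi> ` S)) (\<phi> ` carrier M)"
  unfolding models_def
proof (intro conjI)
  show "bij_betw (\<lambda>S. the_elem (\<phi> ` S)) (carrier (quot_module M K)) (\<phi> ` carrier M)"
    unfolding bij_betw_def
  proof
    show "inj_on (\<lambda>S. the_elem (\<phi> ` S)) (carrier (quot_module M K))"
    proof (rule inj_onI)
      fix S T assume "S \<in> carrier (quot_module M K)" "T \<in> carrier (quot_module M K)"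
        and eq: "the_elem (\<phi> ` S) = the_elem (\<phi> ` T)"
      then obtain a b where "a \<in> carrier M" "b \<in> carrier M" "S = K +>\<^bsub>M\<^esub> a" "T = K +>\<^bsub>M\<^esub> b"
        unfolding quot_carrier by blast
      then show "S = T" using eq by (simp only: quot_the_elem) (simp add: quot_coset)
    qed
    show "(\<lambda>S. the_elem (\<phi> ` S)) ` carrier (quot_module M K) = \<phi> ` carrier M"
      unfolding quot_carrier image_image by (rule image_cong) (auto simp: quot_the_elem)
  qed
qed (auto simp: quot_carrier quot_zero_eq quot_the_elem quot_zero quot_add quot_smult add smult)

end

section \<open>The tensor powers of the quantum group\<close>

lemma free_space_simps [simp]:
  "carrier (free_space B) = {p. Poly_Mapping.keys p \<subseteq> B}" "zero (free_space B) = 0"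
  "add (free_space B) = (+)" "smult (free_space B) = fscale"
  by (simp_all add: free_space_def)

lemma abelian_group_free_space: "abelian_group (free_space B :: ('k::field, 'b \<Rightarrow>\<^sub>0 'k) module)"
proof (rule abelian_groupI)
  show "\<exists>y\<in>carrier (free_space B :: ('k, 'b \<Rightarrow>\<^sub>0 'k) module). y \<oplus>\<^bsub>free_space B\<^esub> x = \<zero>\<^bsub>free_space B\<^esub>"
    if "x \<in> carrier (free_space B :: ('k, 'b \<Rightarrow>\<^sub>0 'k) module)" for x
    using that keys_fscale[of "- 1" x] by (intro bexI[of _ "- x"]) auto
  show "x \<oplus>\<^bsub>free_space B\<^esub> y \<in> carrier (free_space B :: ('k, 'b \<Rightarrow>\<^sub>0 'k) module)"
    if "x \<in> carrier (free_space B :: ('k, 'b \<Rightarrow>\<^sub>0 'k) module)" "y \<in> carrier (free_space B :: ('k, 'b \<Rightarrow>\<^sub>0 'k) module)" for x y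
    using that keys_add[of x y] by auto
qed (simp_all add: add_ac)

lemma free_alg_simps [simp]:
  "carrier free_alg = UNIV" "zero free_alg = 0" "add free_alg = (+)" "smult free_alg = fscale"
  "mult free_alg = (*)" "one free_alg = 1"
  by (simp_all add: free_alg_def)

lemma SLq_simps:
  "carrier (SLq q) = carrier (SLq_alg q)" "zero (SLq q) = zero (SLq_alg q)" "add (SLq q) = add (SLq_alg q)"
  "smult (SLq q) = smult (SLq_alg q)" "mult (SLq q) = mult (SLq_alg q)" "one (SLq q) = one (SLq_alg q)"
  "comult (SLq q) = SLq_comult q" "counit (SLq q) = SLq_counit" "antipode (SLq q) = SLq_antipode q"
  by (simp_all add: SLq_def module.extend_def hopf.fields_def)

context SLq_generic
begin

lemma SLq_quot:
  "SLq_ideal q = {m \<in> carrier free_alg. ev m = 0}"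
  "a \<in> carrier free_alg \<Longrightarrow> b \<in> carrier free_alg \<Longrightarrow> ev (a \<oplus>\<^bsub>free_alg\<^esub> b) = ev a + ev b"
  "a \<in> carrier free_alg \<Longrightarrow> c \<odot>\<^bsub>free_alg\<^esub> a \<in> carrier free_alg \<and> ev (c \<odot>\<^bsub>free_alg\<^esub> a) = fscale c (ev a)"
  by (auto simp: ev_eq_0_iff ev_simps)

lemmas SLq_group = ring.is_abelian_group[OF ring_free_alg]

definition pbw :: "(gen list \<Rightarrow>\<^sub>0 'k) set \<Rightarrow> (idx \<Rightarrow>\<^sub>0 'k)"
  where "pbw S = the_elem (ev ` S)"

lemma pbw_class [simp]: "pbw (SLq_class q p) = ev p"
  unfolding pbw_def SLq_class_def
  by (rule quot_the_elem[OF SLq_group SLq_quot]) simp_all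

lemma carrier_SLq: "carrier (SLq q) = range (SLq_class q)"
  unfolding SLq_simps SLq_alg_def SLq_class_def
  using quot_carrier[OF SLq_group SLq_quot] by simp

lemma models_SLq: "models (SLq q) fscale pbw UNIV"
proof -
  have "models (quot_module free_alg (SLq_ideal q)) fscale (\<lambda>S. the_elem (ev ` S)) (ev ` carrier free_alg)"
    by (rule models_quot[OF SLq_group SLq_quot])
  moreover have "ev ` carrier free_alg = UNIV"
    using surjI[of ev lift] by simp
  ultimately show ?thesis by (simp add: models_def SLq_simps SLq_alg_def pbw_def[abs_def])
qed

lemma pbw_inj: "a \<in> carrier (SLq q) \<Longrightarrow> b \<in> carrier (SLq q) \<Longrightarrow> pbw a = pbw b \<Longrightarrow> a = b"
  by (rule models_inj[OF models_SLq vector_space_fscale])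

lemma SLq_class_closed: "SLq_class q p \<in> carrier (SLq q)"
  by (simp add: carrier_SLq)

lemma SLq_class_mult: "SLq_class q a \<otimes>\<^bsub>SLq q\<^esub> SLq_class q b = SLq_class q (a * b)"
  unfolding SLq_simps SLq_alg_def SLq_class_def quot_module_def
  using ideal.rcoset_mult_add[OF SLq_ideal_ideal, of a b q] by simp

lemma SLq_mult:
  assumes "a \<in> carrier (SLq q)" "b \<in> carrier (SLq q)"
  shows "a \<otimes>\<^bsub>SLq q\<^esub> b \<in> carrier (SLq q) \<and> pbw (a \<otimes>\<^bsub>SLq q\<^esub> b) = pbw a \<star> pbw b"
  using assms by (auto simp: carrier_SLq SLq_class_mult ev_mult)

lemma SLq_one: "\<one>\<^bsub>SLq q\<^esub> = SLq_class q 1"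
  by (simp add: SLq_simps SLq_alg_def SLq_class_def quot_module_def)

definition unpbw :: "(idx \<Rightarrow>\<^sub>0 'k) \<Rightarrow> (gen list \<Rightarrow>\<^sub>0 'k) set"
  where "unpbw x = SLq_class q (lift x)"

lemma unpbw: "unpbw x \<in> carrier (SLq q)" "pbw (unpbw x) = x"
  by (simp_all add: unpbw_def SLq_class_closed)

lemma unpbw_pbw: "h \<in> carrier (SLq q) \<Longrightarrow> unpbw (pbw h) = h"
  by (rule pbw_inj) (simp_all add: unpbw)

lemma unpbw_add: "unpbw (x + y) = unpbw x \<oplus>\<^bsub>SLq q\<^esub> unpbw y"
  and unpbw_smult: "unpbw (fscale c x) = c \<odot>\<^bsub>SLq q\<^esub> unpbw x"
  by (rule pbw_inj;
    simp add: unpbw models_closed[OF models_SLq vector_space_fscale] models_simps[OF models_SLq vector_space_fscale])+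

text \<open>The tensor h_1 \<otimes> ... \<otimes> h_n in the tensor algebra, where multiplication
  is concatenation.\<close>

definition pure :: "(gen list \<Rightarrow>\<^sub>0 'k) set list \<Rightarrow> (idx list \<Rightarrow>\<^sub>0 'k)"
  where "pure hs = prod_list (map (\<lambda>h. emb (pbw h)) hs)"

definition pures :: "((gen list \<Rightarrow>\<^sub>0 'k) set list \<Rightarrow>\<^sub>0 'k) \<Rightarrow> (idx list \<Rightarrow>\<^sub>0 'k)"
  where "pures = lin_ext fscale pure"

lemma pure_simps [simp]: "pure [] = 1" "pure (h # hs) = emb (pbw h) * pure hs" "pure (hs @ hs') = pure hs * pure hs'"
  by (simp_all add: pure_def)

lemma linear_pures [lin]: "linear_map fscale f \<Longrightarrow> linear_map fscale (\<lambda>x. pures (f x))"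
  unfolding pures_def by (intro linear_map_comp[OF linear_map_lin_ext] lin)

lemmas pures_simps = linear_map_simps[OF linear_pures[OF linear_map_id]]

lemma pures_single [simp]: "pures (Poly_Mapping.single hs c) = fscale c (pure hs)"
  by (simp add: pures_def lin_ext_single lin)

lemma tens_pure: "pure hs \<in> tens (length hs)"
  by (induction hs) (auto intro: tens_1 tens_emb_Cons)

abbreviation "tup n \<equiv> tuples (SLq q) n"
abbreviation "rel n \<equiv> multilinear_relations (SLq q) n"

lemma tens_pures: "Poly_Mapping.keys p \<subseteq> tup n \<Longrightarrow> pures p \<in> tens n"
  unfolding pures_def lin_ext_def
  by (intro tens_closed) (use tens_pure in \<open>auto simp: tuples_def\<close>)

lemma rel_closed:
  "0 \<in> rel n" "a \<in> rel n \<Longrightarrow> b \<in> rel n \<Longrightarrow> a + b \<in> rel n" "a \<in> rel n \<Longrightarrow> b \<in> rel n \<Longrightarrow> a - b \<in> rel n"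
  "a \<in> rel n \<Longrightarrow> fscale c a \<in> rel n"
  unfolding multilinear_relations_def
  by (auto intro: fscale.span_zero fscale.span_add fscale.span_diff fscale.span_scale)

lemma rel_add:
  "as @ [a] @ bs \<in> tup n \<Longrightarrow> b \<in> carrier (SLq q) \<Longrightarrow>
    vec (as @ [a \<oplus>\<^bsub>SLq q\<^esub> b] @ bs) - vec (as @ [a] @ bs) - vec (as @ [b] @ bs) \<in> rel n"
  unfolding multilinear_relations_def by (rule fscale.span_base) blast

lemma rel_smult:
  "as @ [a] @ bs \<in> tup n \<Longrightarrow>
    vec (as @ [c \<odot>\<^bsub>SLq q\<^esub> a] @ bs) - fscale c (vec (as @ [a] @ bs)) \<in> rel n"
  unfolding multilinear_relations_def by (rule fscale.span_base) blast

lemma rel_sound: "p \<in> rel n \<Longrightarrow> Poly_Mapping.keys p \<subseteq> tup n \<and> pures p = 0"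
  unfolding multilinear_relations_def
proof (induction p rule: fscale.span_induct_alt)
  case (step c x y)
  note m = models_closed[OF models_SLq vector_space_fscale] models_simps[OF models_SLq vector_space_fscale]
  have "Poly_Mapping.keys x \<subseteq> tup n \<and> pures x = 0"
    using step(1)
  proof
    assume "x \<in> {vec (as @ [a \<oplus>\<^bsub>SLq q\<^esub> b] @ bs) - vec (as @ [a] @ bs) - vec (as @ [b] @ bs) | as a b bs.
        as @ [a] @ bs \<in> tup n \<and> b \<in> carrier (SLq q)}"
    then obtain as a b bs where x: "x = vec (as @ [a \<oplus>\<^bsub>SLq q\<^esub> b] @ bs) - vec (as @ [a] @ bs) - vec (as @ [b] @ bs)"
      and t: "as @ [a] @ bs \<in> tup n" "b \<in> carrier (SLq q)" by blast
    have "a \<in> carrier (SLq q)" using t by (auto simp: tuples_def)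
    then have "pures x = 0" using t by (simp add: x pures_simps m emb_simps algebra_simps)
    moreover have "Poly_Mapping.keys x \<subseteq> tup n"
      using t \<open>a \<in> _\<close> unfolding x
      by (intro order_trans[OF keys_diff] Un_least) (auto simp: tuples_def m)
    ultimately show ?thesis by simp
  next
    assume "x \<in> {vec (as @ [c \<odot>\<^bsub>SLq q\<^esub> a] @ bs) - fscale c (vec (as @ [a] @ bs)) | as c a bs. as @ [a] @ bs \<in> tup n}"
    then obtain as a c bs where x: "x = vec (as @ [c \<odot>\<^bsub>SLq q\<^esub> a] @ bs) - fscale c (vec (as @ [a] @ bs))"
      and t: "as @ [a] @ bs \<in> tup n" by blast
    have "a \<in> carrier (SLq q)" using t by (auto simp: tuples_def)
    then have "pures x = 0" using t
      by (simp add: x pures_simps m emb_simps mult_fscale_left mult_fscale_right)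
    moreover have "Poly_Mapping.keys x \<subseteq> tup n"
      using t \<open>a \<in> _\<close> unfolding x
      by (intro order_trans[OF keys_diff] Un_least order_trans[OF keys_fscale]) (auto simp: tuples_def m)
    ultimately show ?thesis by simp
  qed
  then show ?case using step(2) keys_add[of "fscale c x" y] keys_fscale[of c x]
    by (auto simp: pures_simps)
qed (simp add: pures_simps)

lemma rel_expand:
  assumes "as @ [h] @ bs \<in> tup n"
  shows "vec (as @ [h] @ bs) - (\<Sum>b\<in>Poly_Mapping.keys (pbw h). fscale (Poly_Mapping.lookup (pbw h) b)
    (vec (as @ [unpbw (vec b)] @ bs))) \<in> rel n"
proof -
  have t: "as @ [unpbw x] @ bs \<in> tup n" for x using assms unpbw(1) by (auto simp: tuples_def)
  define c where "c = Poly_Mapping.lookup (pbw h)"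
  have "vec (as @ [unpbw (\<Sum>b\<in>A. fscale (c b) (vec b))] @ bs) -
      (\<Sum>b\<in>A. fscale (c b) (vec (as @ [unpbw (vec b)] @ bs))) \<in> rel n" if "finite A" for A
    using that
  proof (induction A rule: finite_induct)
    case empty
    \<comment> \<open>A tuple with a zero entry is a relation: the entry is 0 times itself.\<close>
    have "unpbw 0 = 0 \<odot>\<^bsub>SLq q\<^esub> unpbw 0" using unpbw_smult[of 0 0] by simp
    then show ?case using rel_smult[OF t[of 0], of 0] by simp
  next
    case (insert x F)
    let ?s = "\<Sum>b\<in>F. fscale (c b) (vec b)"
    have 1: "vec (as @ [unpbw (fscale (c x) (vec x) + ?s)] @ bs) - vec (as @ [unpbw (fscale (c x) (vec x))] @ bs) -
        vec (as @ [unpbw ?s] @ bs) \<in> rel n"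
      using rel_add[OF t unpbw(1), of "fscale (c x) (vec x)" ?s] by (simp only: unpbw_add)
    have 2: "vec (as @ [unpbw (fscale (c x) (vec x))] @ bs) - fscale (c x) (vec (as @ [unpbw (vec x)] @ bs)) \<in> rel n"
      using rel_smult[OF t, of "c x" "vec x"] by (simp only: unpbw_smult)
    show ?case
      using rel_closed(2)[OF rel_closed(2)[OF 1 2] insert.IH]
      unfolding sum.insert[OF insert(1,2)] by (simp add: algebra_simps del: fscale_single)
  qed
  from this[OF finite_keys, of "pbw h"] show ?thesis
    using assms poly_mapping_expand[OF finite_keys order_refl, of "pbw h"]
    by (simp add: c_def unpbw_pbw tuples_def del: fscale_single)
qed

definition unpures :: "(idx list \<Rightarrow>\<^sub>0 'k) \<Rightarrow> ((gen list \<Rightarrow>\<^sub>0 'k) set list \<Rightarrow>\<^sub>0 'k)"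
  where "unpures = lin_ext fscale (\<lambda>bs. vec (map (\<lambda>b. unpbw (vec b)) bs))"

lemma linear_unpures [lin]: "linear_map fscale f \<Longrightarrow> linear_map fscale (\<lambda>x. unpures (f x))"
  unfolding unpures_def by (intro linear_map_comp[OF linear_map_lin_ext] lin)

lemmas unpures_simps = linear_map_simps[OF linear_unpures[OF linear_map_id]]

lemma rel_sum: "(\<And>i. i \<in> I \<Longrightarrow> f i \<in> rel n) \<Longrightarrow> (\<Sum>i\<in>I. f i) \<in> rel n"
  by (induction I rule: infinite_finite_induct) (auto intro: rel_closed)

text \<open>The induction expands the entries from left to right; \<open>bs\<close> records the
  prefix already replaced by basis elements.\<close>

lemma rel_unpures_pure:
  "map (\<lambda>b. unpbw (vec b)) bs @ hs \<in> tup n \<Longrightarrow>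
    vec (map (\<lambda>b. unpbw (vec b)) bs @ hs) - unpures (vec bs * pure hs) \<in> rel n"
proof (induction hs arbitrary: bs)
  case Nil
  then show ?case by (simp add: unpures_def rel_closed)
next
  case (Cons h hs)
  let ?m = "map (\<lambda>b. unpbw (vec b))" and ?c = "Poly_Mapping.lookup (pbw h)" and ?K = "Poly_Mapping.keys (pbw h)"
  have 1: "vec (?m bs @ [h] @ hs) - (\<Sum>b\<in>?K. fscale (?c b) (vec (?m bs @ [unpbw (vec b)] @ hs))) \<in> rel n"
    by (rule rel_expand) (use Cons.prems in simp)
  have "vec (?m (bs @ [b]) @ hs) - unpures (vec (bs @ [b]) * pure hs) \<in> rel n" for b
    by (rule Cons.IH) (use Cons.prems unpbw(1) in \<open>auto simp: tuples_def\<close>)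
  then have "(\<Sum>b\<in>?K. fscale (?c b) (vec (?m (bs @ [b]) @ hs) - unpures (vec (bs @ [b]) * pure hs))) \<in> rel n"
    by (intro rel_sum rel_closed(4))
  then have 2: "(\<Sum>b\<in>?K. fscale (?c b) (vec (?m bs @ [unpbw (vec b)] @ hs))) -
      (\<Sum>b\<in>?K. fscale (?c b) (unpures (vec (bs @ [b]) * pure hs))) \<in> rel n"
    by (simp only: fscale.scale_right_diff_distrib sum_subtractf map_append list.map append.assoc)
  have "linear_map fscale (\<lambda>x. unpures (vec bs * emb x * pure hs))" by (intro lin)
  from linear_map_expand[OF this finite_keys order_refl, of "pbw h"]
  have "unpures (vec bs * pure (h # hs)) = (\<Sum>b\<in>?K. fscale (?c b) (unpures (vec (bs @ [b]) * pure hs)))"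
    by (simp add: vec_mult mult.assoc[symmetric] del: emb_single) (simp add: vec_mult)
  then show ?case using rel_closed(2)[OF 1 2] by simp
qed

text \<open>The multilinear relations exhaust the kernel: modulo them, a combination of tuples
  equals the combination of basis tuples determined by its image.\<close>

lemma rel_complete:
  assumes "Poly_Mapping.keys p \<subseteq> tup n" "pures p = 0"
  shows "p \<in> rel n"
proof -
  have single: "vec hs - unpures (pure hs) \<in> rel n" if "hs \<in> tup n" for hs
    using rel_unpures_pure[of "[]" hs n] that by (simp add: vec_Nil)
  have "(\<Sum>hs\<in>Poly_Mapping.keys p. fscale (Poly_Mapping.lookup p hs) (vec hs - unpures (pure hs))) \<in> rel n"
  proof (rule rel_sum, rule rel_closed(4), rule single)
    show "hs \<in> tup n" if "hs \<in> Poly_Mapping.keys p" for hs using that assms(1) by (rule rev_subsetD)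
  qed
  moreover have "linear_map fscale (\<lambda>p. p - unpures (pures p))" by (intro lin)
  from linear_map_expand[OF this finite_keys order_refl, of p]
  have "p - unpures (pures p) =
      (\<Sum>hs\<in>Poly_Mapping.keys p. fscale (Poly_Mapping.lookup p hs) (vec hs - unpures (pure hs)))"
    by (simp del: fscale_single)
  ultimately show ?thesis by (simp add: assms(2) unpures_simps)
qed

lemma tensor_quot:
  "rel n = {p \<in> carrier (free_space (tup n)). pures p = 0}"
  "a \<in> carrier (free_space (tup n)) \<Longrightarrow> b \<in> carrier (free_space (tup n)) \<Longrightarrow>
    pures (a \<oplus>\<^bsub>free_space (tup n)\<^esub> b) = pures a + pures b"
  "a \<in> carrier (free_space (tup n)) \<Longrightarrow> c \<odot>\<^bsub>free_space (tup n)\<^esub> a \<in> carrier (free_space (tup n)) \<and>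
    pures (c \<odot>\<^bsub>free_space (tup n)\<^esub> a) = fscale c (pures a)"
proof -
  show "rel n = {p \<in> carrier (free_space (tup n)). pures p = 0}"
  proof (intro Set.set_eqI iffI)
    show "p \<in> {p \<in> carrier (free_space (tup n)). pures p = 0}" if "p \<in> rel n" for p
      using rel_sound[OF that] by simp
    show "p \<in> rel n" if "p \<in> {p \<in> carrier (free_space (tup n)). pures p = 0}" for p
      using that by (intro rel_complete) simp_all
  qed
qed (use order_trans[OF keys_fscale] in \<open>simp_all add: pures_simps\<close>)

definition model :: "((gen list \<Rightarrow>\<^sub>0 'k) set list \<Rightarrow>\<^sub>0 'k) set \<Rightarrow> (idx list \<Rightarrow>\<^sub>0 'k)"
  where "model A = the_elem (pures ` A)"

lemma pures_surj: "t \<in> tens n \<Longrightarrow> \<exists>p. Poly_Mapping.keys p \<subseteq> tup n \<and> pures p = t"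
proof (intro exI conjI)
  assume t: "t \<in> tens n"
  have "unpures t = (\<Sum>bs\<in>Poly_Mapping.keys t. fscale (Poly_Mapping.lookup t bs) (vec (map (\<lambda>b. unpbw (vec b)) bs)))"
    by (simp add: unpures_def lin_ext_def)
  then have "Poly_Mapping.keys (unpures t) \<subseteq> (\<Union>bs\<in>Poly_Mapping.keys t. {map (\<lambda>b. unpbw (vec b)) bs})"
    by (simp add: order_trans[OF keys_sum] UN_mono)
  then show "Poly_Mapping.keys (unpures t) \<subseteq> tup n"
    using t unpbw(1) by (fastforce simp: tens_def tuples_def)
  have "pure (map (\<lambda>b. unpbw (vec b)) bs) = vec bs" for bs
    by (induction bs) (simp_all add: unpbw vec_Nil vec_mult)
  then have "pures (unpures (vec bs)) = vec bs" for bs by (simp add: unpures_def)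
  moreover have "linear_map fscale (\<lambda>t. pures (unpures t))" by (intro lin)
  ultimately show "pures (unpures t) = t"
    using linear_map_eqI[OF _ linear_map_id, of "\<lambda>t. pures (unpures t)" t] by blast
qed

lemma models_tensor_power: "models (tensor_power (SLq q) n) fscale model (tens n)"
proof -
  have "models (quot_module (free_space (tup n)) (rel n)) fscale (\<lambda>S. the_elem (pures ` S))
      (pures ` carrier (free_space (tup n)))"
    by (rule models_quot[OF abelian_group_free_space tensor_quot])
  moreover have "pures ` carrier (free_space (tup n)) = tens n"
    using pures_surj tens_pures by auto
  ultimately show ?thesis by (simp add: tensor_power_def model_def[abs_def])
qed

lemma model_tensor_class:
  "Poly_Mapping.keys p \<subseteq> tup n \<Longrightarrow> model (tensor_class (SLq q) n p) = pures p"
  unfolding model_def tensor_class_def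
  by (rule quot_the_elem[OF abelian_group_free_space tensor_quot]) simp_all

lemma carrier_tensor_power:
  "carrier (tensor_power (SLq q) n) = tensor_class (SLq q) n ` {p. Poly_Mapping.keys p \<subseteq> tup n}"
  unfolding tensor_power_def tensor_class_def
  using quot_carrier[OF abelian_group_free_space tensor_quot] by simp

lemma tensor_class_eq_iff:
  assumes "Poly_Mapping.keys p \<subseteq> tup n" "Poly_Mapping.keys p' \<subseteq> tup n"
  shows "tensor_class (SLq q) n p = tensor_class (SLq q) n p' \<longleftrightarrow> pures p = pures p'"
proof
  show "tensor_class (SLq q) n p = tensor_class (SLq q) n p'" if "pures p = pures p'"
    by (rule models_inj[OF models_tensor_power[of n] vector_space_fscale])
      (use that assms in \<open>simp_all add: model_tensor_class carrier_tensor_power\<close>)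
qed (use assms model_tensor_class in metis)

lemma tensor_class_mem:
  "Poly_Mapping.keys p \<subseteq> tup n \<Longrightarrow> p' \<in> tensor_class (SLq q) n p \<Longrightarrow> Poly_Mapping.keys p' \<subseteq> tup n \<and> pures p' = pures p"
  unfolding tensor_class_def
  by (subst (asm) quot_coset[OF abelian_group_free_space tensor_quot]) auto

lemma tensor_class_self: "Poly_Mapping.keys p \<subseteq> tup n \<Longrightarrow> p \<in> tensor_class (SLq q) n p"
  unfolding tensor_class_def
  by (subst quot_coset[OF abelian_group_free_space tensor_quot]) auto

text \<open>If \<phi> on tuples lies over a linear map G, its class is constant on cosets of the
  relations; the constant value picked by \<open>tensor_map\<close> is then G in the model.\<close>

lemma tensor_map_model:
  assumes \<phi>: "\<And>hs. hs \<in> tup n \<Longrightarrow> Poly_Mapping.keys (\<phi> hs) \<subseteq> tup m \<and> pures (\<phi> hs) = G (pure hs)"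
    and G: "linear_map fscale G" and A: "A \<in> carrier (tensor_power (SLq q) n)"
  shows "tensor_map (SLq q) m \<phi> A \<in> carrier (tensor_power (SLq q) m) \<and> model (tensor_map (SLq q) m \<phi> A) = G (model A)"
proof -
  obtain p where p: "A = tensor_class (SLq q) n p" "Poly_Mapping.keys p \<subseteq> tup n"
    using A by (auto simp: carrier_tensor_power)
  have ext: "Poly_Mapping.keys (lin_ext fscale \<phi> p') \<subseteq> tup m \<and> pures (lin_ext fscale \<phi> p') = G (pures p')"
    if k: "Poly_Mapping.keys p' \<subseteq> tup n" for p'
  proof
    have "Poly_Mapping.keys (fscale c (\<phi> hs)) \<subseteq> tup m" if "hs \<in> Poly_Mapping.keys p'" for c hs
    proof -
      have "hs \<in> tup n" using that k by blast
      then have "Poly_Mapping.keys (\<phi> hs) \<subseteq> tup m" using \<phi> by blast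
      then show ?thesis by (rule order_trans[OF keys_fscale])
    qed
    then show "Poly_Mapping.keys (lin_ext fscale \<phi> p') \<subseteq> tup m"
      unfolding lin_ext_def by (intro order_trans[OF keys_sum] UN_least)
    show "pures (lin_ext fscale \<phi> p') = G (pures p')"
    proof (rule linear_map_eqI[where sc = fscale and f = "\<lambda>p'. pures (lin_ext fscale \<phi> p')" and g = "\<lambda>p'. G (pures p')"])
      show "linear_map fscale (\<lambda>p'. pures (lin_ext fscale \<phi> p'))"
        by (rule linear_pures[OF linear_map_lin_ext[OF vector_space_fscale]])
      show "linear_map fscale (\<lambda>p'. G (pures p'))"
        by (rule linear_map_comp[OF G linear_pures[OF linear_map_id]])
      fix hs assume "hs \<in> Poly_Mapping.keys p'"
      then have "hs \<in> tup n" using k by blast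
      then show "pures (lin_ext fscale \<phi> (vec hs)) = G (pures (vec hs))" using \<phi> by simp
    qed
  qed
  let ?c = "tensor_class (SLq q) m (lin_ext fscale \<phi> p)"
  have "tensor_class (SLq q) m (lin_ext fscale \<phi> p') = ?c" if "p' \<in> A" for p'
  proof -
    have p': "Poly_Mapping.keys p' \<subseteq> tup n" "pures p' = pures p"
      using tensor_class_mem[OF p(2)] that p(1) by simp_all
    show ?thesis
      using ext[OF p'(1)] ext[OF p(2)] p'(2) by (simp only: tensor_class_eq_iff)
  qed
  then have "(\<lambda>p. tensor_class (SLq q) m (lin_ext fscale \<phi> p)) ` A = (\<lambda>_. ?c) ` A"
    by (rule image_cong[OF refl])
  moreover have "A \<noteq> {}" using tensor_class_self[OF p(2)] p(1) by blast
  ultimately have "(\<lambda>p. tensor_class (SLq q) m (lin_ext fscale \<phi> p)) ` A = {?c}"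
    by (simp only: image_constant_conv if_False)
  then have "tensor_map (SLq q) m \<phi> A = tensor_class (SLq q) m (lin_ext fscale \<phi> p)"
    by (simp add: tensor_map_def)
  then show ?thesis
    using ext[OF p(2)] p by (simp add: model_tensor_class carrier_tensor_power)
qed

end

section \<open>The cyclic module in the model\<close>

locale SLq_character = SLq_generic q for q :: "'k::field_char_0" +
  fixes \<delta> :: "(gen list \<Rightarrow>\<^sub>0 'k) set \<Rightarrow> 'k"
  assumes char: "character (SLq q) \<delta>"
    and delta_gens: "\<delta> (SLq_gen q GX) = q" "\<delta> (SLq_gen q GU) = 0" "\<delta> (SLq_gen q GV) = 0"
      "\<delta> (SLq_gen q GY) = inverse q"
begin

lemma chi_ev_vec: "s \<noteq> 0 \<Longrightarrow> chi s (ev (vec w)) = prod_list (map (gen_chi s) w)"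
  by (induction w) (simp_all add: ev_def chi_gen_op)

text \<open>Multiplicativity fixes a character on words by its values on generators, and linearity
  does the rest.\<close>

lemma delta_class: "\<delta> (SLq_class q p) = chi q (ev p)"
proof (rule linear_map_eqI[where sc = "(*)" and f = "\<lambda>p. \<delta> (SLq_class q p)"])
  note m = models_simps[OF models_SLq vector_space_fscale] models_closed[OF models_SLq vector_space_fscale]
  have hom: "\<delta> \<in> ring_hom (SLq q) (scalar_space :: ('k, 'k) module)"
    and lin_d: "\<And>c a. a \<in> carrier (SLq q) \<Longrightarrow> \<delta> (c \<odot>\<^bsub>SLq q\<^esub> a) = c * \<delta> a"
    using char by (auto simp: character_def)
  show "linear_map (*) (\<lambda>p. \<delta> (SLq_class q p))"
  proof
    fix a b
    have "SLq_class q (a + b) = SLq_class q a \<oplus>\<^bsub>SLq q\<^esub> SLq_class q b"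
      by (rule pbw_inj) (simp_all add: m SLq_class_closed ev_simps)
    then show "\<delta> (SLq_class q (a + b)) = \<delta> (SLq_class q a) + \<delta> (SLq_class q b)"
      using ring_hom_add[OF hom SLq_class_closed SLq_class_closed] by (simp add: scalar_space_def)
  next
    fix c a
    have "SLq_class q (fscale c a) = c \<odot>\<^bsub>SLq q\<^esub> SLq_class q a"
      by (rule pbw_inj) (simp_all add: m SLq_class_closed ev_simps)
    then show "\<delta> (SLq_class q (fscale c a)) = c * \<delta> (SLq_class q a)"
      using lin_d[OF SLq_class_closed] by simp
  qed
  fix w
  have gen: "\<delta> (SLq_gen q g) = gen_chi q g" for g
    using delta_gens by (cases g) simp_all
  have "\<delta> (SLq_class q (vec w)) = prod_list (map (gen_chi q) w)"
  proof (induction w)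
    case Nil
    then show ?case using ring_hom_one[OF hom] by (simp add: SLq_one vec_Nil scalar_space_def)
  next
    case (Cons g w)
    have "SLq_class q (vec (g # w)) = SLq_gen q g \<otimes>\<^bsub>SLq q\<^esub> SLq_class q (vec w)"
      by (simp add: SLq_class_mult letter_mult)
    then show ?case
      using ring_hom_mult[OF hom SLq_class_closed SLq_class_closed] Cons gen
      by (simp add: scalar_space_def)
  qed
  then show "\<delta> (SLq_class q (vec w)) = chi q (ev (vec w))" by (simp add: chi_ev_vec)
qed (intro lin)

lemma delta_eq: "h \<in> carrier (SLq q) \<Longrightarrow> \<delta> h = chi q (pbw h)"
  by (auto simp: carrier_SLq delta_class)

lemma the_elem_class:
  assumes "\<And>r. ev r = ev p \<Longrightarrow> f r = f p"
  shows "the_elem (f ` SLq_class q p) = f p"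
proof -
  have "SLq_class q p = {r \<in> carrier free_alg. ev r = ev p}"
    unfolding SLq_class_def by (rule quot_coset[OF SLq_group SLq_quot]) simp_all
  then have "SLq_class q p = {r. ev r = ev p}" by simp
  then have "f ` SLq_class q p = (\<lambda>_. f p) ` {r. ev r = ev p}"
    by (intro image_cong) (auto intro: assms)
  moreover have "p \<in> {r. ev r = ev p}" by simp
  ultimately have "f ` SLq_class q p = {f p}" by (metis empty_iff image_constant_conv)
  then show ?thesis by simp
qed

lemma counit_eq:
  assumes "h \<in> carrier (SLq q)"
  shows "counit (SLq q) h = chi 1 (pbw h)"
proof -
  have gen: "(gen_counit :: gen \<Rightarrow> 'k) = gen_chi 1"
  proof
    show "gen_counit g = (gen_chi 1 g :: 'k)" for g by (cases g) simp_all
  qed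
  have e: "lin_ext (*) (\<lambda>w. prod_list (map gen_counit w)) p = chi 1 (ev p)" for p :: "gen list \<Rightarrow>\<^sub>0 'k"
    by (rule lin_ext_eq[where f = "\<lambda>p. chi 1 (ev p)"]) (intro lin | simp add: gen chi_ev_vec)+
  obtain p where h: "h = SLq_class q p" using assms by (auto simp: carrier_SLq)
  have "counit (SLq q) h = lin_ext (*) (\<lambda>w. prod_list (map gen_counit w)) p"
    unfolding SLq_simps SLq_counit_def h by (rule the_elem_class) (simp only: e)
  then show ?thesis by (simp add: e h)
qed

lemma antipode_eq:
  assumes "h \<in> carrier (SLq q)"
  shows "antipode (SLq q) h \<in> carrier (SLq q) \<and> pbw (antipode (SLq q) h) = antip (pbw h)"
proof -
  obtain p where h: "h = SLq_class q p" using assms by (auto simp: carrier_SLq)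
  have "SLq_class q (free_antipode r) = SLq_class q (free_antipode p)" if "ev r = ev p" for r
    by (rule pbw_inj) (use that in \<open>simp_all add: SLq_class_closed flip: antip_ev\<close>)
  then have "antipode (SLq q) h = SLq_class q (free_antipode p)"
    unfolding SLq_simps SLq_antipode_def h free_antipode_def[symmetric] by (rule the_elem_class)
  then show ?thesis by (simp add: SLq_class_closed antip_ev h)
qed

subsection \<open>Faces\<close>

lemma fc_middle:
  assumes "s \<in> tens i"
  shows "fc i (s * emb b * t) = Rm b s * t"
proof (rule linear_map_eqI[where sc = fscale and f = "\<lambda>t. fc i (s * emb b * t)"])
  fix cs
  show "fc i (s * emb b * vec cs) = Rm b s * vec cs"
  proof (rule linear_map_eqI[where sc = fscale and f = "\<lambda>b. fc i (s * emb b * vec cs)"])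
    fix c
    show "fc i (s * emb (vec c) * vec cs) = Rm (vec c) s * vec cs"
      by (rule tens_eqI[where sc = fscale and f = "\<lambda>s. fc i (s * emb (vec c) * vec cs)", OF _ _ assms])
        (intro lin | auto simp: fc_def vec_mult nth_append)+
  qed (intro lin)+
qed (intro lin)+

definition dface :: "nat \<Rightarrow> nat \<Rightarrow> (idx list \<Rightarrow>\<^sub>0 'k) \<Rightarrow> (idx list \<Rightarrow>\<^sub>0 'k)"
  where "dface n i t = (if i < n then fc i t else last_delta t)"

lemma linear_dface [lin]: "linear_map fscale f \<Longrightarrow> linear_map fscale (\<lambda>x. dface n i (f x))"
  unfolding dface_def by (intro lin)

lemma hopf_face_pures:
  assumes hs: "hs \<in> tup (Suc n)" and i: "i \<le> Suc n"
  shows "Poly_Mapping.keys (hopf_face (SLq q) \<delta> (Suc n) i hs) \<subseteq> tup n \<and>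
    pures (hopf_face (SLq q) \<delta> (Suc n) i hs) = dface (Suc n) i (pure hs)"
proof -
  have keys: "Poly_Mapping.keys (Poly_Mapping.single xs c) \<subseteq> tup n" if "xs \<in> tup n" for xs and c :: 'k
    using that by auto
  consider "i = 0" | "i = Suc n" | j where "i = Suc j" "j < n" using i by (cases i) force+
  then show ?thesis
  proof cases
    case 1
    obtain h hs' where h: "hs = h # hs'" "h \<in> carrier (SLq q)" "hs' \<in> tup n"
      using hs by (cases hs) (auto simp: tuples_def)
    then show ?thesis
      using 1 keys[of hs'] fc_0_emb by (simp add: hopf_face_def counit_eq dface_def del: keys_single)
  next
    case 2
    obtain h hs' where h: "hs = hs' @ [h]" "h \<in> carrier (SLq q)" "hs' \<in> tup n"
      using hs by (cases hs rule: rev_cases) (auto simp: tuples_def)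
    then show ?thesis
      using 2 keys[of hs'] by (simp add: hopf_face_def delta_eq dface_def last_delta_snoc del: keys_single)
  next
    case 3
    define xs ys where "xs = take j hs" and "ys = drop (Suc (Suc j)) hs"
    have len: "length hs = Suc n" using hs by (simp add: tuples_def)
    have split: "hs = xs @ hs ! j # hs ! Suc j # ys"
      using 3 len by (simp add: xs_def ys_def Cons_nth_drop_Suc)
    have lx: "length xs = j" using 3 len by (simp add: xs_def)
    let ?a = "hs ! j" and ?b = "hs ! Suc j"
    have mem: "?a \<in> carrier (SLq q)" "?b \<in> carrier (SLq q)" "set xs \<subseteq> carrier (SLq q)" "set ys \<subseteq> carrier (SLq q)"
      "length ys = n - Suc j"
      using hs 3 len set_take_subset[of j hs] set_drop_subset[of "Suc (Suc j)" hs] nth_mem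
      by (auto simp: tuples_def xs_def ys_def)
    have face: "hopf_face (SLq q) \<delta> (Suc n) i hs = vec (xs @ [?a \<otimes>\<^bsub>SLq q\<^esub> ?b] @ ys)"
      using 3 by (simp add: hopf_face_def xs_def ys_def)
    have "xs @ [?a \<otimes>\<^bsub>SLq q\<^esub> ?b] @ ys \<in> tup n"
      using mem lx 3 SLq_mult[OF mem(1,2)] by (auto simp: tuples_def)
    moreover have "dface (Suc n) i (pure hs) = pure (xs @ [?a \<otimes>\<^bsub>SLq q\<^esub> ?b] @ ys)"
    proof -
      have "pure xs * emb (pbw ?a) \<in> tens i"
        using tens_emb_snoc[OF tens_pure, of xs] lx 3 by simp
      then have "fc i (pure xs * emb (pbw ?a) * emb (pbw ?b) * pure ys) = pure xs * emb (pbw ?a \<star> pbw ?b) * pure ys"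
        by (simp add: fc_middle Rm_snoc)
      then show ?thesis using 3 SLq_mult[OF mem(1,2)]
        by (subst split) (simp add: dface_def mult.assoc)
    qed
    ultimately show ?thesis by (simp add: face)
  qed
qed

subsection \<open>The cyclic operator\<close>

lemma keys_add_subset:
  "Poly_Mapping.keys f \<subseteq> S \<Longrightarrow> Poly_Mapping.keys g \<subseteq> S \<Longrightarrow> Poly_Mapping.keys (f + g) \<subseteq> S"
  using keys_add[of f g] by auto

text \<open>The two summands of \<open>gen_comult\<close> are the two values of the middle index, so
  the lists of pairs for a word correspond to the index lists K.\<close>

lemma word_comult_pures:
  "Poly_Mapping.keys (word_comult q w) \<subseteq> tup 2 \<and> pures (word_comult q w) = word_sum (\<lambda>a b. emb a * emb b) w"
proof
  let ?f = "\<lambda>ps. [SLq_class q (vec (map fst ps)), SLq_class q (vec (map snd ps))]"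
  have k: "Poly_Mapping.keys (\<Sum>ps\<leftarrow>pss. vec (?f ps) :: (gen list \<Rightarrow>\<^sub>0 'k) set list \<Rightarrow>\<^sub>0 'k) \<subseteq> tup 2" for pss
  proof (induction pss)
    case (Cons a pss)
    have "Poly_Mapping.keys (vec (?f a) :: (gen list \<Rightarrow>\<^sub>0 'k) set list \<Rightarrow>\<^sub>0 'k) \<subseteq> tup 2"
      by (simp add: tuples_def SLq_class_closed)
    then show ?case unfolding list.map sum_list.Cons by (rule keys_add_subset[OF _ Cons])
  qed simp
  then show "Poly_Mapping.keys (word_comult q w) \<subseteq> tup 2" unfolding word_comult_def .
  have "pures (word_comult q w) = (\<Sum>ps\<leftarrow>product_lists (map gen_comult w). emb (ev (vec (map fst ps))) * emb (ev (vec (map snd ps))))"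
    unfolding word_comult_def linear_map_sum_list[OF linear_pures[OF linear_map_id]]
    by (simp add: mult.assoc)
  also have "\<dots> = word_sum (\<lambda>a b. emb a * emb b) w"
  proof -
    have gen: "gen_comult g = [(mat_gen (gen_row g) False, mat_gen False (gen_col g)),
        (mat_gen (gen_row g) True, mat_gen True (gen_col g))]" for g
      by (cases g) simp_all
    have "(\<Sum>ps\<leftarrow>product_lists (map gen_comult w). F (map fst ps) (map snd ps)) =
        (\<Sum>K\<in>bool_lists (length w). F (map2 mat_gen (map gen_row w) K) (map2 mat_gen K (map gen_col w)))"
      for F :: "gen list \<Rightarrow> gen list \<Rightarrow> idx list \<Rightarrow>\<^sub>0 'k"
    proof (induction w arbitrary: F)
      case (Cons g w)
      have "(\<Sum>ps\<leftarrow>product_lists (map gen_comult (g # w)). F (map fst ps) (map snd ps)) =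
         (\<Sum>ps\<leftarrow>product_lists (map gen_comult w).
            F (mat_gen (gen_row g) False # map fst ps) (mat_gen False (gen_col g) # map snd ps)) +
         (\<Sum>ps\<leftarrow>product_lists (map gen_comult w).
            F (mat_gen (gen_row g) True # map fst ps) (mat_gen True (gen_col g) # map snd ps))"
        by (simp add: gen comp_def)
      also have "\<dots> = (\<Sum>K\<in>bool_lists (length (g # w)).
          F (map2 mat_gen (map gen_row (g # w)) K) (map2 mat_gen K (map gen_col (g # w))))"
        unfolding Cons[of "\<lambda>x y. F (mat_gen (gen_row g) False # x) (mat_gen False (gen_col g) # y)"]
          Cons[of "\<lambda>x y. F (mat_gen (gen_row g) True # x) (mat_gen True (gen_col g) # y)"]
          length_Cons sum_bool_lists_Suc sum.distrib
        by simp
      finally show ?case .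
    qed simp
    from this[of "\<lambda>x y. emb (ev (vec x)) * emb (ev (vec y))"] show ?thesis
      by (simp add: word_sum_def coef_def)
  qed
  finally show "pures (word_comult q w) = word_sum (\<lambda>a b. emb a * emb b) w" .
qed

lemma bilinear_tensor: "bilinear_map (\<lambda>a b :: idx \<Rightarrow>\<^sub>0 'k. emb a * emb b)"
  by (intro bilinear_mapI lin)

lemma comult_model:
  assumes "h \<in> carrier (SLq q)"
  shows "comult (SLq q) h \<in> carrier (tensor_power (SLq q) 2) \<and>
    model (comult (SLq q) h) = sweedler_sum (\<lambda>a b. emb a * emb b) (pbw h)"
proof -
  obtain p where h: "h = SLq_class q p" using assms by (auto simp: carrier_SLq)
  let ?W = "lin_ext fscale (word_comult q)"
  have W: "Poly_Mapping.keys (?W r) \<subseteq> tup 2" "pures (?W r) = sweedler_sum (\<lambda>a b. emb a * emb b) (ev r)" for r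
  proof -
    show "Poly_Mapping.keys (?W r) \<subseteq> tup 2"
      unfolding lin_ext_def
      by (intro order_trans[OF keys_sum] UN_least order_trans[OF keys_fscale]) (simp add: word_comult_pures)
    have "pures (?W r) = lin_ext fscale (word_sum (\<lambda>a b. emb a * emb b)) r"
    proof (rule lin_ext_eq[where f = "\<lambda>r. pures (?W r)", symmetric])
      show "linear_map fscale (\<lambda>r. pures (?W r))"
        by (rule linear_pures[OF linear_map_lin_ext[OF vector_space_fscale]])
    qed (simp_all add: word_comult_pures vector_space_fscale)
    then show "pures (?W r) = sweedler_sum (\<lambda>a b. emb a * emb b) (ev r)"
      by (simp add: sweedler_sum_ev[OF bilinear_tensor])
  qed
  have cls: "tensor_class (SLq q) 2 (?W r) = tensor_class (SLq q) 2 (?W p)" if "ev r = ev p" for r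
    unfolding tensor_class_eq_iff[OF W(1) W(1)] W(2) that ..
  \<comment> \<open>The comultiplication is defined over the underlying algebra; the Hopf record
    shares the fields from which the relations are built.\<close>
  have alg: "tensor_class (SLq_alg q) 2 = tensor_class (SLq q) 2"
    by (rule ext) (simp add: tensor_class_def multilinear_relations_def tuples_def SLq_simps)
  have "comult (SLq q) h = tensor_class (SLq q) 2 (?W p)"
    unfolding SLq_simps(7) SLq_comult_def h alg by (rule the_elem_class) (rule cls)
  then show ?thesis using W by (simp add: model_tensor_class carrier_tensor_power h)
qed

definition pair_sum :: "((gen list \<Rightarrow>\<^sub>0 'k) set \<times> (gen list \<Rightarrow>\<^sub>0 'k) set) list \<Rightarrow> (idx list \<Rightarrow>\<^sub>0 'k)"
  where "pair_sum ps = (\<Sum>(a, b)\<leftarrow>ps. emb (pbw a) * emb (pbw b))"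

lemma pures_pairs:
  assumes "set ps \<subseteq> carrier (SLq q) \<times> carrier (SLq q)"
  shows "Poly_Mapping.keys (\<Sum>(a, b)\<leftarrow>ps. vec [a, b] :: (gen list \<Rightarrow>\<^sub>0 'k) set list \<Rightarrow>\<^sub>0 'k) \<subseteq> tup 2 \<and>
    pures (\<Sum>(a, b)\<leftarrow>ps. vec [a, b]) = pair_sum ps"
  using assms
proof (induction ps)
  case (Cons x ps)
  obtain a b where x: "x = (a, b)" by (cases x)
  have "Poly_Mapping.keys (vec [a, b] :: (gen list \<Rightarrow>\<^sub>0 'k) set list \<Rightarrow>\<^sub>0 'k) \<subseteq> tup 2"
    using Cons.prems by (simp add: x tuples_def)
  moreover have IH: "Poly_Mapping.keys (\<Sum>(a, b)\<leftarrow>ps. vec [a, b] :: (gen list \<Rightarrow>\<^sub>0 'k) set list \<Rightarrow>\<^sub>0 'k) \<subseteq> tup 2 \<and>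
    pures (\<Sum>(a, b)\<leftarrow>ps. vec [a, b]) = pair_sum ps"
    using Cons.prems by (intro Cons.IH) simp
  ultimately have "Poly_Mapping.keys (vec [a, b] + (\<Sum>(a, b)\<leftarrow>ps. vec [a, b]) :: (gen list \<Rightarrow>\<^sub>0 'k) set list \<Rightarrow>\<^sub>0 'k) \<subseteq> tup 2"
    by (intro keys_add_subset) simp_all
  then show ?case using IH by (simp add: x pair_sum_def pures_simps(1) del: keys_single)
qed (simp add: pair_sum_def pures_simps)

text \<open>Scalars are absorbed into first factors, so a list of pairs suffices; this is what makes
  the choice in \<open>sweedler\<close> possible.\<close>

lemma ex_pairs: "t \<in> tens 2 \<Longrightarrow> \<exists>ps. set ps \<subseteq> carrier (SLq q) \<times> carrier (SLq q) \<and> pair_sum ps = t"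
proof -
  assume t: "t \<in> tens 2"
  have "\<exists>ps. set ps \<subseteq> carrier (SLq q) \<times> carrier (SLq q) \<and>
      pair_sum ps = (\<Sum>bs\<in>A. fscale (Poly_Mapping.lookup t bs) (vec bs))" if "finite A" "A \<subseteq> Poly_Mapping.keys t" for A
    using that
  proof (induction A rule: finite_induct)
    case empty
    show ?case by (rule exI[of _ "[]"]) (simp add: pair_sum_def)
  next
    case (insert bs F)
    then obtain ps where ps: "set ps \<subseteq> carrier (SLq q) \<times> carrier (SLq q)"
      "pair_sum ps = (\<Sum>bs\<in>F. fscale (Poly_Mapping.lookup t bs) (vec bs))" by auto
    have "length bs = 2" using insert.prems t by (auto simp: tens_def)
    then obtain b c where bs: "bs = [b, c]" by (auto simp: numeral_2_eq_2 length_Suc_conv)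
    let ?x = "(unpbw (fscale (Poly_Mapping.lookup t bs) (vec b)), unpbw (vec c))"
    have "pair_sum (?x # ps) = (\<Sum>bs\<in>insert bs F. fscale (Poly_Mapping.lookup t bs) (vec bs))"
      using insert(1,2) ps(2) by (simp add: pair_sum_def unpbw bs mult_single plus_list_def)
    moreover have "set (?x # ps) \<subseteq> carrier (SLq q) \<times> carrier (SLq q)"
      using ps(1) unpbw(1) by simp
    ultimately show ?case by blast
  qed
  from this[OF finite_keys order_refl] show ?thesis
    using poly_mapping_expand[OF finite_keys order_refl, of t] by simp
qed

lemma sweedler_props:
  assumes h: "h \<in> carrier (SLq q)"
  shows "set (sweedler (SLq q) h) \<subseteq> carrier (SLq q) \<times> carrier (SLq q)"
    and "pair_sum (sweedler (SLq q) h) = sweedler_sum (\<lambda>a b. emb a * emb b) (pbw h)"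
proof -
  let ?P = "\<lambda>ps. set ps \<subseteq> carrier (SLq q) \<times> carrier (SLq q) \<and>
    comult (SLq q) h = tensor_class (SLq q) 2 (\<Sum>(a, b)\<leftarrow>ps. vec [a, b])"
  note cm = comult_model[OF h]
  have "model (comult (SLq q) h) \<in> tens 2"
    using cm models_closed(4)[OF models_tensor_power[of 2] vector_space_fscale] by blast
  then obtain ps where ps: "set ps \<subseteq> carrier (SLq q) \<times> carrier (SLq q)" "pair_sum ps = model (comult (SLq q) h)"
    using ex_pairs by blast
  have "comult (SLq q) h = tensor_class (SLq q) 2 (\<Sum>(a, b)\<leftarrow>ps. vec [a, b])"
    by (rule models_inj[OF models_tensor_power[of 2] vector_space_fscale])
      (use cm ps pures_pairs[OF ps(1)] in \<open>simp_all add: model_tensor_class carrier_tensor_power\<close>)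
  then have "?P ps" using ps(1) by simp
  then have "?P (sweedler (SLq q) h)" unfolding sweedler_def by (rule someI[of ?P])
  then show 1: "set (sweedler (SLq q) h) \<subseteq> carrier (SLq q) \<times> carrier (SLq q)"
    and "pair_sum (sweedler (SLq q) h) = sweedler_sum (\<lambda>a b. emb a * emb b) (pbw h)"
    using cm pures_pairs[of "sweedler (SLq q) h"] model_tensor_class by metis+
qed

text \<open>A bilinear map factors through a linear map on tensors of degree 2, so the sum depends
  on the comultiplication and not on the chosen list.\<close>

lemma sweedler_sum_sweedler:
  assumes h: "h \<in> carrier (SLq q)" and \<Phi>: "bilinear_map \<Phi>"
  shows "(\<Sum>p\<leftarrow>sweedler (SLq q) h. \<Phi> (pbw (fst p)) (pbw (snd p))) = sweedler_sum \<Phi> (pbw h)"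
proof -
  define G where "G = lin_ext fscale (\<lambda>bs. \<Phi> (vec (bs ! 0)) (vec (bs ! 1)))"
  have lin_G: "linear_map fscale G" unfolding G_def by (intro lin)
  have G: "G (emb a * emb b) = \<Phi> a b" for a b
    by (rule bilinear_map_eqI[where \<Phi> = "\<lambda>a b. G (emb a * emb b)", OF _ \<Phi>])
      (intro bilinear_mapI linear_map_comp[OF lin_G] lin | simp add: G_def vec_mult)+
  have "(\<Sum>p\<leftarrow>sweedler (SLq q) h. \<Phi> (pbw (fst p)) (pbw (snd p))) = G (pair_sum (sweedler (SLq q) h))"
    unfolding pair_sum_def linear_map_sum_list[OF lin_G] by (simp add: G case_prod_beta)
  also have "\<dots> = G (sweedler_sum (\<lambda>a b. emb a * emb b) (pbw h))"
    by (simp only: sweedler_props(2)[OF h])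
  also have "\<dots> = sweedler_sum \<Phi> (pbw h)"
  proof (rule linear_map_eq_coefI[where sc = fscale and f = "\<lambda>x. G (sweedler_sum (\<lambda>a b. emb a * emb b) x)"])
    show "linear_map fscale (\<lambda>x. G (sweedler_sum (\<lambda>a b. emb a * emb b) x))"
      by (rule linear_map_comp[OF lin_G linear_sweedler_sum[OF linear_map_id]])
    fix I J :: "bool list" assume "length I = length J"
    then show "G (sweedler_sum (\<lambda>a b. emb a * emb b) (coef I J)) = sweedler_sum \<Phi> (coef I J)"
      by (simp add: sweedler_sum_coef[OF \<Phi>] sweedler_sum_coef[OF bilinear_tensor] linear_map_sum[OF lin_G] G)
  qed (intro lin)
  finally show ?thesis .
qed

abbreviation "foldH xs \<equiv> foldr (mult (SLq q)) xs \<one>\<^bsub>SLq q\<^esub>"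

lemma foldH: "set xs \<subseteq> carrier (SLq q) \<Longrightarrow> foldH xs \<in> carrier (SLq q) \<and> pbw (foldH xs) = foldr (\<star>) (map pbw xs) \<e>"
  by (induction xs) (auto simp: SLq_mult SLq_one SLq_class_closed)

lemma foldr_mulA_snoc: "foldr (\<star>) (xs @ [x]) \<e> = foldr (\<star>) xs \<e> \<star> x"
  by (induction xs) (simp_all add: mulA_assoc)

lemma sum_list_product_lists_snoc:
  "(\<Sum>ps\<leftarrow>product_lists (xss @ [xs]). F ps) = (\<Sum>ps\<leftarrow>product_lists xss. \<Sum>p\<leftarrow>xs. (F (ps @ [p]) :: 'c::comm_monoid_add))"
proof (induction xss arbitrary: F)
  case Nil
  have "concat (map (\<lambda>x. [[x]]) xs) = map (\<lambda>x. [x]) xs" by (induction xs) simp_all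
  then show ?case by (simp add: comp_def)
next
  case (Cons ys xss)
  have "(\<Sum>ps\<leftarrow>concat (map (\<lambda>x. map ((#) x) pss) ys). F ps) = (\<Sum>y\<leftarrow>ys. \<Sum>ps\<leftarrow>pss. F (y # ps))" for pss and F :: "'a list \<Rightarrow> 'c"
    by (induction ys) (simp_all add: comp_def)
  then show ?case using Cons[of "\<lambda>ps. F (_ # ps)"] by simp
qed

text \<open>Peeling off the last factor reproduces the recursion of the coaction: its first leg ends
  the product, and the antipode brings it to the front.\<close>

lemma coact_sweedler:
  assumes "set hs \<subseteq> carrier (SLq q)"
  shows "(\<Sum>ps\<leftarrow>product_lists (map (sweedler (SLq q)) hs).
      emb (antip (foldr (\<star>) (map (\<lambda>p. pbw (fst p)) ps) \<e>)) * pure (map snd ps)) = coact (pure hs)"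
  using assms
proof (induction hs rule: rev_induct)
  case (snoc h hs)
  let ?sw = "sweedler (SLq q)"
  let ?t = "\<lambda>ps. emb (antip (foldr (\<star>) (map (\<lambda>p. pbw (fst p)) ps) \<e>)) * pure (map snd ps)"
  have h: "h \<in> carrier (SLq q)" using snoc.prems by simp
  have sum_swap: "(\<Sum>x\<leftarrow>xs. \<Sum>y\<leftarrow>ys. (f x y :: idx list \<Rightarrow>\<^sub>0 'k)) = (\<Sum>y\<leftarrow>ys. \<Sum>x\<leftarrow>xs. f x y)"
    for xs :: "'x list" and ys :: "'y list" and f
    by (induction xs) (simp_all add: sum_list_addf)
  have "(\<Sum>ps\<leftarrow>product_lists (map ?sw (hs @ [h])). ?t ps) =
      (\<Sum>ps\<leftarrow>product_lists (map ?sw hs). \<Sum>p\<leftarrow>?sw h. ?t (ps @ [p]))"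
    by (simp only: map_append list.map sum_list_product_lists_snoc)
  also have "\<dots> = (\<Sum>ps\<leftarrow>product_lists (map ?sw hs). \<Sum>p\<leftarrow>?sw h. Lm (antip (pbw (fst p))) (?t ps) * emb (pbw (snd p)))"
    by (simp only: map_append list.map foldr_mulA_snoc antip_mulA Lm_Cons pure_simps mult.assoc mult_1_right)
  also have "\<dots> = (\<Sum>p\<leftarrow>?sw h. \<Sum>ps\<leftarrow>product_lists (map ?sw hs). Lm (antip (pbw (fst p))) (?t ps) * emb (pbw (snd p)))"
    by (rule sum_swap)
  also have "\<dots> = (\<Sum>p\<leftarrow>?sw h. Lm (antip (pbw (fst p))) (coact (pure hs)) * emb (pbw (snd p)))"
  proof -
    have l: "linear_map fscale (\<lambda>t. Lm a t * emb b)" for a b :: "idx \<Rightarrow>\<^sub>0 'k" by (intro lin)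
    have "(\<Sum>ps\<leftarrow>product_lists (map ?sw hs). ?t ps) = coact (pure hs)"
      using snoc.prems by (intro snoc.IH) simp
    then have "(\<Sum>ps\<leftarrow>product_lists (map ?sw hs). Lm a (?t ps) * emb b) = Lm a (coact (pure hs)) * emb b" for a b
      using linear_map_sum_list[OF l[of a b], of ?t "product_lists (map ?sw hs)"] by (simp only:)
    then show ?thesis by (simp only:)
  qed
  also have "\<dots> = coact (pure (hs @ [h]))"
    using sweedler_sum_sweedler[OF h bilinear_coact_step[of "coact (pure hs)"]] coact_snoc[of "pure hs" "pbw h"]
    by simp
  finally show ?case .
qed simp

text \<open>The summands are those of the coaction with \<delta> applied to the last factor.\<close>

lemma hopf_cyc_pures:
  assumes hs: "hs \<in> tup n"
  shows "Poly_Mapping.keys (hopf_cyc (SLq q) \<delta> hs) \<subseteq> tup n \<and> pures (hopf_cyc (SLq q) \<delta> hs) = tau (pure hs)"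
proof (cases "hs = []")
  case True
  then show ?thesis using hs by (simp add: hopf_cyc_def tuples_def)
next
  case False
  let ?L = "product_lists (map (sweedler (SLq q)) hs)"
  let ?s = "\<lambda>ps. Poly_Mapping.single (antipode (SLq q) (foldH (map fst ps)) # butlast (map snd ps)) (\<delta> (snd (last ps)))"
  let ?t = "\<lambda>ps. emb (antip (foldr (\<star>) (map (\<lambda>p. pbw (fst p)) ps) \<e>)) * pure (map snd ps)"
  have H: "set hs \<subseteq> carrier (SLq q)" "length hs = n" using hs by (auto simp: tuples_def)
  have mem: "length ps = n \<and> set ps \<subseteq> carrier (SLq q) \<times> carrier (SLq q)" if "ps \<in> set ?L" for ps
  proof -
    have "list_all2 (\<lambda>x ys. x \<in> set ys) ps (map (sweedler (SLq q)) hs)"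
      using that by (simp add: product_lists_set)
    then have "length ps = length hs" "\<And>i. i < length hs \<Longrightarrow> ps ! i \<in> set (sweedler (SLq q) (hs ! i))"
      by (auto simp: list_all2_conv_all_nth)
    moreover have "set (sweedler (SLq q) (hs ! i)) \<subseteq> carrier (SLq q) \<times> carrier (SLq q)" if "i < length hs" for i
      using H that by (intro sweedler_props(1)) auto
    ultimately show ?thesis using H by (fastforce simp: set_conv_nth[of ps])
  qed
  have each: "antipode (SLq q) (foldH (map fst ps)) # butlast (map snd ps) \<in> tup n \<and>
      pures (?s ps) = last_delta (?t ps)" if "ps \<in> set ?L" for ps
  proof -
    have ps: "length ps = n" "set ps \<subseteq> carrier (SLq q) \<times> carrier (SLq q)"
      using mem[OF that] by simp_all
    then have "ps \<noteq> []" using False H by auto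
    then obtain ps' p where p: "ps = ps' @ [p]" by (cases ps rule: rev_cases) auto
    have c: "set (map fst ps) \<subseteq> carrier (SLq q)" "set (map snd ps) \<subseteq> carrier (SLq q)" using ps(2) by auto
    note f = foldH[OF c(1)]
    have "snd p \<in> carrier (SLq q)" "set (map snd ps') \<subseteq> carrier (SLq q)" using c p by auto
    then show ?thesis
      using f antipode_eq[OF conjunct1[OF f]] ps(1) p
      by (simp add: tuples_def delta_eq last_delta_snoc comp_def flip: mult.assoc)
  qed
  have cyc: "hopf_cyc (SLq q) \<delta> hs = (\<Sum>ps\<leftarrow>?L. ?s ps)" using False by (simp add: hopf_cyc_def)
  have "Poly_Mapping.keys (\<Sum>ps\<leftarrow>L. ?s ps) \<subseteq> tup n" if "set L \<subseteq> set ?L" for L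
    using that
  proof (induction L)
    case (Cons ps L)
    then have "Poly_Mapping.keys (?s ps) \<subseteq> tup n" "Poly_Mapping.keys (\<Sum>ps\<leftarrow>L. ?s ps) \<subseteq> tup n"
      using each[of ps] by simp_all
    then show ?case unfolding list.map sum_list.Cons by (rule keys_add_subset)
  qed simp
  moreover have "pures (\<Sum>ps\<leftarrow>?L. ?s ps) = last_delta (\<Sum>ps\<leftarrow>?L. ?t ps)"
    unfolding linear_map_sum_list[OF linear_pures[OF linear_map_id]]
      linear_map_sum_list[OF linear_last_delta[OF linear_map_id]]
    using each by (intro arg_cong[of _ _ sum_list] map_cong refl) blast
  ultimately show ?thesis unfolding cyc coact_sweedler[OF H(1)] tau_def by blast
qed

end

section \<open>Cyclic and periodic cyclic homology\<close>

lemma direct_product_simps: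
  "carrier (direct_product I M) = (\<Pi>\<^sub>E i\<in>I. carrier (M i))"
  "zero (direct_product I M) = (\<lambda>i\<in>I. \<zero>\<^bsub>M i\<^esub>)"
  "add (direct_product I M) = (\<lambda>f g. \<lambda>i\<in>I. f i \<oplus>\<^bsub>M i\<^esub> g i)"
  "smult (direct_product I M) = (\<lambda>c f. \<lambda>i\<in>I. c \<odot>\<^bsub>M i\<^esub> f i)"
  by (simp_all add: direct_product_def)

lemma abelian_group_direct_product:
  assumes "\<And>i. i \<in> I \<Longrightarrow> abelian_group (M i)"
  shows "abelian_group (direct_product I M)"
proof (rule abelian_groupI)
  fix x assume x: "x \<in> carrier (direct_product I M)"
  have mem: "x i \<in> carrier (M i)" if "i \<in> I" for i
    using x that by (auto simp: direct_product_simps)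
  show "\<exists>y\<in>carrier (direct_product I M). y \<oplus>\<^bsub>direct_product I M\<^esub> x = \<zero>\<^bsub>direct_product I M\<^esub>"
  proof
    show "(\<lambda>i\<in>I. \<ominus>\<^bsub>M i\<^esub> x i) \<oplus>\<^bsub>direct_product I M\<^esub> x = \<zero>\<^bsub>direct_product I M\<^esub>"
      unfolding direct_product_simps
      using mem by (intro restrict_ext) (simp add: abelian_group.l_neg[OF assms])
    show "(\<lambda>i\<in>I. \<ominus>\<^bsub>M i\<^esub> x i) \<in> carrier (direct_product I M)"
      unfolding direct_product_simps using mem by (auto intro: abelian_group.a_inv_closed[OF assms])
  qed
  show "\<zero>\<^bsub>direct_product I M\<^esub> \<oplus>\<^bsub>direct_product I M\<^esub> x = x"
  proof (rule PiE_ext)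
    show "\<zero>\<^bsub>direct_product I M\<^esub> \<oplus>\<^bsub>direct_product I M\<^esub> x \<in> (\<Pi>\<^sub>E i\<in>I. carrier (M i))"
      unfolding direct_product_simps using mem assms
      by (auto simp: abelian_monoid.a_closed abelian_monoid.zero_closed abelian_group.axioms)
    show "x \<in> (\<Pi>\<^sub>E i\<in>I. carrier (M i))" using x by (simp add: direct_product_simps)
    fix i assume "i \<in> I"
    then show "(\<zero>\<^bsub>direct_product I M\<^esub> \<oplus>\<^bsub>direct_product I M\<^esub> x) i = x i"
      using mem assms by (simp add: direct_product_simps abelian_monoid.l_zero abelian_group.axioms)
  qed
next
  fix x y assume x: "x \<in> carrier (direct_product I M)" and y: "y \<in> carrier (direct_product I M)"
  have mem: "x i \<in> carrier (M i)" "y i \<in> carrier (M i)" if "i \<in> I" for i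
    using x y that by (auto simp: direct_product_simps)
  show "x \<oplus>\<^bsub>direct_product I M\<^esub> y \<in> carrier (direct_product I M)"
    unfolding direct_product_simps using mem assms
    by (auto simp: abelian_monoid.a_closed abelian_group.axioms)
  show "x \<oplus>\<^bsub>direct_product I M\<^esub> y = y \<oplus>\<^bsub>direct_product I M\<^esub> x"
    unfolding direct_product_simps using mem assms
    by (intro restrict_ext) (simp add: abelian_monoid.a_comm abelian_group.axioms)
  fix z assume z: "z \<in> carrier (direct_product I M)"
  have "z i \<in> carrier (M i)" if "i \<in> I" for i
    using z that by (auto simp: direct_product_simps)
  then show "x \<oplus>\<^bsub>direct_product I M\<^esub> y \<oplus>\<^bsub>direct_product I M\<^esub> z = x \<oplus>\<^bsub>direct_product I M\<^esub> (y \<oplus>\<^bsub>direct_product I M\<^esub> z)"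
    unfolding direct_product_simps using mem assms
    by (intro restrict_ext) (simp add: abelian_monoid.a_assoc abelian_group.axioms)
next
  show "\<zero>\<^bsub>direct_product I M\<^esub> \<in> carrier (direct_product I M)"
    unfolding direct_product_simps using assms by (auto simp: abelian_monoid.zero_closed abelian_group.axioms)
qed

lemma abelian_group_restrict:
  fixes B :: "('k, 'v) module"
  assumes B: "abelian_group B" and Z: "Z \<subseteq> carrier B" "\<zero>\<^bsub>B\<^esub> \<in> Z" "\<And>x y. x \<in> Z \<Longrightarrow> y \<in> Z \<Longrightarrow> x \<oplus>\<^bsub>B\<^esub> y \<in> Z"
    "\<And>x. x \<in> Z \<Longrightarrow> \<ominus>\<^bsub>B\<^esub> x \<in> Z"
  shows "abelian_group (B\<lparr>carrier := Z\<rparr>)"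
proof -
  interpret abelian_group B by (rule B)
  show ?thesis
  proof (rule abelian_groupI)
    show "\<exists>y\<in>carrier (B\<lparr>carrier := Z\<rparr>). y \<oplus>\<^bsub>B\<lparr>carrier := Z\<rparr>\<^esub> x = \<zero>\<^bsub>B\<lparr>carrier := Z\<rparr>\<^esub>"
      if "x \<in> carrier (B\<lparr>carrier := Z\<rparr>)" for x
      using that Z by (intro bexI[of _ "\<ominus>\<^bsub>B\<^esub> x"]) (auto simp: l_neg)
    show "x \<oplus>\<^bsub>B\<lparr>carrier := Z\<rparr>\<^esub> y = y \<oplus>\<^bsub>B\<lparr>carrier := Z\<rparr>\<^esub> x"
      if "x \<in> carrier (B\<lparr>carrier := Z\<rparr>)" "y \<in> carrier (B\<lparr>carrier := Z\<rparr>)" for x y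
      using that subsetD[OF Z(1)] by (simp add: a_comm)
    show "x \<oplus>\<^bsub>B\<lparr>carrier := Z\<rparr>\<^esub> y \<oplus>\<^bsub>B\<lparr>carrier := Z\<rparr>\<^esub> z = x \<oplus>\<^bsub>B\<lparr>carrier := Z\<rparr>\<^esub> (y \<oplus>\<^bsub>B\<lparr>carrier := Z\<rparr>\<^esub> z)"
      if "x \<in> carrier (B\<lparr>carrier := Z\<rparr>)" "y \<in> carrier (B\<lparr>carrier := Z\<rparr>)" "z \<in> carrier (B\<lparr>carrier := Z\<rparr>)" for x y z
      using that subsetD[OF Z(1)] by (simp add: a_assoc)
  qed (use Z(2-4) subsetD[OF Z(1)] in simp_all)
qed

context SLq_character
begin

abbreviation "CM \<equiv> hopf_cyclic_module (SLq q) \<delta>"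
abbreviation "TP r \<equiv> tensor_power (SLq q) r"

lemma CM_simps: "obj CM = tensor_power (SLq q)"
  "face CM n i = tensor_map (SLq q) (n - 1) (hopf_face (SLq q) \<delta> n i)"
  "cyc CM n = tensor_map (SLq q) n (hopf_cyc (SLq q) \<delta>)"
  by (simp_all add: hopf_cyclic_module_def)

lemmas TP_closed = models_closed[OF models_tensor_power vector_space_fscale]
lemmas TP_simps = models_simps[OF models_tensor_power vector_space_fscale]
lemmas TP_inj = models_inj[OF models_tensor_power vector_space_fscale]
lemmas TP_group = models_abelian_group[OF models_tensor_power vector_space_fscale]
lemmas TP_finsum = models_finsum[OF models_tensor_power vector_space_fscale]
lemmas TP_inv = models_a_inv[OF models_tensor_power vector_space_fscale]
lemmas TP_minus = models_a_minus[OF models_tensor_power vector_space_fscale]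

section \<open>The operators of the cyclic module in the model\<close>

lemma face_model:
  assumes "i \<le> Suc n" "A \<in> carrier (TP (Suc n))"
  shows "face CM (Suc n) i A \<in> carrier (TP n) \<and> model (face CM (Suc n) i A) = dface (Suc n) i (model A)"
  unfolding CM_simps diff_Suc_1
  by (rule tensor_map_model[OF hopf_face_pures linear_dface[OF linear_map_id] assms(2)]) (use assms in auto)

lemma cyc_model:
  assumes "A \<in> carrier (TP n)"
  shows "cyc CM n A \<in> carrier (TP n) \<and> model (cyc CM n A) = tau (model A)"
  unfolding CM_simps
  by (rule tensor_map_model[OF hopf_cyc_pures linear_tau[OF linear_map_id] assms])

lemma hoch_b_model:
  assumes A: "A \<in> carrier (TP (Suc n))"
  shows "hoch_b CM (Suc n) A \<in> carrier (TP n) \<and> model (hoch_b CM (Suc n) A) = bd (Suc n) (model A)"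
proof -
  let ?f = "\<lambda>i. (- 1) ^ i \<odot>\<^bsub>TP n\<^esub> face CM (Suc n) i A"
  have f: "?f i \<in> carrier (TP n)" "model (?f i) = fscale ((- 1) ^ i) (dface (Suc n) i (model A))" if "i \<le> Suc n" for i
    using face_model[OF that A] by (simp_all add: TP_closed TP_simps)
  have "model (hoch_b CM (Suc n) A) = (\<Sum>i\<in>{0..Suc n}. model (?f i)) \<and> hoch_b CM (Suc n) A \<in> carrier (TP n)"
    unfolding hoch_b_def CM_simps(1) diff_Suc_1 using TP_finsum[of ?f "{0..Suc n}" n] f by auto
  moreover have "(\<Sum>i\<in>{0..Suc n}. model (?f i)) = (\<Sum>i\<le>Suc n. fscale ((- 1) ^ i) (dface (Suc n) i (model A)))"
    by (intro sum.cong) (auto simp: f)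
  moreover have "(\<Sum>i\<le>Suc n. fscale ((- 1) ^ i) (dface (Suc n) i (model A))) = bd (Suc n) (model A)"
  proof -
    have "(\<Sum>i\<le>n. fscale ((- 1) ^ i) (dface (Suc n) i (model A))) = bp (Suc n) (model A)"
      unfolding bp_def lessThan_Suc_atMost by (intro sum.cong) (simp_all add: dface_def)
    moreover have "dface (Suc n) (Suc n) (model A) = last_delta (model A)" by (simp add: dface_def)
    ultimately show ?thesis by (simp only: sum.atMost_Suc bd_def)
  qed
  ultimately show ?thesis by (simp only:)
qed

lemma hoch_b'_model:
  assumes A: "A \<in> carrier (TP (Suc n))"
  shows "hoch_b' CM (Suc n) A \<in> carrier (TP n) \<and> model (hoch_b' CM (Suc n) A) = bp (Suc n) (model A)"
proof -
  let ?f = "\<lambda>i. (- 1) ^ i \<odot>\<^bsub>TP n\<^esub> face CM (Suc n) i A"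
  have f: "?f i \<in> carrier (TP n)" "model (?f i) = fscale ((- 1) ^ i) (dface (Suc n) i (model A))" if "i \<le> Suc n" for i
    using face_model[OF that A] by (simp_all add: TP_closed TP_simps)
  have "model (hoch_b' CM (Suc n) A) = (\<Sum>i\<in>{0..<Suc n}. model (?f i)) \<and> hoch_b' CM (Suc n) A \<in> carrier (TP n)"
    unfolding hoch_b'_def CM_simps(1) diff_Suc_1 using TP_finsum[of ?f "{0..<Suc n}" n] f by auto
  moreover have "(\<Sum>i\<in>{0..<Suc n}. model (?f i)) = (\<Sum>i<Suc n. fscale ((- 1) ^ i) (fc i (model A)))"
    by (intro sum.cong) (auto simp: f dface_def)
  ultimately show ?thesis by (simp add: bp_def del: sum.lessThan_Suc)
qed

lemma signed_cyc_model:
  "A \<in> carrier (TP n) \<Longrightarrow> signed_cyc CM n A \<in> carrier (TP n) \<and> model (signed_cyc CM n A) = st n (model A)"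
  using cyc_model[of A n] by (simp add: signed_cyc_def CM_simps(1) TP_closed TP_simps st_def)

lemma cyc_norm_model:
  assumes "A \<in> carrier (TP n)"
  shows "cyc_norm CM n A \<in> carrier (TP n) \<and> model (cyc_norm CM n A) = cn n (model A)"
proof -
  let ?f = "\<lambda>i. (signed_cyc CM n ^^ i) A"
  have f: "?f i \<in> carrier (TP n) \<and> model (?f i) = (st n ^^ i) (model A)" for i
    by (induction i) (use assms signed_cyc_model in auto)
  show ?thesis
    unfolding cyc_norm_def CM_simps(1) cn_def using TP_finsum[of ?f "{0..n}" n] f
    by (simp add: atLeast0AtMost Pi_def)
qed

section \<open>The total complex in the model\<close>

lemma total_space_simps:
  "carrier (total_space CM S) = (\<Pi>\<^sub>E r\<in>S. carrier (TP r))"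
  "\<zero>\<^bsub>total_space CM S\<^esub> = (\<lambda>r\<in>S. \<zero>\<^bsub>TP r\<^esub>)"
  "z \<oplus>\<^bsub>total_space CM S\<^esub> w = (\<lambda>r\<in>S. z r \<oplus>\<^bsub>TP r\<^esub> w r)"
  "c \<odot>\<^bsub>total_space CM S\<^esub> z = (\<lambda>r\<in>S. c \<odot>\<^bsub>TP r\<^esub> z r)"
  by (simp_all add: total_space_def direct_product_simps CM_simps(1))

lemma abelian_group_total_space: "abelian_group (total_space CM S)"
  unfolding total_space_def CM_simps(1) by (rule abelian_group_direct_product) (rule TP_group)

abbreviation "models_at z \<equiv> (\<lambda>r. model (z r))"

lemma total_space_ext:
  assumes "z \<in> carrier (total_space CM S)" "w \<in> carrier (total_space CM S)"
    "\<And>r. r \<in> S \<Longrightarrow> model (z r) = model (w r)"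
  shows "z = w"
proof (rule PiE_ext)
  show "z \<in> (\<Pi>\<^sub>E r\<in>S. carrier (TP r))" "w \<in> (\<Pi>\<^sub>E r\<in>S. carrier (TP r))"
    using assms(1,2) by (simp_all add: total_space_simps)
  then show "z r = w r" if "r \<in> S" for r
    using that assms(3) by (intro TP_inj[of _ r]) auto
qed

text \<open>Row r of the target receives rows r and r + 1 of the source, whence the condition on the
  index sets.\<close>

lemma total_diff_model:
  assumes z: "z \<in> carrier (total_space CM S)" and T: "\<And>r. r \<in> T \<Longrightarrow> r \<in> S \<and> Suc r \<in> S"
  shows "total_diff CM T n z \<in> carrier (total_space CM T)"
    and "r \<in> T \<Longrightarrow> model (total_diff CM T n z r) = td n (models_at z) r"
proof -
  have main: "total_diff CM T n z r \<in> carrier (TP r) \<and> model (total_diff CM T n z r) = td n (models_at z) r"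
    if r: "r \<in> T" for r
  proof -
    have mem: "z r \<in> carrier (TP r)" "z (Suc r) \<in> carrier (TP (Suc r))"
      using z T[OF r] by (auto simp: total_space_simps)
    let ?v = "if even (n - 1 - int r) then hoch_b CM (r + 1) (z (r + 1)) else \<ominus>\<^bsub>TP r\<^esub> hoch_b' CM (r + 1) (z (r + 1))"
    let ?h = "if odd (n - int r) then z r \<ominus>\<^bsub>TP r\<^esub> signed_cyc CM r (z r) else cyc_norm CM r (z r)"
    have v: "?v \<in> carrier (TP r) \<and> model ?v = vd (n - 1 - int r) (Suc r) (model (z (Suc r)))"
      using hoch_b_model[OF mem(2)] hoch_b'_model[OF mem(2)] TP_inv by (simp add: vd_def)
    have h: "?h \<in> carrier (TP r) \<and> model ?h = hd' (n - int r) r (model (z r))"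
      using signed_cyc_model[OF mem(1)] cyc_norm_model[OF mem(1)] TP_minus[OF mem(1)] by (simp add: hd'_def)
    have "total_diff CM T n z r = ?v \<oplus>\<^bsub>TP r\<^esub> ?h"
      using r by (simp add: total_diff_def CM_simps(1))
    then show ?thesis using v h TP_closed(2)[of ?v r ?h] TP_simps(2)[of ?v r ?h] by (simp only: td_def)
  qed
  then show "total_diff CM T n z \<in> carrier (total_space CM T)"
    by (auto simp: total_space_simps total_diff_def)
  show "r \<in> T \<Longrightarrow> model (total_diff CM T n z r) = td n (models_at z) r" using main by blast
qed

lemma model_total_space: "z \<in> carrier (total_space CM S) \<Longrightarrow> r \<in> S \<Longrightarrow> z r \<in> carrier (TP r) \<and> model (z r) \<in> tens r"
  using TP_closed(4) by (auto simp: total_space_simps)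

lemma model_add:
  assumes "z \<in> carrier (total_space CM S)" "w \<in> carrier (total_space CM S)" "r \<in> S"
  shows "model ((z \<oplus>\<^bsub>total_space CM S\<^esub> w) r) = model (z r) + model (w r)"
  using assms model_total_space[OF assms(1,3)] model_total_space[OF assms(2,3)]
  by (simp add: total_space_simps TP_simps)

lemma model_smult:
  assumes "z \<in> carrier (total_space CM S)" "r \<in> S"
  shows "model ((c \<odot>\<^bsub>total_space CM S\<^esub> z) r) = fscale c (model (z r))"
  using assms model_total_space[OF assms] by (simp add: total_space_simps TP_simps)

lemma smult_closed: "z \<in> carrier (total_space CM S) \<Longrightarrow> c \<odot>\<^bsub>total_space CM S\<^esub> z \<in> carrier (total_space CM S)"
  using model_total_space[of z S] by (auto simp: total_space_simps intro!: TP_closed(3))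

lemma model_inv:
  assumes "z \<in> carrier (total_space CM S)" "r \<in> S"
  shows "model ((\<ominus>\<^bsub>total_space CM S\<^esub> z) r) = - model (z r)"
proof -
  interpret abelian_group "total_space CM S" by (rule abelian_group_total_space)
  have "model ((\<ominus>\<^bsub>total_space CM S\<^esub> z) r) + model (z r) = model (\<zero>\<^bsub>total_space CM S\<^esub> r)"
    using model_add[of "\<ominus>\<^bsub>total_space CM S\<^esub> z" S z r] assms by (simp add: l_neg)
  then show ?thesis using assms by (simp add: total_space_simps TP_simps eq_neg_iff_add_eq_0)
qed

definition lift_seq :: "nat set \<Rightarrow> (nat \<Rightarrow> idx list \<Rightarrow>\<^sub>0 'k) \<Rightarrow> nat \<Rightarrow> ((gen list \<Rightarrow>\<^sub>0 'k) set list \<Rightarrow>\<^sub>0 'k) set"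
  where "lift_seq S w = (\<lambda>r\<in>S. SOME a. a \<in> carrier (TP r) \<and> model a = w r)"

lemma lift_seq:
  assumes "\<And>r. r \<in> S \<Longrightarrow> w r \<in> tens r"
  shows "lift_seq S w \<in> carrier (total_space CM S)" "r \<in> S \<Longrightarrow> model (lift_seq S w r) = w r"
proof -
  have "lift_seq S w r \<in> carrier (TP r) \<and> model (lift_seq S w r) = w r" if "r \<in> S" for r
    using someI_ex[of "\<lambda>a. a \<in> carrier (TP r) \<and> model a = w r"]
      models_surj[OF models_tensor_power vector_space_fscale assms[OF that]] that
    by (auto simp: lift_seq_def)
  then show "lift_seq S w \<in> carrier (total_space CM S)" "r \<in> S \<Longrightarrow> model (lift_seq S w r) = w r"
    by (auto simp: total_space_simps lift_seq_def)
qed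

lemma td_cong: "z r = w r \<Longrightarrow> z (Suc r) = w (Suc r) \<Longrightarrow> td n z r = td n w r"
  by (simp add: td_def)

lemma td_add: "td n (\<lambda>r. z r + w r) r = td n z r + td n w r"
  and td_minus: "td n (\<lambda>r. - z r) r = - td n z r"
  and td_scale: "td n (\<lambda>r. fscale c (z r)) r = fscale c (td n z r)"
  and td_zero: "td n (\<lambda>r. 0) r = 0"
  by (simp_all add: td_def vd_simps hd'_simps fscale.scale_right_distrib)

text \<open>The sets are the rows in degrees n - 1, n and n + 1; the conditions fit both the bounded
  rows of the cyclic complex and the full set of rows of the periodic one.\<close>

context
  fixes S0 S1 S2 :: "nat set" and n :: int
  assumes S0: "\<And>r. r \<in> S0 \<longleftrightarrow> Suc r \<in> S1" and down: "\<And>r. Suc r \<in> S1 \<Longrightarrow> r \<in> S1"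
    and S2: "\<And>r. r \<in> S1 \<Longrightarrow> r \<in> S2 \<and> Suc r \<in> S2"
begin

abbreviation "cycles \<equiv> {z \<in> carrier (total_space CM S1). total_diff CM S0 n z = \<zero>\<^bsub>total_space CM S0\<^esub>}"
abbreviation "boundaries \<equiv> total_diff CM S1 (n + 1) ` carrier (total_space CM S2)"

lemma S01: "r \<in> S0 \<Longrightarrow> r \<in> S1 \<and> Suc r \<in> S1"
  using S0 down by blast

lemma mem_cycles: "z \<in> cycles \<longleftrightarrow> z \<in> carrier (total_space CM S1) \<and> (\<forall>r\<in>S0. td n (models_at z) r = 0)"
proof (cases "z \<in> carrier (total_space CM S1)")
  case True
  note d = total_diff_model[OF True S01, where n = n]
  have zero: "\<zero>\<^bsub>total_space CM S0\<^esub> \<in> carrier (total_space CM S0)"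
    by (auto simp: total_space_simps TP_closed)
  show ?thesis
  proof
    assume "z \<in> cycles"
    then have "total_diff CM S0 n z = \<zero>\<^bsub>total_space CM S0\<^esub>" by simp
    then have "model (total_diff CM S0 n z r) = 0" if "r \<in> S0" for r
      using that by (simp add: total_space_simps TP_simps)
    then show "z \<in> carrier (total_space CM S1) \<and> (\<forall>r\<in>S0. td n (models_at z) r = 0)"
      using d(2) True by simp
  next
    assume "z \<in> carrier (total_space CM S1) \<and> (\<forall>r\<in>S0. td n (models_at z) r = 0)"
    then have "total_diff CM S0 n z = \<zero>\<^bsub>total_space CM S0\<^esub>"
      using d(2) by (intro total_space_ext[OF d(1) zero]) (simp_all add: total_space_simps TP_simps)
    then show "z \<in> cycles" using True by simp
  qed
qed simp

lemma cycles_group: "abelian_group (total_space CM S1\<lparr>carrier := cycles\<rparr>)"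
proof (rule abelian_group_restrict[OF abelian_group_total_space])
  interpret abelian_group "total_space CM S1" by (rule abelian_group_total_space)
  show "\<zero>\<^bsub>total_space CM S1\<^esub> \<in> cycles"
    unfolding mem_cycles
  proof (intro conjI ballI)
    fix r assume r: "r \<in> S0"
    have "td n (models_at \<zero>\<^bsub>total_space CM S1\<^esub>) r = td n (\<lambda>_. 0) r"
      by (rule td_cong) (use S01[OF r] in \<open>simp_all add: total_space_simps TP_simps\<close>)
    then show "td n (models_at \<zero>\<^bsub>total_space CM S1\<^esub>) r = 0" by (simp add: td_zero)
  qed simp
  show "x \<oplus>\<^bsub>total_space CM S1\<^esub> y \<in> cycles" if x: "x \<in> cycles" and y: "y \<in> cycles" for x y
    unfolding mem_cycles
  proof (intro conjI ballI)
    note m = x[unfolded mem_cycles] y[unfolded mem_cycles]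
    show "x \<oplus>\<^bsub>total_space CM S1\<^esub> y \<in> carrier (total_space CM S1)" using m by simp
    fix r assume r: "r \<in> S0"
    have "td n (models_at (x \<oplus>\<^bsub>total_space CM S1\<^esub> y)) r = td n (\<lambda>r. model (x r) + model (y r)) r"
      by (rule td_cong) (use m S01[OF r] model_add in blast)+
    then show "td n (models_at (x \<oplus>\<^bsub>total_space CM S1\<^esub> y)) r = 0"
      using m r by (simp add: td_add)
  qed
  show "\<ominus>\<^bsub>total_space CM S1\<^esub> x \<in> cycles" if x: "x \<in> cycles" for x
    unfolding mem_cycles
  proof (intro conjI ballI)
    note m = x[unfolded mem_cycles]
    show "\<ominus>\<^bsub>total_space CM S1\<^esub> x \<in> carrier (total_space CM S1)" using m by simp
    fix r assume r: "r \<in> S0"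
    have "td n (models_at (\<ominus>\<^bsub>total_space CM S1\<^esub> x)) r = td n (\<lambda>r. - model (x r)) r"
      by (rule td_cong) (use m S01[OF r] model_inv in blast)+
    then show "td n (models_at (\<ominus>\<^bsub>total_space CM S1\<^esub> x)) r = 0"
      using m r by (simp add: td_minus)
  qed
qed auto

lemma cycles_smult:
  assumes x: "x \<in> cycles"
  shows "c \<odot>\<^bsub>total_space CM S1\<^esub> x \<in> cycles"
  unfolding mem_cycles
proof (intro conjI ballI)
  note m = x[unfolded mem_cycles]
  show "c \<odot>\<^bsub>total_space CM S1\<^esub> x \<in> carrier (total_space CM S1)" using m smult_closed by blast
  fix r assume r: "r \<in> S0"
  have "td n (models_at (c \<odot>\<^bsub>total_space CM S1\<^esub> x)) r = td n (\<lambda>r. fscale c (model (x r))) r"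
    by (rule td_cong) (use m S01[OF r] model_smult in blast)+
  then show "td n (models_at (c \<odot>\<^bsub>total_space CM S1\<^esub> x)) r = 0"
    using m r by (simp add: td_scale)
qed

lemma boundaries_cycles: "boundaries \<subseteq> cycles"
proof
  fix z assume "z \<in> boundaries"
  then obtain w where w: "w \<in> carrier (total_space CM S2)" "z = total_diff CM S1 (n + 1) w" by blast
  have d: "model (z r) = td (n + 1) (models_at w) r" if "r \<in> S1" for r
    unfolding w(2) by (rule total_diff_model(2)[OF w(1) S2]) (use that in simp_all)
  show "z \<in> cycles"
    unfolding mem_cycles
  proof (intro conjI ballI)
    fix r assume "r \<in> S0"
    then have r: "r \<in> S1" "Suc r \<in> S1" using S01 by blast+
    have "td n (models_at z) r = td n (td (n + 1) (models_at w)) r"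
      by (rule td_cong) (simp_all only: d[OF r(1)] d[OF r(2)])
    also have "\<dots> = td (n + 1 - 1) (td (n + 1) (models_at w)) r" by simp
    also have "\<dots> = 0"
      by (rule td_td) (use model_total_space[OF w(1)] S2 r in blast)+
    finally show "td n (models_at z) r = 0" .
  qed (unfold w(2), rule total_diff_model(1)[OF w(1) S2])
qed

lemma boundaryI:
  assumes z: "z \<in> carrier (total_space CM S1)" and w: "\<And>r. w r \<in> tens r"
    and eq: "\<And>r. r \<in> S1 \<Longrightarrow> td (n + 1) w r = model (z r)"
  shows "z \<in> boundaries"
proof
  note l = lift_seq[of S2 w, OF w]
  show "lift_seq S2 w \<in> carrier (total_space CM S2)" by (rule l)
  note d = total_diff_model[OF l(1) S2, where n = "n + 1"]
  show "z = total_diff CM S1 (n + 1) (lift_seq S2 w)"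
  proof (rule total_space_ext[OF z d(1)])
    fix r assume r: "r \<in> S1"
    have "td (n + 1) (models_at (lift_seq S2 w)) r = td (n + 1) w r"
      by (rule td_cong) (use l(2) S2[OF r] in auto)
    then show "model (z r) = model (total_diff CM S1 (n + 1) (lift_seq S2 w) r)"
      using d(2)[OF _ r] eq[OF r] r by simp
  qed
qed

abbreviation "homologyM \<equiv> homology (total_space CM S2) (total_diff CM S1 (n + 1)) (total_space CM S1)
  (total_diff CM S0 n) (total_space CM S0)"

lemma homology_models:
  assumes K: "boundaries = {z \<in> cycles. \<phi> z = 0}"
    and add: "\<And>x y. x \<in> cycles \<Longrightarrow> y \<in> cycles \<Longrightarrow> \<phi> (x \<oplus>\<^bsub>total_space CM S1\<^esub> y) = \<phi> x + \<phi> y"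
    and smult: "\<And>c x. x \<in> cycles \<Longrightarrow> \<phi> (c \<odot>\<^bsub>total_space CM S1\<^esub> x) = s c (\<phi> x)"
  shows "models homologyM s (\<lambda>S. the_elem (\<phi> ` S)) (\<phi> ` cycles)"
proof -
  have "models (quot_module (total_space CM S1\<lparr>carrier := cycles\<rparr>) boundaries) s (\<lambda>S. the_elem (\<phi> ` S))
    (\<phi> ` carrier (total_space CM S1\<lparr>carrier := cycles\<rparr>))"
  proof (rule models_quot[OF cycles_group])
    show "boundaries = {m \<in> carrier (total_space CM S1\<lparr>carrier := cycles\<rparr>). \<phi> m = 0}" using K by simp
    show "\<phi> (a \<oplus>\<^bsub>total_space CM S1\<lparr>carrier := cycles\<rparr>\<^esub> b) = \<phi> a + \<phi> b"
      if "a \<in> carrier (total_space CM S1\<lparr>carrier := cycles\<rparr>)" "b \<in> carrier (total_space CM S1\<lparr>carrier := cycles\<rparr>)" for a b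
      using add[of a b] that by simp
    show "c \<odot>\<^bsub>total_space CM S1\<lparr>carrier := cycles\<rparr>\<^esub> a \<in> carrier (total_space CM S1\<lparr>carrier := cycles\<rparr>) \<and>
        \<phi> (c \<odot>\<^bsub>total_space CM S1\<lparr>carrier := cycles\<rparr>\<^esub> a) = s c (\<phi> a)"
      if "a \<in> carrier (total_space CM S1\<lparr>carrier := cycles\<rparr>)" for c a
      using smult[of a c] cycles_smult[of a c] that by simp
  qed
  then show ?thesis by (simp add: homology_def)
qed

lemma homology_trivial:
  assumes "even n \<or> Suc (Suc (Suc 0)) \<in> S1"
  shows "carrier homologyM = {\<zero>\<^bsub>homologyM\<^esub>}"
proof -
  have "z \<in> boundaries" if z: "z \<in> cycles" for z
  proof -
    note m = z[unfolded mem_cycles]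
    have hyp: "\<And>r. Suc r \<in> S1 \<Longrightarrow> r \<in> S1" "\<And>r. r \<in> S1 \<Longrightarrow> models_at z r \<in> tens r"
      "\<And>r. Suc r \<in> S1 \<Longrightarrow> td n (models_at z) r = 0"
      using down m model_total_space S0 by blast+
    have "\<exists>w. (\<forall>r. w r \<in> tens r) \<and> (\<forall>r\<in>S1. td (n + 1) w r = models_at z r)"
      using assms total_acyclic_even[OF hyp] total_acyclic_odd[OF hyp] by blast
    then obtain w where w: "\<And>r. w r \<in> tens r" "\<And>r. r \<in> S1 \<Longrightarrow> td (n + 1) w r = model (z r)" by blast
    show ?thesis by (rule boundaryI[OF conjunct1[OF m] w])
  qed
  then have "boundaries = cycles" using boundaries_cycles by blast
  \<comment> \<open>When all cycles are boundaries, the zero functional models the homology, which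
    thus has a single element.\<close>
  then have "models homologyM (*) (\<lambda>S. the_elem ((\<lambda>_. 0 :: 'k) ` S)) ((\<lambda>_. 0) ` cycles)"
    by (intro homology_models) simp_all
  note m = models_inj[OF this vector_space_times] models_closed[OF this vector_space_times]
  have "S = \<zero>\<^bsub>homologyM\<^esub>" if "S \<in> carrier homologyM" for S
    using m(1)[OF that m(2)] m(5)[OF that] m(5)[OF m(2)] by auto
  then show ?thesis using m(2) by blast
qed

end

lemma HC_trivial:
  assumes "n \<noteq> 1"
  shows "carrier (HC (SLq q) \<delta> (int n)) = {\<zero>\<^bsub>HC (SLq q) \<delta> (int n)\<^esub>}"
  unfolding HC_def cyclic_homology_def total_homology_def
proof (rule homology_trivial)
  \<comment> \<open>An odd natural number other than 1 is at least 3, so row 3 is present.\<close>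
  show "even (int n) \<or> Suc (Suc (Suc 0)) \<in> {r. int r \<le> int n}" using assms by simp presburger
qed auto

lemma HP_trivial: "carrier (HP (SLq q) \<delta> n) = {\<zero>\<^bsub>HP (SLq q) \<delta> n\<^esub>}"
  unfolding HP_def periodic_cyclic_homology_def total_homology_def
  by (rule homology_trivial) auto

lemma st_tens_0: "t \<in> tens 0 \<Longrightarrow> st 0 t = t"
  by (rule tens_0_eqI[where sc = fscale and f = "st 0" and g = "\<lambda>t. t"]) (simp_all add: lin st_def linear_map_id)

text \<open>In row 0 the signed operator and the norm are the identity, so the horizontal
  differential there is zero in odd columns and the identity in even ones.\<close>

lemma td_low_degree:
  "w 0 \<in> tens 0 \<Longrightarrow> td 1 w 0 = bd (Suc 0) (w (Suc 0))"
  "td (1 + 1) w (Suc 0) = bd (Suc (Suc 0)) (w (Suc (Suc 0))) + (w (Suc 0) - st (Suc 0) (w (Suc 0)))"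
  "td (1 + 1) w 0 = - bp (Suc 0) (w (Suc 0)) + w 0"
  by (simp_all add: td_def vd_def hd'_def st_tens_0 cn_def)

text \<open>In degree 1 row 3 is absent and the obstruction survives. The values of
  \<open>phi_u\<close> and \<open>phi_v\<close> on row 1 vanish on boundaries by the cocycle
  property and cyclic invariance; conversely \<open>homology_1\<close> leaves no other
  classes.\<close>

lemma HC_1: "linear_iso (HC (SLq q) \<delta> 1) (direct_sum scalar_space scalar_space)"
proof -
  let ?S = "\<lambda>n::int. {r. int r \<le> n}"
  let ?\<phi> = "\<lambda>z. (eval1 phi_u (model (z (Suc 0))), eval1 phi_v (model (z (Suc 0))))"
  let ?s = "\<lambda>c (p :: 'k \<times> 'k). (c * fst p, c * snd p)"
  have ctx: "r \<in> ?S (1 - 1) \<longleftrightarrow> Suc r \<in> ?S 1" "Suc r \<in> ?S 1 \<Longrightarrow> r \<in> ?S 1"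
    "r \<in> ?S 1 \<Longrightarrow> r \<in> ?S (1 + 1) \<and> Suc r \<in> ?S (1 + 1)" for r
    by auto
  have S1: "r \<in> ?S 1 \<longleftrightarrow> r = 0 \<or> r = Suc 0" for r by auto
  have S0: "?S (1 - 1) = {0}" by auto
  define Z where "Z = {z \<in> carrier (total_space CM (?S 1)). total_diff CM (?S (1 - 1)) 1 z = \<zero>\<^bsub>total_space CM (?S (1 - 1))\<^esub>}"
  define B where "B = total_diff CM (?S 1) (1 + 1) ` carrier (total_space CM (?S (1 + 1)))"
  have tens: "model (z r) \<in> tens r" if "z \<in> carrier (total_space CM (?S n))" "int r \<le> n" for z r n
    using model_total_space[OF that(1), of r] that(2) by simp
  have Z: "z \<in> Z \<longleftrightarrow> z \<in> carrier (total_space CM (?S 1)) \<and> bd (Suc 0) (model (z (Suc 0))) = 0" for z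
  proof -
    have "z \<in> Z \<longleftrightarrow> z \<in> carrier (total_space CM (?S 1)) \<and> (\<forall>r\<in>?S (1 - 1). td 1 (models_at z) r = 0)"
      unfolding Z_def by (rule mem_cycles[OF ctx])
    then have "z \<in> Z \<longleftrightarrow> z \<in> carrier (total_space CM (?S 1)) \<and> td 1 (models_at z) 0 = 0"
      unfolding S0 by simp
    then show ?thesis using td_low_degree(1)[of "models_at z"] tens[of z 1 0] by auto
  qed
  have phi_st: "eval1 phi_u (t - st (Suc 0) t) = 0" "eval1 phi_v (t - st (Suc 0) t) = 0" if "t \<in> tens (Suc 0)" for t
    using eval1_st[OF linear_phis(1) phi_u_mulA _ that] eval1_st[OF linear_phis(2) phi_v_mulA _ that]
    by (simp_all add: eval1_simps)
  have "B = {z \<in> Z. ?\<phi> z = 0}"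
  proof (intro subset_antisym subsetI)
    fix z assume "z \<in> B"
    then obtain w where w: "w \<in> carrier (total_space CM (?S (1 + 1)))" "z = total_diff CM (?S 1) (1 + 1) w"
      unfolding B_def by blast
    have zZ: "z \<in> Z" using boundaries_cycles[OF ctx, where n = 1] \<open>z \<in> B\<close> unfolding Z_def B_def by blast
    have "model (z (Suc 0)) = td (1 + 1) (models_at w) (Suc 0)"
      unfolding w(2) by (rule total_diff_model(2)[OF w(1) ctx(3)]) simp_all
    moreover have "model (w (Suc 0)) \<in> tens (Suc 0)" "model (w (Suc (Suc 0))) \<in> tens (Suc (Suc 0))"
      using tens[OF w(1)] by simp_all
    ultimately have "?\<phi> z = 0"
      using phi_st eval1_bd[OF linear_phis(1) phi_u_mulA] eval1_bd[OF linear_phis(2) phi_v_mulA]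
      by (simp only: td_low_degree eval1_simps(1)) (simp add: zero_prod_def)
    then show "z \<in> {z \<in> Z. ?\<phi> z = 0}" using zZ by simp
  next
    fix z assume "z \<in> {z \<in> Z. ?\<phi> z = 0}"
    then have z: "z \<in> carrier (total_space CM (?S 1))" "bd (Suc 0) (model (z (Suc 0))) = 0"
      and phi: "eval1 phi_u (model (z (Suc 0))) = 0" "eval1 phi_v (model (z (Suc 0))) = 0"
      using Z by (simp_all add: zero_prod_def)
    have zt: "model (z 0) \<in> tens 0" "model (z (Suc 0)) \<in> tens (Suc 0)" using tens[OF z(1)] by simp_all
    obtain p a b where p: "p \<in> tens (Suc (Suc 0))"
      and e: "model (z (Suc 0)) = bd (Suc (Suc 0)) p + fscale a (emb gu) + fscale b (emb gv)"
      by (rule homology_1[OF zt(2) z(2)])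
    have "a = 0" "b = 0"
      using phi eval1_bd[OF linear_phis(1) phi_u_mulA p] eval1_bd[OF linear_phis(2) phi_v_mulA p]
      by (simp_all add: e eval1_simps eval1_emb linear_phis del: emb_single fscale_single)
    then have e: "model (z (Suc 0)) = bd (Suc (Suc 0)) p" using e by simp
    \<comment> \<open>The row 0 entry of z is hit by the identity from row 0 in degree 2, so it
      imposes no condition; p accounts for row 1.\<close>
    define w where "w = (\<lambda>r. if r = 0 then model (z 0) else if r = Suc (Suc 0) then p else 0)"
    show "z \<in> B"
      unfolding B_def
    proof (rule boundaryI[OF ctx z(1)])
      show "w r \<in> tens r" for r using zt p by (simp add: w_def tens_closed)
      show "td (1 + 1) w r = model (z r)" if "r \<in> ?S 1" for r
        using that unfolding S1
        by (elim disjE; simp only: td_low_degree) (simp_all add: w_def e st_simps bp_simps bd_simps)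
    qed
  qed
  then have B: "total_diff CM (?S 1) (1 + 1) ` carrier (total_space CM (?S (1 + 1))) =
      {z \<in> {z \<in> carrier (total_space CM (?S 1)). total_diff CM (?S (1 - 1)) 1 z = \<zero>\<^bsub>total_space CM (?S (1 - 1))\<^esub>}. ?\<phi> z = 0}"
    unfolding Z_def B_def .
  have "models (HC (SLq q) \<delta> 1) ?s (\<lambda>S. the_elem (?\<phi> ` S)) (?\<phi> ` Z)"
    unfolding HC_def cyclic_homology_def total_homology_def Z_def
    by (rule homology_models[OF ctx B])
      (simp_all add: model_add model_smult eval1_simps)
  moreover have "?\<phi> ` Z = UNIV"
  proof -
    have "p \<in> ?\<phi> ` Z" for p
    proof
      \<comment> \<open>As u and v are cycles of b, any pair of scalars is attained by a cycle with
        zero entry in row 0.\<close>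
      let ?t = "fscale (fst p) (emb gu) + fscale (snd p) (emb gv)"
      let ?z = "lift_seq (?S 1) (\<lambda>r. if r = Suc 0 then ?t else 0)"
      have t: "(if r = Suc 0 then ?t else 0) \<in> tens r" for r
        by (simp add: tens_closed tens_emb del: emb_single fscale_single)
      note l = lift_seq[of "?S 1" "\<lambda>r. if r = Suc 0 then ?t else 0", OF t]
      have m: "model (?z (Suc 0)) = ?t" using l(2)[of "Suc 0"] by simp
      show "?z \<in> Z" using l(1) unfolding Z m by (simp add: bd_simps bd_gens del: emb_single fscale_single)
      show "p = ?\<phi> ?z"
        unfolding m by (simp add: eval1_simps eval1_emb linear_phis del: emb_single fscale_single)
    qed
    then show ?thesis by blast
  qed
  ultimately show ?thesis
    unfolding linear_iso_def models_def
    by (intro exI[of _ "\<lambda>S. the_elem (?\<phi> ` S)"])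
      (simp add: direct_sum_def scalar_space_def UNIV_Times_UNIV split_beta plus_prod_def)
qed

end

theorem theorem5p1:
  fixes q :: "'k::field_char_0"
    and \<delta> :: "(gen list \<Rightarrow>\<^sub>0 'k) set \<Rightarrow> 'k"
  assumes "q \<noteq> 0"
    and "\<forall>m::nat. m > 0 \<longrightarrow> q ^ m \<noteq> 1"
    and "character (SLq q) \<delta>"
    and "\<delta> (SLq_gen q GX) = q"
    and "\<delta> (SLq_gen q GU) = 0"
    and "\<delta> (SLq_gen q GV) = 0"
    and "\<delta> (SLq_gen q GY) = inverse q"
  shows "linear_iso (HC (SLq q) \<delta> 1) (direct_sum scalar_space scalar_space)
    \<and> (\<forall>n::nat. n \<noteq> 1 \<longrightarrow> carrier (HC (SLq q) \<delta> (int n)) = {\<zero>\<^bsub>HC (SLq q) \<delta> (int n)\<^esub>})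
    \<and> carrier (HP (SLq q) \<delta> 0) = {\<zero>\<^bsub>HP (SLq q) \<delta> 0\<^esub>}
    \<and> carrier (HP (SLq q) \<delta> 1) = {\<zero>\<^bsub>HP (SLq q) \<delta> 1\<^esub>}"
proof -
  interpret SLq_character q \<delta>
  proof
    show "q \<noteq> 1" using assms(2)[rule_format, of 1] by simp
  qed (use assms in simp_all)
  show ?thesis using HC_1 HC_trivial HP_trivial by blast
qed

end
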